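(* Let $(A,c)$ be a braided algebra over a field $K$. Then $(A,c)$ admits a canonical bracket $b=(b^{[n]})_{n\in\mathbb N}$ such that $(A,c,b)$ is a braided Lie algebra. Here the canonical bracket is the one defined recursively as follows: $\varphi^{[0]}:U^{[0]}=T(A,c)\to A$ is the unique algebra homomorphism extending $\mathrm{Id}_A$; for each $n$, $b^{[n]}:P^{[n]}\to A$ is the restriction of $\varphi^{[n]}:U^{[n]}\to A$ to $P^{[n]}=P(U^{[n]})$, and $\varphi^{[n+1]}:U^{[n+1]}\to A$ is the map induced by $\varphi^{[n]}$ on the quotient $U^{[n+1]}$ of $U^{[n]}$.
   Context: Fix a field $K$; all vector spaces, tensor products and maps are over $K$ ($K$-linear). An object also denotes its identity map. Braided vector space $(V,c)$: $c:V\otimes V\to V\otimes V$ linear with $(c\otimes V)(V\otimes c)(c\otimes V)=(V\otimes c)(c\otimes V)(V\otimes c)$; a morphism $f:(V,c_V)\to(W,c_W)$ is linear with $c_W(f\otimes f)=(f\otimes f)c_V$. Braided algebra $(A,m,u,c)$: an associative unital algebra and braided vector space with $c(m\otimes A)=(A\otimes m)(c\otimes A)(A\otimes c)$, $c(A\otimes m)=(m\otimes A)(A\otimes c)(c\otimes A)$, $c(u\otimes A)=A\otimes u$, $c(A\otimes u)=u\otimes A$. Braided coalgebra $(C,\Delta,\varepsilon,c)$: a coassociative counital coalgebra and braided vector space with $(\Delta\otimes C)c=(C\otimes c)(c\otimes C)(C\otimes\Delta)$, $(C\otimes\Delta)c=(c\otimes C)(C\otimes c)(\Delta\otimes C)$,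 $(\varepsilon\otimes C)c=C\otimes\varepsilon$, $(C\otimes\varepsilon)c=\varepsilon\otimes C$. Braided bialgebra $(B,m,u,\Delta,\varepsilon,c)$: a braided algebra and braided coalgebra with $\Delta m=(m\otimes m)(B\otimes c\otimes B)(\Delta\otimes\Delta)$, $\Delta(1)=1\otimes 1$, and $\varepsilon$ an algebra map. Morphisms of braided (bi)algebras are (bi)algebra maps that are morphisms of braided vector spaces. $P(B)=\{x\in B\mid \Delta(x)=x\otimes1+1\otimes x\}$. The braiding $c$ of $B$ satisfies $c(P(B)\otimes B)\subseteq B\otimes P(B)$ and $c(B\otimes P(B))\subseteq P(B)\otimes B$. A braided bialgebra map $f:B\to B'$ induces $P(f):P(B)\to P(B')$. Braided tensor algebra $T(V,c)$: the tensor algebra $T(V)$ with the unique braiding $c_T$ extending $c$ and making it a braided algebra, and with $\Delta_T$, $\varepsilon_T$ the algebra maps $\Delta_T:T(V)\to T(V)\otimes_c T(V)$, $\varepsilon_T:T(V)\to K$ such that $\Delta_T(v)=v\otimes1+1\otimes v$, $\varepsilon_T(v)=0$ for $v\in V$, where $T\otimes_cT$ has multiplication $(m_T\otimes m_T)(T\otimes c_T\otimes T)$. A bracket on a braided vector space $(V,c)$ is a family $b=(b^{[n]})_{n\in\mathbb N}$ of linear maps defined together with braided bialgebras $U^{[n]}$ and braided vector space morphisms $i^{[n]}:V\to P^{[n]}:=P(U^{[n]})$ as follows. $U^{[0]}=T(V,c)$ and $i^{[0]}$ is the inclusion. For each $n$, $b^{[n]}:P^{[n]}\to V$ is linear and,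 with $V^{[n]}:=i^{[n]}(V)$ and $c$ the braiding of $U^{[n]}$, one has on $P^{[n]}\otimes V^{[n]}$ and $V^{[n]}\otimes P^{[n]}$ respectively $c(i^{[n]}b^{[n]}\otimes V^{[n]})=(V^{[n]}\otimes i^{[n]}b^{[n]})c$ and $c(V^{[n]}\otimes i^{[n]}b^{[n]})=(i^{[n]}b^{[n]}\otimes V^{[n]})c$ (these make sense as $c$ maps $P^{[n]}\otimes V^{[n]}$ into $V^{[n]}\otimes P^{[n]}$ and conversely). Then $U^{[n+1]}=U^{[n]}/\big((\mathrm{Id}-i^{[n]}b^{[n]})[P^{[n]}]\big)$ (quotient by the two-sided ideal generated) with the unique braided bialgebra structure making the projection $\pi_n^{n+1}:U^{[n]}\to U^{[n+1]}$ a braided bialgebra map, and $i^{[n+1]}=P(\pi_n^{n+1})i^{[n]}$. The universal enveloping algebra is the direct limit $U(V,c,b)=\varinjlim U^{[n]}$ (a braided bialgebra), with canonical map $i_U:V\to U(V,c,b)$. $(V,c,b)$ is a braided Lie algebra if $i_U$ is injective. In the claim these notions are applied with $V=A$. *)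

theory Defs
  imports "HOL-Algebra.Algebra" "HOL-Algebra.Algebraic_Closure_Type" "HOL-Library.Poly_Mapping"
begin

text \<open>
  The ground field is a type \<open>'k::field\<close>; spaces and algebras over it are HOL-Algebra records with
  explicit carriers, with \<^const>\<open>ring_of_type_algebra\<close> turning the type \<open>'k\<close> into a ring record.
  For a mere vector space the fields \<^const>\<open>monoid.mult\<close> and \<^const>\<open>monoid.one\<close> of the record are irrelevant.
\<close>

definition vec_space :: "('k::field, 'v, 'm) module_scheme \<Rightarrow> bool" where
  "vec_space V \<longleftrightarrow> module (ring_of_type_algebra :: 'k ring) V"

definition linear_map ::
    "('k, 'v, 'm) module_scheme \<Rightarrow> ('k, 'w, 'n) module_scheme \<Rightarrow> ('v \<Rightarrow> 'w) \<Rightarrow> bool" where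
  "linear_map V W f \<longleftrightarrow>
     f \<in> carrier V \<rightarrow> carrier W \<and>
     (\<forall>x\<in>carrier V. \<forall>y\<in>carrier V. f (x \<oplus>\<^bsub>V\<^esub> y) = f x \<oplus>\<^bsub>W\<^esub> f y) \<and>
     (\<forall>a. \<forall>x\<in>carrier V. f (a \<odot>\<^bsub>V\<^esub> x) = a \<odot>\<^bsub>W\<^esub> f x)"

text \<open>Associative unital algebras; the locale \<^locale>\<open>algebra\<close> of the library is restricted to
  commutative ones.\<close>

definition assoc_algebra :: "('k::field, 'v, 'm) module_scheme \<Rightarrow> bool" where
  "assoc_algebra A \<longleftrightarrow>
     vec_space A \<and> ring A \<and>
     (\<forall>a. \<forall>x\<in>carrier A. \<forall>y\<in>carrier A.
        (a \<odot>\<^bsub>A\<^esub> x) \<otimes>\<^bsub>A\<^esub> y = a \<odot>\<^bsub>A\<^esub> (x \<otimes>\<^bsub>A\<^esub> y) \<and>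
        x \<otimes>\<^bsub>A\<^esub> (a \<odot>\<^bsub>A\<^esub> y) = a \<odot>\<^bsub>A\<^esub> (x \<otimes>\<^bsub>A\<^esub> y))"

definition algebra_map ::
    "('k, 'v, 'm) module_scheme \<Rightarrow> ('k, 'w, 'n) module_scheme \<Rightarrow> ('v \<Rightarrow> 'w) \<Rightarrow> bool" where
  "algebra_map A B f \<longleftrightarrow> linear_map A B f \<and> f \<in> ring_hom A B"


section \<open>Quotients\<close>

text \<open>
  The quotient of an algebra by a two-sided ideal, carried by a set of representatives of the cosets
  (the class of \<open>x\<close> is \<open>quot_proj A J x\<close>). In contrast to \<^const>\<open>FactRing\<close>, whose elements are the
  cosets themselves, this stays within the element type of \<open>A\<close>, so that it can be iterated.
\<close>

definition quot_proj :: "('k, 'v, 'm) module_scheme \<Rightarrow> 'v set \<Rightarrow> 'v \<Rightarrow> 'v" where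
  "quot_proj A J x = (SOME y. y \<in> J +>\<^bsub>A\<^esub> x)"

definition quot_alg :: "('k, 'v, 'm) module_scheme \<Rightarrow> 'v set \<Rightarrow> ('k, 'v) module" where
  "quot_alg A J =
     \<lparr>carrier = quot_proj A J ` carrier A,
      monoid.mult = (\<lambda>x y. quot_proj A J (x \<otimes>\<^bsub>A\<^esub> y)), monoid.one = quot_proj A J \<one>\<^bsub>A\<^esub>,
      ring.zero = quot_proj A J \<zero>\<^bsub>A\<^esub>, ring.add = (\<lambda>x y. quot_proj A J (x \<oplus>\<^bsub>A\<^esub> y)),
      module.smult = (\<lambda>a x. quot_proj A J (a \<odot>\<^bsub>A\<^esub> x))\<rparr>"


section \<open>Tensor algebra and tensor powers\<close>

text \<open>
  \<open>T(V)\<close> is the free algebra on the set \<open>carrier V\<close> modulo the relations making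
  \<open>v \<mapsto> [v]\<close> linear. The relations are homogeneous, and in degree \<open>n\<close> they are exactly the
  multilinearity relations for words \<open>[v\<^sub>1, \<dots>, v\<^sub>n]\<close>; so the degree \<open>n\<close> component
  \<open>tens_power V n\<close> is \<open>V\<^sup>\<otimes>\<^sup>n\<close>. The product of \<open>T(V)\<close> is the (strictly associative) tensor product
  of elements \<open>V\<^sup>\<otimes>\<^sup>p \<times> V\<^sup>\<otimes>\<^sup>q \<rightarrow> V\<^sup>\<otimes>\<^sup>(\<^sup>p\<^sup>+\<^sup>q\<^sup>)\<close>, which leaves associativity constraints implicit as usual.
  \<open>tens V [v\<^sub>1, \<dots>, v\<^sub>n]\<close> is \<open>v\<^sub>1 \<otimes> \<dots> \<otimes> v\<^sub>n\<close>.
\<close>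

definition free_alg :: "('k::field, 'v, 'm) module_scheme \<Rightarrow> ('k, 'v list \<Rightarrow>\<^sub>0 'k) module" where
  "free_alg V =
     \<lparr>carrier = {f. \<forall>l\<in>Poly_Mapping.keys f. set l \<subseteq> carrier V},
      monoid.mult = (\<lambda>f g. \<Sum>l\<in>Poly_Mapping.keys f. \<Sum>r\<in>Poly_Mapping.keys g.
                Poly_Mapping.single (l @ r) (Poly_Mapping.lookup f l * Poly_Mapping.lookup g r)),
      monoid.one = Poly_Mapping.single [] 1,
      ring.zero = 0, ring.add = (+),
      module.smult = (\<lambda>a. Poly_Mapping.map ((*) a))\<rparr>"

definition tensor_rels :: "('k::field, 'v, 'm) module_scheme \<Rightarrow> ('v list \<Rightarrow>\<^sub>0 'k) set" where
  "tensor_rels V =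
     {Poly_Mapping.single [v \<oplus>\<^bsub>V\<^esub> w] 1 - Poly_Mapping.single [v] 1 - Poly_Mapping.single [w] 1
        |v w. v \<in> carrier V \<and> w \<in> carrier V} \<union>
     {Poly_Mapping.single [a \<odot>\<^bsub>V\<^esub> v] 1 - Poly_Mapping.single [v] a |a v. v \<in> carrier V}"

definition tensor_ideal :: "('k::field, 'v, 'm) module_scheme \<Rightarrow> ('v list \<Rightarrow>\<^sub>0 'k) set" where
  "tensor_ideal V = genideal (free_alg V) (tensor_rels V)"

definition tensor_alg :: "('k::field, 'v, 'm) module_scheme \<Rightarrow> ('k, 'v list \<Rightarrow>\<^sub>0 'k) module" where
  "tensor_alg V = quot_alg (free_alg V) (tensor_ideal V)"

definition tens :: "('k::field, 'v, 'm) module_scheme \<Rightarrow> 'v list \<Rightarrow> ('v list \<Rightarrow>\<^sub>0 'k)" where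
  "tens V l = quot_proj (free_alg V) (tensor_ideal V) (Poly_Mapping.single l 1)"

definition tens_power ::
    "('k::field, 'v, 'm) module_scheme \<Rightarrow> nat \<Rightarrow> ('k, 'v list \<Rightarrow>\<^sub>0 'k) module" where
  "tens_power V n = (tensor_alg V)
     \<lparr>carrier := quot_proj (free_alg V) (tensor_ideal V) `
        {f \<in> carrier (free_alg V). \<forall>l\<in>Poly_Mapping.keys f. length l = n}\<rparr>"

text \<open>
  The linear map \<open>V\<^sup>\<otimes>\<^sup>n \<rightarrow> W\<close> induced by an \<open>n\<close>-linear map \<open>h\<close> (with arguments passed as a list of
  length \<open>n\<close>). An element of \<open>T(V)\<close> is a formal combination of words representing its class; that
  representative need not be homogeneous, but since the relations are, restricting to the words
  of length \<open>n\<close> amounts to extending the map by 0 to the other degrees of \<open>T(V)\<close>.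
\<close>

definition multilin ::
    "('k::field, 'w, 'm) module_scheme \<Rightarrow> nat \<Rightarrow> ('v list \<Rightarrow> 'w) \<Rightarrow> ('v list \<Rightarrow>\<^sub>0 'k) \<Rightarrow> 'w" where
  "multilin W n h t =
     (\<Oplus>\<^bsub>W\<^esub>l\<in>{l \<in> Poly_Mapping.keys t. length l = n}. Poly_Mapping.lookup t l \<odot>\<^bsub>W\<^esub> h l)"

text \<open>\<open>f\<^sup>\<otimes>\<^sup>n : V\<^sup>\<otimes>\<^sup>n \<rightarrow> W\<^sup>\<otimes>\<^sup>n\<close> for \<open>f : V \<rightarrow> W\<close>.\<close>

definition power_map ::
    "('k::field, 'w, 'm) module_scheme \<Rightarrow> nat \<Rightarrow> ('v \<Rightarrow> 'w)
      \<Rightarrow> ('v list \<Rightarrow>\<^sub>0 'k) \<Rightarrow> ('w list \<Rightarrow>\<^sub>0 'k)" where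
  "power_map W n f = multilin (tensor_alg W) n (\<lambda>l. tens W (map f l))"

text \<open>\<open>tens_map V p f q g\<close> is \<open>f \<otimes> g\<close>, for \<open>f\<close> defined on \<open>V\<^sup>\<otimes>\<^sup>p\<close> and \<open>g\<close> defined on \<open>V\<^sup>\<otimes>\<^sup>q\<close>, both with
  values in tensor powers of \<open>V\<close>.\<close>

definition tens_map ::
    "('k::field, 'v, 'm) module_scheme
      \<Rightarrow> nat \<Rightarrow> (('v list \<Rightarrow>\<^sub>0 'k) \<Rightarrow> ('v list \<Rightarrow>\<^sub>0 'k))
      \<Rightarrow> nat \<Rightarrow> (('v list \<Rightarrow>\<^sub>0 'k) \<Rightarrow> ('v list \<Rightarrow>\<^sub>0 'k))
      \<Rightarrow> ('v list \<Rightarrow>\<^sub>0 'k) \<Rightarrow> ('v list \<Rightarrow>\<^sub>0 'k)" where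
  "tens_map V p f q g =
     multilin (tensor_alg V) (p + q)
       (\<lambda>l. f (tens V (take p l)) \<otimes>\<^bsub>tensor_alg V\<^esub> g (tens V (drop p l)))"


section \<open>Braided structures\<close>

record (overloaded) ('k, 'v) braided_space = "('k::zero, 'v) module" +
  braiding :: "('v list \<Rightarrow>\<^sub>0 'k) \<Rightarrow> ('v list \<Rightarrow>\<^sub>0 'k)"

record (overloaded) ('k, 'v) braided_bialg = "('k::zero, 'v) braided_space" +
  comult :: "'v \<Rightarrow> ('v list \<Rightarrow>\<^sub>0 'k)"
  counit :: "'v \<Rightarrow> 'k"

definition braided_vec_space :: "('k::field, 'v, 'm) braided_space_scheme \<Rightarrow> bool" where
  "braided_vec_space V \<longleftrightarrow>
     vec_space V \<and>
     linear_map (tens_power V 2) (tens_power V 2) (braiding V) \<and>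
     (\<forall>t\<in>carrier (tens_power V 3).
        tens_map V 2 (braiding V) 1 id (tens_map V 1 id 2 (braiding V) (tens_map V 2 (braiding V) 1 id t)) =
        tens_map V 1 id 2 (braiding V) (tens_map V 2 (braiding V) 1 id (tens_map V 1 id 2 (braiding V) t)))"

definition braided_map ::
    "('k::field, 'v, 'm) braided_space_scheme \<Rightarrow> ('k, 'w, 'n) braided_space_scheme
      \<Rightarrow> ('v \<Rightarrow> 'w) \<Rightarrow> bool" where
  "braided_map V W f \<longleftrightarrow>
     linear_map V W f \<and>
     (\<forall>t\<in>carrier (tens_power V 2). braiding W (power_map W 2 f t) = power_map W 2 f (braiding V t))"

text \<open>The structure maps as maps between tensor powers: \<open>m : A\<^sup>\<otimes>\<^sup>2 \<rightarrow> A\<^sup>\<otimes>\<^sup>1\<close>, \<open>u : A\<^sup>\<otimes>\<^sup>0 \<rightarrow> A\<^sup>\<otimes>\<^sup>1\<close>,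
  \<open>\<Delta> : C\<^sup>\<otimes>\<^sup>1 \<rightarrow> C\<^sup>\<otimes>\<^sup>2\<close>, \<open>\<epsilon> : C\<^sup>\<otimes>\<^sup>1 \<rightarrow> C\<^sup>\<otimes>\<^sup>0\<close>.\<close>

definition mult_map :: "('k::field, 'v, 'm) module_scheme \<Rightarrow> ('v list \<Rightarrow>\<^sub>0 'k) \<Rightarrow> ('v list \<Rightarrow>\<^sub>0 'k)" where
  "mult_map A = multilin (tensor_alg A) 2 (\<lambda>l. tens A [l ! 0 \<otimes>\<^bsub>A\<^esub> l ! 1])"

definition unit_map :: "('k::field, 'v, 'm) module_scheme \<Rightarrow> ('v list \<Rightarrow>\<^sub>0 'k) \<Rightarrow> ('v list \<Rightarrow>\<^sub>0 'k)" where
  "unit_map A = multilin (tensor_alg A) 0 (\<lambda>l. tens A [\<one>\<^bsub>A\<^esub>])"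

definition comult_map ::
    "('k::field, 'v, 'm) braided_bialg_scheme \<Rightarrow> ('v list \<Rightarrow>\<^sub>0 'k) \<Rightarrow> ('v list \<Rightarrow>\<^sub>0 'k)" where
  "comult_map C = multilin (tensor_alg C) 1 (\<lambda>l. comult C (l ! 0))"

definition counit_map ::
    "('k::field, 'v, 'm) braided_bialg_scheme \<Rightarrow> ('v list \<Rightarrow>\<^sub>0 'k) \<Rightarrow> ('v list \<Rightarrow>\<^sub>0 'k)" where
  "counit_map C = multilin (tensor_alg C) 1 (\<lambda>l. counit C (l ! 0) \<odot>\<^bsub>tensor_alg C\<^esub> \<one>\<^bsub>tensor_alg C\<^esub>)"

definition braided_algebra :: "('k::field, 'v, 'm) braided_space_scheme \<Rightarrow> bool" where
  "braided_algebra A \<longleftrightarrow>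
     assoc_algebra A \<and> braided_vec_space A \<and>
     (\<forall>t\<in>carrier (tens_power A 3).
        braiding A (tens_map A 2 (mult_map A) 1 id t) =
        tens_map A 1 id 2 (mult_map A)
          (tens_map A 2 (braiding A) 1 id (tens_map A 1 id 2 (braiding A) t))) \<and>
     (\<forall>t\<in>carrier (tens_power A 3).
        braiding A (tens_map A 1 id 2 (mult_map A) t) =
        tens_map A 2 (mult_map A) 1 id
          (tens_map A 1 id 2 (braiding A) (tens_map A 2 (braiding A) 1 id t))) \<and>
     (\<forall>t\<in>carrier (tens_power A 1).
        braiding A (tens_map A 0 (unit_map A) 1 id t) = tens_map A 1 id 0 (unit_map A) t \<and>
        braiding A (tens_map A 1 id 0 (unit_map A) t) = tens_map A 0 (unit_map A) 1 id t)"

definition counit_linear :: "('k::field, 'v, 'm) braided_bialg_scheme \<Rightarrow> bool" where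
  "counit_linear C \<longleftrightarrow>
     (\<forall>x\<in>carrier C. \<forall>y\<in>carrier C. counit C (x \<oplus>\<^bsub>C\<^esub> y) = counit C x + counit C y) \<and>
     (\<forall>a. \<forall>x\<in>carrier C. counit C (a \<odot>\<^bsub>C\<^esub> x) = a * counit C x)"

definition braided_coalgebra :: "('k::field, 'v, 'm) braided_bialg_scheme \<Rightarrow> bool" where
  "braided_coalgebra C \<longleftrightarrow>
     braided_vec_space C \<and>
     linear_map C (tens_power C 2) (comult C) \<and> counit_linear C \<and>
     (\<forall>x\<in>carrier C.
        tens_map C 1 (comult_map C) 1 id (comult C x) = tens_map C 1 id 1 (comult_map C) (comult C x) \<and>
        tens_map C 1 (counit_map C) 1 id (comult C x) = tens C [x] \<and>
        tens_map C 1 id 1 (counit_map C) (comult C x) = tens C [x]) \<and>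
     (\<forall>t\<in>carrier (tens_power C 2).
        tens_map C 1 (comult_map C) 1 id (braiding C t) =
        tens_map C 1 id 2 (braiding C)
          (tens_map C 2 (braiding C) 1 id (tens_map C 1 id 1 (comult_map C) t)) \<and>
        tens_map C 1 id 1 (comult_map C) (braiding C t) =
        tens_map C 2 (braiding C) 1 id
          (tens_map C 1 id 2 (braiding C) (tens_map C 1 (comult_map C) 1 id t)) \<and>
        tens_map C 1 (counit_map C) 1 id (braiding C t) = tens_map C 1 id 1 (counit_map C) t \<and>
        tens_map C 1 id 1 (counit_map C) (braiding C t) = tens_map C 1 (counit_map C) 1 id t)"

text \<open>\<open>\<Delta> : B \<rightarrow> B \<otimes>\<^sub>c B\<close> is an algebra map, where \<open>B \<otimes>\<^sub>c B\<close> has the multiplication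
  \<open>(m \<otimes> m)(B \<otimes> c \<otimes> B)\<close>.\<close>

definition comult_algebra_map :: "('k::field, 'v, 'm) braided_bialg_scheme \<Rightarrow> bool" where
  "comult_algebra_map B \<longleftrightarrow>
     linear_map B (tens_power B 2) (comult B) \<and>
     comult B \<one>\<^bsub>B\<^esub> = tens B [\<one>\<^bsub>B\<^esub>, \<one>\<^bsub>B\<^esub>] \<and>
     (\<forall>x\<in>carrier B. \<forall>y\<in>carrier B.
        comult B (x \<otimes>\<^bsub>B\<^esub> y) =
        tens_map B 2 (mult_map B) 2 (mult_map B)
          (tens_map B 3 (tens_map B 1 id 2 (braiding B)) 1 id
            (comult B x \<otimes>\<^bsub>tensor_alg B\<^esub> comult B y)))"

definition counit_algebra_map :: "('k::field, 'v, 'm) braided_bialg_scheme \<Rightarrow> bool" where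
  "counit_algebra_map B \<longleftrightarrow>
     counit_linear B \<and> counit B \<one>\<^bsub>B\<^esub> = 1 \<and>
     (\<forall>x\<in>carrier B. \<forall>y\<in>carrier B. counit B (x \<otimes>\<^bsub>B\<^esub> y) = counit B x * counit B y)"

definition braided_bialgebra :: "('k::field, 'v, 'm) braided_bialg_scheme \<Rightarrow> bool" where
  "braided_bialgebra B \<longleftrightarrow>
     braided_algebra B \<and> braided_coalgebra B \<and> comult_algebra_map B \<and> counit_algebra_map B"

definition braided_bialgebra_map ::
    "('k::field, 'v, 'm) braided_bialg_scheme \<Rightarrow> ('k, 'w, 'n) braided_bialg_scheme
      \<Rightarrow> ('v \<Rightarrow> 'w) \<Rightarrow> bool" where
  "braided_bialgebra_map B B' f \<longleftrightarrow>
     algebra_map B B' f \<and> braided_map B B' f \<and>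
     (\<forall>x\<in>carrier B. comult B' (f x) = power_map B' 2 f (comult B x) \<and> counit B' (f x) = counit B x)"

definition primitives :: "('k::field, 'v, 'm) braided_bialg_scheme \<Rightarrow> 'v set" where
  "primitives B =
     {x \<in> carrier B. comult B x = tens B [x, \<one>\<^bsub>B\<^esub>] \<oplus>\<^bsub>tensor_alg B\<^esub> tens B [\<one>\<^bsub>B\<^esub>, x]}"


section \<open>Braided tensor algebra\<close>

definition is_braided_tensor_algebra ::
    "('k::field, 'v, 'm) braided_space_scheme \<Rightarrow> ('k, 'v list \<Rightarrow>\<^sub>0 'k) braided_bialg \<Rightarrow> bool" where
  "is_braided_tensor_algebra V T \<longleftrightarrow>
     module.truncate T = tensor_alg V \<and>
     braided_algebra T \<and> braided_map V T (\<lambda>v. tens V [v]) \<and>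
     comult_algebra_map T \<and> counit_algebra_map T \<and>
     (\<forall>v\<in>carrier V.
        comult T (tens V [v]) =
          tens T [tens V [v], \<one>\<^bsub>T\<^esub>] \<oplus>\<^bsub>tensor_alg T\<^esub> tens T [\<one>\<^bsub>T\<^esub>, tens V [v]] \<and>
        counit T (tens V [v]) = 0)"


section \<open>Brackets\<close>

text \<open>The graph of \<open>g \<otimes> h\<close> on the image of \<open>M \<otimes> N\<close> in \<open>B \<otimes> B\<close>, for maps \<open>g, h\<close> into \<open>B\<close> which are linear
  on the subspaces \<open>M, N\<close> of \<open>B\<close> respectively but need not be linear (or meaningful) elsewhere.\<close>

definition sub_tens_graph ::
    "('k::field, 'v, 'm) module_scheme \<Rightarrow> 'v set \<Rightarrow> ('v \<Rightarrow> 'v) \<Rightarrow> 'v set \<Rightarrow> ('v \<Rightarrow> 'v)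
      \<Rightarrow> (('v list \<Rightarrow>\<^sub>0 'k) \<times> ('v list \<Rightarrow>\<^sub>0 'k)) set" where
  "sub_tens_graph B M g N h =
     {(t, s). \<exists>(r::nat) x y. (\<forall>j<r. x j \<in> M \<and> y j \<in> N) \<and>
        t = (\<Oplus>\<^bsub>tensor_alg B\<^esub>j\<in>{..<r}. tens B [x j, y j]) \<and>
        s = (\<Oplus>\<^bsub>tensor_alg B\<^esub>j\<in>{..<r}. tens B [g (x j), h (y j)])}"

definition bracket_ideal ::
    "('k::field, 'u, 'n) braided_bialg_scheme \<Rightarrow> ('v \<Rightarrow> 'u) \<Rightarrow> ('u \<Rightarrow> 'v) \<Rightarrow> 'u set" where
  "bracket_ideal B i b = genideal B {x \<ominus>\<^bsub>B\<^esub> i (b x) |x. x \<in> primitives B}"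

text \<open>One step of the recursion: \<open>b\<close> is an admissible linear map \<open>P(B) \<rightarrow> V\<close>. The two commutation
  conditions are \<open>c(ib \<otimes> i(V)) = (i(V) \<otimes> ib)c\<close> on \<open>P(B) \<otimes> i(V)\<close> and its mirror image; they
  include that \<open>c\<close> exchanges the two tensor products.\<close>

definition admissible ::
    "('k::field, 'v, 'm) braided_space_scheme \<Rightarrow> ('k, 'u) braided_bialg
      \<Rightarrow> ('v \<Rightarrow> 'u) \<Rightarrow> ('u \<Rightarrow> 'v) \<Rightarrow> bool" where
  "admissible V B i b \<longleftrightarrow>
     linear_map (B\<lparr>carrier := primitives B\<rparr>) V b \<and>
     (\<forall>(t, s)\<in>sub_tens_graph B (primitives B) (\<lambda>x. i (b x)) (i ` carrier V) id.
        (braiding B t, braiding B s) \<in>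
          sub_tens_graph B (i ` carrier V) id (primitives B) (\<lambda>x. i (b x))) \<and>
     (\<forall>(t, s)\<in>sub_tens_graph B (i ` carrier V) id (primitives B) (\<lambda>x. i (b x)).
        (braiding B t, braiding B s) \<in>
          sub_tens_graph B (primitives B) (\<lambda>x. i (b x)) (i ` carrier V) id)"

definition bracket_proj ::
    "(nat \<Rightarrow> ('k::field, 'u) braided_bialg) \<Rightarrow> (nat \<Rightarrow> 'v \<Rightarrow> 'u) \<Rightarrow> (nat \<Rightarrow> 'u \<Rightarrow> 'v)
      \<Rightarrow> nat \<Rightarrow> 'u \<Rightarrow> 'u" where
  "bracket_proj U i b n = quot_proj (U n) (bracket_ideal (U n) (i n) (b n))"

text \<open>\<open>b\<close> is a bracket on \<open>V\<close>, with \<open>U\<close> and \<open>i\<close> the bialgebras and maps defined together with it.\<close>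

definition is_bracket ::
    "('k::field, 'v, 'm) braided_space_scheme \<Rightarrow> (nat \<Rightarrow> ('k, 'v list \<Rightarrow>\<^sub>0 'k) braided_bialg)
      \<Rightarrow> (nat \<Rightarrow> 'v \<Rightarrow> ('v list \<Rightarrow>\<^sub>0 'k)) \<Rightarrow> (nat \<Rightarrow> ('v list \<Rightarrow>\<^sub>0 'k) \<Rightarrow> 'v) \<Rightarrow> bool" where
  "is_bracket V U i b \<longleftrightarrow>
     braided_vec_space V \<and>
     is_braided_tensor_algebra V (U 0) \<and>
     (\<forall>v\<in>carrier V. i 0 v = tens V [v]) \<and>
     (\<forall>n. braided_bialgebra (U n) \<and>
          braided_map V (U n) (i n) \<and> i n ` carrier V \<subseteq> primitives (U n) \<and>
          admissible V (U n) (i n) (b n) \<and>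
          module.truncate (U (Suc n)) = quot_alg (U n) (bracket_ideal (U n) (i n) (b n)) \<and>
          braided_bialgebra_map (U n) (U (Suc n)) (bracket_proj U i b n) \<and>
          (\<forall>v\<in>carrier V. i (Suc n) v = bracket_proj U i b n (i n v)))"


section \<open>Direct limits and braided Lie algebras\<close>

text \<open>The transition map \<open>U m \<rightarrow> U (m + d)\<close> of a sequence of maps \<open>\<pi> n : U n \<rightarrow> U (n + 1)\<close>.\<close>

primrec transition :: "(nat \<Rightarrow> 'u \<Rightarrow> 'u) \<Rightarrow> nat \<Rightarrow> nat \<Rightarrow> 'u \<Rightarrow> 'u" where
  "transition \<pi> m 0 x = x"
| "transition \<pi> m (Suc d) x = \<pi> (m + d) (transition \<pi> m d x)"

definition limit_rel ::
    "(nat \<Rightarrow> ('k::zero, 'u) braided_bialg) \<Rightarrow> (nat \<Rightarrow> 'u \<Rightarrow> 'u) \<Rightarrow> ((nat \<times> 'u) \<times> (nat \<times> 'u)) set" where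
  "limit_rel U \<pi> =
     {((m, x), (n, y)) |m x n y. x \<in> carrier (U m) \<and> y \<in> carrier (U n) \<and>
        (\<exists>d e. m + d = n + e \<and> transition \<pi> m d x = transition \<pi> n e y)}"

definition limit_map ::
    "(nat \<Rightarrow> ('k::zero, 'u) braided_bialg) \<Rightarrow> (nat \<Rightarrow> 'u \<Rightarrow> 'u) \<Rightarrow> nat \<Rightarrow> 'u \<Rightarrow> (nat \<times> 'u) set" where
  "limit_map U \<pi> n x = limit_rel U \<pi> `` {(n, x)}"

text \<open>The braided bialgebra structure on the direct limit of the underlying sets is determined by
  the canonical maps being braided bialgebra maps, since every element (and every finite family of
  elements) comes from some stage.\<close>

definition is_direct_limit ::
    "(nat \<Rightarrow> ('k::field, 'u) braided_bialg) \<Rightarrow> (nat \<Rightarrow> 'u \<Rightarrow> 'u)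
      \<Rightarrow> ('k, (nat \<times> 'u) set) braided_bialg \<Rightarrow> bool" where
  "is_direct_limit U \<pi> L \<longleftrightarrow>
     carrier L = (SIGMA n:UNIV. carrier (U n)) // limit_rel U \<pi> \<and>
     braided_bialgebra L \<and>
     (\<forall>n. braided_bialgebra_map (U n) L (limit_map U \<pi> n))"

definition is_braided_Lie_algebra ::
    "('k::field, 'v, 'm) braided_space_scheme \<Rightarrow> (nat \<Rightarrow> ('k, 'v list \<Rightarrow>\<^sub>0 'k) braided_bialg)
      \<Rightarrow> (nat \<Rightarrow> 'v \<Rightarrow> ('v list \<Rightarrow>\<^sub>0 'k)) \<Rightarrow> (nat \<Rightarrow> ('v list \<Rightarrow>\<^sub>0 'k) \<Rightarrow> 'v) \<Rightarrow> bool" where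
  "is_braided_Lie_algebra V U i b \<longleftrightarrow>
     is_bracket V U i b \<and>
     (\<exists>L. is_direct_limit U (bracket_proj U i b) L \<and>
          inj_on (\<lambda>v. limit_map U (bracket_proj U i b) 0 (i 0 v)) (carrier V))"

definition is_canonical_bracket ::
    "('k::field, 'v, 'm) braided_space_scheme \<Rightarrow> (nat \<Rightarrow> ('k, 'v list \<Rightarrow>\<^sub>0 'k) braided_bialg)
      \<Rightarrow> (nat \<Rightarrow> 'v \<Rightarrow> ('v list \<Rightarrow>\<^sub>0 'k)) \<Rightarrow> (nat \<Rightarrow> ('v list \<Rightarrow>\<^sub>0 'k) \<Rightarrow> 'v) \<Rightarrow> bool" where
  "is_canonical_bracket A U i b \<longleftrightarrow>
     is_bracket A U i b \<and>
     (\<exists>\<phi>. algebra_map (U 0) A (\<phi> 0) \<and> (\<forall>a\<in>carrier A. \<phi> 0 (tens A [a]) = a) \<and>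
          (\<forall>n. \<forall>x\<in>primitives (U n). b n x = \<phi> n x) \<and>
          (\<forall>n. \<forall>x\<in>carrier (U n). \<phi> (Suc n) (bracket_proj U i b n x) = \<phi> n x))"

end

theory Submission imports Defs begin

text \<open>
  A basis \<open>E\<close> of \<open>A\<close> turns the structure of \<open>A\<close> into structure constants on letters. The braiding of \<open>T(A)\<close> moves
  words past each other letter by letter, and the coproduct distributes the letters of a word over two words, so the
  axioms of a braided bialgebra for \<open>T(A)\<close> become identities between words, proved by induction.

  The multiplication of \<open>A\<close> extends to an algebra map \<open>\<phi>\<close> from \<open>T(A)\<close> to \<open>A\<close> with \<open>\<phi> i = id\<close>, and \<open>e = i \<phi>\<close> satisfies
  \<open>c(e \<otimes> id) = (id \<otimes> e)c\<close> and \<open>c(id \<otimes> e) = (e \<otimes> id)c\<close> on all of \<open>T(A) \<otimes> T(A)\<close>, because \<open>c\<close> is compatible with the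
  multiplication of \<open>A\<close>. These identities make the restriction of \<open>\<phi>\<close> to the primitive elements
  admissible. As \<open>\<phi>\<close> kills \<open>x - e(x)\<close>, it descends to the quotient by the ideal generated by these elements for
  primitive \<open>x\<close>. That ideal is a biideal compatible with the braiding, and the identities for \<open>e\<close> descend as well, so that the
  step can be iterated. At every stage \<open>\<phi> i = id\<close>, whence \<open>i\<close> is injective also in the limit.
\<close>

section \<open>Free modules\<close>

text \<open>Each map \<open>i b\<close> is prescribed only on primitive elements, and a primitive
  element of a quotient need not lift to a primitive one, so conditions on primitives cannot be
  carried from one stage to the next. What can be carried is an equation between linear maps defined
  on all of \<open>B \<otimes> B\<close>, since it passes along every surjection. This is why
  \<open>i b\<close> is extended to the operator \<open>e\<close> on the whole bialgebra and why its
  two commutation identities form the invariant. Admissibility is read off from them together with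
  the inclusions of \<open>c(P(B) \<otimes> B)\<close> in \<open>B \<otimes> P(B)\<close> and of
  \<open>c(B \<otimes> P(B))\<close> in \<open>P(B) \<otimes> B\<close>. These inclusions are
  statements about kernels: over a field the kernel of \<open>id \<otimes> D\<close> is
  \<open>B \<otimes> ker D\<close>, which again rests on a basis.

  Quotients are carried by representatives in one fixed type, so a single function
  \<open>\<phi>\<close> serves at all stages. All projections are surjective, so the direct limit is
  itself a quotient of the initial bialgebra, by the union of the kernels; one construction of image
  bialgebras covers the quotients and the limit.\<close>

definition fscale :: "'k::field \<Rightarrow> ('x \<Rightarrow>\<^sub>0 'k) \<Rightarrow> ('x \<Rightarrow>\<^sub>0 'k)" where
  "fscale a = Poly_Mapping.map ((*) a)"

abbreviation fret :: "'x \<Rightarrow> ('x \<Rightarrow>\<^sub>0 'k::field)" where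
  "fret x \<equiv> Poly_Mapping.single x 1"

text \<open>The bind of the free-module monad, with \<open>fret\<close> as its unit: the linear
  extension of \<open>f\<close>, evaluated at \<open>t\<close>. Nested binds play the role of sums
  over structure constants.\<close>

definition fbind :: "('x \<Rightarrow>\<^sub>0 'k::field) \<Rightarrow> ('x \<Rightarrow> ('y \<Rightarrow>\<^sub>0 'k)) \<Rightarrow> ('y \<Rightarrow>\<^sub>0 'k)"  (infixl \<open>\<bind>\<close> 54) where
  "t \<bind> f = (\<Sum>x\<in>Poly_Mapping.keys t. fscale (Poly_Mapping.lookup t x) (f x))"

lemma lookup_fscale [simp]: "Poly_Mapping.lookup (fscale a p) x = a * Poly_Mapping.lookup p x"
  by (simp add: fscale_def Poly_Mapping.map.rep_eq when_def)

lemma fscale_simps [simp]: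
  "fscale a (0 :: 'x \<Rightarrow>\<^sub>0 'k::field) = 0" "fscale 0 p = 0" "fscale 1 p = p"
  "fscale a (p + q) = fscale a p + fscale a q" "fscale a (fscale b p) = fscale (a * b) p"
  "fscale a (Poly_Mapping.single x b) = Poly_Mapping.single x (a * b)"
  by (auto intro!: poly_mapping_eqI simp: lookup_add algebra_simps lookup_single when_def)

lemma fscale_add_left: "fscale (a + b) p = fscale a p + fscale b p"
  by (auto intro!: poly_mapping_eqI simp: lookup_add algebra_simps)

lemma fscale_sum: "fscale a (\<Sum>x\<in>S. f x) = (\<Sum>x\<in>S. fscale a (f x))"
  by (induction S rule: infinite_finite_induct) auto

lemma keys_fscale: "Poly_Mapping.keys (fscale a p) \<subseteq> Poly_Mapping.keys p"
  by (auto simp: in_keys_iff)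

lemma keys_single_add:
  "x \<notin> Poly_Mapping.keys t \<Longrightarrow> a \<noteq> 0 \<Longrightarrow>
    Poly_Mapping.keys (Poly_Mapping.single x a + t) = insert x (Poly_Mapping.keys t)"
  by (auto simp: in_keys_iff lookup_add lookup_single when_def split: if_splits)

text \<open>Each new basis element lies outside the support of \<open>t\<close>, so nothing cancels
  and \<open>keys_single_add\<close> gives the support of the sum exactly; hypotheses about supports
  thus pass to \<open>t\<close>.\<close>

lemma free_module_induct [case_names zero add]:
  fixes t :: "'x \<Rightarrow>\<^sub>0 'k::field"
  assumes "P 0"
    and "\<And>x a t. x \<notin> Poly_Mapping.keys t \<Longrightarrow> a \<noteq> 0 \<Longrightarrow> P t \<Longrightarrow> P (Poly_Mapping.single x a + t)"
  shows "P t"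
proof (induction "card (Poly_Mapping.keys t)" arbitrary: t)
  case 0
  then show ?case using assms(1) by (simp add: keys_eq_empty)
next
  case (Suc n)
  then obtain x where x: "x \<in> Poly_Mapping.keys t"
    by (metis card.empty equals0I nat.distinct(1))
  define s where "s = t - Poly_Mapping.single x (Poly_Mapping.lookup t x)"
  have k: "Poly_Mapping.keys s = Poly_Mapping.keys t - {x}"
    by (auto simp: s_def in_keys_iff lookup_minus lookup_single when_def split: if_splits)
  have "P s" using Suc x k by (intro Suc.hyps(1)) auto
  moreover have "t = Poly_Mapping.single x (Poly_Mapping.lookup t x) + s"
    by (simp add: s_def)
  ultimately show ?case using assms(2)[of x s "Poly_Mapping.lookup t x"] x k
    by (auto simp: in_keys_iff)
qed

lemma fbind_superset:
  "finite S \<Longrightarrow> Poly_Mapping.keys t \<subseteq> S \<Longrightarrow>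
    t \<bind> f = (\<Sum>x\<in>S. fscale (Poly_Mapping.lookup t x) (f x))"
  unfolding fbind_def by (rule sum.mono_neutral_left) (auto simp: in_keys_iff)

lemma fbind_zero [simp]: "0 \<bind> f = 0"
  by (simp add: fbind_def)

lemma fbind_single [simp]: "Poly_Mapping.single x a \<bind> f = fscale a (f x)"
  by (cases "a = 0") (auto simp: fbind_def)

lemma fbind_add [simp]: "(s + t) \<bind> f = (s \<bind> f) + (t \<bind> f)"
proof -
  let ?S = "Poly_Mapping.keys s \<union> Poly_Mapping.keys t"
  have "Poly_Mapping.keys (s + t) \<subseteq> ?S" by (rule Poly_Mapping.keys_add)
  then show ?thesis
    by (simp add: fbind_superset[of ?S] lookup_add fscale_add_left sum.distrib)
qed

lemma fbind_scale [simp]: "fscale a t \<bind> f = fscale a (t \<bind> f)"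
  using keys_fscale[of a t]
  by (simp add: fbind_superset[of "Poly_Mapping.keys t"] fscale_sum)

lemma fbind_assoc [simp]: "(t \<bind> f) \<bind> g = t \<bind> (\<lambda>x. f x \<bind> g)"
  by (induction t rule: free_module_induct) auto

lemma fbind_add_right: "t \<bind> (\<lambda>x. f x + g x) = (t \<bind> f) + (t \<bind> g)"
  by (induction t rule: free_module_induct) (auto simp: algebra_simps)

lemma fbind_zero_right [simp]: "t \<bind> (\<lambda>x. 0) = 0"
  by (induction t rule: free_module_induct) auto

lemma fbind_scale_right: "t \<bind> (\<lambda>x. fscale a (f x)) = fscale a (t \<bind> f)"
  by (induction t rule: free_module_induct) (auto simp: mult.commute)

lemma fbind_ret [simp]: "t \<bind> fret = t"
  by (induction t rule: free_module_induct) auto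

text \<open>A finite Fubini rule. In the word calculations it exchanges steps that act on disjoint
  tensor factors.\<close>

lemma fbind_commute: "t \<bind> (\<lambda>x. s \<bind> (\<lambda>y. f x y)) = s \<bind> (\<lambda>y. t \<bind> (\<lambda>x. f x y))"
  by (induction t rule: free_module_induct) (auto simp: fbind_add_right fbind_scale_right)

lemma fbind_cong: "(\<And>x. x \<in> Poly_Mapping.keys t \<Longrightarrow> f x = g x) \<Longrightarrow> t \<bind> f = t \<bind> g"
  by (simp add: fbind_def)

lemma keys_fbind:
  "Poly_Mapping.keys t \<subseteq> S \<Longrightarrow> (\<And>x. x \<in> S \<Longrightarrow> Poly_Mapping.keys (f x) \<subseteq> S') \<Longrightarrow>
    Poly_Mapping.keys (t \<bind> f) \<subseteq> S'"
proof (induction t rule: free_module_induct)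
  case (add x a t)
  have "Poly_Mapping.keys (fscale a (f x) + (t \<bind> f)) \<subseteq> S'"
    using add keys_fscale[of a "f x"] Poly_Mapping.keys_add[of "fscale a (f x)" "t \<bind> f"]
    by (fastforce simp: keys_single_add)
  then show ?case by simp
qed auto


section \<open>Vector spaces\<close>

lemma vec_space_module: "vec_space V \<Longrightarrow> module (ring_of_type_algebra :: 'k::field ring) (V :: ('k,'v,'m) module_scheme)"
  by (simp add: vec_space_def)

lemma vec_space_abelian_group: "vec_space V \<Longrightarrow> abelian_group V"
  by (simp add: vec_space_def module_def)

lemma vec_space_abelian_monoid: "vec_space V \<Longrightarrow> abelian_monoid V"
  by (simp add: vec_space_def module_def abelian_group_def)

lemma vec_space_closed [simp]:
  fixes V :: "('k::field, 'v, 'm) module_scheme"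
  assumes "vec_space V"
  shows "\<zero>\<^bsub>V\<^esub> \<in> carrier V"
    and "x \<in> carrier V \<Longrightarrow> y \<in> carrier V \<Longrightarrow> x \<oplus>\<^bsub>V\<^esub> y \<in> carrier V"
    and "x \<in> carrier V \<Longrightarrow> a \<odot>\<^bsub>V\<^esub> x \<in> carrier V"
    and "x \<in> carrier V \<Longrightarrow> \<ominus>\<^bsub>V\<^esub> x \<in> carrier V"
    and "x \<in> carrier V \<Longrightarrow> y \<in> carrier V \<Longrightarrow> x \<ominus>\<^bsub>V\<^esub> y \<in> carrier V"
proof -
  interpret abelian_group V by (rule vec_space_abelian_group[OF assms])
  show "\<zero>\<^bsub>V\<^esub> \<in> carrier V"
    "x \<in> carrier V \<Longrightarrow> y \<in> carrier V \<Longrightarrow> x \<oplus>\<^bsub>V\<^esub> y \<in> carrier V"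
    "x \<in> carrier V \<Longrightarrow> \<ominus>\<^bsub>V\<^esub> x \<in> carrier V"
    "x \<in> carrier V \<Longrightarrow> y \<in> carrier V \<Longrightarrow> x \<ominus>\<^bsub>V\<^esub> y \<in> carrier V" by auto
  show "x \<in> carrier V \<Longrightarrow> a \<odot>\<^bsub>V\<^esub> x \<in> carrier V"
    using module.smult_closed[OF vec_space_module[OF assms], of a x]
    by (simp add: ring_of_type_algebra_def)
qed

lemma vec_space_smult [simp]:
  fixes V :: "('k::field, 'v, 'm) module_scheme"
  assumes "vec_space V" "x \<in> carrier V"
  shows "1 \<odot>\<^bsub>V\<^esub> x = x" "0 \<odot>\<^bsub>V\<^esub> x = \<zero>\<^bsub>V\<^esub>" "a \<odot>\<^bsub>V\<^esub> (b \<odot>\<^bsub>V\<^esub> x) = (a * b) \<odot>\<^bsub>V\<^esub> x"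
    "y \<in> carrier V \<Longrightarrow> a \<odot>\<^bsub>V\<^esub> (x \<oplus>\<^bsub>V\<^esub> y) = a \<odot>\<^bsub>V\<^esub> x \<oplus>\<^bsub>V\<^esub> a \<odot>\<^bsub>V\<^esub> y"
proof -
  interpret module "ring_of_type_algebra :: 'k ring" V by (rule vec_space_module[OF assms(1)])
  show "1 \<odot>\<^bsub>V\<^esub> x = x" "0 \<odot>\<^bsub>V\<^esub> x = \<zero>\<^bsub>V\<^esub>" "a \<odot>\<^bsub>V\<^esub> (b \<odot>\<^bsub>V\<^esub> x) = (a * b) \<odot>\<^bsub>V\<^esub> x"
    "y \<in> carrier V \<Longrightarrow> a \<odot>\<^bsub>V\<^esub> (x \<oplus>\<^bsub>V\<^esub> y) = a \<odot>\<^bsub>V\<^esub> x \<oplus>\<^bsub>V\<^esub> a \<odot>\<^bsub>V\<^esub> y"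
    using smult_one[of x] smult_l_null[of x] smult_assoc1[of a b x]
      smult_r_distr[of a x y] assms(2)
    by (auto simp: ring_of_type_algebra_def)
qed

lemma vec_space_smult_zero [simp]:
  fixes V :: "('k::field, 'v, 'm) module_scheme"
  assumes "vec_space V"
  shows "a \<odot>\<^bsub>V\<^esub> \<zero>\<^bsub>V\<^esub> = \<zero>\<^bsub>V\<^esub>"
  using module.smult_r_null[OF vec_space_module[OF assms], of a]
  by (simp add: ring_of_type_algebra_def)

lemma vec_space_smult_add:
  fixes V :: "('k::field, 'v, 'm) module_scheme"
  assumes "vec_space V" "x \<in> carrier V"
  shows "(a + b) \<odot>\<^bsub>V\<^esub> x = a \<odot>\<^bsub>V\<^esub> x \<oplus>\<^bsub>V\<^esub> b \<odot>\<^bsub>V\<^esub> x"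
  using module.smult_l_distr[OF vec_space_module[OF assms(1)], of a b x] assms(2)
  by (auto simp: ring_of_type_algebra_def)

lemma vec_space_zero [simp]:
  assumes "vec_space V" "x \<in> carrier V"
  shows "\<zero>\<^bsub>V\<^esub> \<oplus>\<^bsub>V\<^esub> x = x" "x \<oplus>\<^bsub>V\<^esub> \<zero>\<^bsub>V\<^esub> = x" "x \<ominus>\<^bsub>V\<^esub> x = \<zero>\<^bsub>V\<^esub>"
proof -
  interpret abelian_group V by (rule vec_space_abelian_group[OF assms(1)])
  show "\<zero>\<^bsub>V\<^esub> \<oplus>\<^bsub>V\<^esub> x = x" "x \<oplus>\<^bsub>V\<^esub> \<zero>\<^bsub>V\<^esub> = x" "x \<ominus>\<^bsub>V\<^esub> x = \<zero>\<^bsub>V\<^esub>"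
    using assms(2) by (auto simp: a_minus_def r_neg)
qed

lemma vec_space_add_ac:
  assumes "vec_space V" "x \<in> carrier V" "y \<in> carrier V"
  shows "x \<oplus>\<^bsub>V\<^esub> y = y \<oplus>\<^bsub>V\<^esub> x"
    and "z \<in> carrier V \<Longrightarrow> x \<oplus>\<^bsub>V\<^esub> y \<oplus>\<^bsub>V\<^esub> z = x \<oplus>\<^bsub>V\<^esub> (y \<oplus>\<^bsub>V\<^esub> z)"
    and "z \<in> carrier V \<Longrightarrow> x \<oplus>\<^bsub>V\<^esub> (y \<oplus>\<^bsub>V\<^esub> z) = y \<oplus>\<^bsub>V\<^esub> (x \<oplus>\<^bsub>V\<^esub> z)"
proof -
  interpret abelian_group V by (rule vec_space_abelian_group[OF assms(1)])
  show "x \<oplus>\<^bsub>V\<^esub> y = y \<oplus>\<^bsub>V\<^esub> x" "z \<in> carrier V \<Longrightarrow> x \<oplus>\<^bsub>V\<^esub> y \<oplus>\<^bsub>V\<^esub> z = x \<oplus>\<^bsub>V\<^esub> (y \<oplus>\<^bsub>V\<^esub> z)"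
    "z \<in> carrier V \<Longrightarrow> x \<oplus>\<^bsub>V\<^esub> (y \<oplus>\<^bsub>V\<^esub> z) = y \<oplus>\<^bsub>V\<^esub> (x \<oplus>\<^bsub>V\<^esub> z)"
    using assms a_ac by auto
qed

lemma vec_space_minus:
  fixes V :: "('k::field, 'v, 'm) module_scheme"
  assumes "vec_space V" "x \<in> carrier V" "y \<in> carrier V"
  shows "x \<ominus>\<^bsub>V\<^esub> y = x \<oplus>\<^bsub>V\<^esub> (-1) \<odot>\<^bsub>V\<^esub> y"
proof -
  interpret module "ring_of_type_algebra :: 'k ring" V by (rule vec_space_module[OF assms(1)])
  have "(-1) \<odot>\<^bsub>V\<^esub> y \<oplus>\<^bsub>V\<^esub> y = (-1 + 1) \<odot>\<^bsub>V\<^esub> y"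
    using assms by (subst vec_space_smult_add) auto
  then have "(-1) \<odot>\<^bsub>V\<^esub> y = \<ominus>\<^bsub>V\<^esub> y"
    using assms by (intro M.minus_equality[symmetric]) auto
  then show ?thesis by (simp add: a_minus_def)
qed

lemma vec_space_minus_eq_zero:
  assumes "vec_space V" "x \<in> carrier V" "y \<in> carrier V"
  shows "x \<ominus>\<^bsub>V\<^esub> y = \<zero>\<^bsub>V\<^esub> \<longleftrightarrow> x = y"
proof -
  interpret abelian_group V by (rule vec_space_abelian_group[OF assms(1)])
  show ?thesis
    using assms by (metis a_minus_def add.inv_closed minus_equality minus_minus r_neg)
qed

lemma linear_mapD:
  assumes "linear_map V W f"
  shows "x \<in> carrier V \<Longrightarrow> f x \<in> carrier W"
    and "x \<in> carrier V \<Longrightarrow> y \<in> carrier V \<Longrightarrow> f (x \<oplus>\<^bsub>V\<^esub> y) = f x \<oplus>\<^bsub>W\<^esub> f y"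
    and "x \<in> carrier V \<Longrightarrow> f (a \<odot>\<^bsub>V\<^esub> x) = a \<odot>\<^bsub>W\<^esub> f x"
  using assms by (auto simp: linear_map_def)

lemma linear_mapI:
  assumes "\<And>x. x \<in> carrier V \<Longrightarrow> f x \<in> carrier W"
    and "\<And>x y. x \<in> carrier V \<Longrightarrow> y \<in> carrier V \<Longrightarrow> f (x \<oplus>\<^bsub>V\<^esub> y) = f x \<oplus>\<^bsub>W\<^esub> f y"
    and "\<And>a x. x \<in> carrier V \<Longrightarrow> f (a \<odot>\<^bsub>V\<^esub> x) = a \<odot>\<^bsub>W\<^esub> f x"
  shows "linear_map V W f"
  using assms by (auto simp: linear_map_def)

lemma linear_map_zero:
  assumes "linear_map V W f" "vec_space V" "vec_space W"
  shows "f \<zero>\<^bsub>V\<^esub> = \<zero>\<^bsub>W\<^esub>"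
proof -
  have "f (0 \<odot>\<^bsub>V\<^esub> \<zero>\<^bsub>V\<^esub>) = 0 \<odot>\<^bsub>W\<^esub> f \<zero>\<^bsub>V\<^esub>"
    using assms by (intro linear_mapD(3)[OF assms(1)]) simp
  then show ?thesis using assms linear_mapD(1)[OF assms(1), of "\<zero>\<^bsub>V\<^esub>"] by simp
qed

lemma linear_map_minus:
  assumes "linear_map V W f" "vec_space V" "vec_space W" "x \<in> carrier V" "y \<in> carrier V"
  shows "f (x \<ominus>\<^bsub>V\<^esub> y) = f x \<ominus>\<^bsub>W\<^esub> f y"
  using assms by (simp add: vec_space_minus linear_mapD[OF assms(1)])

lemma linear_map_comp:
  "linear_map V W f \<Longrightarrow> linear_map W Z g \<Longrightarrow> linear_map V Z (\<lambda>x. g (f x))"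
  by (simp add: linear_map_def Pi_iff)


section \<open>Linear extension from a free module\<close>

text \<open>The counterpart of \<open>fbind\<close> with values in a space given by a carrier.
  Finite sums are well behaved only for summands in the carrier, which explains the closure
  hypotheses on supports in the lemmas below.\<close>

definition lin_ext :: "('k::field, 'w, 'm) module_scheme \<Rightarrow> ('x \<Rightarrow>\<^sub>0 'k) \<Rightarrow> ('x \<Rightarrow> 'w) \<Rightarrow> 'w" where
  "lin_ext W t h = (\<Oplus>\<^bsub>W\<^esub>x\<in>Poly_Mapping.keys t. Poly_Mapping.lookup t x \<odot>\<^bsub>W\<^esub> h x)"

lemma lin_ext_superset:
  assumes W: "vec_space W" and S: "finite S" "Poly_Mapping.keys t \<subseteq> S" and h: "\<And>x. x \<in> S \<Longrightarrow> h x \<in> carrier W"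
  shows "lin_ext W t h = (\<Oplus>\<^bsub>W\<^esub>x\<in>S. Poly_Mapping.lookup t x \<odot>\<^bsub>W\<^esub> h x)"
proof -
  interpret abelian_group W by (rule vec_space_abelian_group[OF W])
  show ?thesis unfolding lin_ext_def
    by (rule add.finprod_mono_neutral_cong_left) (use assms in \<open>auto simp: in_keys_iff\<close>)
qed

lemma lin_ext_closed:
  assumes W: "vec_space W" and h: "\<And>x. x \<in> Poly_Mapping.keys t \<Longrightarrow> h x \<in> carrier W"
  shows "lin_ext W t h \<in> carrier W"
proof -
  interpret abelian_group W by (rule vec_space_abelian_group[OF W])
  show ?thesis unfolding lin_ext_def using assms by (intro finsum_closed) auto
qed

lemma lin_ext_zero [simp]: "vec_space W \<Longrightarrow> lin_ext W 0 h = \<zero>\<^bsub>W\<^esub>"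
  by (simp add: lin_ext_def abelian_monoid.finsum_empty vec_space_abelian_monoid)

lemma lin_ext_single:
  assumes W: "vec_space W" and h: "h x \<in> carrier W"
  shows "lin_ext W (Poly_Mapping.single x a) h = a \<odot>\<^bsub>W\<^esub> h x"
proof -
  interpret abelian_group W by (rule vec_space_abelian_group[OF W])
  show ?thesis using assms
    by (subst lin_ext_superset[OF W, of "{x}"]) auto
qed

lemma lin_ext_add:
  assumes W: "vec_space W"
    and h: "\<And>x. x \<in> Poly_Mapping.keys s \<Longrightarrow> h x \<in> carrier W" "\<And>x. x \<in> Poly_Mapping.keys t \<Longrightarrow> h x \<in> carrier W"
  shows "lin_ext W (s + t) h = lin_ext W s h \<oplus>\<^bsub>W\<^esub> lin_ext W t h"
proof -
  interpret abelian_group W by (rule vec_space_abelian_group[OF W])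
  let ?S = "Poly_Mapping.keys s \<union> Poly_Mapping.keys t"
  have h': "\<And>x. x \<in> ?S \<Longrightarrow> h x \<in> carrier W" using h by auto
  have k: "Poly_Mapping.keys (s + t) \<subseteq> ?S" by (rule Poly_Mapping.keys_add)
  have eq: "lin_ext W r h = (\<Oplus>\<^bsub>W\<^esub>x\<in>?S. Poly_Mapping.lookup r x \<odot>\<^bsub>W\<^esub> h x)"
    if "Poly_Mapping.keys r \<subseteq> ?S" for r
    using lin_ext_superset[OF W _ that h'] by simp
  have "(\<Oplus>\<^bsub>W\<^esub>x\<in>?S. Poly_Mapping.lookup (s + t) x \<odot>\<^bsub>W\<^esub> h x) =
      (\<Oplus>\<^bsub>W\<^esub>x\<in>?S. Poly_Mapping.lookup s x \<odot>\<^bsub>W\<^esub> h x \<oplus>\<^bsub>W\<^esub> Poly_Mapping.lookup t x \<odot>\<^bsub>W\<^esub> h x)"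
    using h' W by (intro finsum_cong') (auto simp: lookup_add vec_space_smult_add)
  also have "\<dots> = (\<Oplus>\<^bsub>W\<^esub>x\<in>?S. Poly_Mapping.lookup s x \<odot>\<^bsub>W\<^esub> h x) \<oplus>\<^bsub>W\<^esub> (\<Oplus>\<^bsub>W\<^esub>x\<in>?S. Poly_Mapping.lookup t x \<odot>\<^bsub>W\<^esub> h x)"
    using h' W by (intro finsum_addf) auto
  finally show ?thesis using k by (simp add: eq)
qed

lemma lin_ext_scale:
  fixes W :: "('k::field, 'w, 'm) module_scheme"
  assumes W: "vec_space W" and h: "\<And>x. x \<in> Poly_Mapping.keys t \<Longrightarrow> h x \<in> carrier W"
  shows "lin_ext W (fscale a t) h = a \<odot>\<^bsub>W\<^esub> lin_ext W t h"
proof -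
  interpret module "ring_of_type_algebra :: 'k ring" W by (rule vec_space_module[OF W])
  have "lin_ext W (fscale a t) h =
      (\<Oplus>\<^bsub>W\<^esub>x\<in>Poly_Mapping.keys t. Poly_Mapping.lookup (fscale a t) x \<odot>\<^bsub>W\<^esub> h x)"
    using h keys_fscale[of a t] by (intro lin_ext_superset[OF W]) auto
  also have "\<dots> = (\<Oplus>\<^bsub>W\<^esub>x\<in>Poly_Mapping.keys t. a \<odot>\<^bsub>W\<^esub> (Poly_Mapping.lookup t x \<odot>\<^bsub>W\<^esub> h x))"
    using h W by (intro M.finsum_cong') auto
  also have "\<dots> = a \<odot>\<^bsub>W\<^esub> lin_ext W t h"
    unfolding lin_ext_def
    using h W by (intro finsum_smult_ldistr[symmetric]) (auto simp: ring_of_type_algebra_def)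
  finally show ?thesis .
qed

lemma lin_ext_single_add:
  assumes W: "vec_space W" "x \<notin> Poly_Mapping.keys t" "a \<noteq> 0"
    and h: "h x \<in> carrier W" "\<And>y. y \<in> Poly_Mapping.keys t \<Longrightarrow> h y \<in> carrier W"
  shows "lin_ext W (Poly_Mapping.single x a + t) h = a \<odot>\<^bsub>W\<^esub> h x \<oplus>\<^bsub>W\<^esub> lin_ext W t h"
  using h assms(3) by (subst lin_ext_add) (auto simp: lin_ext_single W(1))

lemma lin_ext_cong:
  assumes "vec_space W" "\<And>x. x \<in> Poly_Mapping.keys t \<Longrightarrow> f x = g x"
    "\<And>x. x \<in> Poly_Mapping.keys t \<Longrightarrow> g x \<in> carrier W"
  shows "lin_ext W t f = lin_ext W t g"
proof -
  interpret abelian_group W by (rule vec_space_abelian_group[OF assms(1)])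
  show ?thesis unfolding lin_ext_def using assms by (intro finsum_cong') auto
qed

lemma lin_ext_add_right:
  assumes W: "vec_space W"
    and "\<And>x. x \<in> Poly_Mapping.keys t \<Longrightarrow> f x \<in> carrier W" "\<And>x. x \<in> Poly_Mapping.keys t \<Longrightarrow> g x \<in> carrier W"
  shows "lin_ext W t (\<lambda>x. f x \<oplus>\<^bsub>W\<^esub> g x) = lin_ext W t f \<oplus>\<^bsub>W\<^esub> lin_ext W t g"
  using assms(2,3)
  by (induction t rule: free_module_induct)
    (simp_all add: W lin_ext_single_add keys_single_add lin_ext_closed vec_space_add_ac)

lemma lin_ext_scale_right:
  assumes W: "vec_space W" and "\<And>x. x \<in> Poly_Mapping.keys t \<Longrightarrow> f x \<in> carrier W"
  shows "lin_ext W t (\<lambda>x. a \<odot>\<^bsub>W\<^esub> f x) = a \<odot>\<^bsub>W\<^esub> lin_ext W t f"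
  using assms(2)
  by (induction t rule: free_module_induct)
    (simp_all add: W lin_ext_single_add keys_single_add lin_ext_closed mult.commute)

lemma lin_ext_zero_right:
  assumes W: "vec_space W"
  shows "lin_ext W t (\<lambda>x. \<zero>\<^bsub>W\<^esub>) = \<zero>\<^bsub>W\<^esub>"
  by (induction t rule: free_module_induct)
    (simp_all add: W lin_ext_single_add lin_ext_closed)

lemma lin_ext_linear:
  assumes F: "linear_map V W F" and V: "vec_space V" and W: "vec_space W"
    and "\<And>x. x \<in> Poly_Mapping.keys t \<Longrightarrow> h x \<in> carrier V"
  shows "F (lin_ext V t h) = lin_ext W t (\<lambda>x. F (h x))"
  using assms(4)
  by (induction t rule: free_module_induct)
    (simp_all add: V W lin_ext_single_add keys_single_add lin_ext_closed linear_mapD[OF F] linear_map_zero[OF F])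

lemma lin_ext_bind:
  assumes W: "vec_space W"
    and "\<And>x y. x \<in> Poly_Mapping.keys t \<Longrightarrow> y \<in> Poly_Mapping.keys (f x) \<Longrightarrow> h y \<in> carrier W"
  shows "lin_ext W (t \<bind> f) h = lin_ext W t (\<lambda>x. lin_ext W (f x) h)"
  using assms(2)
proof (induction t rule: free_module_induct)
  case (add x a t)
  have k: "h y \<in> carrier W" if "y \<in> Poly_Mapping.keys (t \<bind> f)" for y
    using keys_fbind[of t "Poly_Mapping.keys t" f "\<Union>x\<in>Poly_Mapping.keys t. Poly_Mapping.keys (f x)"] that add
    by (force simp: keys_single_add)
  have k2: "h y \<in> carrier W" if "y \<in> Poly_Mapping.keys (fscale a (f x))" for y
    using keys_fscale[of a "f x"] that add by (auto simp: keys_single_add)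
  have hx: "\<And>y. y \<in> Poly_Mapping.keys (f x) \<Longrightarrow> h y \<in> carrier W"
    and ht: "\<And>z y. z \<in> Poly_Mapping.keys t \<Longrightarrow> y \<in> Poly_Mapping.keys (f z) \<Longrightarrow> h y \<in> carrier W"
    using add by (auto simp: keys_single_add)
  have "lin_ext W (Poly_Mapping.single x a + t) (\<lambda>x. lin_ext W (f x) h) =
      a \<odot>\<^bsub>W\<^esub> lin_ext W (f x) h \<oplus>\<^bsub>W\<^esub> lin_ext W t (\<lambda>x. lin_ext W (f x) h)"
    using add hx ht by (intro lin_ext_single_add lin_ext_closed W) auto
  moreover have "lin_ext W (t \<bind> f) h = lin_ext W t (\<lambda>x. lin_ext W (f x) h)"
    using ht by (intro add.IH) auto
  ultimately show ?case using k k2 hx by (simp add: W lin_ext_add lin_ext_scale)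
qed (auto simp: W)

lemma lin_ext_commute:
  assumes W: "vec_space W"
    and "\<And>x y. x \<in> Poly_Mapping.keys s \<Longrightarrow> y \<in> Poly_Mapping.keys t \<Longrightarrow> h x y \<in> carrier W"
  shows "lin_ext W s (\<lambda>x. lin_ext W t (\<lambda>y. h x y)) = lin_ext W t (\<lambda>y. lin_ext W s (\<lambda>x. h x y))"
  using assms(2)
proof (induction s rule: free_module_induct)
  case (add x a s)
  have "lin_ext W t (\<lambda>y. lin_ext W (Poly_Mapping.single x a + s) (\<lambda>x. h x y)) =
     lin_ext W t (\<lambda>y. a \<odot>\<^bsub>W\<^esub> h x y \<oplus>\<^bsub>W\<^esub> lin_ext W s (\<lambda>x. h x y))"
    using add by (intro lin_ext_cong) (auto simp: W lin_ext_single_add keys_single_add lin_ext_closed)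
  also have "\<dots> = a \<odot>\<^bsub>W\<^esub> lin_ext W t (\<lambda>y. h x y) \<oplus>\<^bsub>W\<^esub> lin_ext W t (\<lambda>y. lin_ext W s (\<lambda>x. h x y))"
    using add by (simp add: W lin_ext_add_right lin_ext_scale_right keys_single_add lin_ext_closed)
  finally show ?case using add
    by (simp add: W lin_ext_single_add keys_single_add lin_ext_closed)
qed (simp add: W lin_ext_zero_right)

section \<open>Algebras and their quotients\<close>

lemma assoc_algebraD [simp]:
  "assoc_algebra A \<Longrightarrow> vec_space A" "assoc_algebra A \<Longrightarrow> ring A"
  by (auto simp: assoc_algebra_def)

lemma assoc_algebra_closed [simp]:
  assumes "assoc_algebra A"
  shows "x \<in> carrier A \<Longrightarrow> y \<in> carrier A \<Longrightarrow> x \<otimes>\<^bsub>A\<^esub> y \<in> carrier A" "\<one>\<^bsub>A\<^esub> \<in> carrier A"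
proof -
  interpret ring A using assms by simp
  show "x \<in> carrier A \<Longrightarrow> y \<in> carrier A \<Longrightarrow> x \<otimes>\<^bsub>A\<^esub> y \<in> carrier A" "\<one>\<^bsub>A\<^esub> \<in> carrier A" by auto
qed

lemma assoc_algebra_mult [simp]:
  assumes "assoc_algebra A" "x \<in> carrier A"
  shows "y \<in> carrier A \<Longrightarrow> z \<in> carrier A \<Longrightarrow> (x \<otimes>\<^bsub>A\<^esub> y) \<otimes>\<^bsub>A\<^esub> z = x \<otimes>\<^bsub>A\<^esub> (y \<otimes>\<^bsub>A\<^esub> z)"
    "\<one>\<^bsub>A\<^esub> \<otimes>\<^bsub>A\<^esub> x = x" "x \<otimes>\<^bsub>A\<^esub> \<one>\<^bsub>A\<^esub> = x" "x \<otimes>\<^bsub>A\<^esub> \<zero>\<^bsub>A\<^esub> = \<zero>\<^bsub>A\<^esub>" "\<zero>\<^bsub>A\<^esub> \<otimes>\<^bsub>A\<^esub> x = \<zero>\<^bsub>A\<^esub>"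
    "y \<in> carrier A \<Longrightarrow> (a \<odot>\<^bsub>A\<^esub> x) \<otimes>\<^bsub>A\<^esub> y = a \<odot>\<^bsub>A\<^esub> (x \<otimes>\<^bsub>A\<^esub> y)"
    "y \<in> carrier A \<Longrightarrow> x \<otimes>\<^bsub>A\<^esub> (a \<odot>\<^bsub>A\<^esub> y) = a \<odot>\<^bsub>A\<^esub> (x \<otimes>\<^bsub>A\<^esub> y)"
proof -
  interpret ring A using assms(1) by simp
  show "y \<in> carrier A \<Longrightarrow> z \<in> carrier A \<Longrightarrow> (x \<otimes>\<^bsub>A\<^esub> y) \<otimes>\<^bsub>A\<^esub> z = x \<otimes>\<^bsub>A\<^esub> (y \<otimes>\<^bsub>A\<^esub> z)"
    "\<one>\<^bsub>A\<^esub> \<otimes>\<^bsub>A\<^esub> x = x" "x \<otimes>\<^bsub>A\<^esub> \<one>\<^bsub>A\<^esub> = x" "x \<otimes>\<^bsub>A\<^esub> \<zero>\<^bsub>A\<^esub> = \<zero>\<^bsub>A\<^esub>" "\<zero>\<^bsub>A\<^esub> \<otimes>\<^bsub>A\<^esub> x = \<zero>\<^bsub>A\<^esub>"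
    using assms(2) by (auto simp: m_assoc)
  show "y \<in> carrier A \<Longrightarrow> (a \<odot>\<^bsub>A\<^esub> x) \<otimes>\<^bsub>A\<^esub> y = a \<odot>\<^bsub>A\<^esub> (x \<otimes>\<^bsub>A\<^esub> y)"
    "y \<in> carrier A \<Longrightarrow> x \<otimes>\<^bsub>A\<^esub> (a \<odot>\<^bsub>A\<^esub> y) = a \<odot>\<^bsub>A\<^esub> (x \<otimes>\<^bsub>A\<^esub> y)"
    using assms unfolding assoc_algebra_def by blast+
qed

lemma assoc_algebra_distr:
  assumes "assoc_algebra A" "x \<in> carrier A" "y \<in> carrier A" "z \<in> carrier A"
  shows "(x \<oplus>\<^bsub>A\<^esub> y) \<otimes>\<^bsub>A\<^esub> z = x \<otimes>\<^bsub>A\<^esub> z \<oplus>\<^bsub>A\<^esub> y \<otimes>\<^bsub>A\<^esub> z"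
    "z \<otimes>\<^bsub>A\<^esub> (x \<oplus>\<^bsub>A\<^esub> y) = z \<otimes>\<^bsub>A\<^esub> x \<oplus>\<^bsub>A\<^esub> z \<otimes>\<^bsub>A\<^esub> y"
proof -
  interpret ring A using assms by simp
  show "(x \<oplus>\<^bsub>A\<^esub> y) \<otimes>\<^bsub>A\<^esub> z = x \<otimes>\<^bsub>A\<^esub> z \<oplus>\<^bsub>A\<^esub> y \<otimes>\<^bsub>A\<^esub> z"
    "z \<otimes>\<^bsub>A\<^esub> (x \<oplus>\<^bsub>A\<^esub> y) = z \<otimes>\<^bsub>A\<^esub> x \<oplus>\<^bsub>A\<^esub> z \<otimes>\<^bsub>A\<^esub> y"
    using assms by (auto simp: l_distr r_distr)
qed

lemma vec_spaceI:
  fixes V :: "('k::field, 'v, 'm) module_scheme"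
  assumes "\<zero>\<^bsub>V\<^esub> \<in> carrier V"
    and add: "\<And>x y. x \<in> carrier V \<Longrightarrow> y \<in> carrier V \<Longrightarrow> x \<oplus>\<^bsub>V\<^esub> y \<in> carrier V"
    and smult: "\<And>a x. x \<in> carrier V \<Longrightarrow> a \<odot>\<^bsub>V\<^esub> x \<in> carrier V"
    and assoc: "\<And>x y z. x \<in> carrier V \<Longrightarrow> y \<in> carrier V \<Longrightarrow> z \<in> carrier V \<Longrightarrow> x \<oplus>\<^bsub>V\<^esub> y \<oplus>\<^bsub>V\<^esub> z = x \<oplus>\<^bsub>V\<^esub> (y \<oplus>\<^bsub>V\<^esub> z)"
    and comm: "\<And>x y. x \<in> carrier V \<Longrightarrow> y \<in> carrier V \<Longrightarrow> x \<oplus>\<^bsub>V\<^esub> y = y \<oplus>\<^bsub>V\<^esub> x"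
    and zero: "\<And>x. x \<in> carrier V \<Longrightarrow> \<zero>\<^bsub>V\<^esub> \<oplus>\<^bsub>V\<^esub> x = x"
    and one: "\<And>x. x \<in> carrier V \<Longrightarrow> 1 \<odot>\<^bsub>V\<^esub> x = x"
    and smult0: "\<And>x. x \<in> carrier V \<Longrightarrow> 0 \<odot>\<^bsub>V\<^esub> x = \<zero>\<^bsub>V\<^esub>"
    and l_distr: "\<And>a b x. x \<in> carrier V \<Longrightarrow> (a + b) \<odot>\<^bsub>V\<^esub> x = a \<odot>\<^bsub>V\<^esub> x \<oplus>\<^bsub>V\<^esub> b \<odot>\<^bsub>V\<^esub> x"
    and r_distr: "\<And>a x y. x \<in> carrier V \<Longrightarrow> y \<in> carrier V \<Longrightarrow> a \<odot>\<^bsub>V\<^esub> (x \<oplus>\<^bsub>V\<^esub> y) = a \<odot>\<^bsub>V\<^esub> x \<oplus>\<^bsub>V\<^esub> a \<odot>\<^bsub>V\<^esub> y"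
    and smult_assoc: "\<And>a b x. x \<in> carrier V \<Longrightarrow> (a * b) \<odot>\<^bsub>V\<^esub> x = a \<odot>\<^bsub>V\<^esub> (b \<odot>\<^bsub>V\<^esub> x)"
  shows "vec_space V"
  unfolding vec_space_def
proof (rule moduleI)
  show "cring (ring_of_type_algebra :: 'k ring)" by (rule cring_from_type_algebra)
  show "abelian_group V"
  proof (rule abelian_groupI)
    fix x assume x: "x \<in> carrier V"
    \<comment> \<open>Additive inverses come from the scalar -1: adding \<open>x\<close> gives
      \<open>0 \<odot> x\<close>, which is zero.\<close>
    have "(-1) \<odot>\<^bsub>V\<^esub> x \<oplus>\<^bsub>V\<^esub> 1 \<odot>\<^bsub>V\<^esub> x = (-1 + 1) \<odot>\<^bsub>V\<^esub> x"
      using x by (simp only: l_distr)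
    then show "\<exists>y\<in>carrier V. y \<oplus>\<^bsub>V\<^esub> x = \<zero>\<^bsub>V\<^esub>"
      using x assms by (intro bexI[of _ "(-1) \<odot>\<^bsub>V\<^esub> x"]) auto
  qed (use assms in auto)
qed (use assms in \<open>auto simp: ring_of_type_algebra_def\<close>)

lemma assoc_algebraI:
  assumes "vec_space A"
    and "\<And>x y. x \<in> carrier A \<Longrightarrow> y \<in> carrier A \<Longrightarrow> x \<otimes>\<^bsub>A\<^esub> y \<in> carrier A" "\<one>\<^bsub>A\<^esub> \<in> carrier A"
    and "\<And>x y z. x \<in> carrier A \<Longrightarrow> y \<in> carrier A \<Longrightarrow> z \<in> carrier A \<Longrightarrow> (x \<otimes>\<^bsub>A\<^esub> y) \<otimes>\<^bsub>A\<^esub> z = x \<otimes>\<^bsub>A\<^esub> (y \<otimes>\<^bsub>A\<^esub> z)"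
    and "\<And>x. x \<in> carrier A \<Longrightarrow> \<one>\<^bsub>A\<^esub> \<otimes>\<^bsub>A\<^esub> x = x" "\<And>x. x \<in> carrier A \<Longrightarrow> x \<otimes>\<^bsub>A\<^esub> \<one>\<^bsub>A\<^esub> = x"
    and "\<And>x y z. x \<in> carrier A \<Longrightarrow> y \<in> carrier A \<Longrightarrow> z \<in> carrier A \<Longrightarrow> (x \<oplus>\<^bsub>A\<^esub> y) \<otimes>\<^bsub>A\<^esub> z = x \<otimes>\<^bsub>A\<^esub> z \<oplus>\<^bsub>A\<^esub> y \<otimes>\<^bsub>A\<^esub> z"
    and "\<And>x y z. x \<in> carrier A \<Longrightarrow> y \<in> carrier A \<Longrightarrow> z \<in> carrier A \<Longrightarrow> z \<otimes>\<^bsub>A\<^esub> (x \<oplus>\<^bsub>A\<^esub> y) = z \<otimes>\<^bsub>A\<^esub> x \<oplus>\<^bsub>A\<^esub> z \<otimes>\<^bsub>A\<^esub> y"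
    and "\<And>a x y. x \<in> carrier A \<Longrightarrow> y \<in> carrier A \<Longrightarrow> (a \<odot>\<^bsub>A\<^esub> x) \<otimes>\<^bsub>A\<^esub> y = a \<odot>\<^bsub>A\<^esub> (x \<otimes>\<^bsub>A\<^esub> y)"
    and "\<And>a x y. x \<in> carrier A \<Longrightarrow> y \<in> carrier A \<Longrightarrow> x \<otimes>\<^bsub>A\<^esub> (a \<odot>\<^bsub>A\<^esub> y) = a \<odot>\<^bsub>A\<^esub> (x \<otimes>\<^bsub>A\<^esub> y)"
  shows "assoc_algebra A"
  unfolding assoc_algebra_def
  using assms vec_space_abelian_group[OF assms(1)]
  by (auto intro!: ringI monoidI)

lemma algebra_mapI:
  assumes "linear_map A B f"
    and "\<And>x y. x \<in> carrier A \<Longrightarrow> y \<in> carrier A \<Longrightarrow> f (x \<otimes>\<^bsub>A\<^esub> y) = f x \<otimes>\<^bsub>B\<^esub> f y" "f \<one>\<^bsub>A\<^esub> = \<one>\<^bsub>B\<^esub>"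
  shows "algebra_map A B f"
  using assms by (auto simp: algebra_map_def ring_hom_def linear_map_def)

lemma algebra_mapD:
  assumes "algebra_map A B f"
  shows "linear_map A B f"
    and "x \<in> carrier A \<Longrightarrow> y \<in> carrier A \<Longrightarrow> f (x \<otimes>\<^bsub>A\<^esub> y) = f x \<otimes>\<^bsub>B\<^esub> f y" "f \<one>\<^bsub>A\<^esub> = \<one>\<^bsub>B\<^esub>"
  using assms by (auto simp: algebra_map_def ring_hom_def)

lemma algebra_map_comp:
  "algebra_map A B f \<Longrightarrow> algebra_map B C g \<Longrightarrow> algebra_map A C (\<lambda>x. g (f x))"
  by (intro algebra_mapI) (auto simp: algebra_mapD linear_mapD[OF algebra_mapD(1)] intro: linear_map_comp algebra_mapD(1))

text \<open>Equational laws survive a surjection: every element of \<open>B\<close> is some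
  \<open>f x\<close>, so each law for \<open>B\<close> is the image under \<open>f\<close> of the
  law for \<open>A\<close>. Applied to quotients, to images under a map with a section, and to the
  record \<open>T\<close>.\<close>

lemma assoc_algebra_surj_image:
  assumes A: "assoc_algebra A"
    and surj: "carrier B = f ` carrier A"
    and zero: "\<zero>\<^bsub>B\<^esub> = f \<zero>\<^bsub>A\<^esub>" and one: "\<one>\<^bsub>B\<^esub> = f \<one>\<^bsub>A\<^esub>"
    and add: "\<And>x y. x \<in> carrier A \<Longrightarrow> y \<in> carrier A \<Longrightarrow> f x \<oplus>\<^bsub>B\<^esub> f y = f (x \<oplus>\<^bsub>A\<^esub> y)"
    and mult: "\<And>x y. x \<in> carrier A \<Longrightarrow> y \<in> carrier A \<Longrightarrow> f x \<otimes>\<^bsub>B\<^esub> f y = f (x \<otimes>\<^bsub>A\<^esub> y)"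
    and smult: "\<And>a x. x \<in> carrier A \<Longrightarrow> a \<odot>\<^bsub>B\<^esub> f x = f (a \<odot>\<^bsub>A\<^esub> x)"
  shows "assoc_algebra B" "algebra_map A B f"
proof -
  note [simp] = A zero one add mult smult assoc_algebra_distr
  have "vec_space B"
    unfolding surj by (rule vec_spaceI) (auto simp: surj vec_space_smult_add vec_space_add_ac)
  then show "assoc_algebra B"
    by (rule assoc_algebraI) (auto simp: surj)
  show "algebra_map A B f"
    by (intro algebra_mapI linear_mapI) (auto simp: surj)
qed

text \<open>As \<open>a \<odot> x\<close> equals \<open>(a \<odot> \<one>) \<otimes> x\<close>,
  absorption of ring elements already yields closure under scalars.\<close>

lemma ideal_smult:
  assumes "assoc_algebra A" "ideal J A" "x \<in> J"
  shows "a \<odot>\<^bsub>A\<^esub> x \<in> J"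
proof -
  have x: "x \<in> carrier A" using assms(2,3) by (simp add: ideal.Icarr)
  have "(a \<odot>\<^bsub>A\<^esub> \<one>\<^bsub>A\<^esub>) \<otimes>\<^bsub>A\<^esub> x \<in> J"
    using assms by (intro ideal.I_l_closed) auto
  then show ?thesis using assms(1) x by simp
qed

lemma quot_proj_mem:
  assumes "ring A" "ideal J A" "x \<in> carrier A"
  shows "quot_proj A J x \<in> carrier A" "quot_proj A J x \<ominus>\<^bsub>A\<^esub> x \<in> J"
proof -
  interpret ring A by fact
  interpret ideal J A by fact
  have "x \<in> J +>\<^bsub>A\<^esub> x" by (rule a_rcos_self[OF assms(3)])
  then have m: "quot_proj A J x \<in> J +>\<^bsub>A\<^esub> x" unfolding quot_proj_def by (rule someI)
  then show c: "quot_proj A J x \<in> carrier A"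
    using a_r_coset_subset_G[of J x] a_subset assms(3) by auto
  from m obtain j where "j \<in> J" "quot_proj A J x = j \<oplus>\<^bsub>A\<^esub> x"
    by (auto simp: a_r_coset_def')
  then show "quot_proj A J x \<ominus>\<^bsub>A\<^esub> x \<in> J"
    using assms(3) Icarr[of j] by (simp add: a_minus_def a_assoc r_neg)
qed

text \<open>The chosen representative depends only on the coset. Conversely, a common representative
  q gives x - y = (q - y) - (q - x).\<close>

lemma quot_proj_eq_iff:
  assumes "ring A" "ideal J A" "x \<in> carrier A" "y \<in> carrier A"
  shows "quot_proj A J x = quot_proj A J y \<longleftrightarrow> x \<ominus>\<^bsub>A\<^esub> y \<in> J"
proof -
  interpret ring A by fact
  interpret ideal J A by fact
  show ?thesis
  proof
    assume eq: "quot_proj A J x = quot_proj A J y"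
    have "(quot_proj A J y \<ominus>\<^bsub>A\<^esub> y) \<oplus>\<^bsub>A\<^esub> \<ominus>\<^bsub>A\<^esub> (quot_proj A J x \<ominus>\<^bsub>A\<^esub> x) \<in> J"
      using quot_proj_mem[OF assms(1,2)] assms(3,4) by blast
    also have "(quot_proj A J y \<ominus>\<^bsub>A\<^esub> y) \<oplus>\<^bsub>A\<^esub> \<ominus>\<^bsub>A\<^esub> (quot_proj A J x \<ominus>\<^bsub>A\<^esub> x) = x \<ominus>\<^bsub>A\<^esub> y"
    proof -
      have "(q \<ominus>\<^bsub>A\<^esub> y) \<oplus>\<^bsub>A\<^esub> \<ominus>\<^bsub>A\<^esub> (q \<ominus>\<^bsub>A\<^esub> x) = x \<ominus>\<^bsub>A\<^esub> y" if "q \<in> carrier A" for q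
        using that assms(3,4) by algebra
      then show ?thesis using quot_proj_mem[OF assms(1,2)] assms(4) by (simp add: eq)
    qed
    finally show "x \<ominus>\<^bsub>A\<^esub> y \<in> J" .
  next
    assume "x \<ominus>\<^bsub>A\<^esub> y \<in> J"
    then have "(x \<ominus>\<^bsub>A\<^esub> y) \<oplus>\<^bsub>A\<^esub> y \<in> J +>\<^bsub>A\<^esub> y" by (auto simp: a_r_coset_def')
    moreover have "(x \<ominus>\<^bsub>A\<^esub> y) \<oplus>\<^bsub>A\<^esub> y = x" using assms(3,4) by algebra
    ultimately have "J +>\<^bsub>A\<^esub> x = J +>\<^bsub>A\<^esub> y"
      using a_repr_independence'[of x y] assms(4) by simp
    then show "quot_proj A J x = quot_proj A J y" by (simp add: quot_proj_def)
  qed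
qed

text \<open>A representative represents itself. Hence \<open>id\<close> can serve as the section of
  the projection when the quotient is later treated as an image.\<close>

lemma quot_proj_idem:
  assumes "ring A" "ideal J A" "x \<in> carrier A"
  shows "quot_proj A J (quot_proj A J x) = quot_proj A J x"
  using quot_proj_mem[OF assms] assms by (subst quot_proj_eq_iff) auto

lemma quot_alg:
  assumes A: "assoc_algebra A" and J: "ideal J A"
  shows "assoc_algebra (quot_alg A J)" "algebra_map A (quot_alg A J) (quot_proj A J)"
proof -
  interpret R: ring A using A by simp
  interpret ideal J A by fact
  let ?p = "quot_proj A J"
  note q = quot_proj_mem[OF R.ring_axioms J]
  note eq = quot_proj_eq_iff[OF R.ring_axioms J]
  have Jadd: "u \<oplus>\<^bsub>A\<^esub> v \<in> J" if "u \<in> J" "v \<in> J" for u v using that by blast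
  have minus2: "(u \<ominus>\<^bsub>A\<^esub> v) \<oplus>\<^bsub>A\<^esub> (v \<ominus>\<^bsub>A\<^esub> w) = u \<ominus>\<^bsub>A\<^esub> w"
    if "u \<in> carrier A" "v \<in> carrier A" "w \<in> carrier A" for u v w
    using that by algebra
  have aux1: "(p \<ominus>\<^bsub>A\<^esub> x) \<oplus>\<^bsub>A\<^esub> (q \<ominus>\<^bsub>A\<^esub> y) = (p \<oplus>\<^bsub>A\<^esub> q) \<ominus>\<^bsub>A\<^esub> (x \<oplus>\<^bsub>A\<^esub> y)"
    if "p \<in> carrier A" "q \<in> carrier A" "x \<in> carrier A" "y \<in> carrier A" for p q x y
    using that by algebra
  have aux2: "(p \<ominus>\<^bsub>A\<^esub> x) \<otimes>\<^bsub>A\<^esub> q \<oplus>\<^bsub>A\<^esub> x \<otimes>\<^bsub>A\<^esub> (q \<ominus>\<^bsub>A\<^esub> y) = (p \<otimes>\<^bsub>A\<^esub> q) \<ominus>\<^bsub>A\<^esub> (x \<otimes>\<^bsub>A\<^esub> y)"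
    if "p \<in> carrier A" "q \<in> carrier A" "x \<in> carrier A" "y \<in> carrier A" for p q x y
  proof -
    have "(p \<ominus>\<^bsub>A\<^esub> x) \<otimes>\<^bsub>A\<^esub> q = p \<otimes>\<^bsub>A\<^esub> q \<ominus>\<^bsub>A\<^esub> x \<otimes>\<^bsub>A\<^esub> q"
      "x \<otimes>\<^bsub>A\<^esub> (q \<ominus>\<^bsub>A\<^esub> y) = x \<otimes>\<^bsub>A\<^esub> q \<ominus>\<^bsub>A\<^esub> x \<otimes>\<^bsub>A\<^esub> y"
      using that by (simp_all add: a_minus_def R.l_distr R.r_distr R.l_minus R.r_minus)
    then show ?thesis using that by (simp add: minus2)
  qed
  have add: "?p (?p x \<oplus>\<^bsub>A\<^esub> ?p y) = ?p (x \<oplus>\<^bsub>A\<^esub> y)" if "x \<in> carrier A" "y \<in> carrier A" for x y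
  proof -
    have "(?p x \<ominus>\<^bsub>A\<^esub> x) \<oplus>\<^bsub>A\<^esub> (?p y \<ominus>\<^bsub>A\<^esub> y) \<in> J" using q that by blast
    moreover have "(?p x \<ominus>\<^bsub>A\<^esub> x) \<oplus>\<^bsub>A\<^esub> (?p y \<ominus>\<^bsub>A\<^esub> y) = (?p x \<oplus>\<^bsub>A\<^esub> ?p y) \<ominus>\<^bsub>A\<^esub> (x \<oplus>\<^bsub>A\<^esub> y)"
      using q that by (intro aux1) auto
    ultimately show ?thesis using q that by (simp add: eq)
  qed
  have mult: "?p (?p x \<otimes>\<^bsub>A\<^esub> ?p y) = ?p (x \<otimes>\<^bsub>A\<^esub> y)" if "x \<in> carrier A" "y \<in> carrier A" for x y
  proof -
    have "(?p x \<ominus>\<^bsub>A\<^esub> x) \<otimes>\<^bsub>A\<^esub> ?p y \<oplus>\<^bsub>A\<^esub> x \<otimes>\<^bsub>A\<^esub> (?p y \<ominus>\<^bsub>A\<^esub> y) \<in> J"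
      using q that by (intro Jadd I_l_closed I_r_closed) auto
    moreover have "(?p x \<ominus>\<^bsub>A\<^esub> x) \<otimes>\<^bsub>A\<^esub> ?p y \<oplus>\<^bsub>A\<^esub> x \<otimes>\<^bsub>A\<^esub> (?p y \<ominus>\<^bsub>A\<^esub> y) = (?p x \<otimes>\<^bsub>A\<^esub> ?p y) \<ominus>\<^bsub>A\<^esub> (x \<otimes>\<^bsub>A\<^esub> y)"
      using q that by (intro aux2) auto
    ultimately show ?thesis using q that by (simp add: eq)
  qed
  have smult: "?p (a \<odot>\<^bsub>A\<^esub> ?p x) = ?p (a \<odot>\<^bsub>A\<^esub> x)" if "x \<in> carrier A" for a x
  proof -
    have "a \<odot>\<^bsub>A\<^esub> (?p x \<ominus>\<^bsub>A\<^esub> x) \<in> J" using ideal_smult[OF A J] q that by blast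
    moreover have "a \<odot>\<^bsub>A\<^esub> (?p x \<ominus>\<^bsub>A\<^esub> x) = a \<odot>\<^bsub>A\<^esub> ?p x \<ominus>\<^bsub>A\<^esub> a \<odot>\<^bsub>A\<^esub> x"
      using A q(1)[OF that] that by (simp add: vec_space_minus mult.commute)
    ultimately show ?thesis using q that A by (simp add: eq)
  qed
  show "assoc_algebra (quot_alg A J)" "algebra_map A (quot_alg A J) ?p"
    using assoc_algebra_surj_image[OF A, of "quot_alg A J" ?p]
    by (auto simp: quot_alg_def add mult smult)
qed


section \<open>The tensor algebra\<close>

lemma keys_subsetI:
  fixes f g :: "'x \<Rightarrow>\<^sub>0 'k::field"
  assumes "Poly_Mapping.keys f \<subseteq> S"
  shows "Poly_Mapping.keys g \<subseteq> S \<Longrightarrow> Poly_Mapping.keys (f + g) \<subseteq> S"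
    "Poly_Mapping.keys g \<subseteq> S \<Longrightarrow> Poly_Mapping.keys (f - g) \<subseteq> S"
    "Poly_Mapping.keys (fscale a f) \<subseteq> S"
proof -
  show "Poly_Mapping.keys g \<subseteq> S \<Longrightarrow> Poly_Mapping.keys (f + g) \<subseteq> S"
    using assms Poly_Mapping.keys_add[of f g] by blast
  show "Poly_Mapping.keys g \<subseteq> S \<Longrightarrow> Poly_Mapping.keys (f - g) \<subseteq> S"
  proof
    fix x assume "Poly_Mapping.keys g \<subseteq> S" "x \<in> Poly_Mapping.keys (f - g)"
    moreover from this(2) have "x \<in> Poly_Mapping.keys f \<or> x \<in> Poly_Mapping.keys g"
      by (auto simp: in_keys_iff lookup_minus)
    ultimately show "x \<in> S" using assms by blast
  qed
  show "Poly_Mapping.keys (fscale a f) \<subseteq> S"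
    using assms keys_fscale[of a f] by blast
qed

lemma free_alg_simps [simp]:
  "carrier (free_alg V) = {f. Poly_Mapping.keys f \<subseteq> lists (carrier V)}"
  "\<one>\<^bsub>free_alg V\<^esub> = fret []" "\<zero>\<^bsub>free_alg V\<^esub> = 0" "f \<oplus>\<^bsub>free_alg V\<^esub> g = f + g" "a \<odot>\<^bsub>free_alg V\<^esub> f = fscale a f"
  by (auto simp: free_alg_def fscale_def)

lemma free_alg_mult [simp]: "f \<otimes>\<^bsub>free_alg V\<^esub> g = f \<bind> (\<lambda>l. g \<bind> (\<lambda>r. fret (l @ r)))"
proof -
  have "f \<bind> (\<lambda>l. g \<bind> (\<lambda>r. fret (l @ r))) =
      (\<Sum>l\<in>Poly_Mapping.keys f. \<Sum>r\<in>Poly_Mapping.keys g.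
        Poly_Mapping.single (l @ r) (Poly_Mapping.lookup f l * Poly_Mapping.lookup g r))"
    by (simp add: fbind_def fscale_sum)
  then show ?thesis by (simp add: free_alg_def)
qed

lemma free_alg: "assoc_algebra (free_alg (V :: ('k::field, 'v, 'm) module_scheme))"
proof (rule assoc_algebraI)
  show "vec_space (free_alg V)"
    by (rule vec_spaceI) (simp_all add: algebra_simps fscale_add_left keys_subsetI)
  show "f \<otimes>\<^bsub>free_alg V\<^esub> g \<in> carrier (free_alg V)"
    if "f \<in> carrier (free_alg V)" "g \<in> carrier (free_alg V)" for f g
    using that unfolding free_alg_simps free_alg_mult mem_Collect_eq
    by (intro keys_fbind[of f "lists (carrier V)"] keys_fbind[of g "lists (carrier V)"]) (simp_all add: lists_eq_set)
qed (auto simp: fbind_add_right fbind_scale_right)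

lemma tensor_ideal:
  fixes V :: "('k::field, 'v, 'm) module_scheme"
  assumes V: "vec_space V"
  shows "ideal (tensor_ideal V) (free_alg V)" "tensor_rels V \<subseteq> carrier (free_alg V)"
proof -
  interpret ring "free_alg V" by (rule assoc_algebraD(2)[OF free_alg])
  show "tensor_rels V \<subseteq> carrier (free_alg V)"
  proof
    fix f assume "f \<in> tensor_rels V"
    then consider (add) a b where "a \<in> carrier V" "b \<in> carrier V" "f = fret [a \<oplus>\<^bsub>V\<^esub> b] - fret [a] - fret [b]"
      | (smult) k a where "a \<in> carrier V" "f = fret [k \<odot>\<^bsub>V\<^esub> a] - Poly_Mapping.single [a] k"
      by (auto simp: tensor_rels_def)
    then show "f \<in> carrier (free_alg V)"
      unfolding free_alg_simps mem_Collect_eq using V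
      by cases (simp_all only:, (rule keys_subsetI | simp)+)
  qed
  then show "ideal (tensor_ideal V) (free_alg V)" unfolding tensor_ideal_def by (rule genideal_ideal)
qed

lemma tensor_alg [simp]: "vec_space V \<Longrightarrow> assoc_algebra (tensor_alg V)"
  unfolding tensor_alg_def by (intro quot_alg free_alg tensor_ideal)

section \<open>The universal property of the tensor algebra\<close>

lemma lin_ext_diff:
  assumes W: "vec_space W"
    and h: "\<And>x. x \<in> Poly_Mapping.keys s \<Longrightarrow> h x \<in> carrier W" "\<And>x. x \<in> Poly_Mapping.keys t \<Longrightarrow> h x \<in> carrier W"
  shows "lin_ext W (s - t) h = lin_ext W s h \<ominus>\<^bsub>W\<^esub> lin_ext W t h"
proof -
  have eq: "s - t = s + fscale (-1) t" by (rule poly_mapping_eqI) (simp add: lookup_minus lookup_add)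
  have k: "h x \<in> carrier W" if "x \<in> Poly_Mapping.keys (fscale (-1) t)" for x
    using h(2)[OF subsetD[OF keys_fscale that]] .
  show ?thesis unfolding eq using h k W
    by (simp add: lin_ext_add lin_ext_scale lin_ext_closed vec_space_minus)
qed

lemma keys_diff_single:
  "x \<in> Poly_Mapping.keys (fret y - fret z :: 'x \<Rightarrow>\<^sub>0 'k::field) \<Longrightarrow> x = y \<or> x = z"
  by (auto simp: in_keys_iff lookup_minus lookup_single when_def split: if_splits)

lemma vec_space_add_minus:
  assumes "vec_space W" "x \<in> carrier W" "y \<in> carrier W"
  shows "x \<oplus>\<^bsub>W\<^esub> y \<ominus>\<^bsub>W\<^esub> x \<ominus>\<^bsub>W\<^esub> y = \<zero>\<^bsub>W\<^esub>"
proof -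
  interpret abelian_group W by (rule vec_space_abelian_group) fact
  show ?thesis using assms(2,3)
    by (metis a_comm a_minus_def add.inv_solve_right' add.m_closed minus_closed vec_space_zero(3)[OF assms(1)])
qed

lemma lin_ext_free_alg:
  assumes W: "vec_space W" and h: "\<And>l. set l \<subseteq> carrier V \<Longrightarrow> h l \<in> carrier W"
  shows "linear_map (free_alg V) W (\<lambda>f. lin_ext W f h)"
  using h by (intro linear_mapI) (auto intro!: lin_ext_closed lin_ext_add lin_ext_scale W)

text \<open>One condition for words of all lengths at once: exactly the compatibility with
  \<open>tensor_rels\<close>, in every context of surrounding letters, that a linear map out of the
  whole tensor algebra requires.\<close>

definition multilinear :: "('k::field, 'v, 'm) module_scheme \<Rightarrow> ('k, 'w, 'n) module_scheme \<Rightarrow> ('v list \<Rightarrow> 'w) \<Rightarrow> bool" where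
  "multilinear V W h \<longleftrightarrow>
     (\<forall>l. set l \<subseteq> carrier V \<longrightarrow> h l \<in> carrier W) \<and>
     (\<forall>u w. set u \<subseteq> carrier V \<longrightarrow> set w \<subseteq> carrier V \<longrightarrow>
        (\<forall>a\<in>carrier V. \<forall>b\<in>carrier V. h (u @ (a \<oplus>\<^bsub>V\<^esub> b) # w) = h (u @ a # w) \<oplus>\<^bsub>W\<^esub> h (u @ b # w)) \<and>
        (\<forall>k. \<forall>a\<in>carrier V. h (u @ (k \<odot>\<^bsub>V\<^esub> a) # w) = k \<odot>\<^bsub>W\<^esub> h (u @ a # w)))"

lemma multilinearD:
  assumes "multilinear V W h"
  shows "set l \<subseteq> carrier V \<Longrightarrow> h l \<in> carrier W"
    and "set u \<subseteq> carrier V \<Longrightarrow> set w \<subseteq> carrier V \<Longrightarrow> a \<in> carrier V \<Longrightarrow> b \<in> carrier V \<Longrightarrow>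
      h (u @ (a \<oplus>\<^bsub>V\<^esub> b) # w) = h (u @ a # w) \<oplus>\<^bsub>W\<^esub> h (u @ b # w)"
    and "set u \<subseteq> carrier V \<Longrightarrow> set w \<subseteq> carrier V \<Longrightarrow> a \<in> carrier V \<Longrightarrow>
      h (u @ (k \<odot>\<^bsub>V\<^esub> a) # w) = k \<odot>\<^bsub>W\<^esub> h (u @ a # w)"
  using assms unfolding multilinear_def by blast+

text \<open>\<open>tensor_ideal\<close> is the smallest ideal containing the relations, so it
  suffices to find one ideal that contains them and on which the linear extension of
  \<open>h\<close> vanishes.\<close>

lemma lin_ext_tensor_ideal:
  fixes V :: "('k::field, 'v, 'm) module_scheme"
  assumes V: "vec_space V" and W: "vec_space W" and h: "multilinear V W h" and f: "f \<in> tensor_ideal V"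
  shows "lin_ext W f h = \<zero>\<^bsub>W\<^esub>"
proof -
  interpret F: ring "free_alg V" by (rule assoc_algebraD(2)[OF free_alg])
  note [simp] = W
  have hc: "h l \<in> carrier W" if "l \<in> lists (carrier V)" for l
    using multilinearD(1)[OF h] that by auto
  let ?D = "lists (carrier V)"
  \<comment> \<open>The elements killed in every context \<open>u\<close>, \<open>w\<close>.
    Allowing arbitrary surrounding words makes this set absorb multiplication; the kernel of the
    extension of \<open>h\<close> alone need not do so.\<close>
  define I where "I = {f \<in> carrier (free_alg V). \<forall>u\<in>?D. \<forall>w\<in>?D. lin_ext W f (\<lambda>l. h (u @ l @ w)) = \<zero>\<^bsub>W\<^esub>}"
  have hc': "h (u @ l @ w) \<in> carrier W" if "u \<in> ?D" "w \<in> ?D" "l \<in> ?D" for u l w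
    using that by (intro hc) auto
  have minus: "\<ominus>\<^bsub>free_alg V\<^esub> f = fscale (-1) f" if "f \<in> carrier (free_alg V)" for f
    using that vec_space_minus[OF assoc_algebraD(1)[OF free_alg, of V], of 0 f]
    by (simp add: a_minus_def keys_subsetI)
  have "ideal I (free_alg V)"
  proof (rule idealI)
    show "subgroup I (add_monoid (free_alg V))"
    proof (rule F.add.subgroupI)
      show "I \<subseteq> carrier (free_alg V)" by (auto simp: I_def)
      have "0 \<in> I" by (auto simp: I_def)
      then show "I \<noteq> {}" by blast
      show "\<ominus>\<^bsub>free_alg V\<^esub> f \<in> I" if "f \<in> I" for f
      proof -
        have "lin_ext W (fscale (-1) f) (\<lambda>l. h (u @ l @ w)) = \<zero>\<^bsub>W\<^esub>" if "u \<in> ?D" "w \<in> ?D" for u w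
          using that \<open>f \<in> I\<close> hc' by (subst lin_ext_scale) (auto simp: I_def subset_iff)
        then show ?thesis using that by (subst minus) (auto simp: I_def keys_subsetI)
      qed
      show "f \<oplus>\<^bsub>free_alg V\<^esub> g \<in> I" if "f \<in> I" "g \<in> I" for f g
      proof -
        have "lin_ext W (f + g) (\<lambda>l. h (u @ l @ w)) = \<zero>\<^bsub>W\<^esub>" if "u \<in> ?D" "w \<in> ?D" for u w
          using that \<open>f \<in> I\<close> \<open>g \<in> I\<close> hc' by (subst lin_ext_add) (auto simp: I_def subset_iff)
        then show ?thesis using that by (auto simp: I_def keys_subsetI)
      qed
    qed
    fix f g assume f: "f \<in> I" and g: "g \<in> carrier (free_alg V)"
    have fD: "\<And>l. l \<in> Poly_Mapping.keys f \<Longrightarrow> l \<in> ?D" and gD: "\<And>l. l \<in> Poly_Mapping.keys g \<Longrightarrow> l \<in> ?D"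
      using f g unfolding I_def free_alg_simps by blast+
    have z: "lin_ext W f (\<lambda>l. h (u @ l @ w)) = \<zero>\<^bsub>W\<^esub>" if "u \<in> ?D" "w \<in> ?D" for u w
      using f that unfolding I_def by blast
    have eval: "lin_ext W (p \<bind> (\<lambda>l. q \<bind> (\<lambda>r. fret (l @ r)))) (\<lambda>l. h (u @ l @ w)) =
        lin_ext W p (\<lambda>l. lin_ext W q (\<lambda>r. h (u @ (l @ r) @ w)))"
      if uw: "u \<in> ?D" "w \<in> ?D" and p: "\<And>l. l \<in> Poly_Mapping.keys p \<Longrightarrow> l \<in> ?D"
        and q: "\<And>l. l \<in> Poly_Mapping.keys q \<Longrightarrow> l \<in> ?D" for p q :: "'v list \<Rightarrow>\<^sub>0 'k" and u w
    proof -
      have *: "lin_ext W (q \<bind> (\<lambda>r. fret (l @ r))) (\<lambda>l. h (u @ l @ w)) = lin_ext W q (\<lambda>r. h (u @ (l @ r) @ w))"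
        if "l \<in> Poly_Mapping.keys p" for l
        using hc' uw p[OF that] q by (subst lin_ext_bind) (simp_all add: lin_ext_single cong: lin_ext_cong)
      have k: "Poly_Mapping.keys (q \<bind> (\<lambda>r. fret (l @ r))) \<subseteq> ?D" if "l \<in> Poly_Mapping.keys p" for l
        using p[OF that] q by (intro keys_fbind[of q "Poly_Mapping.keys q"]) simp_all
      have "lin_ext W (p \<bind> (\<lambda>l. q \<bind> (\<lambda>r. fret (l @ r)))) (\<lambda>l. h (u @ l @ w)) =
        lin_ext W p (\<lambda>l. lin_ext W (q \<bind> (\<lambda>r. fret (l @ r))) (\<lambda>l. h (u @ l @ w)))"
        using k uw by (intro lin_ext_bind W hc') blast+
      also have "\<dots> = lin_ext W p (\<lambda>l. lin_ext W q (\<lambda>r. h (u @ (l @ r) @ w)))"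
        using p q uw by (intro lin_ext_cong lin_ext_closed * W hc') simp_all
      finally show ?thesis .
    qed
    have closed: "f \<otimes>\<^bsub>free_alg V\<^esub> g \<in> carrier (free_alg V)" "g \<otimes>\<^bsub>free_alg V\<^esub> f \<in> carrier (free_alg V)"
      using f g unfolding I_def by (blast intro: F.m_closed)+
    show "g \<otimes>\<^bsub>free_alg V\<^esub> f \<in> I"
    proof -
      have "lin_ext W (g \<otimes>\<^bsub>free_alg V\<^esub> f) (\<lambda>l. h (u @ l @ w)) = \<zero>\<^bsub>W\<^esub>" if uw: "u \<in> ?D" "w \<in> ?D" for u w
      proof -
        have "lin_ext W (g \<otimes>\<^bsub>free_alg V\<^esub> f) (\<lambda>l. h (u @ l @ w)) =
            lin_ext W g (\<lambda>l. lin_ext W f (\<lambda>r. h ((u @ l) @ r @ w)))"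
          using uw fD gD by (simp add: eval)
        also have "\<dots> = lin_ext W g (\<lambda>l. \<zero>\<^bsub>W\<^esub>)"
          using gD uw by (intro lin_ext_cong z) simp_all
        finally show ?thesis by (simp add: lin_ext_zero_right)
      qed
      then show ?thesis using closed unfolding I_def by blast
    qed
    show "f \<otimes>\<^bsub>free_alg V\<^esub> g \<in> I"
    proof -
      have "lin_ext W (f \<otimes>\<^bsub>free_alg V\<^esub> g) (\<lambda>l. h (u @ l @ w)) = \<zero>\<^bsub>W\<^esub>" if uw: "u \<in> ?D" "w \<in> ?D" for u w
      proof -
        have "lin_ext W (f \<otimes>\<^bsub>free_alg V\<^esub> g) (\<lambda>l. h (u @ l @ w)) =
            lin_ext W f (\<lambda>l. lin_ext W g (\<lambda>r. h (u @ l @ (r @ w))))"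
          using uw fD gD by (simp add: eval)
        also have "\<dots> = lin_ext W g (\<lambda>r. lin_ext W f (\<lambda>l. h (u @ l @ (r @ w))))"
          using fD gD uw by (intro lin_ext_commute W hc') simp_all
        also have "\<dots> = lin_ext W g (\<lambda>l. \<zero>\<^bsub>W\<^esub>)"
          using gD uw by (intro lin_ext_cong z) simp_all
        finally show ?thesis by (simp add: lin_ext_zero_right)
      qed
      then show ?thesis using closed unfolding I_def by blast
    qed
  qed (rule F.ring_axioms)
  moreover have "tensor_rels V \<subseteq> I"
  proof
    fix f assume f: "f \<in> tensor_rels V"
    then have fc: "f \<in> carrier (free_alg V)" using tensor_ideal(2)[OF V] by blast
    from f consider (add) a b where "a \<in> carrier V" "b \<in> carrier V" "f = fret [a \<oplus>\<^bsub>V\<^esub> b] - fret [a] - fret [b]"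
      | (smult) k a where "a \<in> carrier V" "f = fret [k \<odot>\<^bsub>V\<^esub> a] - Poly_Mapping.single [a] k"
      by (auto simp: tensor_rels_def)
    then have "lin_ext W f (\<lambda>l. h (u @ l @ w)) = \<zero>\<^bsub>W\<^esub>" if uw: "u \<in> ?D" "w \<in> ?D" for u w
    proof cases
      case add
      have hh: "h (u @ a # w) \<in> carrier W" "h (u @ b # w) \<in> carrier W" "h (u @ (a \<oplus>\<^bsub>V\<^esub> b) # w) \<in> carrier W"
        using add uw V by (auto intro!: hc)
      have e: "h (u @ (a \<oplus>\<^bsub>V\<^esub> b) # w) = h (u @ a # w) \<oplus>\<^bsub>W\<^esub> h (u @ b # w)"
        using add uw by (intro multilinearD(2)[OF h]) auto
      have "lin_ext W f (\<lambda>l. h (u @ l @ w)) =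
          lin_ext W (fret [a \<oplus>\<^bsub>V\<^esub> b] - fret [a]) (\<lambda>l. h (u @ l @ w)) \<ominus>\<^bsub>W\<^esub> h (u @ b # w)"
        unfolding add(3) using hh by (subst lin_ext_diff) (auto dest!: keys_diff_single simp: lin_ext_single)
      also have "lin_ext W (fret [a \<oplus>\<^bsub>V\<^esub> b] - fret [a]) (\<lambda>l. h (u @ l @ w)) =
          h (u @ (a \<oplus>\<^bsub>V\<^esub> b) # w) \<ominus>\<^bsub>W\<^esub> h (u @ a # w)"
        using hh by (subst lin_ext_diff) (auto simp: lin_ext_single)
      finally show ?thesis using hh e by (simp add: vec_space_add_minus)
    next
      case smult
      have hh: "h (u @ a # w) \<in> carrier W" "h (u @ (k \<odot>\<^bsub>V\<^esub> a) # w) \<in> carrier W"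
        using smult uw V by (auto intro!: hc)
      have e: "h (u @ (k \<odot>\<^bsub>V\<^esub> a) # w) = k \<odot>\<^bsub>W\<^esub> h (u @ a # w)"
        using smult uw by (intro multilinearD(3)[OF h]) auto
      show ?thesis
        unfolding smult(2) using hh e by (subst lin_ext_diff) (auto simp: lin_ext_single split: if_splits)
    qed
    then show "f \<in> I" using fc by (auto simp: I_def)
  qed
  ultimately have "tensor_ideal V \<subseteq> I" unfolding tensor_ideal_def by (intro F.genideal_minimal)
  then have "\<forall>u\<in>?D. \<forall>w\<in>?D. lin_ext W f (\<lambda>l. h (u @ l @ w)) = \<zero>\<^bsub>W\<^esub>" using f unfolding I_def by blast
  from bspec[OF bspec[OF this, of "[]"], of "[]"] show ?thesis by simp
qed

abbreviation "tproj V \<equiv> quot_proj (free_alg V) (tensor_ideal V)"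

lemma tproj_mem:
  assumes "vec_space V" "f \<in> carrier (free_alg V)"
  shows "tproj V f \<in> carrier (free_alg V)" "tproj V f \<ominus>\<^bsub>free_alg V\<^esub> f \<in> tensor_ideal V"
  using quot_proj_mem[OF assoc_algebraD(2)[OF free_alg] tensor_ideal(1)] assms by blast+

lemma tensor_alg_carrier: "carrier (tensor_alg V) = tproj V ` carrier (free_alg V)"
  by (simp add: tensor_alg_def quot_alg_def)

lemma algebra_map_tproj: "vec_space V \<Longrightarrow> algebra_map (free_alg V) (tensor_alg V) (tproj V)"
  unfolding tensor_alg_def by (intro quot_alg free_alg tensor_ideal)

lemma tensor_alg_keys:
  assumes "vec_space V" "t \<in> carrier (tensor_alg V)" "l \<in> Poly_Mapping.keys t"
  shows "set l \<subseteq> carrier V"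
  using assms tproj_mem(1)[OF assms(1)] unfolding tensor_alg_carrier free_alg_simps by blast

text \<open>A representative differs from the original by an element of the ideal, on which the
  extension of \<open>h\<close> vanishes. So a linear map may be evaluated on whatever formal
  combination represents a class.\<close>

lemma lin_ext_tproj:
  assumes V: "vec_space V" and W: "vec_space W" and h: "multilinear V W h" and f: "f \<in> carrier (free_alg V)"
  shows "lin_ext W (tproj V f) h = lin_ext W f h"
proof -
  have l: "linear_map (free_alg V) W (\<lambda>f. lin_ext W f h)"
    using h by (intro lin_ext_free_alg W) (auto dest: multilinearD)
  have "lin_ext W (tproj V f) h \<ominus>\<^bsub>W\<^esub> lin_ext W f h = lin_ext W (tproj V f \<ominus>\<^bsub>free_alg V\<^esub> f) h"
    using tproj_mem(1)[OF V f] f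
    by (intro linear_map_minus[OF l _ W, symmetric]) (simp_all add: assoc_algebraD(1)[OF free_alg])
  also have "\<dots> = \<zero>\<^bsub>W\<^esub>"
    by (rule lin_ext_tensor_ideal[OF V W h]) (rule tproj_mem(2)[OF V f])
  finally show ?thesis
    using vec_space_minus_eq_zero[OF W] linear_mapD(1)[OF l] tproj_mem(1)[OF V f] f by metis
qed

text \<open>The existence half of the universal property: multilinear maps on words factor through
  the tensor algebra.\<close>

lemma linear_map_lin_ext:
  assumes V: "vec_space V" and W: "vec_space W" and h: "multilinear V W h"
  shows "linear_map (tensor_alg V) W (\<lambda>t. lin_ext W t h)"
proof -
  have l: "linear_map (free_alg V) W (\<lambda>f. lin_ext W f h)"
    using h by (intro lin_ext_free_alg W) (auto dest: multilinearD)
  note p = algebra_map_tproj[OF V]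
  have "lin_ext W (tproj V f \<oplus>\<^bsub>tensor_alg V\<^esub> tproj V g) h = lin_ext W (tproj V f) h \<oplus>\<^bsub>W\<^esub> lin_ext W (tproj V g) h"
    "lin_ext W (a \<odot>\<^bsub>tensor_alg V\<^esub> tproj V f) h = a \<odot>\<^bsub>W\<^esub> lin_ext W (tproj V f) h"
    "lin_ext W (tproj V f) h \<in> carrier W"
    if "f \<in> carrier (free_alg V)" "g \<in> carrier (free_alg V)" for f g a
  proof -
    have c: "f \<oplus>\<^bsub>free_alg V\<^esub> g \<in> carrier (free_alg V)" "a \<odot>\<^bsub>free_alg V\<^esub> f \<in> carrier (free_alg V)"
      using that assoc_algebraD(1)[OF free_alg, of V] by (metis vec_space_closed)+
    show "lin_ext W (tproj V f \<oplus>\<^bsub>tensor_alg V\<^esub> tproj V g) h = lin_ext W (tproj V f) h \<oplus>\<^bsub>W\<^esub> lin_ext W (tproj V g) h"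
      using linear_mapD(2)[OF algebra_mapD(1)[OF p] that] linear_mapD(2)[OF l that]
      unfolding lin_ext_tproj[OF V W h that(1)] lin_ext_tproj[OF V W h that(2)]
      by (metis lin_ext_tproj[OF V W h c(1)])
    show "lin_ext W (a \<odot>\<^bsub>tensor_alg V\<^esub> tproj V f) h = a \<odot>\<^bsub>W\<^esub> lin_ext W (tproj V f) h"
      using linear_mapD(3)[OF algebra_mapD(1)[OF p] that(1), of a] linear_mapD(3)[OF l that(1), of a]
      unfolding lin_ext_tproj[OF V W h that(1)]
      by (metis lin_ext_tproj[OF V W h c(2)])
    show "lin_ext W (tproj V f) h \<in> carrier W"
      using that linear_mapD(1)[OF l] by (simp add: lin_ext_tproj[OF V W h])
  qed
  then show ?thesis unfolding tensor_alg_carrier by (intro linear_mapI) (auto simp: tensor_alg_carrier)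
qed

lemma tens_closed: "vec_space V \<Longrightarrow> set l \<subseteq> carrier V \<Longrightarrow> tens V l \<in> carrier (tensor_alg V)"
  unfolding tens_def tensor_alg_carrier by (rule imageI) auto

lemma lin_ext_tens:
  assumes V: "vec_space V" and W: "vec_space W" and h: "multilinear V W h" and l: "set l \<subseteq> carrier V"
  shows "lin_ext W (tens V l) h = h l"
  using l multilinearD(1)[OF h l] W
  by (simp add: tens_def lin_ext_tproj[OF V W h] lin_ext_single lists_eq_set)

lemma tens_append:
  assumes V: "vec_space V" and l: "set l \<subseteq> carrier V" "set r \<subseteq> carrier V"
  shows "tens V l \<otimes>\<^bsub>tensor_alg V\<^esub> tens V r = tens V (l @ r)"
  using algebra_mapD(2)[OF algebra_map_tproj[OF V], of "fret l" "fret r"] l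
  by (simp add: tens_def lists_eq_set)

lemma tens_Nil [simp]: "vec_space V \<Longrightarrow> tens V [] = \<one>\<^bsub>tensor_alg V\<^esub>"
  using algebra_mapD(3)[OF algebra_map_tproj[of V]] by (simp add: tens_def)

lemma multilinear_tens:
  fixes V :: "('k::field, 'v, 'm) module_scheme"
  assumes V: "vec_space V"
  shows "multilinear V (tensor_alg V) (tens V)"
proof -
  interpret F: ring "free_alg V" by (rule assoc_algebraD(2)[OF free_alg])
  note T = tensor_alg[OF V]
  note p = linear_mapD[OF algebra_mapD(1)[OF algebra_map_tproj[OF V]]]
  note eq = quot_proj_eq_iff[OF F.ring_axioms tensor_ideal(1)[OF V]]
  have incl: "tensor_rels V \<subseteq> tensor_ideal V"
    unfolding tensor_ideal_def by (rule F.genideal_self[OF tensor_ideal(2)[OF V]])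
  have m: "f \<ominus>\<^bsub>free_alg V\<^esub> g = f - g" if "f \<in> carrier (free_alg V)" "g \<in> carrier (free_alg V)" for f g
    using vec_space_minus[OF assoc_algebraD(1)[OF free_alg] that]
    by (simp add: poly_mapping_eq_iff fun_eq_iff lookup_add lookup_minus)
  have add: "tens V [a \<oplus>\<^bsub>V\<^esub> b] = tens V [a] \<oplus>\<^bsub>tensor_alg V\<^esub> tens V [b]" if ab: "a \<in> carrier V" "b \<in> carrier V" for a b
  proof -
    have c: "fret [a \<oplus>\<^bsub>V\<^esub> b] \<in> carrier (free_alg V)" "fret [a] + fret [b] \<in> carrier (free_alg V)"
      "fret [a] \<in> carrier (free_alg V)" "fret [b] \<in> carrier (free_alg V)"
      using V ab unfolding free_alg_simps mem_Collect_eq by (simp_all add: keys_subsetI)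
    have "fret [a \<oplus>\<^bsub>V\<^esub> b] - fret [a] - fret [b] \<in> tensor_rels V"
      using ab unfolding tensor_rels_def by blast
    then have "fret [a \<oplus>\<^bsub>V\<^esub> b] \<ominus>\<^bsub>free_alg V\<^esub> (fret [a] + fret [b]) \<in> tensor_ideal V"
      unfolding m[OF c(1,2)] using incl by (auto simp: diff_diff_add)
    then have "tproj V (fret [a \<oplus>\<^bsub>V\<^esub> b]) = tproj V (fret [a] + fret [b])"
      using eq[OF c(1,2)] by blast
    also have "\<dots> = tproj V (fret [a]) \<oplus>\<^bsub>tensor_alg V\<^esub> tproj V (fret [b])"
      using p(2)[OF c(3,4)] by simp
    finally show ?thesis by (simp add: tens_def)
  qed
  have smult: "tens V [k \<odot>\<^bsub>V\<^esub> a] = k \<odot>\<^bsub>tensor_alg V\<^esub> tens V [a]" if a: "a \<in> carrier V" for k a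
  proof -
    have c: "fret [k \<odot>\<^bsub>V\<^esub> a] \<in> carrier (free_alg V)" "Poly_Mapping.single [a] k \<in> carrier (free_alg V)"
      "fret [a] \<in> carrier (free_alg V)"
      using V a unfolding free_alg_simps mem_Collect_eq by auto
    have "fret [k \<odot>\<^bsub>V\<^esub> a] - Poly_Mapping.single [a] k \<in> tensor_rels V"
      using a unfolding tensor_rels_def by blast
    then have "fret [k \<odot>\<^bsub>V\<^esub> a] \<ominus>\<^bsub>free_alg V\<^esub> Poly_Mapping.single [a] k \<in> tensor_ideal V"
      unfolding m[OF c(1,2)] using incl by blast
    then have "tproj V (fret [k \<odot>\<^bsub>V\<^esub> a]) = tproj V (Poly_Mapping.single [a] k)"
      using eq[OF c(1,2)] by blast
    also have "\<dots> = k \<odot>\<^bsub>tensor_alg V\<^esub> tproj V (fret [a])"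
      using p(3)[OF c(3), of k] by simp
    finally show ?thesis by (simp add: tens_def)
  qed
  \<comment> \<open>Writing the word as a product isolates the letter being varied, so that the
    one-letter relations and the distributive laws suffice.\<close>
  have split: "tens V (u @ a # w) = tens V u \<otimes>\<^bsub>tensor_alg V\<^esub> (tens V [a] \<otimes>\<^bsub>tensor_alg V\<^esub> tens V w)"
    if "set u \<subseteq> carrier V" "set w \<subseteq> carrier V" "a \<in> carrier V" for u w a
    using that V by (simp add: tens_append)
  show ?thesis
    unfolding multilinear_def
    by (simp add: V split add smult tens_closed T assoc_algebra_distr[OF T])
qed

lemma linear_map_tens_singleton: "vec_space V \<Longrightarrow> linear_map V (tensor_alg V) (\<lambda>v. tens V [v])"
  using multilinearD(1)[OF multilinear_tens, of V] multilinearD(2,3)[OF multilinear_tens, of V "[]" "[]"]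
  by (intro linear_mapI) auto

lemma tensor_alg_induct [consumes 2, case_names tens add smult]:
  assumes V: "vec_space V" and t: "t \<in> carrier (tensor_alg V)"
    and tens: "\<And>l. set l \<subseteq> carrier V \<Longrightarrow> P (tens V l)"
    and add: "\<And>s t. s \<in> carrier (tensor_alg V) \<Longrightarrow> t \<in> carrier (tensor_alg V) \<Longrightarrow> P s \<Longrightarrow> P t \<Longrightarrow> P (s \<oplus>\<^bsub>tensor_alg V\<^esub> t)"
    and smult: "\<And>a t. t \<in> carrier (tensor_alg V) \<Longrightarrow> P t \<Longrightarrow> P (a \<odot>\<^bsub>tensor_alg V\<^esub> t)"
  shows "P t"
proof -
  note p = linear_mapD[OF algebra_mapD(1)[OF algebra_map_tproj[OF V]]]
  have "P (tproj V f)" if "f \<in> carrier (free_alg V)" for f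
    using that
  proof (induction f rule: free_module_induct)
    case zero
    \<comment> \<open>The zero element is produced as 0 times the empty word.\<close>
    have "P (0 \<odot>\<^bsub>tensor_alg V\<^esub> tens V [])" using V by (intro smult tens tens_closed) auto
    moreover have "0 \<odot>\<^bsub>tensor_alg V\<^esub> tens V [] = tproj V 0"
      using p(3)[of "fret []" 0] by (simp add: tens_def)
    ultimately show ?case by (simp only:)
  next
    case (add l a f)
    then have c: "fret l \<in> carrier (free_alg V)" "Poly_Mapping.single l a \<in> carrier (free_alg V)"
      "f \<in> carrier (free_alg V)" "set l \<subseteq> carrier V"
      by (auto simp: keys_single_add)
    have "tproj V (Poly_Mapping.single l a + f) = a \<odot>\<^bsub>tensor_alg V\<^esub> tens V l \<oplus>\<^bsub>tensor_alg V\<^esub> tproj V f"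
      using p(2)[OF c(2,3)] p(3)[OF c(1), of a] by (simp add: tens_def)
    then show ?case
      using add.IH[OF c(3)] c(4) V p(1)[OF c(3)] by (simp add: assms(4) smult tens tens_closed)
  qed
  then show ?thesis using t unfolding tensor_alg_carrier by blast
qed


section \<open>Tensor powers\<close>

lemma tens_power_simps [simp]:
  "\<one>\<^bsub>tens_power V n\<^esub> = \<one>\<^bsub>tensor_alg V\<^esub>" "\<zero>\<^bsub>tens_power V n\<^esub> = \<zero>\<^bsub>tensor_alg V\<^esub>"
  "s \<oplus>\<^bsub>tens_power V n\<^esub> t = s \<oplus>\<^bsub>tensor_alg V\<^esub> t" "a \<odot>\<^bsub>tens_power V n\<^esub> t = a \<odot>\<^bsub>tensor_alg V\<^esub> t"
  by (auto simp: tens_power_def)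

abbreviation "hom_words V n \<equiv> {f. Poly_Mapping.keys f \<subseteq> {l. set l \<subseteq> carrier V \<and> length l = n}}"

lemma tens_power_carrier: "carrier (tens_power V n) = tproj V ` hom_words V n"
proof -
  have "{f \<in> carrier (free_alg V). \<forall>l\<in>Poly_Mapping.keys f. length l = n} = hom_words V n" by auto
  then show ?thesis by (simp add: tens_power_def)
qed

lemma tens_power_subset: "t \<in> carrier (tens_power V n) \<Longrightarrow> t \<in> carrier (tensor_alg V)"
  unfolding tens_power_carrier tensor_alg_carrier free_alg_simps by (auto simp: lists_eq_set)

lemma hom_words_closed:
  assumes "f \<in> hom_words V n" "g \<in> hom_words V n"
  shows "f + g \<in> hom_words V n" "fscale a f \<in> hom_words V n"
  using assms unfolding mem_Collect_eq by (simp_all only: keys_subsetI)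

lemma tens_power_closed [simp]:
  assumes V: "vec_space V"
  shows "\<zero>\<^bsub>tensor_alg V\<^esub> \<in> carrier (tens_power V n)"
    "s \<in> carrier (tens_power V n) \<Longrightarrow> t \<in> carrier (tens_power V n) \<Longrightarrow> s \<oplus>\<^bsub>tensor_alg V\<^esub> t \<in> carrier (tens_power V n)"
    "s \<in> carrier (tens_power V n) \<Longrightarrow> a \<odot>\<^bsub>tensor_alg V\<^esub> s \<in> carrier (tens_power V n)"
proof -
  note p = linear_mapD[OF algebra_mapD(1)[OF algebra_map_tproj[OF V]]]
  have "tproj V 0 = \<zero>\<^bsub>tensor_alg V\<^esub>"
    using linear_map_zero[OF algebra_mapD(1)[OF algebra_map_tproj[OF V]]] V
    by (simp add: assoc_algebraD(1)[OF free_alg])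
  then show "\<zero>\<^bsub>tensor_alg V\<^esub> \<in> carrier (tens_power V n)"
    unfolding tens_power_carrier by (intro image_eqI[of _ _ 0]) auto
  show "s \<in> carrier (tens_power V n) \<Longrightarrow> t \<in> carrier (tens_power V n) \<Longrightarrow> s \<oplus>\<^bsub>tensor_alg V\<^esub> t \<in> carrier (tens_power V n)"
  proof -
    assume "s \<in> carrier (tens_power V n)" "t \<in> carrier (tens_power V n)"
    then obtain f g where f: "f \<in> hom_words V n" "s = tproj V f" "g \<in> hom_words V n" "t = tproj V g"
      unfolding tens_power_carrier by blast
    then have "f \<in> carrier (free_alg V)" "g \<in> carrier (free_alg V)"
      unfolding free_alg_simps lists_eq_set by blast+
    then have "s \<oplus>\<^bsub>tensor_alg V\<^esub> t = tproj V (f + g)" using p(2)[of f g] f by simp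
    then show ?thesis using hom_words_closed(1)[OF f(1,3)] unfolding tens_power_carrier by blast
  qed
  show "s \<in> carrier (tens_power V n) \<Longrightarrow> a \<odot>\<^bsub>tensor_alg V\<^esub> s \<in> carrier (tens_power V n)"
  proof -
    assume "s \<in> carrier (tens_power V n)"
    then obtain f where f: "f \<in> hom_words V n" "s = tproj V f" unfolding tens_power_carrier by blast
    then have "f \<in> carrier (free_alg V)" unfolding free_alg_simps lists_eq_set by blast
    then have "a \<odot>\<^bsub>tensor_alg V\<^esub> s = tproj V (fscale a f)" using p(3)[of f a] f by simp
    then show ?thesis using hom_words_closed(2)[OF f(1,1)] unfolding tens_power_carrier by blast
  qed
qed

lemma vec_space_tens_power [simp]:
  assumes V: "vec_space V"
  shows "vec_space (tens_power V n)"
  using V tensor_alg[OF V] tens_power_subset[of _ V n]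
  by (intro vec_spaceI) (simp_all add: vec_space_add_ac[of "tensor_alg V"] vec_space_smult_add)

lemma tens_in_power: "vec_space V \<Longrightarrow> set l \<subseteq> carrier V \<Longrightarrow> length l = n \<Longrightarrow> tens V l \<in> carrier (tens_power V n)"
  unfolding tens_def tens_power_carrier by (rule imageI) auto

lemma tens_power_induct [consumes 2, case_names tens add smult zero]:
  assumes V: "vec_space V" and t: "t \<in> carrier (tens_power V n)"
    and tens: "\<And>l. set l \<subseteq> carrier V \<Longrightarrow> length l = n \<Longrightarrow> P (tens V l)"
    and add: "\<And>s t. s \<in> carrier (tens_power V n) \<Longrightarrow> t \<in> carrier (tens_power V n) \<Longrightarrow> P s \<Longrightarrow> P t \<Longrightarrow> P (s \<oplus>\<^bsub>tensor_alg V\<^esub> t)"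
    and smult: "\<And>a t. t \<in> carrier (tens_power V n) \<Longrightarrow> P t \<Longrightarrow> P (a \<odot>\<^bsub>tensor_alg V\<^esub> t)"
    and zero: "P \<zero>\<^bsub>tensor_alg V\<^esub>"
  shows "P t"
proof -
  note p = linear_mapD[OF algebra_mapD(1)[OF algebra_map_tproj[OF V]]]
  have "P (tproj V f)" if "f \<in> hom_words V n" for f
    using that
  proof (induction f rule: free_module_induct)
    case zero
    have "tproj V 0 = \<zero>\<^bsub>tensor_alg V\<^esub>"
      using linear_map_zero[OF algebra_mapD(1)[OF algebra_map_tproj[OF V]]] V
      by (simp add: assoc_algebraD(1)[OF free_alg])
    then show ?case using assms(6) by simp
  next
    case (add l a f)
    then have c: "fret l \<in> carrier (free_alg V)" "Poly_Mapping.single l a \<in> carrier (free_alg V)"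
      "f \<in> hom_words V n" "set l \<subseteq> carrier V" "length l = n" "f \<in> carrier (free_alg V)"
      by (auto simp: keys_single_add)
    have "tproj V (Poly_Mapping.single l a + f) = a \<odot>\<^bsub>tensor_alg V\<^esub> tens V l \<oplus>\<^bsub>tensor_alg V\<^esub> tproj V f"
      using p(2)[OF c(2,6)] p(3)[OF c(1), of a] by (simp add: tens_def)
    moreover have "tproj V f \<in> carrier (tens_power V n)" using c(3) unfolding tens_power_carrier by blast
    ultimately show ?case
      using add.IH[OF c(3)] c(4,5) V by (simp add: assms(4) smult tens tens_in_power)
  qed
  then show ?thesis using t unfolding tens_power_carrier by blast
qed

lemma linear_map_tens_eq:
  assumes V: "vec_space V" and W: "vec_space W"
    and F: "linear_map (tens_power V n) W F" and G: "linear_map (tens_power V n) W G"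
    and eq: "\<And>l. set l \<subseteq> carrier V \<Longrightarrow> length l = n \<Longrightarrow> F (tens V l) = G (tens V l)"
    and t: "t \<in> carrier (tens_power V n)"
  shows "F t = G t"
  using V t
proof (induction t rule: tens_power_induct)
  case zero
  then show ?case using linear_map_zero[OF F] linear_map_zero[OF G] V W by simp
qed (use eq linear_mapD[OF F] linear_mapD[OF G] in auto)

lemma linear_map_into_power:
  assumes V: "vec_space V" and W: "vec_space W"
    and F: "linear_map (tens_power V n) (tensor_alg W) F"
    and t: "\<And>l. set l \<subseteq> carrier V \<Longrightarrow> length l = n \<Longrightarrow> F (tens V l) \<in> carrier (tens_power W m)"
  shows "linear_map (tens_power V n) (tens_power W m) F"
proof (rule linear_mapI)
  show "F t \<in> carrier (tens_power W m)" if "t \<in> carrier (tens_power V n)" for t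
    using V that
  proof (induction t rule: tens_power_induct)
    case zero
    then show ?case using linear_map_zero[OF F] V W by simp
  qed (use assms(4) linear_mapD[OF F] V W in auto)
qed (use linear_mapD[OF F] in auto)

lemma linear_map_from_power:
  "linear_map (tensor_alg V) W F \<Longrightarrow> linear_map (tens_power V n) W F"
  by (auto simp: linear_map_def tens_power_subset)

lemma linear_map_to_tensor_alg:
  "linear_map Z (tens_power V n) F \<Longrightarrow> linear_map Z (tensor_alg V) F"
  using tens_power_subset[of _ V n] by (fastforce simp: linear_map_def)

lemma tens_power_mult:
  assumes V: "vec_space V" and s: "s \<in> carrier (tens_power V p)" and t: "t \<in> carrier (tens_power V q)"
    and n: "n = p + q"
  shows "s \<otimes>\<^bsub>tensor_alg V\<^esub> t \<in> carrier (tens_power V n)"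
  using V s
proof (induction s rule: tens_power_induct)
  case (tens l)
  then have l: "tens V l \<in> carrier (tensor_alg V)" using V by (simp add: tens_closed)
  show ?case using V t
  proof (induction t rule: tens_power_induct)
    case (tens r)
    then show ?case using V \<open>length l = p\<close> \<open>set l \<subseteq> _\<close> by (simp add: tens_append tens_in_power n)
  qed (use V l in \<open>simp_all add: assoc_algebra_distr tens_power_subset\<close>)
qed (use V tens_power_subset[OF t] in \<open>simp_all add: assoc_algebra_distr tens_power_subset\<close>)

section \<open>Maps on tensor powers induced by multilinear maps of fixed degree\<close>

definition multilinear_on :: "nat \<Rightarrow> ('k::field, 'v, 'm) module_scheme \<Rightarrow> ('k, 'w, 'n) module_scheme \<Rightarrow> ('v list \<Rightarrow> 'w) \<Rightarrow> bool" where
  "multilinear_on n V W h \<longleftrightarrow>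
     (\<forall>l. set l \<subseteq> carrier V \<longrightarrow> length l = n \<longrightarrow> h l \<in> carrier W) \<and>
     (\<forall>u w. set u \<subseteq> carrier V \<longrightarrow> set w \<subseteq> carrier V \<longrightarrow> Suc (length u + length w) = n \<longrightarrow>
        (\<forall>a\<in>carrier V. \<forall>b\<in>carrier V. h (u @ (a \<oplus>\<^bsub>V\<^esub> b) # w) = h (u @ a # w) \<oplus>\<^bsub>W\<^esub> h (u @ b # w)) \<and>
        (\<forall>k. \<forall>a\<in>carrier V. h (u @ (k \<odot>\<^bsub>V\<^esub> a) # w) = k \<odot>\<^bsub>W\<^esub> h (u @ a # w)))"

lemma multilinear_onI:
  assumes "\<And>l. set l \<subseteq> carrier V \<Longrightarrow> length l = n \<Longrightarrow> h l \<in> carrier W"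
    and "\<And>u w a b. set u \<subseteq> carrier V \<Longrightarrow> set w \<subseteq> carrier V \<Longrightarrow> Suc (length u + length w) = n \<Longrightarrow>
        a \<in> carrier V \<Longrightarrow> b \<in> carrier V \<Longrightarrow> h (u @ (a \<oplus>\<^bsub>V\<^esub> b) # w) = h (u @ a # w) \<oplus>\<^bsub>W\<^esub> h (u @ b # w)"
    and "\<And>u w k a. set u \<subseteq> carrier V \<Longrightarrow> set w \<subseteq> carrier V \<Longrightarrow> Suc (length u + length w) = n \<Longrightarrow>
        a \<in> carrier V \<Longrightarrow> h (u @ (k \<odot>\<^bsub>V\<^esub> a) # w) = k \<odot>\<^bsub>W\<^esub> h (u @ a # w)"
  shows "multilinear_on n V W h"
  using assms unfolding multilinear_on_def by blast

text \<open>Extension by zero to the other lengths matches the sum in \<open>multilin\<close>, which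
  runs over the words of length \<open>n\<close> only; this places \<open>multilin\<close> under the
  universal property of the whole tensor algebra.\<close>

lemma multilinear_on_extend:
  assumes "multilinear_on n V W h" "vec_space W"
  shows "multilinear V W (\<lambda>l. if length l = n then h l else \<zero>\<^bsub>W\<^esub>)"
  using assms by (simp add: multilinear_def multilinear_on_def)

lemma multilinear_on_1I:
  assumes "linear_map V W f"
  shows "multilinear_on 1 V W (\<lambda>l. f (l ! 0))"
  using linear_mapD[OF assms] by (intro multilinear_onI) (auto simp: length_Suc_conv)

lemma multilinear_on_2I:
  assumes "\<And>y. y \<in> carrier V \<Longrightarrow> linear_map V W (\<lambda>x. f x y)" "\<And>x. x \<in> carrier V \<Longrightarrow> linear_map V W (f x)"
  shows "multilinear_on 2 V W (\<lambda>l. f (l ! 0) (l ! 1))"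
proof (rule multilinear_onI)
  fix l assume "set l \<subseteq> carrier V" "length l = 2"
  then show "f (l ! 0) (l ! 1) \<in> carrier W"
    using linear_mapD(1)[OF assms(2)] by (auto simp: numeral_2_eq_2 length_Suc_conv)
next
  fix u w assume uw: "set u \<subseteq> carrier V" "set w \<subseteq> carrier V" "Suc (length u + length w) = 2"
  then consider y where "u = []" "w = [y]" "y \<in> carrier V" | x where "u = [x]" "w = []" "x \<in> carrier V"
    by (cases u; cases w; auto)
  note c = this
  show "f ((u @ (a \<oplus>\<^bsub>V\<^esub> b) # w) ! 0) ((u @ (a \<oplus>\<^bsub>V\<^esub> b) # w) ! 1) =
      f ((u @ a # w) ! 0) ((u @ a # w) ! 1) \<oplus>\<^bsub>W\<^esub> f ((u @ b # w) ! 0) ((u @ b # w) ! 1)"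
    if "a \<in> carrier V" "b \<in> carrier V" for a b
    using c by cases (use that linear_mapD(2)[OF assms(1)] linear_mapD(2)[OF assms(2)] in auto)
  show "f ((u @ (k \<odot>\<^bsub>V\<^esub> a) # w) ! 0) ((u @ (k \<odot>\<^bsub>V\<^esub> a) # w) ! 1) =
      k \<odot>\<^bsub>W\<^esub> f ((u @ a # w) ! 0) ((u @ a # w) ! 1)"
    if "a \<in> carrier V" for k a
    using c by cases (use that linear_mapD(3)[OF assms(1)] linear_mapD(3)[OF assms(2)] in auto)
qed

lemma multilin_eq_lin_ext:
  assumes V: "vec_space V" and W: "vec_space W" and h: "multilinear_on n V W h" and t: "t \<in> carrier (tensor_alg V)"
  shows "multilin W n h t = lin_ext W t (\<lambda>l. if length l = n then h l else \<zero>\<^bsub>W\<^esub>)"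
proof -
  interpret abelian_group W by (rule vec_space_abelian_group[OF W])
  have h': "h l \<in> carrier W" if "l \<in> Poly_Mapping.keys t" "length l = n" for l
    using h tensor_alg_keys[OF V t that(1)] that(2) by (auto simp: multilinear_on_def)
  show ?thesis unfolding multilin_def lin_ext_def
    by (rule add.finprod_mono_neutral_cong_left) (use h' W in auto)
qed

lemma multilin_linear_tensor_alg:
  assumes V: "vec_space V" and W: "vec_space W" and h: "multilinear_on n V W h"
  shows "linear_map (tensor_alg V) W (multilin W n h)"
proof -
  note l = linear_mapD[OF linear_map_lin_ext[OF V W multilinear_on_extend[OF h W]]]
  show ?thesis
    by (rule linear_mapI) (use l V W in \<open>simp_all add: multilin_eq_lin_ext[OF V W h]\<close>)
qed

lemma multilin_linear:
  assumes "vec_space V" "vec_space W" "multilinear_on n V W h"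
  shows "linear_map (tens_power V m) W (multilin W n h)"
  by (intro linear_map_from_power multilin_linear_tensor_alg assms)

lemma multilin_tens:
  assumes V: "vec_space V" and W: "vec_space W" and h: "multilinear_on n V W h" and l: "set l \<subseteq> carrier V" "length l = n"
  shows "multilin W n h (tens V l) = h l"
  using lin_ext_tens[OF V W multilinear_on_extend[OF h W] l(1)] l
  by (simp add: multilin_eq_lin_ext[OF V W h] tens_closed V)

lemma multilin_linear_power:
  assumes V: "vec_space V" and Z: "vec_space Z" and h: "multilinear_on n V (tensor_alg Z) h"
    and "\<And>l. set l \<subseteq> carrier V \<Longrightarrow> length l = n \<Longrightarrow> h l \<in> carrier (tens_power Z m)"
  shows "linear_map (tens_power V n) (tens_power Z m) (multilin (tensor_alg Z) n h)"
  using assms by (intro linear_map_into_power multilin_linear) (simp_all add: multilin_tens)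

lemma set_take_drop_subset: "set l \<subseteq> S \<Longrightarrow> set (take p l) \<subseteq> S" "set l \<subseteq> S \<Longrightarrow> set (drop p l) \<subseteq> S"
  by (meson order_trans set_take_subset set_drop_subset)+

lemma multilinear_tens_map:
  assumes V: "vec_space V"
    and f: "linear_map (tens_power V p) (tens_power V p') f" and g: "linear_map (tens_power V q) (tens_power V q') g"
  shows "multilinear_on (p + q) V (tensor_alg V) (\<lambda>l. f (tens V (take p l)) \<otimes>\<^bsub>tensor_alg V\<^esub> g (tens V (drop p l)))"
proof (rule multilinear_onI)
  note [simp] = V
  note ff = linear_mapD[OF f] and gg = linear_mapD[OF g] and T = multilinearD[OF multilinear_tens[OF V]]
  have fc: "f (tens V u) \<in> carrier (tensor_alg V)" if "set u \<subseteq> carrier V" "length u = p" for u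
    using that by (intro tens_power_subset[OF ff(1)] tens_in_power) auto
  have gc: "g (tens V u) \<in> carrier (tensor_alg V)" if "set u \<subseteq> carrier V" "length u = q" for u
    using that by (intro tens_power_subset[OF gg(1)] tens_in_power) auto
  show "f (tens V (take p l)) \<otimes>\<^bsub>tensor_alg V\<^esub> g (tens V (drop p l)) \<in> carrier (tensor_alg V)"
    if "set l \<subseteq> carrier V" "length l = p + q" for l
    using that by (intro assoc_algebra_closed fc gc tensor_alg) (simp_all add: set_take_drop_subset)
  fix u w assume uw: "set u \<subseteq> carrier V" "set w \<subseteq> carrier V" "Suc (length u + length w) = p + q"
  have tp: "tens V (u @ a # w) \<in> carrier (tens_power V n)"
    if "set u \<subseteq> carrier V" "set w \<subseteq> carrier V" "Suc (length u + length w) = n" "a \<in> carrier V" for u w n a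
    using that by (intro tens_in_power) auto
  \<comment> \<open>The varied letter lies left or right of the cut at \<open>p\<close>, and only
    the factor containing it changes.\<close>
  consider (l) "length u < p" | (r) "p \<le> length u" by linarith
  note c = this
  have cl: "take p (u @ x # w) = u @ x # take (p - Suc (length u)) w"
    "drop p (u @ x # w) = drop (p - Suc (length u)) w"
    "Suc (length u + length (take (p - Suc (length u)) w)) = p"
    "set (take (p - Suc (length u)) w) \<subseteq> carrier V" "set (drop (p - Suc (length u)) w) \<subseteq> carrier V"
    "length (drop (p - Suc (length u)) w) = q"
    if "length u < p" for x
    using that uw by (auto simp: take_Cons' drop_Cons' dest: in_set_takeD in_set_dropD)
  have cr: "take p (u @ x # w) = take p u" "drop p (u @ x # w) = drop p u @ x # w"
    "length (take p u) = p" "set (take p u) \<subseteq> carrier V" "set (drop p u) \<subseteq> carrier V"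
    "Suc (length (drop p u) + length w) = q"
    if "p \<le> length u" for x
    using that uw by (auto dest: in_set_takeD in_set_dropD)
  show "f (tens V (take p (u @ (a \<oplus>\<^bsub>V\<^esub> b) # w))) \<otimes>\<^bsub>tensor_alg V\<^esub> g (tens V (drop p (u @ (a \<oplus>\<^bsub>V\<^esub> b) # w))) =
     f (tens V (take p (u @ a # w))) \<otimes>\<^bsub>tensor_alg V\<^esub> g (tens V (drop p (u @ a # w))) \<oplus>\<^bsub>tensor_alg V\<^esub>
     f (tens V (take p (u @ b # w))) \<otimes>\<^bsub>tensor_alg V\<^esub> g (tens V (drop p (u @ b # w)))"
    if ab: "a \<in> carrier V" "b \<in> carrier V" for a b
    using c
  proof cases
    case l
    note k = cl[OF l]
    have "f (tens V (u @ (a \<oplus>\<^bsub>V\<^esub> b) # take (p - Suc (length u)) w)) =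
        f (tens V (u @ a # take (p - Suc (length u)) w)) \<oplus>\<^bsub>tensor_alg V\<^esub> f (tens V (u @ b # take (p - Suc (length u)) w))"
      using ff(2)[OF tp tp] T(2) uw k(3,4) ab by simp
    then show ?thesis unfolding k(1,2)
      using k(3-6) uw ab by (simp add: assoc_algebra_distr(1) fc gc)
  next
    case r
    note k = cr[OF r]
    have "g (tens V (drop p u @ (a \<oplus>\<^bsub>V\<^esub> b) # w)) =
        g (tens V (drop p u @ a # w)) \<oplus>\<^bsub>tensor_alg V\<^esub> g (tens V (drop p u @ b # w))"
      using gg(2)[OF tp tp] T(2) uw k(3-6) ab by simp
    then show ?thesis unfolding k(1,2)
      using k(3-6) uw ab by (simp add: assoc_algebra_distr(2) fc gc)
  qed
  show "f (tens V (take p (u @ (k \<odot>\<^bsub>V\<^esub> a) # w))) \<otimes>\<^bsub>tensor_alg V\<^esub> g (tens V (drop p (u @ (k \<odot>\<^bsub>V\<^esub> a) # w))) =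
     k \<odot>\<^bsub>tensor_alg V\<^esub> (f (tens V (take p (u @ a # w))) \<otimes>\<^bsub>tensor_alg V\<^esub> g (tens V (drop p (u @ a # w))))"
    if a: "a \<in> carrier V" for k a
    using c
  proof cases
    case l
    note k = cl[OF l]
    have "f (tens V (u @ (k \<odot>\<^bsub>V\<^esub> a) # take (p - Suc (length u)) w)) =
        k \<odot>\<^bsub>tensor_alg V\<^esub> f (tens V (u @ a # take (p - Suc (length u)) w))" for k
      using ff(3)[OF tp] T(3) uw cl(3,4)[OF l] a by simp
    then show ?thesis unfolding k(1,2)
      using k(3-6) uw a by (simp add: fc gc)
  next
    case r
    note k = cr[OF r]
    have "g (tens V (drop p u @ (k \<odot>\<^bsub>V\<^esub> a) # w)) = k \<odot>\<^bsub>tensor_alg V\<^esub> g (tens V (drop p u @ a # w))" for k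
      using gg(3)[OF tp] T(3) uw cr(3-6)[OF r] a by simp
    then show ?thesis unfolding k(1,2)
      using k(3-6) uw a by (simp add: fc gc)
  qed
qed

lemma tens_map_tens:
  assumes V: "vec_space V"
    and f: "linear_map (tens_power V p) (tens_power V p') f" and g: "linear_map (tens_power V q) (tens_power V q') g"
    and "set u \<subseteq> carrier V" "set w \<subseteq> carrier V" "length u = p" "length w = q"
  shows "tens_map V p f q g (tens V (u @ w)) = f (tens V u) \<otimes>\<^bsub>tensor_alg V\<^esub> g (tens V w)"
  unfolding tens_map_def using assms(1,4-) by (subst multilin_tens[OF V _ multilinear_tens_map[OF V f g]]) auto

lemma linear_map_mult_left:
  assumes "assoc_algebra A" "linear_map V A f" "x \<in> carrier A"
  shows "linear_map V A (\<lambda>t. x \<otimes>\<^bsub>A\<^esub> f t)"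
  using assms linear_mapD[OF assms(2)] by (intro linear_mapI) (auto simp: assoc_algebra_distr)

lemma linear_map_mult_right:
  assumes "assoc_algebra A" "linear_map V A f" "x \<in> carrier A"
  shows "linear_map V A (\<lambda>t. f t \<otimes>\<^bsub>A\<^esub> x)"
  using assms linear_mapD[OF assms(2)] by (intro linear_mapI) (auto simp: assoc_algebra_distr)

lemma linear_map_id_power: "vec_space V \<Longrightarrow> linear_map (tens_power V n) (tens_power V n) id"
  by (intro linear_mapI) auto

lemma linear_map_incl: "linear_map (tens_power V n) (tensor_alg V) (\<lambda>t. t)"
  by (intro linear_mapI) (auto simp: tens_power_subset)

lemma tens_map_linear:
  assumes V: "vec_space V"
    and f: "linear_map (tens_power V p) (tens_power V p') f" and g: "linear_map (tens_power V q) (tens_power V q') g"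
    and nm: "n = p + q" "m = p' + q'"
  shows "linear_map (tens_power V n) (tens_power V m) (tens_map V p f q g)"
proof (rule linear_map_into_power[OF V V])
  show "linear_map (tens_power V n) (tensor_alg V) (tens_map V p f q g)"
    unfolding tens_map_def
    by (rule multilin_linear[OF V assoc_algebraD(1)[OF tensor_alg[OF V]] multilinear_tens_map[OF V f g]])
  fix l assume l: "set l \<subseteq> carrier V" "length l = n"
  show "tens_map V p f q g (tens V l) \<in> carrier (tens_power V m)"
  proof -
    have "tens V (take p l) \<in> carrier (tens_power V p)" "tens V (drop p l) \<in> carrier (tens_power V q)"
      using l nm V by (simp_all add: tens_in_power set_take_drop_subset)
    then show ?thesis
      using tens_map_tens[OF V f g, of "take p l" "drop p l"] l nm linear_mapD(1)[OF f] linear_mapD(1)[OF g] V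
      by (simp add: tens_power_mult[of V _ p' _ q'] set_take_drop_subset)
  qed
qed

text \<open>Both sides are linear in each factor separately, so agreement on words propagates first
  to arbitrary \<open>t\<close> with \<open>s\<close> a word and then to arbitrary
  \<open>s\<close>.\<close>

lemma bilinear_ext:
  assumes V: "vec_space V" and W: "vec_space W" and n: "n = p + q"
    and F: "linear_map (tens_power V n) W F"
    and G: "\<And>t. t \<in> carrier (tens_power V q) \<Longrightarrow> linear_map (tens_power V p) W (\<lambda>s. G s t)"
      "\<And>s. s \<in> carrier (tens_power V p) \<Longrightarrow> linear_map (tens_power V q) W (G s)"
    and eq: "\<And>u w. set u \<subseteq> carrier V \<Longrightarrow> set w \<subseteq> carrier V \<Longrightarrow> length u = p \<Longrightarrow> length w = q \<Longrightarrow>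
      F (tens V (u @ w)) = G (tens V u) (tens V w)"
    and s: "s \<in> carrier (tens_power V p)" and t: "t \<in> carrier (tens_power V q)"
  shows "F (s \<otimes>\<^bsub>tensor_alg V\<^esub> t) = G s t"
proof -
  have T: "assoc_algebra (tensor_alg V)" using V by simp
  have m: "linear_map (tens_power V p) W (\<lambda>s. F (s \<otimes>\<^bsub>tensor_alg V\<^esub> t))" if "t \<in> carrier (tens_power V q)" for t
  proof (rule linear_map_comp[OF _ F], rule linear_mapI)
  qed (use that V T in \<open>auto intro!: tens_power_mult simp: n assoc_algebra_distr tens_power_subset\<close>)
  have m2: "linear_map (tens_power V q) W (\<lambda>t. F (s \<otimes>\<^bsub>tensor_alg V\<^esub> t))" if "s \<in> carrier (tens_power V p)" for s
  proof (rule linear_map_comp[OF _ F], rule linear_mapI)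
  qed (use that V T in \<open>auto intro!: tens_power_mult simp: n assoc_algebra_distr tens_power_subset\<close>)
  have "F (tens V u \<otimes>\<^bsub>tensor_alg V\<^esub> t) = G (tens V u) t" if u: "set u \<subseteq> carrier V" "length u = p" for u
  proof (rule linear_map_tens_eq[OF V W m2 G(2) _ t])
    show "F (tens V u \<otimes>\<^bsub>tensor_alg V\<^esub> tens V w) = G (tens V u) (tens V w)" if "set w \<subseteq> carrier V" "length w = q" for w
      using that u V by (simp add: tens_append eq)
  qed (use u V in \<open>auto intro: tens_in_power\<close>)
  then show ?thesis using linear_map_tens_eq[OF V W m[OF t] G(1)[OF t] _ s] by blast
qed

lemma tens_map_mult:
  assumes V: "vec_space V"
    and f: "linear_map (tens_power V p) (tens_power V p') f" and g: "linear_map (tens_power V q) (tens_power V q') g"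
    and st: "s \<in> carrier (tens_power V p)" "t \<in> carrier (tens_power V q)"
  shows "tens_map V p f q g (s \<otimes>\<^bsub>tensor_alg V\<^esub> t) = f s \<otimes>\<^bsub>tensor_alg V\<^esub> g t"
proof (rule bilinear_ext[OF V _ refl _ _ _ _ st])
  note T = tensor_alg[OF V]
  show "linear_map (tens_power V (p + q)) (tensor_alg V) (tens_map V p f q g)"
    by (rule linear_map_to_tensor_alg[OF tens_map_linear[OF V f g refl refl]])
  show "linear_map (tens_power V p) (tensor_alg V) (\<lambda>s. f s \<otimes>\<^bsub>tensor_alg V\<^esub> g t)" if "t \<in> carrier (tens_power V q)" for t
    using linear_mapD(1)[OF g that] by (intro linear_map_mult_right[OF T] linear_map_to_tensor_alg[OF f] tens_power_subset)
  show "linear_map (tens_power V q) (tensor_alg V) (\<lambda>t. f s \<otimes>\<^bsub>tensor_alg V\<^esub> g t)" if "s \<in> carrier (tens_power V p)" for s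
    using linear_mapD(1)[OF f that] by (intro linear_map_mult_left[OF T] linear_map_to_tensor_alg[OF g] tens_power_subset)
qed (use V tens_map_tens[OF V f g] in simp_all)

section \<open>Functoriality of tensor powers\<close>

lemma map_in_carrier: "linear_map V W f \<Longrightarrow> set l \<subseteq> carrier V \<Longrightarrow> set (map f l) \<subseteq> carrier W"
  using linear_mapD(1)[of V W f] by auto

lemma multilinear_power_map:
  assumes V: "vec_space V" and W: "vec_space W" and f: "linear_map V W f"
  shows "multilinear_on n V (tensor_alg W) (\<lambda>l. tens W (map f l))"
  using multilinearD[OF multilinear_tens[OF W]] linear_mapD[OF f] map_in_carrier[OF f]
  by (intro multilinear_onI) (simp_all del: set_map)

lemma power_map_tens:
  assumes "vec_space V" "vec_space W" "linear_map V W f" "set l \<subseteq> carrier V" "length l = n"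
  shows "power_map W n f (tens V l) = tens W (map f l)"
  unfolding power_map_def using assms by (subst multilin_tens[OF assms(1) _ multilinear_power_map]) auto

lemma power_map_linear:
  assumes "vec_space V" "vec_space W" "linear_map V W f"
  shows "linear_map (tens_power V n) (tens_power W n) (power_map W n f)"
  unfolding power_map_def
  using assms by (intro multilin_linear_power multilinear_power_map tens_in_power map_in_carrier) auto

lemma power_map_mult:
  assumes V: "vec_space V" and W: "vec_space W" and f: "linear_map V W f" and n: "n = p + q"
    and st: "s \<in> carrier (tens_power V p)" "t \<in> carrier (tens_power V q)"
  shows "power_map W n f (s \<otimes>\<^bsub>tensor_alg V\<^esub> t) = power_map W p f s \<otimes>\<^bsub>tensor_alg W\<^esub> power_map W q f t"
proof (rule bilinear_ext[OF V _ n _ _ _ _ st])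
  note T = tensor_alg[OF W] and l = power_map_linear[OF V W f]
  show "linear_map (tens_power V n) (tensor_alg W) (power_map W n f)"
    by (rule linear_map_to_tensor_alg[OF l])
  show "linear_map (tens_power V p) (tensor_alg W) (\<lambda>s. power_map W p f s \<otimes>\<^bsub>tensor_alg W\<^esub> power_map W q f t)" if "t \<in> carrier (tens_power V q)" for t
    using linear_mapD(1)[OF l that] by (intro linear_map_mult_right[OF T] linear_map_to_tensor_alg[OF l] tens_power_subset)
  show "linear_map (tens_power V q) (tensor_alg W) (\<lambda>t. power_map W p f s \<otimes>\<^bsub>tensor_alg W\<^esub> power_map W q f t)" if "s \<in> carrier (tens_power V p)" for s
    using linear_mapD(1)[OF l that] by (intro linear_map_mult_left[OF T] linear_map_to_tensor_alg[OF l] tens_power_subset)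
qed (use V W n map_in_carrier[OF f] in \<open>auto simp: power_map_tens[OF V W f] tens_append simp del: set_map\<close>)

lemma power_map_comp:
  assumes V: "vec_space V" and W: "vec_space W" and Z: "vec_space Z" and f: "linear_map V W f" and g: "linear_map W Z g"
    and t: "t \<in> carrier (tens_power V n)"
  shows "power_map Z n g (power_map W n f t) = power_map Z n (\<lambda>x. g (f x)) t"
proof (rule linear_map_tens_eq[OF V _ _ _ _ t])
  show "linear_map (tens_power V n) (tens_power Z n) (\<lambda>t. power_map Z n g (power_map W n f t))"
    by (rule linear_map_comp[OF power_map_linear[OF V W f] power_map_linear[OF W Z g]])
  show "linear_map (tens_power V n) (tens_power Z n) (power_map Z n (\<lambda>x. g (f x)))"
    by (intro power_map_linear V Z linear_map_comp[OF f g])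
  show "power_map Z n g (power_map W n f (tens V l)) = power_map Z n (\<lambda>x. g (f x)) (tens V l)"
    if "set l \<subseteq> carrier V" "length l = n" for l
    using that map_in_carrier[OF f that(1)]
    by (simp add: power_map_tens[OF V W f] power_map_tens[OF W Z g] power_map_tens[OF V Z linear_map_comp[OF f g]] comp_def del: set_map)
qed (use Z in auto)

lemma power_map_cong:
  assumes V: "vec_space V" and W: "vec_space W" and f: "linear_map V W f" and g: "linear_map V W g"
    and eq: "\<And>x. x \<in> carrier V \<Longrightarrow> f x = g x" and t: "t \<in> carrier (tens_power V n)"
  shows "power_map W n f t = power_map W n g t"
proof (rule linear_map_tens_eq[OF V _ _ _ _ t])
  show "power_map W n f (tens V l) = power_map W n g (tens V l)" if "set l \<subseteq> carrier V" "length l = n" for l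
  proof -
    have "map f l = map g l" using that eq by (auto intro: map_cong)
    then show ?thesis using that by (simp add: power_map_tens[OF V W f] power_map_tens[OF V W g] del: map_eq_conv)
  qed
qed (use V W f g in \<open>auto intro: power_map_linear\<close>)

text \<open>Words lift letter by letter, and sums and multiples of liftable tensors are liftable.
  This is what carries identities on tensor powers of a bialgebra over to its images.\<close>

lemma power_map_surj:
  assumes V: "vec_space V" and W: "vec_space W" and f: "linear_map V W f" and surj: "carrier W = f ` carrier V"
    and t: "t \<in> carrier (tens_power W n)"
  obtains s where "s \<in> carrier (tens_power V n)" "t = power_map W n f s"
proof -
  note l = linear_mapD[OF power_map_linear[OF V W f, of n]]
  have "\<exists>s\<in>carrier (tens_power V n). t = power_map W n f s"
    using W t
  proof (induction t rule: tens_power_induct)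
    case (tens r)
    define u where "u = map (inv_into (carrier V) f) r"
    have "set u \<subseteq> carrier V" "map f u = r" "length u = n"
      using tens surj unfolding u_def by (auto simp: inv_into_into f_inv_into_f intro!: map_idI)
    then show ?case using V W f by (intro bexI[of _ "tens V u"]) (auto simp: power_map_tens tens_in_power)
  next
    case (add s t)
    then obtain s' t' where "s' \<in> carrier (tens_power V n)" "t' \<in> carrier (tens_power V n)"
      "s = power_map W n f s'" "t = power_map W n f t'" by blast
    then show ?case using l V by (intro bexI[of _ "s' \<oplus>\<^bsub>tensor_alg V\<^esub> t'"]) auto
  next
    case (smult a t)
    then obtain t' where "t' \<in> carrier (tens_power V n)" "t = power_map W n f t'" by blast
    then show ?case using l V by (intro bexI[of _ "a \<odot>\<^bsub>tensor_alg V\<^esub> t'"]) auto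
  next
    case zero
    show ?case using linear_map_zero[OF power_map_linear[OF V W f, of n]] V W
      by (intro bexI[of _ "\<zero>\<^bsub>tensor_alg V\<^esub>"]) auto
  qed
  then show thesis using that by blast
qed

lemma tens_map_natural:
  assumes V: "vec_space V" and W: "vec_space W" and h: "linear_map V W h"
    and f: "linear_map (tens_power V p) (tens_power V p') f" and g: "linear_map (tens_power V q) (tens_power V q') g"
    and f': "linear_map (tens_power W p) (tens_power W p') f'" and g': "linear_map (tens_power W q) (tens_power W q') g'"
    and ff: "\<And>t. t \<in> carrier (tens_power V p) \<Longrightarrow> f' (power_map W p h t) = power_map W p' h (f t)"
    and gg: "\<And>t. t \<in> carrier (tens_power V q) \<Longrightarrow> g' (power_map W q h t) = power_map W q' h (g t)"
    and nm: "n = p + q" "m = p' + q'" and t: "t \<in> carrier (tens_power V n)"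
  shows "tens_map W p f' q g' (power_map W n h t) = power_map W m h (tens_map V p f q g t)"
proof (rule linear_map_tens_eq[OF V _ _ _ _ t])
  note l = power_map_linear[OF V W h]
  show "linear_map (tens_power V n) (tens_power W m) (\<lambda>t. tens_map W p f' q g' (power_map W n h t))"
    by (rule linear_map_comp[OF l tens_map_linear[OF W f' g' nm]])
  show "linear_map (tens_power V n) (tens_power W m) (\<lambda>t. power_map W m h (tens_map V p f q g t))"
    by (rule linear_map_comp[OF tens_map_linear[OF V f g nm] l])
  fix r assume r: "set r \<subseteq> carrier V" "length r = n"
  let ?u = "tens V (take p r)" and ?w = "tens V (drop p r)"
  have uw: "?u \<in> carrier (tens_power V p)" "?w \<in> carrier (tens_power V q)"
    using r nm V by (simp_all add: tens_in_power set_take_drop_subset)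
  have eq: "tens V r = ?u \<otimes>\<^bsub>tensor_alg V\<^esub> ?w"
    using r V by (simp add: tens_append set_take_drop_subset)
  show "tens_map W p f' q g' (power_map W n h (tens V r)) = power_map W m h (tens_map V p f q g (tens V r))"
    unfolding eq using uw linear_mapD(1)[OF l] linear_mapD(1)[OF f] linear_mapD(1)[OF g]
    by (simp add: power_map_mult[OF V W h nm(1)] power_map_mult[OF V W h nm(2)] tens_map_mult[OF V f g]
        tens_map_mult[OF W f' g'] ff gg)
qed (use W in auto)

lemma tens_power_1:
  assumes V: "vec_space V" and t: "t \<in> carrier (tens_power V 1)"
  obtains x where "x \<in> carrier V" "t = tens V [x]"
proof -
  note T = multilinearD[OF multilinear_tens[OF V]]
  have "\<exists>x\<in>carrier V. t = tens V [x]"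
    using V t
  proof (induction t rule: tens_power_induct)
    case (tens l)
    then show ?case by (auto simp: length_Suc_conv)
  next
    case (add s t)
    then obtain x y where "x \<in> carrier V" "y \<in> carrier V" "s = tens V [x]" "t = tens V [y]" by blast
    then show ?case using T(2)[of "[]" "[]"] V by (intro bexI[of _ "x \<oplus>\<^bsub>V\<^esub> y"]) auto
  next
    case (smult a t)
    then obtain x where "x \<in> carrier V" "t = tens V [x]" by blast
    then show ?case using T(3)[of "[]" "[]"] V by (intro bexI[of _ "a \<odot>\<^bsub>V\<^esub> x"]) auto
  next
    case zero
    have "tens V [0 \<odot>\<^bsub>V\<^esub> \<zero>\<^bsub>V\<^esub>] = 0 \<odot>\<^bsub>tensor_alg V\<^esub> tens V [\<zero>\<^bsub>V\<^esub>]"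
      using T(3)[of "[]" "[]" "\<zero>\<^bsub>V\<^esub>" 0] V by simp
    then show ?case using V by (intro bexI[of _ "\<zero>\<^bsub>V\<^esub>"]) (auto simp: tens_closed)
  qed
  then show thesis using that by blast
qed

section \<open>Surjective images of braided bialgebras\<close>

lemma mult_map:
  assumes A: "assoc_algebra A"
  shows "linear_map (tens_power A 2) (tens_power A 1) (mult_map A)"
    and "x \<in> carrier A \<Longrightarrow> y \<in> carrier A \<Longrightarrow> mult_map A (tens A [x, y]) = tens A [x \<otimes>\<^bsub>A\<^esub> y]"
proof -
  note V = assoc_algebraD(1)[OF A] and T = multilinearD[OF multilinear_tens[OF assoc_algebraD(1)[OF A]]]
  have m: "multilinear_on 2 A (tensor_alg A) (\<lambda>l. tens A [l ! 0 \<otimes>\<^bsub>A\<^esub> l ! 1])"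
    using A V T(1) T(2,3)[of "[]" "[]"]
    by (intro multilinear_on_2I[of A "tensor_alg A" "\<lambda>x y. tens A [x \<otimes>\<^bsub>A\<^esub> y]"] linear_mapI)
      (simp_all add: assoc_algebra_distr)
  show "linear_map (tens_power A 2) (tens_power A 1) (mult_map A)"
    unfolding mult_map_def using A
    by (intro multilin_linear_power[OF V V m] tens_in_power[OF V]) (auto simp: numeral_2_eq_2 length_Suc_conv)
  show "x \<in> carrier A \<Longrightarrow> y \<in> carrier A \<Longrightarrow> mult_map A (tens A [x, y]) = tens A [x \<otimes>\<^bsub>A\<^esub> y]"
    unfolding mult_map_def using V by (subst multilin_tens[OF V _ m]) auto
qed

lemma unit_map:
  assumes A: "assoc_algebra A"
  shows "linear_map (tens_power A 0) (tens_power A 1) (unit_map A)"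
    and "unit_map A (tens A []) = tens A [\<one>\<^bsub>A\<^esub>]"
proof -
  note V = assoc_algebraD(1)[OF A]
  have m: "multilinear_on 0 A (tensor_alg A) (\<lambda>l. tens A [\<one>\<^bsub>A\<^esub>])"
    using A V by (intro multilinear_onI) (simp_all add: tens_closed)
  show "linear_map (tens_power A 0) (tens_power A 1) (unit_map A)"
    unfolding unit_map_def using A by (intro multilin_linear_power[OF V V m] tens_in_power[OF V]) auto
  show "unit_map A (tens A []) = tens A [\<one>\<^bsub>A\<^esub>]"
    unfolding unit_map_def using V by (subst multilin_tens[OF V _ m]) auto
qed

lemma comult_map:
  assumes V: "vec_space C" and C: "linear_map C (tens_power C 2) (comult C)"
  shows "linear_map (tens_power C 1) (tens_power C 2) (comult_map C)"
    and "x \<in> carrier C \<Longrightarrow> comult_map C (tens C [x]) = comult C x"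
proof -
  note m = multilinear_on_1I[OF linear_map_to_tensor_alg[OF C]]
  show "linear_map (tens_power C 1) (tens_power C 2) (comult_map C)"
    unfolding comult_map_def using linear_mapD(1)[OF C]
    by (intro multilin_linear_power[OF V V m]) (auto simp: length_Suc_conv)
  show "x \<in> carrier C \<Longrightarrow> comult_map C (tens C [x]) = comult C x"
    unfolding comult_map_def using V by (subst multilin_tens[OF V _ m]) auto
qed

lemma counit_map:
  assumes V: "vec_space C" and C: "counit_linear C"
  shows "linear_map (tens_power C 1) (tens_power C 0) (counit_map C)"
    and "x \<in> carrier C \<Longrightarrow> counit_map C (tens C [x]) = counit C x \<odot>\<^bsub>tensor_alg C\<^esub> \<one>\<^bsub>tensor_alg C\<^esub>"
proof -
  have "linear_map C (tensor_alg C) (\<lambda>x. counit C x \<odot>\<^bsub>tensor_alg C\<^esub> \<one>\<^bsub>tensor_alg C\<^esub>)"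
    using V C by (intro linear_mapI) (simp_all add: counit_linear_def vec_space_smult_add)
  note m = multilinear_on_1I[OF this]
  have one: "\<one>\<^bsub>tensor_alg C\<^esub> \<in> carrier (tens_power C 0)" using tens_in_power[OF V, of "[]" 0] V by simp
  show "linear_map (tens_power C 1) (tens_power C 0) (counit_map C)"
    unfolding counit_map_def using V one by (intro multilin_linear_power[OF V V m]) auto
  show "x \<in> carrier C \<Longrightarrow> counit_map C (tens C [x]) = counit C x \<odot>\<^bsub>tensor_alg C\<^esub> \<one>\<^bsub>tensor_alg C\<^esub>"
    unfolding counit_map_def using V by (subst multilin_tens[OF V _ m]) auto
qed

text \<open>Linearity of both maps is part of the notion, so that it is closed under composition and
  under \<open>tens_map\<close>. Every operator occurring in an axiom is assembled in these two ways
  from structure maps.\<close>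

definition natural ::
    "('k::field, 'v, 'm) module_scheme \<Rightarrow> ('k, 'w, 'n) module_scheme \<Rightarrow> ('v \<Rightarrow> 'w) \<Rightarrow> nat \<Rightarrow> nat \<Rightarrow>
      (('v list \<Rightarrow>\<^sub>0 'k) \<Rightarrow> ('v list \<Rightarrow>\<^sub>0 'k)) \<Rightarrow> (('w list \<Rightarrow>\<^sub>0 'k) \<Rightarrow> ('w list \<Rightarrow>\<^sub>0 'k)) \<Rightarrow> bool" where
  "natural V W h p q f f' \<longleftrightarrow>
     linear_map (tens_power V p) (tens_power V q) f \<and> linear_map (tens_power W p) (tens_power W q) f' \<and>
     (\<forall>t\<in>carrier (tens_power V p). f' (power_map W p h t) = power_map W q h (f t))"

lemma naturalD:
  assumes "natural V W h p q f f'"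
  shows "linear_map (tens_power V p) (tens_power V q) f" "linear_map (tens_power W p) (tens_power W q) f'"
    "t \<in> carrier (tens_power V p) \<Longrightarrow> f' (power_map W p h t) = power_map W q h (f t)"
  using assms by (auto simp: natural_def)

lemma natural_id: "vec_space V \<Longrightarrow> vec_space W \<Longrightarrow> natural V W h n n id id"
  by (simp add: natural_def linear_map_id_power)

lemma natural_comp:
  "natural V W h p q f f' \<Longrightarrow> natural V W h q r g g' \<Longrightarrow> natural V W h p r (g \<circ> f) (g' \<circ> f')"
  unfolding natural_def comp_def using linear_mapD(1)[of "tens_power V p" "tens_power V q" f]
  by (auto intro: linear_map_comp)

lemma natural_tens_map:
  assumes "vec_space V" "vec_space W" "linear_map V W h" "natural V W h p p' f f'" "natural V W h q q' g g'"
    "n = p + q" "m = p' + q'"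
  shows "natural V W h n m (tens_map V p f q g) (tens_map W p f' q g')"
  unfolding natural_def
  using assms(6,7)
  by (auto intro!: tens_map_linear tens_map_natural naturalD[OF assms(4)] naturalD[OF assms(5)] assms(1-3))

text \<open>Every tensor over the image is the image of a tensor, where the two operators agree by
  assumption. This transports an axiom from \<open>V\<close> to \<open>W\<close>.\<close>

lemma natural_eq:
  assumes "vec_space V" "vec_space W" "linear_map V W h" "carrier W = h ` carrier V"
    "natural V W h p q f f'" "natural V W h p q g g'"
    "\<And>t. t \<in> carrier (tens_power V p) \<Longrightarrow> f t = g t" "t \<in> carrier (tens_power W p)"
  shows "f' t = g' t"
proof -
  obtain s where "s \<in> carrier (tens_power V p)" "t = power_map W p h s"
    using power_map_surj[OF assms(1-4,8)] by blast
  then show ?thesis using naturalD(3)[OF assms(5)] naturalD(3)[OF assms(6)] assms(7) by simp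
qed

text \<open>Linearity of \<open>f'\<close> is inherited from the linear map that applies
  \<open>f\<close> and then the tensor power of \<open>h\<close>, because every argument of
  \<open>f'\<close> comes from a tensor over \<open>V\<close>.\<close>

lemma naturalI_surj:
  assumes V: "vec_space V" and W: "vec_space W" and h: "linear_map V W h" and surj: "carrier W = h ` carrier V"
    and f: "linear_map (tens_power V p) (tens_power V q) f"
    and ff: "\<And>t. t \<in> carrier (tens_power V p) \<Longrightarrow> f' (power_map W p h t) = power_map W q h (f t)"
  shows "natural V W h p q f f'"
proof -
  note l = power_map_linear[OF V W h]
  have lc: "linear_map (tens_power V p) (tens_power W q) (\<lambda>t. power_map W q h (f t))"
    by (rule linear_map_comp[OF f l])
  have "linear_map (tens_power W p) (tens_power W q) f'"
  proof (rule linear_mapI)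
    fix t assume "t \<in> carrier (tens_power W p)"
    then obtain s where s: "s \<in> carrier (tens_power V p)" "t = power_map W p h s"
      using power_map_surj[OF V W h surj] by blast
    then show "f' t \<in> carrier (tens_power W q)" using linear_mapD(1)[OF lc] by (simp add: ff)
    show "f' (a \<odot>\<^bsub>tens_power W p\<^esub> t) = a \<odot>\<^bsub>tens_power W q\<^esub> f' t" for a
      using linear_mapD(3)[OF l s(1), of a] linear_mapD(3)[OF lc s(1), of a] ff[of "a \<odot>\<^bsub>tensor_alg V\<^esub> s"] s V
      by (simp add: ff)
    fix t' assume "t' \<in> carrier (tens_power W p)"
    then obtain s' where s': "s' \<in> carrier (tens_power V p)" "t' = power_map W p h s'"
      using power_map_surj[OF V W h surj] by blast
    show "f' (t \<oplus>\<^bsub>tens_power W p\<^esub> t') = f' t \<oplus>\<^bsub>tens_power W q\<^esub> f' t'"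
      using linear_mapD(2)[OF l s(1) s'(1)] linear_mapD(2)[OF lc s(1) s'(1)] ff[of "s \<oplus>\<^bsub>tensor_alg V\<^esub> s'"] s s' V
      by (simp add: ff)
  qed
  then show ?thesis using f ff by (simp add: natural_def)
qed

lemma natural_structure_maps:
  assumes A: "assoc_algebra A" and B: "assoc_algebra B" and h: "algebra_map A B h"
  shows "natural A B h 2 1 (mult_map A) (mult_map B)" "natural A B h 0 1 (unit_map A) (unit_map B)"
proof -
  note V = assoc_algebraD(1)[OF A] and W = assoc_algebraD(1)[OF B] and l = algebra_mapD(1)[OF h]
  note hc = linear_mapD(1)[OF l]
  have "mult_map B (power_map B 2 h t) = power_map B 1 h (mult_map A t)" if "t \<in> carrier (tens_power A 2)" for t
  proof (rule linear_map_tens_eq[OF V _ linear_map_comp[OF power_map_linear[OF V W l] mult_map(1)[OF B]]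
        linear_map_comp[OF mult_map(1)[OF A] power_map_linear[OF V W l]] _ that])
    show "mult_map B (power_map B 2 h (tens A r)) = power_map B 1 h (mult_map A (tens A r))"
      if "set r \<subseteq> carrier A" "length r = 2" for r
      using that hc A by (auto simp: numeral_2_eq_2 length_Suc_conv mult_map(2)[OF A] mult_map(2)[OF B, unfolded numeral_2_eq_2]
          power_map_tens[OF V W l] algebra_mapD(2)[OF h])
  qed (use W in auto)
  then show "natural A B h 2 1 (mult_map A) (mult_map B)"
    unfolding natural_def using mult_map(1)[OF A] mult_map(1)[OF B] by blast
  have "unit_map B (power_map B 0 h t) = power_map B 1 h (unit_map A t)" if "t \<in> carrier (tens_power A 0)" for t
  proof (rule linear_map_tens_eq[OF V _ linear_map_comp[OF power_map_linear[OF V W l] unit_map(1)[OF B]]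
        linear_map_comp[OF unit_map(1)[OF A] power_map_linear[OF V W l]] _ that])
    show "unit_map B (power_map B 0 h (tens A r)) = power_map B 1 h (unit_map A (tens A r))"
      if "set r \<subseteq> carrier A" "length r = 0" for r
      using that A unit_map(2)[OF A] unit_map(2)[OF B]
      by (simp add: power_map_tens[OF V W l] algebra_mapD(3)[OF h] del: tens_Nil)
  qed (use W in auto)
  then show "natural A B h 0 1 (unit_map A) (unit_map B)"
    unfolding natural_def using unit_map(1)[OF A] unit_map(1)[OF B] by blast
qed

lemma natural_coalgebra_maps:
  assumes V: "vec_space C" and W: "vec_space D" and l: "linear_map C D h"
    and C: "linear_map C (tens_power C 2) (comult C)" "counit_linear C"
    and D: "linear_map D (tens_power D 2) (comult D)" "counit_linear D"
    and eq: "\<And>x. x \<in> carrier C \<Longrightarrow> comult D (h x) = power_map D 2 h (comult C x)" "\<And>x. x \<in> carrier C \<Longrightarrow> counit D (h x) = counit C x"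
  shows "natural C D h 1 2 (comult_map C) (comult_map D)" "natural C D h 1 0 (counit_map C) (counit_map D)"
proof -
  note hc = linear_mapD(1)[OF l] and p = power_map_linear[OF V W l]
  have "comult_map D (power_map D 1 h t) = power_map D 2 h (comult_map C t)" if t: "t \<in> carrier (tens_power C 1)" for t
  proof -
    obtain x where "x \<in> carrier C" "t = tens C [x]" using tens_power_1[OF V t] .
    then show ?thesis
      using hc by (simp add: power_map_tens[OF V W l] comult_map(2)[OF V C(1)] comult_map(2)[OF W D(1)] eq)
  qed
  then show "natural C D h 1 2 (comult_map C) (comult_map D)"
    unfolding natural_def using comult_map(1)[OF V C(1)] comult_map(1)[OF W D(1)] by blast
  have one: "power_map D 0 h \<one>\<^bsub>tensor_alg C\<^esub> = \<one>\<^bsub>tensor_alg D\<^esub>"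
    using power_map_tens[OF V W l, of "[]" 0] V W by simp
  have one': "\<one>\<^bsub>tensor_alg C\<^esub> \<in> carrier (tens_power C 0)" using tens_in_power[OF V, of "[]" 0] V by simp
  have "counit_map D (power_map D 1 h t) = power_map D 0 h (counit_map C t)" if t: "t \<in> carrier (tens_power C 1)" for t
  proof -
    obtain x where "x \<in> carrier C" "t = tens C [x]" using tens_power_1[OF V t] .
    then show ?thesis
      using hc linear_mapD(3)[OF p one']
      by (simp add: power_map_tens[OF V W l] counit_map(2)[OF V C(2)] counit_map(2)[OF W D(2)] eq one)
  qed
  then show "natural C D h 1 0 (counit_map C) (counit_map D)"
    unfolding natural_def using counit_map(1)[OF V C(2)] counit_map(1)[OF W D(2)] by blast
qed

lemma braided_bialgebraD:
  assumes "braided_bialgebra B"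
  shows "braided_algebra B" "assoc_algebra B" "vec_space B" "braided_vec_space B"
    "linear_map (tens_power B 2) (tens_power B 2) (braiding B)"
    "linear_map B (tens_power B 2) (comult B)" "counit_linear B" "braided_coalgebra B"
    "comult_algebra_map B" "counit_algebra_map B"
  using assms by (auto simp: braided_bialgebra_def braided_algebra_def braided_coalgebra_def braided_vec_space_def)

text \<open>Each axiom equates composites of structure maps. Once braiding, coproduct and counit
  commute with \<open>h\<close>, all these composites are natural, and \<open>natural_eq\<close> or
  evaluation at \<open>h u\<close> yields the axiom for the image.\<close>

lemma braided_bialgebra_surj_image:
  assumes B: "braided_bialgebra B" and B': "assoc_algebra B'" and h: "algebra_map B B' h"
    and surj: "carrier B' = h ` carrier B"
    and br: "\<And>t. t \<in> carrier (tens_power B 2) \<Longrightarrow> braiding B' (power_map B' 2 h t) = power_map B' 2 h (braiding B t)"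
    and cm: "\<And>x. x \<in> carrier B \<Longrightarrow> comult B' (h x) = power_map B' 2 h (comult B x)"
    and cu: "\<And>x. x \<in> carrier B \<Longrightarrow> counit B' (h x) = counit B x"
  shows "braided_bialgebra B'" "braided_bialgebra_map B B' h"
proof -
  note d = braided_bialgebraD[OF B]
  note V = d(3) and W = assoc_algebraD(1)[OF B'] and l = algebra_mapD(1)[OF h]
  note p = power_map_linear[OF V W l] and hl = linear_mapD[OF l]
  note eqI = natural_eq[OF V W l surj]
  note tm = natural_tens_map[OF V W l]
  note nid = natural_id[OF V W, of h]
  have nbr: "natural B B' h 2 2 (braiding B) (braiding B')"
    using br by (intro naturalI_surj V W l surj d)
  have comult': "linear_map B' (tens_power B' 2) (comult B')"
  proof (rule linear_mapI)
    fix x a assume "x \<in> carrier B'"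
    then obtain u where u: "u \<in> carrier B" "x = h u" using surj by auto
    then show "comult B' x \<in> carrier (tens_power B' 2)"
      using linear_mapD(1)[OF p] linear_mapD(1)[OF d(6)] by (simp add: cm)
    show "comult B' (a \<odot>\<^bsub>B'\<^esub> x) = a \<odot>\<^bsub>tens_power B' 2\<^esub> comult B' x"
      using u linear_mapD[OF d(6)] linear_mapD[OF p, of _ 2] hl(3)[OF u(1), of a] V cm[of "a \<odot>\<^bsub>B\<^esub> u"] by (simp add: cm)
    fix y assume "y \<in> carrier B'"
    then obtain v where v: "v \<in> carrier B" "y = h v" using surj by auto
    show "comult B' (x \<oplus>\<^bsub>B'\<^esub> y) = comult B' x \<oplus>\<^bsub>tens_power B' 2\<^esub> comult B' y"
      using u v linear_mapD[OF d(6)] linear_mapD[OF p, of _ 2] hl(2)[OF u(1) v(1)] V cm[of "u \<oplus>\<^bsub>B\<^esub> v"] by (simp add: cm)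
  qed
  have counit': "counit_linear B'"
    unfolding counit_linear_def
  proof (intro conjI ballI allI)
    fix x a assume "x \<in> carrier B'"
    then obtain u where u: "u \<in> carrier B" "x = h u" using surj by auto
    show "counit B' (a \<odot>\<^bsub>B'\<^esub> x) = a * counit B' x"
      using u d(7) hl(3)[OF u(1), of a] V cu[of "a \<odot>\<^bsub>B\<^esub> u"] by (simp add: cu counit_linear_def)
    fix y assume "y \<in> carrier B'"
    then obtain v where v: "v \<in> carrier B" "y = h v" using surj by auto
    show "counit B' (x \<oplus>\<^bsub>B'\<^esub> y) = counit B' x + counit B' y"
      using u v d(7) hl(2)[OF u(1) v(1)] V cu[of "u \<oplus>\<^bsub>B\<^esub> v"] by (simp add: cu counit_linear_def)
  qed
  note nm = natural_structure_maps[OF d(2) B' h]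
  have nc: "natural B B' h 1 2 (comult_map B) (comult_map B')" "natural B B' h 1 0 (counit_map B) (counit_map B')"
    by (rule natural_coalgebra_maps[OF V W l d(6,7) comult' counit']; (rule cm cu, assumption))+
  have c12: "natural B B' h 3 3 (tens_map B 2 (braiding B) 1 id) (tens_map B' 2 (braiding B') 1 id)"
    and c23: "natural B B' h 3 3 (tens_map B 1 id 2 (braiding B)) (tens_map B' 1 id 2 (braiding B'))"
    and m12: "natural B B' h 3 2 (tens_map B 2 (mult_map B) 1 id) (tens_map B' 2 (mult_map B') 1 id)"
    and m23: "natural B B' h 3 2 (tens_map B 1 id 2 (mult_map B)) (tens_map B' 1 id 2 (mult_map B'))"
    and u1: "natural B B' h 1 2 (tens_map B 0 (unit_map B) 1 id) (tens_map B' 0 (unit_map B') 1 id)"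
    and u2: "natural B B' h 1 2 (tens_map B 1 id 0 (unit_map B)) (tens_map B' 1 id 0 (unit_map B'))"
    and d1: "natural B B' h 2 3 (tens_map B 1 (comult_map B) 1 id) (tens_map B' 1 (comult_map B') 1 id)"
    and d2: "natural B B' h 2 3 (tens_map B 1 id 1 (comult_map B)) (tens_map B' 1 id 1 (comult_map B'))"
    and e1: "natural B B' h 2 1 (tens_map B 1 (counit_map B) 1 id) (tens_map B' 1 (counit_map B') 1 id)"
    and e2: "natural B B' h 2 1 (tens_map B 1 id 1 (counit_map B)) (tens_map B' 1 id 1 (counit_map B'))"
    by (rule tm, rule nbr nid nm nc, rule nbr nid nm nc, simp, simp)+
  have c23': "natural B B' h 4 4 (tens_map B 3 (tens_map B 1 id 2 (braiding B)) 1 id) (tens_map B' 3 (tens_map B' 1 id 2 (braiding B')) 1 id)"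
    and mm: "natural B B' h 4 2 (tens_map B 2 (mult_map B) 2 (mult_map B)) (tens_map B' 2 (mult_map B') 2 (mult_map B'))"
    by (rule tm, rule c23 nm, rule nid nm, simp, simp)+
  note comp = natural_comp
  have bvs: "braided_vec_space B'"
    unfolding braided_vec_space_def
  proof (intro conjI ballI)
    show "linear_map (tens_power B' 2) (tens_power B' 2) (braiding B')" by (rule naturalD(2)[OF nbr])
    fix t assume "t \<in> carrier (tens_power B' 3)"
    from eqI[OF comp[OF comp[OF c12 c23] c12] comp[OF comp[OF c23 c12] c23] _ this]
    show "tens_map B' 2 (braiding B') 1 id (tens_map B' 1 id 2 (braiding B') (tens_map B' 2 (braiding B') 1 id t)) =
       tens_map B' 1 id 2 (braiding B') (tens_map B' 2 (braiding B') 1 id (tens_map B' 1 id 2 (braiding B') t))"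
      using d(4) unfolding braided_vec_space_def comp_def by blast
  qed (rule W)
  have bra: "braided_algebra B'"
    unfolding braided_algebra_def
  proof (intro conjI ballI)
    fix t assume t: "t \<in> carrier (tens_power B' 3)"
    show "braiding B' (tens_map B' 2 (mult_map B') 1 id t) =
        tens_map B' 1 id 2 (mult_map B') (tens_map B' 2 (braiding B') 1 id (tens_map B' 1 id 2 (braiding B') t))"
      using eqI[OF comp[OF m12 nbr] comp[OF comp[OF c23 c12] m23] _ t]
      using d(1) unfolding braided_algebra_def comp_def by blast
    show "braiding B' (tens_map B' 1 id 2 (mult_map B') t) =
        tens_map B' 2 (mult_map B') 1 id (tens_map B' 1 id 2 (braiding B') (tens_map B' 2 (braiding B') 1 id t))"
      using eqI[OF comp[OF m23 nbr] comp[OF comp[OF c12 c23] m12] _ t]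
      using d(1) unfolding braided_algebra_def comp_def by blast
  next
    fix t assume t: "t \<in> carrier (tens_power B' 1)"
    show "braiding B' (tens_map B' 0 (unit_map B') 1 id t) = tens_map B' 1 id 0 (unit_map B') t"
      using eqI[OF comp[OF u1 nbr] u2 _ t]
      using d(1) unfolding braided_algebra_def comp_def by blast
    show "braiding B' (tens_map B' 1 id 0 (unit_map B') t) = tens_map B' 0 (unit_map B') 1 id t"
      using eqI[OF comp[OF u2 nbr] u1 _ t]
      using d(1) unfolding braided_algebra_def comp_def by blast
  qed (rule B' bvs)+
  have coal: "braided_coalgebra B'"
    unfolding braided_coalgebra_def
  proof (intro conjI ballI)
    fix x assume "x \<in> carrier B'"
    then obtain u where u: "u \<in> carrier B" "x = h u" using surj by auto
    have cu: "comult B u \<in> carrier (tens_power B 2)" using linear_mapD(1)[OF d(6) u(1)] .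
    have tx: "tens B' [x] = power_map B' 1 h (tens B [u])" using u by (simp add: power_map_tens[OF V W l])
    note ax = d(8)[unfolded braided_coalgebra_def, THEN conjunct2, THEN conjunct2, THEN conjunct2, THEN conjunct1, rule_format, OF u(1)]
    show "tens_map B' 1 (comult_map B') 1 id (comult B' x) = tens_map B' 1 id 1 (comult_map B') (comult B' x)"
      unfolding u(2) cm[OF u(1)] naturalD(3)[OF d1 cu] naturalD(3)[OF d2 cu] using ax by simp
    show "tens_map B' 1 (counit_map B') 1 id (comult B' x) = tens B' [x]"
      unfolding tx unfolding u(2) cm[OF u(1)] naturalD(3)[OF e1 cu] using ax by simp
    show "tens_map B' 1 id 1 (counit_map B') (comult B' x) = tens B' [x]"
      unfolding tx unfolding u(2) cm[OF u(1)] naturalD(3)[OF e2 cu] using ax by simp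
  next
    fix t assume t: "t \<in> carrier (tens_power B' 2)"
    note ax = d(8)[unfolded braided_coalgebra_def, THEN conjunct2, THEN conjunct2, THEN conjunct2, THEN conjunct2, rule_format]
    show "tens_map B' 1 (comult_map B') 1 id (braiding B' t) =
        tens_map B' 1 id 2 (braiding B') (tens_map B' 2 (braiding B') 1 id (tens_map B' 1 id 1 (comult_map B') t))"
      using eqI[OF comp[OF nbr d1] comp[OF comp[OF d2 c12] c23] _ t] ax unfolding comp_def by blast
    show "tens_map B' 1 id 1 (comult_map B') (braiding B' t) =
        tens_map B' 2 (braiding B') 1 id (tens_map B' 1 id 2 (braiding B') (tens_map B' 1 (comult_map B') 1 id t))"
      using eqI[OF comp[OF nbr d2] comp[OF comp[OF d1 c23] c12] _ t] ax unfolding comp_def by blast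
    show "tens_map B' 1 (counit_map B') 1 id (braiding B' t) = tens_map B' 1 id 1 (counit_map B') t"
      using eqI[OF comp[OF nbr e1] e2 _ t] ax unfolding comp_def by blast
    show "tens_map B' 1 id 1 (counit_map B') (braiding B' t) = tens_map B' 1 (counit_map B') 1 id t"
      using eqI[OF comp[OF nbr e2] e1 _ t] ax unfolding comp_def by blast
  qed (rule bvs comult' counit')+
  have cam: "comult_algebra_map B'"
    unfolding comult_algebra_map_def
  proof (intro conjI ballI)
    have "comult B \<one>\<^bsub>B\<^esub> = tens B [\<one>\<^bsub>B\<^esub>, \<one>\<^bsub>B\<^esub>]" using d(9) by (simp add: comult_algebra_map_def)
    then show "comult B' \<one>\<^bsub>B'\<^esub> = tens B' [\<one>\<^bsub>B'\<^esub>, \<one>\<^bsub>B'\<^esub>]"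
      using cm[of "\<one>\<^bsub>B\<^esub>"] d(2) algebra_mapD(3)[OF h] by (simp add: power_map_tens[OF V W l])
    fix x y assume "x \<in> carrier B'" "y \<in> carrier B'"
    then obtain u v where u: "u \<in> carrier B" "x = h u" and v: "v \<in> carrier B" "y = h v" using surj by auto
    note cc = linear_mapD(1)[OF d(6) u(1)] linear_mapD(1)[OF d(6) v(1)]
    have cuv: "comult B u \<otimes>\<^bsub>tensor_alg B\<^esub> comult B v \<in> carrier (tens_power B 4)"
      using cc by (intro tens_power_mult[OF V]) auto
    have uv: "x \<otimes>\<^bsub>B'\<^esub> y = h (u \<otimes>\<^bsub>B\<^esub> v)" using u v algebra_mapD(2)[OF h] by simp
    have prod: "comult B' x \<otimes>\<^bsub>tensor_alg B'\<^esub> comult B' y = power_map B' 4 h (comult B u \<otimes>\<^bsub>tensor_alg B\<^esub> comult B v)"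
      using u v cc by (simp add: cm power_map_mult[OF V W l, of 4 2 2])
    have "comult B (u \<otimes>\<^bsub>B\<^esub> v) = tens_map B 2 (mult_map B) 2 (mult_map B)
          (tens_map B 3 (tens_map B 1 id 2 (braiding B)) 1 id (comult B u \<otimes>\<^bsub>tensor_alg B\<^esub> comult B v))"
      using d(9) u v by (simp add: comult_algebra_map_def)
    then show "comult B' (x \<otimes>\<^bsub>B'\<^esub> y) = tens_map B' 2 (mult_map B') 2 (mult_map B')
          (tens_map B' 3 (tens_map B' 1 id 2 (braiding B')) 1 id (comult B' x \<otimes>\<^bsub>tensor_alg B'\<^esub> comult B' y))"
      unfolding uv prod using naturalD(3)[OF comp[OF c23' mm] cuv] cm[of "u \<otimes>\<^bsub>B\<^esub> v"] u v d(2) by simp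
  qed (rule comult')
  have cuam: "counit_algebra_map B'"
    unfolding counit_algebra_map_def
  proof (intro conjI ballI)
    show "counit B' \<one>\<^bsub>B'\<^esub> = 1"
      using cu[of "\<one>\<^bsub>B\<^esub>"] d(2,10) algebra_mapD(3)[OF h] by (simp add: counit_algebra_map_def)
    fix x y assume "x \<in> carrier B'" "y \<in> carrier B'"
    then obtain u v where u: "u \<in> carrier B" "x = h u" and v: "v \<in> carrier B" "y = h v" using surj by auto
    then have "x \<otimes>\<^bsub>B'\<^esub> y = h (u \<otimes>\<^bsub>B\<^esub> v)" using algebra_mapD(2)[OF h] by simp
    then show "counit B' (x \<otimes>\<^bsub>B'\<^esub> y) = counit B' x * counit B' y"
      using u v cu d(2,10) by (simp add: counit_algebra_map_def)
  qed (rule counit')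
  show "braided_bialgebra B'" using bra coal cam cuam by (simp add: braided_bialgebra_def)
  show "braided_bialgebra_map B B' h"
    using h l br cm cu by (simp add: braided_bialgebra_map_def braided_map_def)
qed

section \<open>Coordinates\<close>

text \<open>A basis \<open>E\<close> with its coordinate map \<open>g\<close>. The values
  \<open>g x = fret x\<close> on \<open>E\<close> express linear independence, the condition on
  \<open>lin_ext\<close> that \<open>E\<close> spans.\<close>

definition coordinates :: "('k::field, 'v, 'm) module_scheme \<Rightarrow> 'v set \<Rightarrow> ('v \<Rightarrow> ('v \<Rightarrow>\<^sub>0 'k)) \<Rightarrow> bool" where
  "coordinates V E g \<longleftrightarrow> E \<subseteq> carrier V \<and> (\<forall>x\<in>E. g x = fret x) \<and>
     (\<forall>a\<in>carrier V. Poly_Mapping.keys (g a) \<subseteq> E \<and> lin_ext V (g a) (\<lambda>x. x) = a) \<and>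
     (\<forall>a\<in>carrier V. \<forall>b\<in>carrier V. g (a \<oplus>\<^bsub>V\<^esub> b) = g a + g b) \<and>
     (\<forall>k. \<forall>a\<in>carrier V. g (k \<odot>\<^bsub>V\<^esub> a) = fscale k (g a))"

lemma vector_space_fscale: "vector_space (fscale :: 'k::field \<Rightarrow> ('x \<Rightarrow>\<^sub>0 'k) \<Rightarrow> ('x \<Rightarrow>\<^sub>0 'k))"
  by unfold_locales (auto simp: fscale_add_left)

text \<open>\<open>V\<close> is a quotient of the free module on its elements, and the latter is a
  vector space on a whole type. A basis \<open>BR\<close> of the kernel \<open>R\<close> is extended
  by generators \<open>fret x\<close> to a basis of the free module; the added generators give the
  basis of \<open>V\<close>, and the projection that kills \<open>R\<close> gives the
  coordinates.\<close>

lemma coordinates_exist: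
  fixes V :: "('k::field, 'v, 'm) module_scheme"
  assumes V: "vec_space V"
  obtains E g where "coordinates V E g"
proof -
  interpret F: vector_space "fscale :: 'k \<Rightarrow> ('v \<Rightarrow>\<^sub>0 'k) \<Rightarrow> ('v \<Rightarrow>\<^sub>0 'k)" by (rule vector_space_fscale)
  interpret FF: vector_space_pair "fscale :: 'k \<Rightarrow> ('v \<Rightarrow>\<^sub>0 'k) \<Rightarrow> ('v \<Rightarrow>\<^sub>0 'k)" "fscale :: 'k \<Rightarrow> ('v \<Rightarrow>\<^sub>0 'k) \<Rightarrow> ('v \<Rightarrow>\<^sub>0 'k)" ..
  \<comment> \<open>Elements outside the carrier are sent to zero. Their generators then lie in the
    kernel, so by independence none of them can be among the added basis vectors.\<close>
  define p where "p x = (if x \<in> carrier V then x else \<zero>\<^bsub>V\<^esub>)" for x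
  have [simp]: "p x \<in> carrier V" for x using V by (simp add: p_def)
  define q where "q f = lin_ext V f p" for f :: "'v \<Rightarrow>\<^sub>0 'k"
  have q: "q f \<in> carrier V" "q (f + g) = q f \<oplus>\<^bsub>V\<^esub> q g" "q (fscale a f) = a \<odot>\<^bsub>V\<^esub> q f" "q 0 = \<zero>\<^bsub>V\<^esub>"
    "q (fret x) = p x" "q (f - g) = q f \<ominus>\<^bsub>V\<^esub> q g" for f g a x
    using V by (simp_all add: q_def lin_ext_add lin_ext_scale lin_ext_single lin_ext_closed lin_ext_diff)
  define R where "R = {f :: 'v \<Rightarrow>\<^sub>0 'k. q f = \<zero>\<^bsub>V\<^esub>}"
  have "F.subspace R" using V unfolding F.subspace_def R_def by (simp add: q)
  obtain BR where BR: "BR \<subseteq> R" "F.independent BR" "R \<subseteq> F.span BR"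
    using F.maximal_independent_subset[of R] by blast
  define S :: "('v \<Rightarrow>\<^sub>0 'k) set" where "S = range fret"
  obtain B where B: "BR \<subseteq> B" "B \<subseteq> BR \<union> S" "F.independent B" "BR \<union> S \<subseteq> F.span B"
    using F.maximal_independent_subset_extend[of BR "BR \<union> S"] BR(2) by blast
  have spanS: "f \<in> F.span S" for f :: "'v \<Rightarrow>\<^sub>0 'k"
  proof (induction f rule: free_module_induct)
    case (add x a f)
    have "fscale a (fret x) \<in> F.span S" by (intro F.span_scale F.span_base) (simp add: S_def)
    then show ?case using add by (simp add: F.span_add)
  qed (simp add: F.span_zero)
  have spanB: "f \<in> F.span B" for f
    using spanS[of f] B(4) F.span_mono[of S "F.span B"] by (auto simp: F.span_span)
  define C where "C = B - BR"
  \<comment> \<open>The projection onto the span of \<open>C\<close> along the span of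
    \<open>BR\<close>.\<close>
  obtain P where P: "Vector_Spaces.linear fscale fscale P" "\<And>b. b \<in> B \<Longrightarrow> P b = (if b \<in> C then b else 0)"
    using FF.linear_independent_extend[OF B(3), of "\<lambda>b. if b \<in> C then b else 0"] by blast
  interpret P: Vector_Spaces.linear fscale fscale P by (rule P(1))
  have P0: "P f = 0" if "f \<in> F.span BR" for f
    using that by (induction rule: F.span_induct_alt) (use B(1) P(2) in \<open>auto simp: P.add P.scale C_def P.zero\<close>)
  have PC: "P f \<in> F.span C" for f
    using spanB[of f]
    by (induction rule: F.span_induct_alt) (auto simp: P.add P.scale P(2) P.zero F.span_zero intro!: F.span_add F.span_scale intro: F.span_base)
  have qP: "q (P f) = q f" for f
    using spanB[of f]
  proof (induction rule: F.span_induct_alt)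
    case (step c x y)
    have "q (P x) = q x"
      using step(1) BR(1) by (auto simp: P(2) C_def q R_def)
    then show ?case using step by (simp add: P.add P.scale q)
  qed (simp add: P.zero)
  define E where "E = {x. fret x \<in> C}"
  have CX: "\<exists>x\<in>E. b = fret x" if "b \<in> C" for b
    using that B(2) unfolding C_def S_def E_def by blast
  have keys: "Poly_Mapping.keys (P f) \<subseteq> E" for f
    using PC[of f]
  proof (induction rule: F.span_induct_alt)
    case (step c b y)
    obtain x where "x \<in> E" "b = fret x" using CX step(1) by blast
    then show ?case using step(2) by (intro keys_subsetI) auto
  qed simp
  have XV: "E \<subseteq> carrier V"
  proof
    fix x assume x: "x \<in> E"
    show "x \<in> carrier V"
    proof (rule ccontr)
      assume "x \<notin> carrier V"
      then have "fret x \<in> R" by (simp add: R_def q p_def)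
      then have "fret x \<in> F.span BR" using BR(3) by blast
      moreover have "fret x \<in> B" "fret x \<notin> BR" using x by (auto simp: E_def C_def)
      moreover have "F.span BR \<subseteq> F.span (B - {fret x})"
        using \<open>fret x \<notin> BR\<close> B(1) by (intro F.span_mono) auto
      ultimately show False using B(3) unfolding F.dependent_def by blast
    qed
  qed
  define g where "g a = P (fret a)" for a
  have PR: "P f = 0" if "q f = \<zero>\<^bsub>V\<^esub>" for f using that P0 BR(3) by (auto simp: R_def)
  have "coordinates V E g"
    unfolding coordinates_def
  proof (intro conjI ballI allI XV)
    show "g x = fret x" if "x \<in> E" for x
      using that P(2)[of "fret x"] by (simp add: g_def E_def C_def)
    fix a assume a: "a \<in> carrier V"
    show "Poly_Mapping.keys (g a) \<subseteq> E" by (simp add: g_def keys)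
    have "lin_ext V (g a) (\<lambda>x. x) = q (g a)"
      unfolding q_def using keys[of "fret a"] XV by (intro lin_ext_cong V) (auto simp: p_def g_def)
    also have "\<dots> = a" using a by (simp add: g_def qP q p_def)
    finally show "lin_ext V (g a) (\<lambda>x. x) = a" .
    show "g (k \<odot>\<^bsub>V\<^esub> a) = fscale k (g a)" for k
    proof -
      have "P (fret (k \<odot>\<^bsub>V\<^esub> a) - fscale k (fret a)) = 0"
        using a V by (intro PR) (simp add: q p_def del: fscale_simps)
      then show ?thesis unfolding g_def by (simp only: P.diff P.scale right_minus_eq)
    qed
    fix b assume b: "b \<in> carrier V"
    have "P (fret (a \<oplus>\<^bsub>V\<^esub> b) - (fret a + fret b)) = 0"
      using a b V by (intro PR) (simp add: q p_def)
    then show "g (a \<oplus>\<^bsub>V\<^esub> b) = g a + g b" unfolding g_def by (simp only: P.diff P.add right_minus_eq)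
  qed
  then show thesis by (rule that)
qed

section \<open>Kernels of one-sided tensor maps\<close>

text \<open>The image of \<open>M \<otimes> N\<close> in the tensor square, as finite sums of pure
  tensors without coefficients; this matches the shape of \<open>sub_tens_graph\<close>. A scalar is
  absorbed into the first factor, whence the hypothesis on \<open>M\<close> in
  \<open>tspan_smult\<close>.\<close>

inductive_set tspan :: "('k::field, 'v, 'm) module_scheme \<Rightarrow> 'v set \<Rightarrow> 'v set \<Rightarrow> ('v list \<Rightarrow>\<^sub>0 'k) set"
  for V M N where
  zero: "\<zero>\<^bsub>tensor_alg V\<^esub> \<in> tspan V M N"
| add: "x \<in> M \<Longrightarrow> y \<in> N \<Longrightarrow> s \<in> tspan V M N \<Longrightarrow> tens V [x, y] \<oplus>\<^bsub>tensor_alg V\<^esub> s \<in> tspan V M N"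

lemma tspan_closed:
  assumes "vec_space V" "M \<subseteq> carrier V" "N \<subseteq> carrier V" "s \<in> tspan V M N"
  shows "s \<in> carrier (tens_power V 2)"
  using assms(4)
proof induction
  case (add x y s)
  have "tens V [x, y] \<in> carrier (tens_power V 2)" using add assms by (auto intro!: tens_in_power)
  then show ?case using add assms by simp
qed (use assms in simp)

lemma tspan_tens:
  assumes "vec_space V" "M \<subseteq> carrier V" "N \<subseteq> carrier V" "x \<in> M" "y \<in> N"
  shows "tens V [x, y] \<in> tspan V M N"
proof -
  have "tens V [x, y] \<in> carrier (tensor_alg V)" using assms by (auto intro!: tens_closed)
  then show ?thesis using tspan.add[OF assms(4,5) tspan.zero, of V] assms(1) by simp
qed

lemma tspan_add:
  assumes V: "vec_space V" and MN: "M \<subseteq> carrier V" "N \<subseteq> carrier V" and s: "s \<in> tspan V M N" and t: "t \<in> tspan V M N"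
  shows "s \<oplus>\<^bsub>tensor_alg V\<^esub> t \<in> tspan V M N"
  using s
proof induction
  case zero
  then show ?case using tens_power_subset[OF tspan_closed[OF V MN t]] V t by simp
next
  case (add x y s)
  have c: "tens V [x, y] \<in> carrier (tensor_alg V)" using add MN V by (auto intro!: tens_closed)
  show ?case
    using tspan.add[OF add(1,2,4)] tens_power_subset[OF tspan_closed[OF V MN t]]
      tens_power_subset[OF tspan_closed[OF V MN add(3)]] c V
    by (simp add: vec_space_add_ac)
qed

lemma tens2_linear:
  assumes V: "vec_space V"
  shows "y \<in> carrier V \<Longrightarrow> linear_map V (tensor_alg V) (\<lambda>x. tens V [x, y])"
    "x \<in> carrier V \<Longrightarrow> linear_map V (tensor_alg V) (\<lambda>y. tens V [x, y])"
  using multilinearD[OF multilinear_tens[OF V]] multilinearD(2,3)[OF multilinear_tens[OF V], of "[]" "[y]"]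
    multilinearD(2,3)[OF multilinear_tens[OF V], of "[x]" "[]"]
  by (auto intro!: linear_mapI)

lemma tspan_smult:
  assumes V: "vec_space V" and MN: "M \<subseteq> carrier V" "N \<subseteq> carrier V" and s: "s \<in> tspan V M N"
    and M: "\<And>x. x \<in> M \<Longrightarrow> a \<odot>\<^bsub>V\<^esub> x \<in> M"
  shows "a \<odot>\<^bsub>tensor_alg V\<^esub> s \<in> tspan V M N"
  using s
proof induction
  case zero
  then show ?case using V by (simp add: tspan.zero)
next
  case (add x y s)
  have xy: "x \<in> carrier V" "y \<in> carrier V" using add MN by auto
  have c: "tens V [x, y] \<in> carrier (tensor_alg V)" using xy V by (auto intro!: tens_closed)
  have "a \<odot>\<^bsub>tensor_alg V\<^esub> tens V [x, y] = tens V [a \<odot>\<^bsub>V\<^esub> x, y]"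
    using linear_mapD(3)[OF tens2_linear(1)[OF V xy(2)] xy(1)] by simp
  then show ?case
    using tspan.add[OF M[OF add(1)] add(2,4)] tens_power_subset[OF tspan_closed[OF V MN add(3)]] c V by simp
qed

lemma tspan_image:
  assumes V: "vec_space V" and W: "vec_space W" and MN: "M \<subseteq> carrier V" "N \<subseteq> carrier V"
    and F: "linear_map (tens_power V 2) W F" and s: "s \<in> tspan V M N"
    and Q: "\<And>x y. x \<in> M \<Longrightarrow> y \<in> N \<Longrightarrow> F (tens V [x, y]) \<in> Q" "\<zero>\<^bsub>W\<^esub> \<in> Q"
      "\<And>u v. u \<in> Q \<Longrightarrow> v \<in> Q \<Longrightarrow> u \<oplus>\<^bsub>W\<^esub> v \<in> Q"
  shows "F s \<in> Q"
  using s
proof induction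
  case zero
  then show ?case using linear_map_zero[OF F] V W Q by simp
next
  case (add x y s)
  have "tens V [x, y] \<in> carrier (tens_power V 2)" using add MN V by (auto intro!: tens_in_power)
  then show ?case using linear_mapD(2)[OF F, of "tens V [x, y]" s] tspan_closed[OF V MN add(3)] Q add by simp
qed

lemma tens_power_2_tspan:
  assumes V: "vec_space V" and t: "t \<in> carrier (tens_power V 2)"
  shows "t \<in> tspan V (carrier V) (carrier V)"
  using V t
proof (induction t rule: tens_power_induct)
  case (tens l)
  then show ?case using V by (auto simp: numeral_2_eq_2 length_Suc_conv intro!: tspan_tens)
qed (use V in \<open>auto intro: tspan_add tspan_smult tspan.zero\<close>)

text \<open>The flag \<open>swap\<close> lets one proof serve both \<open>id \<otimes> D\<close> and \<open>D \<otimes> id\<close>: the coordinate of the factor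
  on which \<open>D\<close> does not act is extracted before and after applying \<open>\<Phi>\<close>.\<close>

lemma kernel_tspan:
  fixes V :: "('k::field, 'v, 'm) module_scheme" and swap :: bool
  defines "q x y \<equiv> tens V (if swap then [y, x] else [x, y])"
  assumes V: "vec_space V" and W: "vec_space W" and Z: "vec_space Z" and E: "coordinates V E g"
    and D: "linear_map V W D" and \<Phi>: "linear_map (tens_power V 2) Z \<Phi>"
    and \<kappa>: "\<And>x. linear_map Z W (\<kappa> x)"
    and eq: "\<And>x b y. b \<in> carrier V \<Longrightarrow> y \<in> carrier V \<Longrightarrow>
      \<kappa> x (\<Phi> (q b y)) = Poly_Mapping.lookup (g b) x \<odot>\<^bsub>W\<^esub> D y"
    and t: "t \<in> carrier (tens_power V 2)" and 0: "\<Phi> t = \<zero>\<^bsub>Z\<^esub>"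
  shows "t \<in> (if swap then tspan V {y \<in> carrier V. D y = \<zero>\<^bsub>W\<^esub>} (carrier V) else tspan V (carrier V) {y \<in> carrier V. D y = \<zero>\<^bsub>W\<^esub>})"
proof -
  interpret T: abelian_group "tensor_alg V" by (rule vec_space_abelian_group) (simp add: V)
  note XX = E[unfolded coordinates_def]
  \<comment> \<open>\<open>Y x t\<close> is the coefficient of the basis vector \<open>x\<close> of
    the factor on which \<open>D\<close> does not act.\<close>
  define Y where "Y x = multilin V 2 (\<lambda>l. if swap then Poly_Mapping.lookup (g (l ! 1)) x \<odot>\<^bsub>V\<^esub> l ! 0
      else Poly_Mapping.lookup (g (l ! 0)) x \<odot>\<^bsub>V\<^esub> l ! 1)" for x
  have m: "multilinear_on 2 V V (\<lambda>l. if swap then Poly_Mapping.lookup (g (l ! 1)) x \<odot>\<^bsub>V\<^esub> l ! 0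
      else Poly_Mapping.lookup (g (l ! 0)) x \<odot>\<^bsub>V\<^esub> l ! 1)" for x
    using XX V
    by (intro multilinear_on_2I[of V V "\<lambda>u v. if swap then Poly_Mapping.lookup (g v) x \<odot>\<^bsub>V\<^esub> u
      else Poly_Mapping.lookup (g u) x \<odot>\<^bsub>V\<^esub> v"] linear_mapI) (auto simp: lookup_add vec_space_smult_add mult.commute)
  have Yl: "linear_map (tens_power V 2) V (Y x)" for x
    unfolding Y_def by (rule multilin_linear[OF V V m])
  have Yq: "Y x (q b y) = Poly_Mapping.lookup (g b) x \<odot>\<^bsub>V\<^esub> y" if "b \<in> carrier V" "y \<in> carrier V" for x b y
    unfolding Y_def q_def using that by (subst multilin_tens[OF V V m]) auto
  have word: "\<exists>b y. b \<in> carrier V \<and> y \<in> carrier V \<and> tens V l = q b y" if "set l \<subseteq> carrier V" "length l = 2" for l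
  proof (cases swap)
    case True
    then show ?thesis using that
      by (intro exI[of _ "l ! 1"] exI[of _ "l ! 0"]) (auto simp: q_def numeral_2_eq_2 length_Suc_conv)
  next
    case False
    then show ?thesis using that
      by (intro exI[of _ "l ! 0"] exI[of _ "l ! 1"]) (auto simp: q_def numeral_2_eq_2 length_Suc_conv)
  qed
  have qc: "q x y \<in> carrier (tensor_alg V)" if "x \<in> carrier V" "y \<in> carrier V" for x y
    using that V by (auto simp: q_def intro!: tens_closed)
  have qr: "linear_map V (tensor_alg V) (q x)" if "x \<in> carrier V" for x
    unfolding q_def using tens2_linear[OF V] that by (cases swap) simp_all
  have ql: "linear_map V (tensor_alg V) (\<lambda>x. q x y)" if "y \<in> carrier V" for y
    unfolding q_def using tens2_linear[OF V] that by (cases swap) simp_all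
  note Yc = linear_mapD(1)[OF Yl]
  \<comment> \<open>The expansion is claimed for every finite \<open>S'\<close> between
    \<open>S\<close> and \<open>E\<close>, because a sum of two tensors needs a set containing both
    supports.\<close>
  have "\<exists>S. finite S \<and> S \<subseteq> E \<and> (\<forall>S'. finite S' \<longrightarrow> S \<subseteq> S' \<longrightarrow> S' \<subseteq> E \<longrightarrow> t = (\<Oplus>\<^bsub>tensor_alg V\<^esub>x\<in>S'. q x (Y x t)))"
    using V t
  proof (induction t rule: tens_power_induct)
    case (tens l)
    then obtain b y where b: "b \<in> carrier V" "y \<in> carrier V" "tens V l = q b y" using word by blast
    have "q b y = (\<Oplus>\<^bsub>tensor_alg V\<^esub>x\<in>S'. q x (Y x (q b y)))"
      if S': "finite S'" "Poly_Mapping.keys (g b) \<subseteq> S'" "S' \<subseteq> E" for S'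
    proof -
      have XV: "x \<in> S' \<Longrightarrow> x \<in> carrier V" for x using S' XX by auto
      have "q b y = q (lin_ext V (g b) (\<lambda>x. x)) y" using XX b by simp
      also have "\<dots> = lin_ext (tensor_alg V) (g b) (\<lambda>x. q x y)"
        using XX b V by (intro lin_ext_linear[OF ql]) auto
      also have "\<dots> = (\<Oplus>\<^bsub>tensor_alg V\<^esub>x\<in>S'. Poly_Mapping.lookup (g b) x \<odot>\<^bsub>tensor_alg V\<^esub> q x y)"
        using S' XV b V by (intro lin_ext_superset qc) auto
      also have "\<dots> = (\<Oplus>\<^bsub>tensor_alg V\<^esub>x\<in>S'. q x (Y x (q b y)))"
        using XV b V by (intro T.finsum_cong') (auto simp: Yq linear_mapD(3)[OF qr] intro!: qc)
      finally show ?thesis .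
    qed
    then show ?case using XX b by (intro exI[of _ "Poly_Mapping.keys (g b)"]) auto
  next
    case (add s t)
    from add(3) obtain S where S: "finite S" "S \<subseteq> E"
        "\<forall>S'. finite S' \<longrightarrow> S \<subseteq> S' \<longrightarrow> S' \<subseteq> E \<longrightarrow> s = (\<Oplus>\<^bsub>tensor_alg V\<^esub>x\<in>S'. q x (Y x s))" by blast
    from add(4) obtain S' where S': "finite S'" "S' \<subseteq> E"
        "\<forall>S. finite S \<longrightarrow> S' \<subseteq> S \<longrightarrow> S \<subseteq> E \<longrightarrow> t = (\<Oplus>\<^bsub>tensor_alg V\<^esub>x\<in>S. q x (Y x t))" by blast
    have "s \<oplus>\<^bsub>tensor_alg V\<^esub> t = (\<Oplus>\<^bsub>tensor_alg V\<^esub>x\<in>S1. q x (Y x (s \<oplus>\<^bsub>tensor_alg V\<^esub> t)))"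
      if S1: "finite S1" "S \<union> S' \<subseteq> S1" "S1 \<subseteq> E" for S1
    proof -
      have XV: "x \<in> S1 \<Longrightarrow> x \<in> carrier V" for x using S1 XX by auto
      have "(\<Oplus>\<^bsub>tensor_alg V\<^esub>x\<in>S1. q x (Y x (s \<oplus>\<^bsub>tensor_alg V\<^esub> t))) =
          (\<Oplus>\<^bsub>tensor_alg V\<^esub>x\<in>S1. q x (Y x s) \<oplus>\<^bsub>tensor_alg V\<^esub> q x (Y x t))"
        using XV Yc[OF add(1)] Yc[OF add(2)] linear_mapD(2)[OF Yl add(1,2)] V
        by (intro T.finsum_cong') (auto simp: linear_mapD(2)[OF qr] intro!: qc)
      also have "\<dots> = (\<Oplus>\<^bsub>tensor_alg V\<^esub>x\<in>S1. q x (Y x s)) \<oplus>\<^bsub>tensor_alg V\<^esub> (\<Oplus>\<^bsub>tensor_alg V\<^esub>x\<in>S1. q x (Y x t))"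
        using XV Yc[OF add(1)] Yc[OF add(2)] by (intro T.finsum_addf) (auto intro!: qc)
      also have "\<dots> = s \<oplus>\<^bsub>tensor_alg V\<^esub> t" using S(3)[rule_format, of S1, symmetric] S'(3)[rule_format, of S1, symmetric] S1 by simp
      finally show ?thesis by simp
    qed
    then show ?case using S S' by (intro exI[of _ "S \<union> S'"]) auto
  next
    case (smult a t)
    from smult(2) obtain S where S: "finite S" "S \<subseteq> E"
        "\<forall>S'. finite S' \<longrightarrow> S \<subseteq> S' \<longrightarrow> S' \<subseteq> E \<longrightarrow> t = (\<Oplus>\<^bsub>tensor_alg V\<^esub>x\<in>S'. q x (Y x t))" by blast
    interpret M: module "ring_of_type_algebra :: 'k ring" "tensor_alg V" by (rule vec_space_module) (simp add: V)
    have "a \<odot>\<^bsub>tensor_alg V\<^esub> t = (\<Oplus>\<^bsub>tensor_alg V\<^esub>x\<in>S1. q x (Y x (a \<odot>\<^bsub>tensor_alg V\<^esub> t)))"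
      if S1: "finite S1" "S \<subseteq> S1" "S1 \<subseteq> E" for S1
    proof -
      have XV: "x \<in> S1 \<Longrightarrow> x \<in> carrier V" for x using S1 XX by auto
      have "a \<odot>\<^bsub>tensor_alg V\<^esub> t = a \<odot>\<^bsub>tensor_alg V\<^esub> (\<Oplus>\<^bsub>tensor_alg V\<^esub>x\<in>S1. q x (Y x t))"
        using S(3)[rule_format, of S1, symmetric] S1 by simp
      also have "\<dots> = (\<Oplus>\<^bsub>tensor_alg V\<^esub>x\<in>S1. a \<odot>\<^bsub>tensor_alg V\<^esub> q x (Y x t))"
        using S1(1) XV Yc[OF smult(1)]
        by (intro M.finsum_smult_ldistr) (auto simp: ring_of_type_algebra_def intro!: qc)
      also have "\<dots> = (\<Oplus>\<^bsub>tensor_alg V\<^esub>x\<in>S1. q x (Y x (a \<odot>\<^bsub>tensor_alg V\<^esub> t)))"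
        using XV Yc[OF smult(1)] linear_mapD(3)[OF Yl smult(1), of _ a] V
        by (intro T.finsum_cong') (auto simp: linear_mapD(3)[OF qr] intro!: qc)
      finally show ?thesis .
    qed
    then show ?case using S by (intro exI[of _ S]) auto
  next
    case zero
    have "q x (Y x \<zero>\<^bsub>tensor_alg V\<^esub>) = \<zero>\<^bsub>tensor_alg V\<^esub>" if "x \<in> carrier V" for x
      using linear_map_zero[OF Yl, of x] linear_map_zero[OF qr[OF that]] V by simp
    then have "\<zero>\<^bsub>tensor_alg V\<^esub> = (\<Oplus>\<^bsub>tensor_alg V\<^esub>x\<in>S. q x (Y x \<zero>\<^bsub>tensor_alg V\<^esub>))" if "S \<subseteq> E" for S
      using that XX T.finsum_zero[of S] T.finsum_cong'[of S S "\<lambda>_. \<zero>\<^bsub>tensor_alg V\<^esub>" "\<lambda>x. q x (Y x \<zero>\<^bsub>tensor_alg V\<^esub>)"] by (auto simp: subset_iff)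
    then show ?case by (intro exI[of _ "{}"]) auto
  qed
  then obtain S where S: "finite S" "S \<subseteq> E" "t = (\<Oplus>\<^bsub>tensor_alg V\<^esub>x\<in>S. q x (Y x t))" by blast
  \<comment> \<open>Contracting after \<open>\<Phi>\<close> gives \<open>D\<close> of the
    coefficient, so \<open>\<Phi> t = \<zero>\<close> puts every coefficient into the kernel of
    \<open>D\<close>, and the expansion of \<open>t\<close> has the required form.\<close>
  have "\<kappa> x (\<Phi> t) = D (Y x t)" for x
  proof (rule linear_map_tens_eq[OF V W linear_map_comp[OF \<Phi> \<kappa>] linear_map_comp[OF Yl D] _ t])
    fix l assume "set l \<subseteq> carrier V" "length l = 2"
    then obtain b y where "b \<in> carrier V" "y \<in> carrier V" "tens V l = q b y" using word by blast
    then show "\<kappa> x (\<Phi> (tens V l)) = D (Y x (tens V l))" using linear_mapD(3)[OF D] by (simp add: eq Yq)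
  qed
  then have DY: "D (Y x t) = \<zero>\<^bsub>W\<^esub>" for x using 0 linear_map_zero[OF \<kappa> Z W] by simp
  let ?N = "{y \<in> carrier V. D y = \<zero>\<^bsub>W\<^esub>}"
  let ?G = "if swap then tspan V ?N (carrier V) else tspan V (carrier V) ?N"
  have "(\<Oplus>\<^bsub>tensor_alg V\<^esub>x\<in>S. q x (Y x t)) \<in> ?G"
    using S(1,2)
  proof (induction S rule: finite_induct)
    case empty
    then show ?case using T.finsum_empty by (auto intro: tspan.zero)
  next
    case (insert x S)
    have XV: "z \<in> insert x S \<Longrightarrow> z \<in> carrier V" for z using insert XX by auto
    have "(\<Oplus>\<^bsub>tensor_alg V\<^esub>x\<in>insert x S. q x (Y x t)) = q x (Y x t) \<oplus>\<^bsub>tensor_alg V\<^esub> (\<Oplus>\<^bsub>tensor_alg V\<^esub>x\<in>S. q x (Y x t))"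
      using insert XV Yc[OF t] by (intro T.finsum_insert) (auto intro!: qc)
    then show ?case
      using insert XV Yc[OF t] DY by (auto simp: q_def intro!: tspan.add split: if_splits)
  qed
  then show ?thesis using S(3) by simp
qed

text \<open>The degree 1 of a tensor power is to remain literally 1, so that rules about
  \<open>tens_power V 1\<close> and \<open>tens_map V 1\<close> keep matching.\<close>

declare One_nat_def [simp del]

section \<open>The braiding and primitive elements\<close>

lemma length_2: "length l = 2 \<Longrightarrow> \<exists>x y. l = [x, y]"
  by (auto simp: numeral_2_eq_2 length_Suc_conv)

lemma braiding_one:
  assumes B: "braided_algebra B" and y: "y \<in> carrier B"
  shows "braiding B (tens B [\<one>\<^bsub>B\<^esub>, y]) = tens B [y, \<one>\<^bsub>B\<^esub>]" "braiding B (tens B [y, \<one>\<^bsub>B\<^esub>]) = tens B [\<one>\<^bsub>B\<^esub>, y]"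
proof -
  have A: "assoc_algebra B" and V: "vec_space B" using B by (simp_all add: braided_algebra_def)
  note i = linear_map_id_power[OF V]
  have t: "tens B [y] \<in> carrier (tens_power B 1)" using V y by (simp add: tens_in_power)
  have 1: "tens_map B 0 (unit_map B) 1 id (tens B [y]) = tens B [\<one>\<^bsub>B\<^esub>, y]"
    using tens_map_tens[OF V unit_map(1)[OF A] i, of "[]" "[y]" 1] unit_map(2)[OF A] V y A
      tens_append[OF V, of "[\<one>\<^bsub>B\<^esub>]" "[y]"] by simp
  have 2: "tens_map B 1 id 0 (unit_map B) (tens B [y]) = tens B [y, \<one>\<^bsub>B\<^esub>]"
    using tens_map_tens[OF V i unit_map(1)[OF A], of "[y]" "[]" 1] unit_map(2)[OF A] V y A
      tens_append[OF V, of "[y]" "[\<one>\<^bsub>B\<^esub>]"] by simp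
  show "braiding B (tens B [\<one>\<^bsub>B\<^esub>, y]) = tens B [y, \<one>\<^bsub>B\<^esub>]" "braiding B (tens B [y, \<one>\<^bsub>B\<^esub>]) = tens B [\<one>\<^bsub>B\<^esub>, y]"
    using B t 1 2 unfolding braided_algebra_def by metis+
qed

lemma primitives_subset: "x \<in> primitives B \<Longrightarrow> x \<in> carrier B"
  by (simp add: primitives_def)

text \<open>Contraction of the first, respectively last, letter with a coordinate function. Both are
  defined on the whole tensor algebra, so the remaining factor \<open>s\<close> may have any degree.
  They supply the maps \<open>\<kappa>\<close> of \<open>kernel_tspan\<close>.\<close>

lemma coordinates_contract:
  assumes V: "vec_space V" and E: "coordinates V E g"
  shows "\<exists>\<kappa>. linear_map (tensor_alg V) (tensor_alg V) \<kappa> \<and>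
      (\<forall>b\<in>carrier V. \<forall>s\<in>carrier (tensor_alg V). \<kappa> (tens V [b] \<otimes>\<^bsub>tensor_alg V\<^esub> s) = Poly_Mapping.lookup (g b) x \<odot>\<^bsub>tensor_alg V\<^esub> s)"
    and "\<exists>\<kappa>. linear_map (tensor_alg V) (tensor_alg V) \<kappa> \<and>
      (\<forall>b\<in>carrier V. \<forall>s\<in>carrier (tensor_alg V). \<kappa> (s \<otimes>\<^bsub>tensor_alg V\<^esub> tens V [b]) = Poly_Mapping.lookup (g b) x \<odot>\<^bsub>tensor_alg V\<^esub> s)"
proof -
  note T = tensor_alg[OF V] and m = multilinearD[OF multilinear_tens[OF V]] and EE = E[unfolded coordinates_def]
  have W: "vec_space (tensor_alg V)" using T by simp
  note [simp] = V
  let ?G = "\<lambda>b. Poly_Mapping.lookup (g b) x"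
  have G: "a \<in> carrier V \<Longrightarrow> b \<in> carrier V \<Longrightarrow> ?G (a \<oplus>\<^bsub>V\<^esub> b) = ?G a + ?G b" "a \<in> carrier V \<Longrightarrow> ?G (k \<odot>\<^bsub>V\<^esub> a) = k * ?G a" for a b k
    using EE by (simp_all add: lookup_add)
  let ?h = "\<lambda>l. case l of [] \<Rightarrow> \<zero>\<^bsub>tensor_alg V\<^esub> | b # r \<Rightarrow> ?G b \<odot>\<^bsub>tensor_alg V\<^esub> tens V r"
  have 1: "multilinear V (tensor_alg V) ?h"
    unfolding multilinear_def
  proof (intro conjI allI impI ballI)
    fix l assume "set l \<subseteq> carrier V"
    then show "?h l \<in> carrier (tensor_alg V)" using m(1) by (cases l) simp_all
  next
    fix u w a b assume "set u \<subseteq> carrier V" "set w \<subseteq> carrier V" "a \<in> carrier V" "b \<in> carrier V"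
    then show "?h (u @ (a \<oplus>\<^bsub>V\<^esub> b) # w) = ?h (u @ a # w) \<oplus>\<^bsub>tensor_alg V\<^esub> ?h (u @ b # w)"
      using m(1,2) by (cases u) (simp_all add: G vec_space_smult_add)
  next
    fix u w k a assume "set u \<subseteq> carrier V" "set w \<subseteq> carrier V" "a \<in> carrier V"
    then show "?h (u @ (k \<odot>\<^bsub>V\<^esub> a) # w) = k \<odot>\<^bsub>tensor_alg V\<^esub> ?h (u @ a # w)"
      using m(1,3) by (cases u) (simp_all add: G mult.commute)
  qed
  let ?h' = "\<lambda>l. if l = [] then \<zero>\<^bsub>tensor_alg V\<^esub> else ?G (last l) \<odot>\<^bsub>tensor_alg V\<^esub> tens V (butlast l)"
  have bl: "set l \<subseteq> carrier V \<Longrightarrow> set (butlast l) \<subseteq> carrier V" for l by (auto dest: in_set_butlastD)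
  have 2: "multilinear V (tensor_alg V) ?h'"
    unfolding multilinear_def
  proof (intro conjI allI impI ballI)
    fix l assume "set l \<subseteq> carrier V"
    then show "?h' l \<in> carrier (tensor_alg V)" using m(1) bl by simp
  next
    fix u w a b assume "set u \<subseteq> carrier V" "set w \<subseteq> carrier V" "a \<in> carrier V" "b \<in> carrier V"
    then show "?h' (u @ (a \<oplus>\<^bsub>V\<^esub> b) # w) = ?h' (u @ a # w) \<oplus>\<^bsub>tensor_alg V\<^esub> ?h' (u @ b # w)"
      using m(1,2) bl[of w] by (cases w rule: rev_cases) (simp_all add: G vec_space_smult_add butlast_append)
  next
    fix u w k a assume "set u \<subseteq> carrier V" "set w \<subseteq> carrier V" "a \<in> carrier V"
    then show "?h' (u @ (k \<odot>\<^bsub>V\<^esub> a) # w) = k \<odot>\<^bsub>tensor_alg V\<^esub> ?h' (u @ a # w)"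
      using m(1,3) bl[of w] by (cases w rule: rev_cases) (simp_all add: G mult.commute butlast_append)
  qed
  define \<kappa> where "\<kappa> t = lin_ext (tensor_alg V) t ?h" for t
  define \<kappa>' where "\<kappa>' t = lin_ext (tensor_alg V) t ?h'" for t
  have l: "linear_map (tensor_alg V) (tensor_alg V) \<kappa>" "linear_map (tensor_alg V) (tensor_alg V) \<kappa>'"
    unfolding \<kappa>_def \<kappa>'_def by (intro linear_map_lin_ext V W 1 2)+
  note ll = linear_mapD[OF l(1)] linear_mapD[OF l(2)]
  have "\<kappa> (tens V [b] \<otimes>\<^bsub>tensor_alg V\<^esub> s) = ?G b \<odot>\<^bsub>tensor_alg V\<^esub> s \<and> \<kappa>' (s \<otimes>\<^bsub>tensor_alg V\<^esub> tens V [b]) = ?G b \<odot>\<^bsub>tensor_alg V\<^esub> s"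
    if b: "b \<in> carrier V" and s: "s \<in> carrier (tensor_alg V)" for b s
    using V s
  proof (induction s rule: tensor_alg_induct)
    case (tens r)
    then show ?case using b
      by (simp add: tens_append \<kappa>_def \<kappa>'_def lin_ext_tens[OF V W 1] lin_ext_tens[OF V W 2])
  next
    case (add s t)
    then show ?case using b m(1)[of "[b]"] ll by (simp add: assoc_algebra_distr)
  next
    case (smult a t)
    then show ?case using b m(1)[of "[b]"] ll by (simp add: mult.commute)
  qed
  then show "\<exists>\<kappa>. linear_map (tensor_alg V) (tensor_alg V) \<kappa> \<and>
      (\<forall>b\<in>carrier V. \<forall>s\<in>carrier (tensor_alg V). \<kappa> (tens V [b] \<otimes>\<^bsub>tensor_alg V\<^esub> s) = Poly_Mapping.lookup (g b) x \<odot>\<^bsub>tensor_alg V\<^esub> s)"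
    "\<exists>\<kappa>. linear_map (tensor_alg V) (tensor_alg V) \<kappa> \<and>
      (\<forall>b\<in>carrier V. \<forall>s\<in>carrier (tensor_alg V). \<kappa> (s \<otimes>\<^bsub>tensor_alg V\<^esub> tens V [b]) = Poly_Mapping.lookup (g b) x \<odot>\<^bsub>tensor_alg V\<^esub> s)"
    using l by blast+
qed

lemma linear_map_add:
  assumes "vec_space Z" "linear_map W Z f" "linear_map W Z g"
  shows "linear_map W Z (\<lambda>x. f x \<oplus>\<^bsub>Z\<^esub> g x)" "linear_map W Z (\<lambda>x. f x \<ominus>\<^bsub>Z\<^esub> g x)"
  using assms linear_mapD[OF assms(2)] linear_mapD[OF assms(3)]
  by (auto intro!: linear_mapI simp: vec_space_minus vec_space_add_ac mult.commute)

locale bialg =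
  fixes B :: "('k::field, 'u) braided_bialg"
  assumes B: "braided_bialgebra B"
begin

lemmas D = braided_bialgebraD[OF B]
lemmas V = D(3)
lemmas T = tensor_alg[OF D(3)]

abbreviation "c12 \<equiv> tens_map B 2 (braiding B) 1 id"
abbreviation "c23 \<equiv> tens_map B 1 id 2 (braiding B)"
abbreviation "m12 \<equiv> tens_map B 2 (mult_map B) 1 id"
abbreviation "m23 \<equiv> tens_map B 1 id 2 (mult_map B)"
abbreviation "d12 \<equiv> tens_map B 1 (comult_map B) 1 id"
abbreviation "d23 \<equiv> tens_map B 1 id 1 (comult_map B)"
abbreviation tmult (infixl \<open>\<cdot>\<close> 70) where "s \<cdot> t \<equiv> s \<otimes>\<^bsub>tensor_alg B\<^esub> t"
abbreviation tadd (infixl \<open>\<boxplus>\<close> 65) where "s \<boxplus> t \<equiv> s \<oplus>\<^bsub>tensor_alg B\<^esub> t"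

lemma lin:
  "linear_map (tens_power B 3) (tens_power B 3) c12" "linear_map (tens_power B 3) (tens_power B 3) c23"
  "linear_map (tens_power B 3) (tens_power B 2) m12" "linear_map (tens_power B 3) (tens_power B 2) m23"
  "linear_map (tens_power B 2) (tens_power B 3) d12" "linear_map (tens_power B 2) (tens_power B 3) d23"
  by (rule tens_map_linear[OF V], rule D linear_map_id_power[OF V] mult_map[OF D(2)] comult_map[OF V D(6)],
      rule D linear_map_id_power[OF V] mult_map[OF D(2)] comult_map[OF V D(6)], simp, simp)+

lemma tens12 [simp]:
  "x \<in> carrier B \<Longrightarrow> tens B [x] \<in> carrier (tens_power B 1)"
  "x \<in> carrier B \<Longrightarrow> y \<in> carrier B \<Longrightarrow> tens B [x, y] \<in> carrier (tens_power B 2)"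
  "x \<in> carrier B \<Longrightarrow> tens B [x] \<in> carrier (tensor_alg B)"
  "x \<in> carrier B \<Longrightarrow> y \<in> carrier B \<Longrightarrow> tens B [x, y] \<in> carrier (tensor_alg B)"
  using V by (auto intro: tens_in_power tens_closed)

lemma tens_split:
  assumes "x \<in> carrier B" "y \<in> carrier B"
  shows "tens B [x, y] = tens B [x] \<cdot> tens B [y]"
    "z \<in> carrier B \<Longrightarrow> tens B [x, y, z] = tens B [x] \<cdot> tens B [y, z]"
    "z \<in> carrier B \<Longrightarrow> tens B [x, y] \<cdot> tens B [z] = tens B [x] \<cdot> tens B [y, z]"
  using assms V by (simp_all add: tens_append)

lemma pos_simps [simp]:
  assumes "s \<in> carrier (tens_power B 2)" "x \<in> carrier B"
  shows "c12 (s \<cdot> tens B [x]) = braiding B s \<cdot> tens B [x]" "c23 (tens B [x] \<cdot> s) = tens B [x] \<cdot> braiding B s"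
    "m12 (s \<cdot> tens B [x]) = mult_map B s \<cdot> tens B [x]" "m23 (tens B [x] \<cdot> s) = tens B [x] \<cdot> mult_map B s"
  using assms tens_map_mult[OF V D(5) linear_map_id_power[OF V], of s "tens B [x]" 1]
    tens_map_mult[OF V mult_map(1)[OF D(2)] linear_map_id_power[OF V], of s "tens B [x]" 1]
    tens_map_mult[OF V linear_map_id_power[OF V] D(5), of "tens B [x]" 1 s]
    tens_map_mult[OF V linear_map_id_power[OF V] mult_map(1)[OF D(2)], of "tens B [x]" 1 s]
  by simp_all

lemma d_simps [simp]:
  assumes "x \<in> carrier B" "y \<in> carrier B"
  shows "d12 (tens B [x, y]) = comult B x \<cdot> tens B [y]" "d23 (tens B [x, y]) = tens B [x] \<cdot> comult B y"
  using assms tens_map_tens[OF V comult_map(1)[OF V D(6)] linear_map_id_power[OF V], of "[x]" "[y]" 1]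
    tens_map_tens[OF V linear_map_id_power[OF V] comult_map(1)[OF V D(6)], of "[x]" "[y]" 1]
    comult_map(2)[OF V D(6)]
  by simp_all

lemma mult_map_tens [simp]: "x \<in> carrier B \<Longrightarrow> y \<in> carrier B \<Longrightarrow> mult_map B (tens B [x, y]) = tens B [x \<otimes>\<^bsub>B\<^esub> y]"
  by (rule mult_map(2)[OF D(2)])

lemma one_closed [simp]: "\<one>\<^bsub>B\<^esub> \<in> carrier B" using D(2) by simp

lemma axioms_c:
  "t \<in> carrier (tens_power B 3) \<Longrightarrow> braiding B (m12 t) = m23 (c12 (c23 t))"
  "t \<in> carrier (tens_power B 3) \<Longrightarrow> braiding B (m23 t) = m12 (c23 (c12 t))"
  "t \<in> carrier (tens_power B 2) \<Longrightarrow> d12 (braiding B t) = c23 (c12 (d23 t))"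
  "t \<in> carrier (tens_power B 2) \<Longrightarrow> d23 (braiding B t) = c12 (c23 (d12 t))"
  using D(1,8) unfolding braided_algebra_def braided_coalgebra_def by blast+

text \<open>The map \<open>id \<otimes> u \<otimes> id\<close>. It is the summand with the unit in
  the middle, which arises both from \<open>id \<otimes> \<Delta>\<close> and from
  \<open>\<Delta> \<otimes> id\<close> when the coproduct is applied to a primitive factor.\<close>

definition ins :: "('u list \<Rightarrow>\<^sub>0 'k) \<Rightarrow> ('u list \<Rightarrow>\<^sub>0 'k)" where
  "ins = multilin (tensor_alg B) 2 (\<lambda>l. tens B [l ! 0, \<one>\<^bsub>B\<^esub>, l ! 1])"

lemma ins: "linear_map (tens_power B 2) (tensor_alg B) ins"
  "x \<in> carrier B \<Longrightarrow> y \<in> carrier B \<Longrightarrow> ins (tens B [x, y]) = tens B [x, \<one>\<^bsub>B\<^esub>, y]"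
proof -
  have W: "vec_space (tensor_alg B)" using T by simp
  have m: "multilinear_on 2 B (tensor_alg B) (\<lambda>l. tens B [l ! 0, \<one>\<^bsub>B\<^esub>, l ! 1])"
    using multilinearD[OF multilinear_tens[OF V]]
      multilinearD(2,3)[OF multilinear_tens[OF V], of "[]" "[\<one>\<^bsub>B\<^esub>, y]" for y]
      multilinearD(2,3)[OF multilinear_tens[OF V], of "[x, \<one>\<^bsub>B\<^esub>]" "[]" for x]
    by (intro multilinear_on_2I[of B _ "\<lambda>x y. tens B [x, \<one>\<^bsub>B\<^esub>, y]"] linear_mapI) simp_all
  show "linear_map (tens_power B 2) (tensor_alg B) ins"
    unfolding ins_def by (rule multilin_linear[OF V W m])
  show "x \<in> carrier B \<Longrightarrow> y \<in> carrier B \<Longrightarrow> ins (tens B [x, y]) = tens B [x, \<one>\<^bsub>B\<^esub>, y]"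
    unfolding ins_def by (subst multilin_tens[OF V W m]) auto
qed

lemma mult_one_linear:
  "linear_map (tens_power B 2) (tensor_alg B) (\<lambda>s. tens B [\<one>\<^bsub>B\<^esub>] \<cdot> s)"
  "linear_map (tens_power B 2) (tensor_alg B) (\<lambda>s. s \<cdot> tens B [\<one>\<^bsub>B\<^esub>])"
  by (rule linear_map_mult_left[OF T linear_map_incl] linear_map_mult_right[OF T linear_map_incl], simp)+

text \<open>The braiding carries the unit across any element unchanged, so a unit entering from
  either end arrives in the middle.\<close>

lemma c_ins:
  assumes s: "s \<in> carrier (tens_power B 2)"
  shows "c12 (tens B [\<one>\<^bsub>B\<^esub>] \<cdot> s) = ins s" "c23 (s \<cdot> tens B [\<one>\<^bsub>B\<^esub>]) = ins s"
proof -
  have W: "vec_space (tensor_alg B)" using T by simp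
  have l: "linear_map (tens_power B 2) (tens_power B 3) (\<lambda>s. tens B [\<one>\<^bsub>B\<^esub>] \<cdot> s)"
    "linear_map (tens_power B 2) (tens_power B 3) (\<lambda>s. s \<cdot> tens B [\<one>\<^bsub>B\<^esub>])"
    using mult_one_linear V by (auto intro!: linear_map_into_power simp: tens_append tens_in_power)
  have "c12 (tens B [\<one>\<^bsub>B\<^esub>] \<cdot> tens B [x, y]) = ins (tens B [x, y])"
    "c23 (tens B [x, y] \<cdot> tens B [\<one>\<^bsub>B\<^esub>]) = ins (tens B [x, y])"
    if "x \<in> carrier B" "y \<in> carrier B" for x y
  proof -
    have "tens B [\<one>\<^bsub>B\<^esub>] \<cdot> tens B [x, y] = tens B [\<one>\<^bsub>B\<^esub>, x] \<cdot> tens B [y]" using that by (simp add: tens_split(3))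
    then show "c12 (tens B [\<one>\<^bsub>B\<^esub>] \<cdot> tens B [x, y]) = ins (tens B [x, y])"
      using that by (simp add: braiding_one[OF D(1)] ins) (simp add: tens_append V)
    show "c23 (tens B [x, y] \<cdot> tens B [\<one>\<^bsub>B\<^esub>]) = ins (tens B [x, y])"
      using that by (simp add: tens_split(3) braiding_one[OF D(1)] ins) (simp add: tens_append V)
  qed
  note w = this
  show "c12 (tens B [\<one>\<^bsub>B\<^esub>] \<cdot> s) = ins s"
    by (rule linear_map_tens_eq[OF V W linear_map_comp[OF l(1) linear_map_to_tensor_alg[OF lin(1)]] ins(1) _ s])
      (use w in \<open>auto dest!: length_2\<close>)
  show "c23 (s \<cdot> tens B [\<one>\<^bsub>B\<^esub>]) = ins s"
    by (rule linear_map_tens_eq[OF V W linear_map_comp[OF l(2) linear_map_to_tensor_alg[OF lin(2)]] ins(1) _ s])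
      (use w in \<open>auto dest!: length_2\<close>)
qed

text \<open>Turns primitivity into membership in the kernel of a linear map, the form required by
  \<open>kernel_tspan\<close>.\<close>

definition "defect x = comult B x \<ominus>\<^bsub>tensor_alg B\<^esub> (tens B [x, \<one>\<^bsub>B\<^esub>] \<boxplus> tens B [\<one>\<^bsub>B\<^esub>, x])"

lemma defect: "linear_map B (tensor_alg B) defect" "{x \<in> carrier B. defect x = \<zero>\<^bsub>tensor_alg B\<^esub>} = primitives B"
proof -
  have W: "vec_space (tensor_alg B)" using T by simp
  show "linear_map B (tensor_alg B) defect"
    unfolding defect_def
    by (intro linear_map_add W linear_map_to_tensor_alg[OF D(6)] tens2_linear V one_closed)
  show "{x \<in> carrier B. defect x = \<zero>\<^bsub>tensor_alg B\<^esub>} = primitives B"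
    using tens_power_subset[OF linear_mapD(1)[OF D(6)]] W
    by (auto simp: defect_def primitives_def vec_space_minus_eq_zero)
qed

lemma minus_distr:
  assumes "s \<in> carrier (tensor_alg B)" "t \<in> carrier (tensor_alg B)" "u \<in> carrier (tensor_alg B)"
  shows "s \<cdot> (t \<ominus>\<^bsub>tensor_alg B\<^esub> u) = s \<cdot> t \<ominus>\<^bsub>tensor_alg B\<^esub> s \<cdot> u" "(t \<ominus>\<^bsub>tensor_alg B\<^esub> u) \<cdot> s = t \<cdot> s \<ominus>\<^bsub>tensor_alg B\<^esub> u \<cdot> s"
  using assms T by (simp_all add: vec_space_minus assoc_algebra_distr)

text \<open>For primitive \<open>x\<close> the axiom \<open>(C \<otimes> \<Delta>)c = (c \<otimes>
  C)(C \<otimes> c)(\<Delta> \<otimes> C)\<close> shows that \<open>c(x \<otimes> y)\<close> is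
  annihilated by \<open>id \<otimes> defect\<close>, and \<open>kernel_tspan\<close> identifies the
  kernel of this map. The second half is the mirror image.\<close>

lemma braiding_primitives:
  assumes x: "x \<in> primitives B" and y: "y \<in> carrier B"
  shows "braiding B (tens B [x, y]) \<in> tspan B (carrier B) (primitives B)"
    "braiding B (tens B [y, x]) \<in> tspan B (primitives B) (carrier B)"
proof -
  have W: "vec_space (tensor_alg B)" using T by simp
  have xc: "x \<in> carrier B" and dx: "comult B x = tens B [x, \<one>\<^bsub>B\<^esub>] \<boxplus> tens B [\<one>\<^bsub>B\<^esub>, x]"
    using x by (auto simp: primitives_def)
  obtain E g where E: "coordinates B E g" using coordinates_exist[OF V] .
  have ct: "braiding B (tens B [x, y]) \<in> carrier (tens_power B 2)" "braiding B (tens B [y, x]) \<in> carrier (tens_power B 2)"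
    using xc y linear_mapD(1)[OF D(5)] by auto
  have t3: "s \<cdot> t \<in> carrier (tens_power B 3)" if "s \<in> carrier (tens_power B 1) \<and> t \<in> carrier (tens_power B 2) \<or> s \<in> carrier (tens_power B 2) \<and> t \<in> carrier (tens_power B 1)" for s t
    using that V tens_power_mult[of B s 1 t 2 3] tens_power_mult[of B s 2 t 1 3] by auto
  have dc: "comult B z \<in> carrier (tensor_alg B)" if "z \<in> carrier B" for z
    using that tens_power_subset[OF linear_mapD(1)[OF D(6)]] by blast
  show "braiding B (tens B [x, y]) \<in> tspan B (carrier B) (primitives B)"
  proof -
    \<comment> \<open>This is \<open>id \<otimes> defect\<close>, written with operators on the
      whole tensor square; \<open>\<Phi>w\<close> confirms it on pure tensors.\<close>
    define \<Phi> where "\<Phi> s = d23 s \<ominus>\<^bsub>tensor_alg B\<^esub> (s \<cdot> tens B [\<one>\<^bsub>B\<^esub>] \<boxplus> ins s)" for s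
    have \<Phi>: "linear_map (tens_power B 2) (tensor_alg B) \<Phi>"
      unfolding \<Phi>_def by (intro linear_map_add W linear_map_to_tensor_alg[OF lin(6)] mult_one_linear ins)
    have "\<forall>x. \<exists>\<kappa>. linear_map (tensor_alg B) (tensor_alg B) \<kappa> \<and>
      (\<forall>b\<in>carrier B. \<forall>s\<in>carrier (tensor_alg B). \<kappa> (tens B [b] \<cdot> s) = Poly_Mapping.lookup (g b) x \<odot>\<^bsub>tensor_alg B\<^esub> s)"
      using coordinates_contract(1)[OF V E] by blast
    then obtain \<kappa> where \<kappa>: "\<And>x. linear_map (tensor_alg B) (tensor_alg B) (\<kappa> x)"
      "\<And>x b s. b \<in> carrier B \<Longrightarrow> s \<in> carrier (tensor_alg B) \<Longrightarrow> \<kappa> x (tens B [b] \<cdot> s) = Poly_Mapping.lookup (g b) x \<odot>\<^bsub>tensor_alg B\<^esub> s"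
      by metis
    have \<Phi>w: "\<Phi> (tens B [b, z]) = tens B [b] \<cdot> defect z" if "b \<in> carrier B" "z \<in> carrier B" for b z
      using that T W dc[of z] by (simp add: \<Phi>_def defect_def ins minus_distr assoc_algebra_distr) (simp add: tens_split)
    have "d23 (braiding B (tens B [x, y])) = braiding B (tens B [x, y]) \<cdot> tens B [\<one>\<^bsub>B\<^esub>] \<boxplus> ins (braiding B (tens B [x, y]))"
    proof -
      have "d23 (braiding B (tens B [x, y])) = c12 (c23 (d12 (tens B [x, y])))" using xc y by (intro axioms_c) auto
      also have "d12 (tens B [x, y]) = tens B [x] \<cdot> tens B [\<one>\<^bsub>B\<^esub>, y] \<boxplus> tens B [\<one>\<^bsub>B\<^esub>] \<cdot> tens B [x, y]"
        using xc y T dx by (simp add: assoc_algebra_distr tens_split(3))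
      also have "c23 \<dots> = tens B [x] \<cdot> tens B [y, \<one>\<^bsub>B\<^esub>] \<boxplus> tens B [\<one>\<^bsub>B\<^esub>] \<cdot> braiding B (tens B [x, y])"
        using xc y linear_mapD(2)[OF lin(2)] t3 by (simp add: braiding_one[OF D(1)])
      also have "tens B [x] \<cdot> tens B [y, \<one>\<^bsub>B\<^esub>] = tens B [x, y] \<cdot> tens B [\<one>\<^bsub>B\<^esub>]" using xc y by (simp add: tens_split(3))
      also have "c12 (tens B [x, y] \<cdot> tens B [\<one>\<^bsub>B\<^esub>] \<boxplus> tens B [\<one>\<^bsub>B\<^esub>] \<cdot> braiding B (tens B [x, y])) =
          braiding B (tens B [x, y]) \<cdot> tens B [\<one>\<^bsub>B\<^esub>] \<boxplus> ins (braiding B (tens B [x, y]))"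
        using xc y ct linear_mapD(2)[OF lin(1)] t3 by (simp add: c_ins)
      finally show ?thesis .
    qed
    then have 0: "\<Phi> (braiding B (tens B [x, y])) = \<zero>\<^bsub>tensor_alg B\<^esub>"
      unfolding \<Phi>_def using W linear_mapD(1)[OF linear_map_to_tensor_alg[OF lin(6)] ct(1)] by simp
    have "\<kappa> z (\<Phi> (tens B (if False then [u, b] else [b, u]))) = Poly_Mapping.lookup (g b) z \<odot>\<^bsub>tensor_alg B\<^esub> defect u"
      if "b \<in> carrier B" "u \<in> carrier B" for z b u
      using that linear_mapD(1)[OF defect(1)] by (simp add: \<Phi>w \<kappa>)
    from kernel_tspan[of B "tensor_alg B" "tensor_alg B" E g defect \<Phi> \<kappa> False, OF V W W E defect(1) \<Phi> \<kappa>(1) this ct(1) 0]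
    show ?thesis by (simp add: defect(2))
  qed
  show "braiding B (tens B [y, x]) \<in> tspan B (primitives B) (carrier B)"
  proof -
    define \<Phi> where "\<Phi> s = d12 s \<ominus>\<^bsub>tensor_alg B\<^esub> (ins s \<boxplus> tens B [\<one>\<^bsub>B\<^esub>] \<cdot> s)" for s
    have \<Phi>: "linear_map (tens_power B 2) (tensor_alg B) \<Phi>"
      unfolding \<Phi>_def by (intro linear_map_add W linear_map_to_tensor_alg[OF lin(5)] mult_one_linear ins)
    have "\<forall>x. \<exists>\<kappa>. linear_map (tensor_alg B) (tensor_alg B) \<kappa> \<and>
      (\<forall>b\<in>carrier B. \<forall>s\<in>carrier (tensor_alg B). \<kappa> (s \<cdot> tens B [b]) = Poly_Mapping.lookup (g b) x \<odot>\<^bsub>tensor_alg B\<^esub> s)"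
      using coordinates_contract(2)[OF V E] by blast
    then obtain \<kappa> where \<kappa>: "\<And>x. linear_map (tensor_alg B) (tensor_alg B) (\<kappa> x)"
      "\<And>x b s. b \<in> carrier B \<Longrightarrow> s \<in> carrier (tensor_alg B) \<Longrightarrow> \<kappa> x (s \<cdot> tens B [b]) = Poly_Mapping.lookup (g b) x \<odot>\<^bsub>tensor_alg B\<^esub> s"
      by metis
    have \<Phi>w: "\<Phi> (tens B [z, b]) = defect z \<cdot> tens B [b]" if "b \<in> carrier B" "z \<in> carrier B" for b z
      using that T W dc[of z] by (simp add: \<Phi>_def defect_def ins minus_distr assoc_algebra_distr) (simp add: tens_split)
    have "d12 (braiding B (tens B [y, x])) = ins (braiding B (tens B [y, x])) \<boxplus> tens B [\<one>\<^bsub>B\<^esub>] \<cdot> braiding B (tens B [y, x])"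
    proof -
      have "d12 (braiding B (tens B [y, x])) = c23 (c12 (d23 (tens B [y, x])))" using xc y by (intro axioms_c) auto
      also have "d23 (tens B [y, x]) = tens B [y, x] \<cdot> tens B [\<one>\<^bsub>B\<^esub>] \<boxplus> tens B [y, \<one>\<^bsub>B\<^esub>] \<cdot> tens B [x]"
        using xc y T dx by (simp add: assoc_algebra_distr tens_split(3))
      also have "c12 \<dots> = braiding B (tens B [y, x]) \<cdot> tens B [\<one>\<^bsub>B\<^esub>] \<boxplus> tens B [\<one>\<^bsub>B\<^esub>, y] \<cdot> tens B [x]"
        using xc y linear_mapD(2)[OF lin(1)] t3 by (simp add: braiding_one[OF D(1)])
      also have "tens B [\<one>\<^bsub>B\<^esub>, y] \<cdot> tens B [x] = tens B [\<one>\<^bsub>B\<^esub>] \<cdot> tens B [y, x]" using xc y by (simp add: tens_split(3))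
      also have "c23 (braiding B (tens B [y, x]) \<cdot> tens B [\<one>\<^bsub>B\<^esub>] \<boxplus> tens B [\<one>\<^bsub>B\<^esub>] \<cdot> tens B [y, x]) =
          ins (braiding B (tens B [y, x])) \<boxplus> tens B [\<one>\<^bsub>B\<^esub>] \<cdot> braiding B (tens B [y, x])"
        using xc y ct linear_mapD(2)[OF lin(2)] t3 by (simp add: c_ins)
      finally show ?thesis .
    qed
    then have 0: "\<Phi> (braiding B (tens B [y, x])) = \<zero>\<^bsub>tensor_alg B\<^esub>"
      unfolding \<Phi>_def using W linear_mapD(1)[OF linear_map_to_tensor_alg[OF lin(5)] ct(2)] by simp
    have "\<kappa> z (\<Phi> (tens B (if True then [u, b] else [b, u]))) = Poly_Mapping.lookup (g b) z \<odot>\<^bsub>tensor_alg B\<^esub> defect u"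
      if "b \<in> carrier B" "u \<in> carrier B" for z b u
      using that linear_mapD(1)[OF defect(1)] by (simp add: \<Phi>w \<kappa>)
    from kernel_tspan[of B "tensor_alg B" "tensor_alg B" E g defect \<Phi> \<kappa> True, OF V W W E defect(1) \<Phi> \<kappa>(1) this ct(2) 0]
    show ?thesis by (simp add: defect(2))
  qed
qed

end

section \<open>Quotient bialgebras\<close>

text \<open>The tensor constructions read only the module fields of a record. The two sides differ
  in the type of the record, which is why the fact has to be stated.\<close>

lemma tensor_alg_truncate:
  "tensor_alg (module.truncate V) = tensor_alg V" "tens (module.truncate V) = tens V"
  "tens_power (module.truncate V) n = tens_power V n" "power_map (module.truncate V) n f = power_map V n f"
proof -
  have f: "free_alg (module.truncate V) = free_alg V" by (simp add: free_alg_def module.truncate_def)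
  have i: "tensor_ideal (module.truncate V) = tensor_ideal V"
    unfolding tensor_ideal_def f by (simp add: tensor_rels_def module.truncate_def)
  show t: "tensor_alg (module.truncate V) = tensor_alg V" by (simp add: tensor_alg_def f i)
  show u: "tens (module.truncate V) = tens V" by (rule ext) (simp add: tens_def f i)
  show "tens_power (module.truncate V) n = tens_power V n" by (simp add: tens_power_def t f i)
  show "power_map (module.truncate V) n f = power_map V n f" by (simp add: power_map_def t u)
qed

lemma ideal_subspaceI:
  assumes A: "assoc_algebra A" and S: "S \<subseteq> carrier A" "\<zero>\<^bsub>A\<^esub> \<in> S"
    and add: "\<And>x y. x \<in> S \<Longrightarrow> y \<in> S \<Longrightarrow> x \<oplus>\<^bsub>A\<^esub> y \<in> S" and smult: "\<And>a x. x \<in> S \<Longrightarrow> a \<odot>\<^bsub>A\<^esub> x \<in> S"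
    and mult: "\<And>x y. x \<in> S \<Longrightarrow> y \<in> carrier A \<Longrightarrow> x \<otimes>\<^bsub>A\<^esub> y \<in> S" "\<And>x y. x \<in> S \<Longrightarrow> y \<in> carrier A \<Longrightarrow> y \<otimes>\<^bsub>A\<^esub> x \<in> S"
  shows "ideal S A"
proof -
  interpret ring A using A by simp
  have "\<ominus>\<^bsub>A\<^esub> x = (-1) \<odot>\<^bsub>A\<^esub> x" if "x \<in> carrier A" for x
    using vec_space_minus[of A "\<zero>\<^bsub>A\<^esub>" x] A that by (simp add: a_minus_def)
  then show ?thesis
    using assms by (intro idealI add.subgroupI ring_axioms) (auto simp: subset_iff)
qed

text \<open>The module part of \<open>image_bialg\<close>, given separately because the braiding and
  coproduct there take values in the tensor algebra of the very record being defined.\<close>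

definition image_alg :: "('k::field, 'u, 'm) module_scheme \<Rightarrow> ('u \<Rightarrow> 'w) \<Rightarrow> ('w \<Rightarrow> 'u) \<Rightarrow> ('k, 'w) module" where
  "image_alg B p s =
     \<lparr>carrier = p ` carrier B, monoid.mult = (\<lambda>x y. p (s x \<otimes>\<^bsub>B\<^esub> s y)), monoid.one = p \<one>\<^bsub>B\<^esub>,
      ring.zero = p \<zero>\<^bsub>B\<^esub>, ring.add = (\<lambda>x y. p (s x \<oplus>\<^bsub>B\<^esub> s y)), module.smult = (\<lambda>a x. p (a \<odot>\<^bsub>B\<^esub> s x))\<rparr>"

definition image_bialg :: "('k::field, 'u) braided_bialg \<Rightarrow> ('u \<Rightarrow> 'w) \<Rightarrow> ('w \<Rightarrow> 'u) \<Rightarrow> ('k, 'w) braided_bialg" where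
  "image_bialg B p s =
     \<lparr>carrier = p ` carrier B, monoid.mult = (\<lambda>x y. p (s x \<otimes>\<^bsub>B\<^esub> s y)), monoid.one = p \<one>\<^bsub>B\<^esub>,
      ring.zero = p \<zero>\<^bsub>B\<^esub>, ring.add = (\<lambda>x y. p (s x \<oplus>\<^bsub>B\<^esub> s y)), module.smult = (\<lambda>a x. p (a \<odot>\<^bsub>B\<^esub> s x)),
      braiding = multilin (tensor_alg (image_alg B p s)) 2
        (\<lambda>l. power_map (image_alg B p s) 2 p (braiding B (tens B [s (l ! 0), s (l ! 1)]))),
      comult = (\<lambda>x. power_map (image_alg B p s) 2 p (comult B (s x))),
      counit = (\<lambda>x. counit B (s x))\<rparr>"

text \<open>By \<open>tensor_alg_truncate\<close> the tensor algebra of \<open>image_alg\<close> is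
  that of the finished record, in terms of which the fields are described from here on.\<close>

lemma image_bialg_simps:
  "module.truncate (image_bialg B p s) = image_alg B p s"
  "carrier (image_bialg B p s) = p ` carrier B"
  "braiding (image_bialg B p s) = multilin (tensor_alg (image_bialg B p s)) 2
        (\<lambda>l. power_map (image_bialg B p s) 2 p (braiding B (tens B [s (l ! 0), s (l ! 1)])))"
  "comult (image_bialg B p s) x = power_map (image_bialg B p s) 2 p (comult B (s x))"
  "counit (image_bialg B p s) x = counit B (s x)"
proof -
  show t: "module.truncate (image_bialg B p s) = image_alg B p s"
    by (simp add: image_bialg_def image_alg_def module.truncate_def)
  note tt = tensor_alg_truncate[of "image_bialg B p s", unfolded t]
  show "carrier (image_bialg B p s) = p ` carrier B"
    "braiding (image_bialg B p s) = multilin (tensor_alg (image_bialg B p s)) 2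
        (\<lambda>l. power_map (image_bialg B p s) 2 p (braiding B (tens B [s (l ! 0), s (l ! 1)])))"
    "comult (image_bialg B p s) x = power_map (image_bialg B p s) 2 p (comult B (s x))"
    "counit (image_bialg B p s) x = counit B (s x)"
    unfolding tt(1,4)[symmetric] by (simp_all add: image_bialg_def)
qed

text \<open>A map \<open>p\<close> whose fibres are the cosets of the ideal \<open>J\<close>, with a
  choice \<open>s\<close> of preimages. It has two instances: the quotient at one stage, with
  \<open>id\<close> as section, and the direct limit as an image of \<open>U 0\<close>.\<close>

locale alg_image = bialg B for B :: "('k::field, 'u) braided_bialg" +
  fixes p :: "'u \<Rightarrow> 'w" and s :: "'w \<Rightarrow> 'u" and J
  assumes J: "ideal J B"
    and sec: "\<And>x. x \<in> carrier B \<Longrightarrow> s (p x) \<in> carrier B" "\<And>x. x \<in> carrier B \<Longrightarrow> p (s (p x)) = p x"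
    and ker: "\<And>x y. x \<in> carrier B \<Longrightarrow> y \<in> carrier B \<Longrightarrow> p x = p y \<longleftrightarrow> x \<ominus>\<^bsub>B\<^esub> y \<in> J"
begin

abbreviation "B' \<equiv> image_bialg B p s"

interpretation J: ideal J B by (rule J)

lemma J_carrier: "x \<in> J \<Longrightarrow> x \<in> carrier B" by (rule J.Icarr)

lemma p_ops:
  assumes "x \<in> carrier B" "y \<in> carrier B"
  shows "p (s (p x) \<oplus>\<^bsub>B\<^esub> s (p y)) = p (x \<oplus>\<^bsub>B\<^esub> y)" "p (s (p x) \<otimes>\<^bsub>B\<^esub> s (p y)) = p (x \<otimes>\<^bsub>B\<^esub> y)"
    "p (a \<odot>\<^bsub>B\<^esub> s (p x)) = p (a \<odot>\<^bsub>B\<^esub> x)"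
proof -
  note q = algebra_mapD[OF quot_alg(2)[OF D(2) J]]
  note lq = linear_mapD[OF q(1)]
  \<comment> \<open>\<open>p\<close> and \<open>quot_proj\<close> identify the same elements, so
    compatibility of the operations is borrowed from the quotient algebra.\<close>
  have e: "p u = p v \<longleftrightarrow> quot_proj B J u = quot_proj B J v" if "u \<in> carrier B" "v \<in> carrier B" for u v
    using ker[OF that] quot_proj_eq_iff[OF _ J that] D(2) by simp
  have qs: "quot_proj B J (s (p u)) = quot_proj B J u" if "u \<in> carrier B" for u
    using e[of "s (p u)" u] sec that by simp
  show "p (s (p x) \<oplus>\<^bsub>B\<^esub> s (p y)) = p (x \<oplus>\<^bsub>B\<^esub> y)" "p (s (p x) \<otimes>\<^bsub>B\<^esub> s (p y)) = p (x \<otimes>\<^bsub>B\<^esub> y)"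
    "p (a \<odot>\<^bsub>B\<^esub> s (p x)) = p (a \<odot>\<^bsub>B\<^esub> x)"
    using assms sec V D(2) by (simp_all add: e lq q(2) qs)
qed

lemma image_algebra: "assoc_algebra B'" "algebra_map B B' p"
proof -
  have "carrier B' = p ` carrier B" by (simp add: image_bialg_def)
  then show "assoc_algebra B'" "algebra_map B B' p"
    using assoc_algebra_surj_image[OF D(2), of B' p] p_ops by (simp_all add: image_bialg_def)
qed

lemmas W = assoc_algebraD(1)[OF image_algebra(1)]
lemmas pl = algebra_mapD(1)[OF image_algebra(2)]
lemmas pp = power_map_linear[OF V W pl]

lemma p_zero: "x \<in> J \<Longrightarrow> p x = \<zero>\<^bsub>B'\<^esub>"
  using ker[of x "\<zero>\<^bsub>B\<^esub>"] J_carrier[of x] V vec_space_minus[of B x "\<zero>\<^bsub>B\<^esub>"]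
  by (simp add: linear_map_zero[OF pl V W])

lemma image_surj: "carrier B' = p ` carrier B"
  by (simp add: image_bialg_simps)

end

locale bialg_image = alg_image B p s J for B :: "('k::field, 'u) braided_bialg" and p :: "'u \<Rightarrow> 'w" and s J +
  assumes braiding_kernel:
      "\<And>x y. x \<in> J \<Longrightarrow> y \<in> carrier B \<Longrightarrow>
        power_map (image_bialg B p s) 2 p (braiding B (tens B [x, y])) = \<zero>\<^bsub>tensor_alg (image_bialg B p s)\<^esub>"
      "\<And>x y. x \<in> J \<Longrightarrow> y \<in> carrier B \<Longrightarrow>
        power_map (image_bialg B p s) 2 p (braiding B (tens B [y, x])) = \<zero>\<^bsub>tensor_alg (image_bialg B p s)\<^esub>"
begin

text \<open>By the two kernel conditions, \<open>p \<otimes> p\<close> after the braiding depends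
  only on the classes of the two factors. Hence the value defined through the section
  \<open>s\<close> is that of any representatives.\<close>

lemma image_braiding:
  assumes t: "t \<in> carrier (tens_power B 2)"
  shows "braiding B' (power_map B' 2 p t) = power_map B' 2 p (braiding B t)"
proof -
  define F where "F x y = power_map B' 2 p (braiding B (tens B [x, y]))" for x y
  note Tw = tensor_alg[OF W]
  have TW: "vec_space (tensor_alg B')" using Tw by simp
  have lF: "linear_map B (tensor_alg B') (\<lambda>x. F x y)" "linear_map B (tensor_alg B') (F y)" if "y \<in> carrier B" for y
    unfolding F_def using that tens2_linear[OF V] linear_mapD[OF linear_map_to_tensor_alg[OF linear_map_comp[OF D(5) pp]]]
    by (auto intro!: linear_mapI simp: linear_mapD[OF tens2_linear(1)[OF V]] linear_mapD[OF tens2_linear(2)[OF V]])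
  have z: "F x y = \<zero>\<^bsub>tensor_alg B'\<^esub>" "F y x = \<zero>\<^bsub>tensor_alg B'\<^esub>" if "x \<in> J" "y \<in> carrier B" for x y
    using braiding_kernel that by (simp_all add: F_def)
  have F1: "F x y = F x' y" "F y x = F y x'" if "p x = p x'" "x \<in> carrier B" "x' \<in> carrier B" "y \<in> carrier B" for x x' y
    using that ker[OF that(2,3)] z[of "x \<ominus>\<^bsub>B\<^esub> x'" y] linear_map_minus[OF lF(1) V TW] linear_map_minus[OF lF(2) V TW]
      linear_mapD(1)[OF lF(1)] linear_mapD(1)[OF lF(2)] vec_space_minus_eq_zero[OF TW]
    by auto
  have sp: "F (s (p x)) y = F x y" "F y (s (p x)) = F y x" if "x \<in> carrier B" "y \<in> carrier B" for x y
    using F1[of "s (p x)" x y] sec that by auto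
  have bil: "F (s (p (x \<oplus>\<^bsub>B\<^esub> y))) z = F x z \<oplus>\<^bsub>tensor_alg B'\<^esub> F y z" "F (s (p (a \<odot>\<^bsub>B\<^esub> x))) z = a \<odot>\<^bsub>tensor_alg B'\<^esub> F x z"
    "F z (s (p (x \<oplus>\<^bsub>B\<^esub> y))) = F z x \<oplus>\<^bsub>tensor_alg B'\<^esub> F z y" "F z (s (p (a \<odot>\<^bsub>B\<^esub> x))) = a \<odot>\<^bsub>tensor_alg B'\<^esub> F z x"
    if "x \<in> carrier B" "y \<in> carrier B" "z \<in> carrier B" for x y z a
    using that V sp linear_mapD[OF lF(1)] linear_mapD[OF lF(2)] by simp_all
  note ql = linear_mapD[OF pl]
  have Fc: "F x y \<in> carrier (tensor_alg B')" if "x \<in> carrier B" "y \<in> carrier B" for x y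
    using linear_mapD(1)[OF lF(1)[OF that(2)] that(1)] .
  have m: "multilinear_on 2 B' (tensor_alg B') (\<lambda>l. F (s (l ! 0)) (s (l ! 1)))"
    by (rule multilinear_on_2I[of B' _ "\<lambda>x y. F (s x) (s y)"]; rule linear_mapI)
      (auto simp: image_surj bil sp sec Fc V linear_mapD(2)[OF lF(1)] linear_mapD(2)[OF lF(2)]
        linear_mapD(3)[OF lF(1)] linear_mapD(3)[OF lF(2)] ql(2)[symmetric] ql(3)[symmetric])
  have br: "braiding B' (tens B' [p x, p y]) = F x y" if "x \<in> carrier B" "y \<in> carrier B" for x y
  proof -
    have "braiding B' (tens B' [p x, p y]) = F (s (p x)) (s (p y))"
      unfolding image_bialg_simps(3) F_def[symmetric]
      using that ql(1) by (subst multilin_tens[OF W TW m]) auto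
    then show ?thesis using that sec by (simp add: sp)
  qed
  have l: "linear_map (tens_power B' 2) (tensor_alg B') (braiding B')"
    unfolding image_bialg_simps(3) F_def[symmetric] by (rule multilin_linear[OF W TW m])
  show ?thesis
  proof (rule linear_map_tens_eq[OF V TW linear_map_comp[OF pp l] linear_map_to_tensor_alg[OF linear_map_comp[OF D(5) pp]] _ t])
    fix l assume l: "set l \<subseteq> carrier B" "length l = 2"
    then obtain x y where "l = [x, y]" using length_2 by blast
    then show "braiding B' (power_map B' 2 p (tens B l)) = power_map B' 2 p (braiding B (tens B l))"
      using l by (simp add: power_map_tens[OF V W pl] br F_def)
  qed
qed

text \<open>Since the coproduct is multiplicative and the braiding descends,
  \<open>(p \<otimes> p)\<Delta>(x y)\<close> is a linear function of the product of
  \<open>(p \<otimes> p)\<Delta>(x)\<close> and \<open>(p \<otimes> p)\<Delta>(y)\<close>; it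
  vanishes as soon as one of these does. The coideal condition can therefore be checked on
  generators of an ideal.\<close>

lemma comult_kernel: "ideal {x \<in> carrier B. power_map B' 2 p (comult B x) = \<zero>\<^bsub>tensor_alg B'\<^esub>} B"
proof -
  let ?F = "\<lambda>x. power_map B' 2 p (comult B x)"
  note Tw = tensor_alg[OF W]
  have TW: "vec_space (tensor_alg B')" using Tw by simp
  have l: "linear_map B (tensor_alg B') ?F" by (rule linear_map_to_tensor_alg[OF linear_map_comp[OF D(6) pp]])
  have nbr: "natural B B' p 2 2 (braiding B) (braiding B')"
    by (rule naturalI_surj[OF V W pl image_surj D(5)]) (rule image_braiding)
  note tm = natural_tens_map[OF V W pl] and nm = natural_structure_maps[OF D(2) image_algebra]
    and nid = natural_id[OF V W, of p]
  have c23': "natural B B' p 4 4 (tens_map B 3 c23 1 id) (tens_map B' 3 (tens_map B' 1 id 2 (braiding B')) 1 id)"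
    by (rule tm, rule tm, rule nid, rule nbr, simp, simp, rule nid, simp, simp)
  have mm: "natural B B' p 4 2 (tens_map B 2 (mult_map B) 2 (mult_map B)) (tens_map B' 2 (mult_map B') 2 (mult_map B'))"
    by (rule tm, rule nm, rule nm, simp, simp)
  note N = natural_comp[OF c23' mm]
  let ?N = "tens_map B' 2 (mult_map B') 2 (mult_map B') \<circ> tens_map B' 3 (tens_map B' 1 id 2 (braiding B')) 1 id"
  have F: "?F (x \<otimes>\<^bsub>B\<^esub> y) = ?N (?F x \<otimes>\<^bsub>tensor_alg B'\<^esub> ?F y)" if "x \<in> carrier B" "y \<in> carrier B" for x y
  proof -
    note cc = linear_mapD(1)[OF D(6) that(1)] linear_mapD(1)[OF D(6) that(2)]
    have "comult B x \<cdot> comult B y \<in> carrier (tens_power B 4)" using cc by (intro tens_power_mult[OF V]) auto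
    then show ?thesis
      using D(9) that naturalD(3)[OF N, of "comult B x \<cdot> comult B y"] power_map_mult[OF V W pl _ cc, of 4]
      by (simp add: comult_algebra_map_def)
  qed
  have N0: "?N \<zero>\<^bsub>tensor_alg B'\<^esub> = \<zero>\<^bsub>tensor_alg B'\<^esub>" using linear_map_zero[OF naturalD(2)[OF N]] W by simp
  show ?thesis
    using linear_mapD[OF l] linear_map_zero[OF l V TW] V W TW Tw D(2) N0
    by (intro ideal_subspaceI[OF D(2)]) (auto simp: F simp del: comp_apply)
qed

lemma image_bialgebra:
  assumes comult_J: "\<And>x. x \<in> J \<Longrightarrow> power_map B' 2 p (comult B x) = \<zero>\<^bsub>tensor_alg B'\<^esub>"
    and counit_J: "\<And>x. x \<in> J \<Longrightarrow> counit B x = 0"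
  shows "braided_bialgebra B'" "braided_bialgebra_map B B' p"
proof -
  have TW: "vec_space (tensor_alg B')" using W by simp
  have l: "linear_map B (tensor_alg B') (\<lambda>x. power_map B' 2 p (comult B x))"
    by (rule linear_map_to_tensor_alg[OF linear_map_comp[OF D(6) pp]])
  have d: "x \<ominus>\<^bsub>B\<^esub> y \<in> J \<Longrightarrow> counit B x = counit B y" if "x \<in> carrier B" "y \<in> carrier B" for x y
    using counit_J[of "x \<ominus>\<^bsub>B\<^esub> y"] D(7) that V by (simp add: vec_space_minus counit_linear_def)
  have "comult B' (p x) = power_map B' 2 p (comult B x)" "counit B' (p x) = counit B x" if "x \<in> carrier B" for x
    using that sec ker[of "s (p x)" x] comult_J[of "s (p x) \<ominus>\<^bsub>B\<^esub> x"] d[of "s (p x)" x]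
      linear_map_minus[OF l V TW, of "s (p x)" x] vec_space_minus_eq_zero[OF TW] linear_mapD(1)[OF l]
    by (simp_all add: image_bialg_simps)
  then show "braided_bialgebra B'" "braided_bialgebra_map B B' p"
    using braided_bialgebra_surj_image[OF B image_algebra image_surj image_braiding] by auto
qed

end

section \<open>One step of the recursion\<close>

text \<open>The operators \<open>e \<otimes> id\<close> and, below, \<open>id \<otimes> e\<close> on
  the whole tensor square. Because they are total, the graph relations in \<open>admissible\<close>
  become equations between linear maps.\<close>

definition act1 :: "('k::field, 'u, 'm) module_scheme \<Rightarrow> ('u \<Rightarrow> 'u) \<Rightarrow> ('u list \<Rightarrow>\<^sub>0 'k) \<Rightarrow> ('u list \<Rightarrow>\<^sub>0 'k)" where
  "act1 B e = tens_map B 1 (power_map B 1 e) 1 id"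

definition act2 :: "('k::field, 'u, 'm) module_scheme \<Rightarrow> ('u \<Rightarrow> 'u) \<Rightarrow> ('u list \<Rightarrow>\<^sub>0 'k) \<Rightarrow> ('u list \<Rightarrow>\<^sub>0 'k)" where
  "act2 B e = tens_map B 1 id 1 (power_map B 1 e)"

lemma act:
  assumes V: "vec_space B" and e: "linear_map B B e"
  shows "linear_map (tens_power B 2) (tens_power B 2) (act1 B e)" "linear_map (tens_power B 2) (tens_power B 2) (act2 B e)"
    "x \<in> carrier B \<Longrightarrow> y \<in> carrier B \<Longrightarrow> act1 B e (tens B [x, y]) = tens B [e x, y]"
    "x \<in> carrier B \<Longrightarrow> y \<in> carrier B \<Longrightarrow> act2 B e (tens B [x, y]) = tens B [x, e y]"
proof -
  note i = linear_map_id_power[OF V, of 1] and p = power_map_linear[OF V V e, of 1]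
  show "linear_map (tens_power B 2) (tens_power B 2) (act1 B e)" "linear_map (tens_power B 2) (tens_power B 2) (act2 B e)"
    unfolding act1_def act2_def by (rule tens_map_linear[OF V p i], simp, simp, rule tens_map_linear[OF V i p], simp, simp)
  show "x \<in> carrier B \<Longrightarrow> y \<in> carrier B \<Longrightarrow> act1 B e (tens B [x, y]) = tens B [e x, y]"
    "x \<in> carrier B \<Longrightarrow> y \<in> carrier B \<Longrightarrow> act2 B e (tens B [x, y]) = tens B [x, e y]"
    using tens_map_tens[OF V p i, of "[x]" "[y]"] tens_map_tens[OF V i p, of "[x]" "[y]"] V linear_mapD(1)[OF e]
    by (simp_all add: act1_def act2_def power_map_tens[OF V V e] tens_append)
qed

lemma natural_act:
  assumes V: "vec_space V" and W: "vec_space W" and h: "linear_map V W h" and e: "linear_map V V e" and e': "linear_map W W e'"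
    and he: "\<And>x. x \<in> carrier V \<Longrightarrow> e' (h x) = h (e x)"
  shows "natural V W h 2 2 (act1 V e) (act1 W e')" "natural V W h 2 2 (act2 V e) (act2 W e')"
proof -
  have "power_map W 1 e' (power_map W 1 h t) = power_map W 1 h (power_map V 1 e t)" if "t \<in> carrier (tens_power V 1)" for t
    using that he power_map_cong[OF V W linear_map_comp[OF h e'] linear_map_comp[OF e h] _ that]
    by (simp add: power_map_comp[OF V W W h e'] power_map_comp[OF V V W e h])
  then have 1: "natural V W h 1 1 (power_map V 1 e) (power_map W 1 e')"
    using power_map_linear[OF V V e] power_map_linear[OF W W e'] by (simp add: natural_def)
  show "natural V W h 2 2 (act1 V e) (act1 W e')" "natural V W h 2 2 (act2 V e) (act2 W e')"
    unfolding act1_def act2_def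
    by (rule natural_tens_map[OF V W h 1 natural_id[OF V W]], simp, simp,
        rule natural_tens_map[OF V W h natural_id[OF V W] 1], simp, simp)
qed

lemma sum_lessThan_Suc:
  assumes "vec_space V" "\<And>j. j < Suc n \<Longrightarrow> f j \<in> carrier V"
  shows "(\<Oplus>\<^bsub>V\<^esub>j\<in>{..<Suc n}. f j) = f n \<oplus>\<^bsub>V\<^esub> (\<Oplus>\<^bsub>V\<^esub>j\<in>{..<n}. f j)"
proof -
  interpret abelian_group V by (rule vec_space_abelian_group) fact
  show ?thesis unfolding lessThan_Suc using assms(2) by (intro finsum_insert) auto
qed

text \<open>If a total linear map \<open>F\<close> agrees with \<open>g \<otimes> h\<close> on pure
  tensors, the value of a sum does not depend on its decomposition: the graph is the restriction of
  \<open>F\<close> to \<open>tspan\<close>.\<close>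

lemma sub_tens_graph_iff:
  assumes V: "vec_space B" and M: "M \<subseteq> carrier B" and N: "N \<subseteq> carrier B"
    and F: "linear_map (tens_power B 2) (tens_power B 2) F"
    and Fw: "\<And>x y. x \<in> M \<Longrightarrow> y \<in> N \<Longrightarrow> F (tens B [x, y]) = tens B [g x, h y]"
    and g: "\<And>x. x \<in> M \<Longrightarrow> g x \<in> carrier B" and h: "\<And>y. y \<in> N \<Longrightarrow> h y \<in> carrier B"
  shows "(t, u) \<in> sub_tens_graph B M g N h \<longleftrightarrow> t \<in> tspan B M N \<and> u = F t"
proof
  have W: "vec_space (tensor_alg B)" using V by simp
  interpret T: abelian_group "tensor_alg B" by (rule vec_space_abelian_group[OF W])
  have c: "tens B [x, y] \<in> carrier (tens_power B 2)" if "x \<in> M" "y \<in> N" for x y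
    using that M N V by (intro tens_in_power) auto
  have c': "tens B [x, y] \<in> carrier (tensor_alg B)" "tens B [g x, h y] \<in> carrier (tensor_alg B)" if "x \<in> M" "y \<in> N" for x y
    using that M N V g h by (auto intro!: tens_closed)
  {
    fix r :: nat and x y
    assume "\<forall>j<r. x j \<in> M \<and> y j \<in> N"
    then have "(\<Oplus>\<^bsub>tensor_alg B\<^esub>j\<in>{..<r}. tens B [x j, y j]) \<in> tspan B M N \<and>
        F (\<Oplus>\<^bsub>tensor_alg B\<^esub>j\<in>{..<r}. tens B [x j, y j]) = (\<Oplus>\<^bsub>tensor_alg B\<^esub>j\<in>{..<r}. tens B [g (x j), h (y j)])"
    proof (induction r)
      case 0
      then show ?case using linear_map_zero[OF F] V T.finsum_empty by (simp add: tspan.zero)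
    next
      case (Suc r)
      then have xy: "x r \<in> M" "y r \<in> N" by auto
      have 1: "(\<Oplus>\<^bsub>tensor_alg B\<^esub>j\<in>{..<Suc r}. tens B [x j, y j]) =
          tens B [x r, y r] \<oplus>\<^bsub>tensor_alg B\<^esub> (\<Oplus>\<^bsub>tensor_alg B\<^esub>j\<in>{..<r}. tens B [x j, y j])"
        using Suc(2) c' by (intro sum_lessThan_Suc W) auto
      have 2: "(\<Oplus>\<^bsub>tensor_alg B\<^esub>j\<in>{..<Suc r}. tens B [g (x j), h (y j)]) =
          tens B [g (x r), h (y r)] \<oplus>\<^bsub>tensor_alg B\<^esub> (\<Oplus>\<^bsub>tensor_alg B\<^esub>j\<in>{..<r}. tens B [g (x j), h (y j)])"
        using Suc(2) c' by (intro sum_lessThan_Suc W) auto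
      have IH: "(\<Oplus>\<^bsub>tensor_alg B\<^esub>j\<in>{..<r}. tens B [x j, y j]) \<in> tspan B M N"
        "F (\<Oplus>\<^bsub>tensor_alg B\<^esub>j\<in>{..<r}. tens B [x j, y j]) = (\<Oplus>\<^bsub>tensor_alg B\<^esub>j\<in>{..<r}. tens B [g (x j), h (y j)])"
        using Suc by auto
      show ?case unfolding 1 2
        using tspan.add[OF xy IH(1)] linear_mapD(2)[OF F c[OF xy] tspan_closed[OF V M N IH(1)]] IH(2) Fw[OF xy] by simp
    qed
  }
  note sums = this
  show "t \<in> tspan B M N \<and> u = F t" if tu: "(t, u) \<in> sub_tens_graph B M g N h"
  proof -
    from tu obtain r :: nat and x y where r: "\<forall>j<r. x j \<in> M \<and> y j \<in> N"
      "t = (\<Oplus>\<^bsub>tensor_alg B\<^esub>j\<in>{..<r}. tens B [x j, y j])" "u = (\<Oplus>\<^bsub>tensor_alg B\<^esub>j\<in>{..<r}. tens B [g (x j), h (y j)])"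
      unfolding sub_tens_graph_def by blast
    show ?thesis using sums[OF r(1)] unfolding r(2,3) by metis
  qed
  assume "t \<in> tspan B M N \<and> u = F t"
  then have "t \<in> tspan B M N" "u = F t" by auto
  then show "(t, u) \<in> sub_tens_graph B M g N h"
  proof (induction t arbitrary: u)
    case zero
    then show ?case using linear_map_zero[OF F] V T.finsum_empty unfolding sub_tens_graph_def
      by (auto intro!: exI[of _ "0::nat"])
  next
    case (add x y t)
    from add(4)[OF refl] obtain r :: nat and x' y' where r: "\<forall>j<r. x' j \<in> M \<and> y' j \<in> N"
      "t = (\<Oplus>\<^bsub>tensor_alg B\<^esub>j\<in>{..<r}. tens B [x' j, y' j])" "F t = (\<Oplus>\<^bsub>tensor_alg B\<^esub>j\<in>{..<r}. tens B [g (x' j), h (y' j)])"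
      unfolding sub_tens_graph_def by blast
    define x1 where "x1 = x'(r := x)"
    define y1 where "y1 = y'(r := y)"
    have xy: "\<forall>j<Suc r. x1 j \<in> M \<and> y1 j \<in> N" using r(1) add(1,2) by (auto simp: x1_def y1_def less_Suc_eq)
    have 1: "(\<Oplus>\<^bsub>tensor_alg B\<^esub>j\<in>{..<Suc r}. tens B [x1 j, y1 j]) =
          tens B [x1 r, y1 r] \<oplus>\<^bsub>tensor_alg B\<^esub> (\<Oplus>\<^bsub>tensor_alg B\<^esub>j\<in>{..<r}. tens B [x1 j, y1 j])"
      using xy c' by (intro sum_lessThan_Suc W) auto
    have 2: "(\<Oplus>\<^bsub>tensor_alg B\<^esub>j\<in>{..<Suc r}. tens B [g (x1 j), h (y1 j)]) =
          tens B [g (x1 r), h (y1 r)] \<oplus>\<^bsub>tensor_alg B\<^esub> (\<Oplus>\<^bsub>tensor_alg B\<^esub>j\<in>{..<r}. tens B [g (x1 j), h (y1 j)])"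
      using xy c' by (intro sum_lessThan_Suc W) auto
    have 3: "(\<Oplus>\<^bsub>tensor_alg B\<^esub>j\<in>{..<r}. tens B [x1 j, y1 j]) = t"
      unfolding r(2) using r(1) c' by (intro T.finsum_cong') (auto simp: x1_def y1_def)
    have 4: "(\<Oplus>\<^bsub>tensor_alg B\<^esub>j\<in>{..<r}. tens B [g (x1 j), h (y1 j)]) = F t"
      unfolding r(3) using r(1) c' by (intro T.finsum_cong') (auto simp: x1_def y1_def)
    have "tens B [x, y] \<oplus>\<^bsub>tensor_alg B\<^esub> t = (\<Oplus>\<^bsub>tensor_alg B\<^esub>j\<in>{..<Suc r}. tens B [x1 j, y1 j])"
      unfolding 1 3 by (simp add: x1_def y1_def)
    moreover have "u = (\<Oplus>\<^bsub>tensor_alg B\<^esub>j\<in>{..<Suc r}. tens B [g (x1 j), h (y1 j)])"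
      unfolding 2 4 add(5) using linear_mapD(2)[OF F c[OF add(1,2)] tspan_closed[OF V M N add(3)]] Fw[OF add(1,2)]
      by (simp add: x1_def y1_def)
    ultimately show ?case using xy unfolding sub_tens_graph_def by blast
  qed
qed

text \<open>The multilinear map \<open>h\<close> sends the empty word to a nonzero vector and every
  other word to zero, thus reading off the scalar component. It permits cancelling the unit in
  equations obtained from \<open>counit_map\<close>.\<close>

lemma tensor_alg_one_free:
  fixes V :: "('k::field, 'v, 'm) module_scheme"
  assumes V: "vec_space V" and a: "a \<odot>\<^bsub>tensor_alg V\<^esub> \<one>\<^bsub>tensor_alg V\<^esub> = \<zero>\<^bsub>tensor_alg V\<^esub>"
  shows "a = 0"
proof -
  define h where "h l = (if l = [] then fret [] else 0 :: 'v list \<Rightarrow>\<^sub>0 'k)" for l :: "'v list"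
  note F = assoc_algebraD(1)[OF free_alg, of V]
  have m: "multilinear V (free_alg V) h" by (simp add: multilinear_def h_def)
  have "lin_ext (free_alg V) (a \<odot>\<^bsub>tensor_alg V\<^esub> tens V []) h = fscale a (h [])"
    using linear_mapD(3)[OF linear_map_lin_ext[OF V F m], of "tens V []" a] V
    by (simp add: lin_ext_tens[OF V F m] tens_closed del: tens_Nil)
  moreover have "lin_ext (free_alg V) \<zero>\<^bsub>tensor_alg V\<^esub> h = 0"
    using linear_map_zero[OF linear_map_lin_ext[OF V F m]] V F by simp
  ultimately have "Poly_Mapping.single [] a = (0 :: 'v list \<Rightarrow>\<^sub>0 'k)" using a V by (simp add: h_def)
  then show ?thesis by (metis lookup_single_eq lookup_zero)
qed

lemma tensor_alg_one_inject:
  fixes V :: "('k::field, 'v, 'm) module_scheme"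
  assumes V: "vec_space V" and ab: "a \<odot>\<^bsub>tensor_alg V\<^esub> \<one>\<^bsub>tensor_alg V\<^esub> = b \<odot>\<^bsub>tensor_alg V\<^esub> \<one>\<^bsub>tensor_alg V\<^esub>"
  shows "a = b"
proof -
  have W: "vec_space (tensor_alg V)" using V by simp
  interpret abelian_group "tensor_alg V" by (rule vec_space_abelian_group[OF W])
  have 1: "\<one>\<^bsub>tensor_alg V\<^esub> \<in> carrier (tensor_alg V)" using V by simp
  have "(a - b) \<odot>\<^bsub>tensor_alg V\<^esub> \<one>\<^bsub>tensor_alg V\<^esub> = a \<odot>\<^bsub>tensor_alg V\<^esub> \<one>\<^bsub>tensor_alg V\<^esub> \<ominus>\<^bsub>tensor_alg V\<^esub> b \<odot>\<^bsub>tensor_alg V\<^esub> \<one>\<^bsub>tensor_alg V\<^esub>"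
    using W 1 vec_space_smult_add[OF W 1, of a "- b"] by (simp add: vec_space_minus)
  then have "(a - b) \<odot>\<^bsub>tensor_alg V\<^esub> \<one>\<^bsub>tensor_alg V\<^esub> = \<zero>\<^bsub>tensor_alg V\<^esub>"
    using W 1 ab by (simp add: a_minus_def r_neg)
  from tensor_alg_one_free[OF V this] show ?thesis by simp
qed

text \<open>The induction hypothesis of the recursion, re-established by \<open>next_stage\<close>.
  The identities \<open>braiding_act\<close> are demanded on all of \<open>B \<otimes> B\<close>:
  they have to govern the primitive elements of later quotients, which are not known at this
  stage.\<close>

locale lie_stage = bialg B for B :: "('k::field, 'u) braided_bialg" +
  fixes A :: "('k, 'a) braided_space" and i :: "'a \<Rightarrow> 'u" and \<phi> :: "'u \<Rightarrow> 'a"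
  assumes A: "assoc_algebra A"
    and braiding_A: "\<And>t. t \<in> carrier (tens_power A 2) \<Longrightarrow> braiding A t \<in> carrier (tens_power A 2)"
    and i: "braided_map A B i"
    and i_primitive: "\<And>a. a \<in> carrier A \<Longrightarrow> i a \<in> primitives B"
    and \<phi>: "algebra_map B A \<phi>" and \<phi>_i: "\<And>a. a \<in> carrier A \<Longrightarrow> \<phi> (i a) = a"
    and braiding_act:
      "\<And>t. t \<in> carrier (tens_power B 2) \<Longrightarrow> braiding B (act1 B (\<lambda>x. i (\<phi> x)) t) = act2 B (\<lambda>x. i (\<phi> x)) (braiding B t)"
      "\<And>t. t \<in> carrier (tens_power B 2) \<Longrightarrow> braiding B (act2 B (\<lambda>x. i (\<phi> x)) t) = act1 B (\<lambda>x. i (\<phi> x)) (braiding B t)"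
begin

abbreviation "e x \<equiv> i (\<phi> x)"
definition "J = bracket_ideal B i \<phi>"
abbreviation "q \<equiv> quot_proj B J"
abbreviation "Q \<equiv> image_bialg B q id"

lemma i_linear: "linear_map A B i" using i by (simp add: braided_map_def)
lemmas \<phi>_linear = algebra_mapD(1)[OF \<phi>]
lemma e_linear: "linear_map B B e" by (rule linear_map_comp[OF \<phi>_linear i_linear])
lemmas ac = act[OF V e_linear]
lemma \<phi>_closed [simp]: "x \<in> carrier B \<Longrightarrow> \<phi> x \<in> carrier A" by (rule linear_mapD(1)[OF \<phi>_linear])
lemma e_closed [simp]: "x \<in> carrier B \<Longrightarrow> e x \<in> carrier B" by (rule linear_mapD(1)[OF e_linear])
lemma e_primitive: "x \<in> carrier B \<Longrightarrow> e x \<in> primitives B" by (simp add: i_primitive)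
lemma e_i [simp]: "a \<in> carrier A \<Longrightarrow> e (i a) = i a" by (simp add: \<phi>_i)
lemma primitives_carrier: "primitives B \<subseteq> carrier B" by (auto simp: primitives_def)
lemma i_carrier: "i ` carrier A \<subseteq> carrier B" using i_primitive primitives_carrier by auto

lemma primitives_closed:
  assumes "x \<in> primitives B"
  shows "y \<in> primitives B \<Longrightarrow> x \<oplus>\<^bsub>B\<^esub> y \<in> primitives B" "a \<odot>\<^bsub>B\<^esub> x \<in> primitives B" "y \<in> primitives B \<Longrightarrow> x \<ominus>\<^bsub>B\<^esub> y \<in> primitives B"
proof -
  have W: "vec_space (tensor_alg B)" using T by simp
  note d = linear_mapD[OF defect(1)]
  show 1: "y \<in> primitives B \<Longrightarrow> x \<oplus>\<^bsub>B\<^esub> y \<in> primitives B" for y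
    using assms d V W unfolding defect(2)[symmetric] by auto
  show "a \<odot>\<^bsub>B\<^esub> x \<in> primitives B" for a
    using assms d V W unfolding defect(2)[symmetric] by auto
  have 3: "a \<odot>\<^bsub>B\<^esub> y \<in> primitives B" if "y \<in> primitives B" for y a
    using that d V W unfolding defect(2)[symmetric] by auto
  show "x \<ominus>\<^bsub>B\<^esub> y \<in> primitives B" if y: "y \<in> primitives B"
    using 1[OF 3[OF y, of "-1"]] vec_space_minus[OF V primitives_subset[OF assms] primitives_subset[OF y]] by simp
qed

text \<open>The ideal is generated by primitive elements. Their coproduct and counit are explicit,
  and this is what makes the ideal a biideal.\<close>

lemma generators: "{x \<ominus>\<^bsub>B\<^esub> e x |x. x \<in> primitives B} \<subseteq> primitives B"
  using primitives_closed(3) e_primitive primitives_carrier by auto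

lemma J_ideal: "ideal J B"
  unfolding J_def bracket_ideal_def using generators primitives_carrier D(2)
  by (intro ring.genideal_ideal) auto

lemma J_minimal: "J \<subseteq> I" if "ideal I B" "\<And>x. x \<in> primitives B \<Longrightarrow> x \<ominus>\<^bsub>B\<^esub> e x \<in> I"
  unfolding J_def bracket_ideal_def using D(2) that by (intro ring.genideal_minimal) auto

lemma generator_in_J: "x \<in> primitives B \<Longrightarrow> x \<ominus>\<^bsub>B\<^esub> e x \<in> J"
  unfolding J_def bracket_ideal_def using D(2) generators primitives_carrier
  by (intro subsetD[OF ring.genideal_self]) auto

lemma J_carrier: "J \<subseteq> carrier B"
  using ideal.Icarr[OF J_ideal] by auto

lemma J_closed:
  assumes "x \<in> J"
  shows "y \<in> J \<Longrightarrow> x \<oplus>\<^bsub>B\<^esub> y \<in> J" "a \<odot>\<^bsub>B\<^esub> x \<in> J" "b \<in> carrier B \<Longrightarrow> b \<otimes>\<^bsub>B\<^esub> x \<in> J" "b \<in> carrier B \<Longrightarrow> x \<otimes>\<^bsub>B\<^esub> b \<in> J"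
proof -
  interpret ideal J B by (rule J_ideal)
  show "y \<in> J \<Longrightarrow> x \<oplus>\<^bsub>B\<^esub> y \<in> J" "b \<in> carrier B \<Longrightarrow> b \<otimes>\<^bsub>B\<^esub> x \<in> J" "b \<in> carrier B \<Longrightarrow> x \<otimes>\<^bsub>B\<^esub> b \<in> J"
    using assms by (auto intro: I_l_closed I_r_closed)
  show "a \<odot>\<^bsub>B\<^esub> x \<in> J" by (rule ideal_smult[OF D(2) J_ideal assms])
qed

lemma \<phi>_J: "x \<in> J \<Longrightarrow> \<phi> x = \<zero>\<^bsub>A\<^esub>"
proof -
  have VA: "vec_space A" using A by simp
  note l = linear_mapD[OF \<phi>_linear]
  have "ideal {x \<in> carrier B. \<phi> x = \<zero>\<^bsub>A\<^esub>} B"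
    using linear_map_zero[OF \<phi>_linear V VA] l algebra_mapD(2)[OF \<phi>] A D(2) V VA
    by (intro ideal_subspaceI) auto
  moreover have "\<phi> (x \<ominus>\<^bsub>B\<^esub> e x) = \<zero>\<^bsub>A\<^esub>" if "x \<in> carrier B" for x
    using that V VA by (simp add: linear_map_minus[OF \<phi>_linear V VA] \<phi>_i)
  ultimately have "J \<subseteq> {x \<in> carrier B. \<phi> x = \<zero>\<^bsub>A\<^esub>}"
    using primitives_carrier V by (intro J_minimal) auto
  then show "x \<in> J \<Longrightarrow> \<phi> x = \<zero>\<^bsub>A\<^esub>" by auto
qed

lemma braiding_closed [simp]: "t \<in> carrier (tens_power B 2) \<Longrightarrow> braiding B t \<in> carrier (tens_power B 2)"
  by (rule linear_mapD(1)[OF D(5)])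

lemmas l1 = tens2_linear(1)[OF V] and l2 = tens2_linear(2)[OF V]

lemma braiding_bilinear:
  assumes "x \<in> carrier B" "y \<in> carrier B" "z \<in> carrier B"
  shows "braiding B (tens B [x \<oplus>\<^bsub>B\<^esub> y, z]) = braiding B (tens B [x, z]) \<boxplus> braiding B (tens B [y, z])"
    "braiding B (tens B [a \<odot>\<^bsub>B\<^esub> x, z]) = a \<odot>\<^bsub>tensor_alg B\<^esub> braiding B (tens B [x, z])"
    "braiding B (tens B [z, x \<oplus>\<^bsub>B\<^esub> y]) = braiding B (tens B [z, x]) \<boxplus> braiding B (tens B [z, y])"
    "braiding B (tens B [z, a \<odot>\<^bsub>B\<^esub> x]) = a \<odot>\<^bsub>tensor_alg B\<^esub> braiding B (tens B [z, x])"
  using assms linear_mapD[OF D(5)] linear_mapD[OF l1[OF assms(3)]] linear_mapD[OF l2[OF assms(3)]]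
  by simp_all

lemma braiding_minus:
  assumes "t \<in> carrier (tens_power B 2)" "u \<in> carrier (tens_power B 2)"
  shows "braiding B (t \<ominus>\<^bsub>tensor_alg B\<^esub> u) = braiding B t \<ominus>\<^bsub>tensor_alg B\<^esub> braiding B u"
  using assms T V by (simp add: vec_space_minus tens_power_subset[of _ B 2] linear_mapD(2)[OF D(5), simplified] linear_mapD(3)[OF D(5), simplified])

lemma tspan_map:
  assumes M: "M \<subseteq> carrier B" and N: "N \<subseteq> carrier B" and M': "M' \<subseteq> carrier B" and N': "N' \<subseteq> carrier B"
    and F: "linear_map (tens_power B 2) (tensor_alg B) F" and t: "t \<in> tspan B M N"
    and w: "\<And>x y. x \<in> M \<Longrightarrow> y \<in> N \<Longrightarrow> F (tens B [x, y]) \<in> tspan B M' N'"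
  shows "F t \<in> tspan B M' N'"
  using T by (intro tspan_image[OF V _ M N F t w tspan.zero]) (auto intro: tspan_add[OF V M' N'])

lemma mult_positions:
  assumes "x \<in> carrier B"
  shows "linear_map (tens_power B 2) (tens_power B 3) (\<lambda>t. tens B [x] \<cdot> t)"
    "linear_map (tens_power B 2) (tens_power B 3) (\<lambda>t. t \<cdot> tens B [x])"
proof -
  note T' = tens_power_mult[OF V]
  have "linear_map (tens_power B 2) (tensor_alg B) (\<lambda>t. tens B [x] \<cdot> t)" "linear_map (tens_power B 2) (tensor_alg B) (\<lambda>t. t \<cdot> tens B [x])"
    using assms by (intro linear_map_mult_left[OF T linear_map_incl] linear_map_mult_right[OF T linear_map_incl]; simp)+
  then show "linear_map (tens_power B 2) (tens_power B 3) (\<lambda>t. tens B [x] \<cdot> t)"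
    "linear_map (tens_power B 2) (tens_power B 3) (\<lambda>t. t \<cdot> tens B [x])"
    using assms T'[of "tens B [x]" 1 _ 2 3] T'[of _ 2 "tens B [x]" 1 3] by (auto simp: linear_map_def Pi_iff)
qed

lemma t3 [simp]: "x \<in> carrier B \<Longrightarrow> y \<in> carrier B \<Longrightarrow> z \<in> carrier B \<Longrightarrow> tens B [x, y, z] \<in> carrier (tens_power B 3)"
  using V by (intro tens_in_power) auto

lemma positions:
  assumes "x \<in> carrier B" "y \<in> carrier B" "z \<in> carrier B"
  shows "m23 (tens B [x, y] \<cdot> tens B [z]) = tens B [x, y \<otimes>\<^bsub>B\<^esub> z]" "m12 (tens B [x] \<cdot> tens B [y, z]) = tens B [x \<otimes>\<^bsub>B\<^esub> y, z]"
    "c12 (tens B [x] \<cdot> tens B [y, z]) = braiding B (tens B [x, y]) \<cdot> tens B [z]"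
    "c23 (tens B [x, y] \<cdot> tens B [z]) = tens B [x] \<cdot> braiding B (tens B [y, z])"
proof -
  have e: "tens B [x, y] \<cdot> tens B [z] = tens B [x] \<cdot> tens B [y, z]" using assms by (rule tens_split(3))
  show "m23 (tens B [x, y] \<cdot> tens B [z]) = tens B [x, y \<otimes>\<^bsub>B\<^esub> z]" "c23 (tens B [x, y] \<cdot> tens B [z]) = tens B [x] \<cdot> braiding B (tens B [y, z])"
    unfolding e using assms D(2) by (simp_all add: tens_split(1)[symmetric])
  show "m12 (tens B [x] \<cdot> tens B [y, z]) = tens B [x \<otimes>\<^bsub>B\<^esub> y, z]" "c12 (tens B [x] \<cdot> tens B [y, z]) = braiding B (tens B [x, y]) \<cdot> tens B [z]"
    unfolding e[symmetric] using assms D(2) by (simp_all add: tens_split(1)[symmetric])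
qed

text \<open>The elements \<open>x\<close> with \<open>c(x \<otimes> B)\<close> inside
  \<open>B \<otimes> J\<close> form an ideal, by the compatibility of the braiding with the
  multiplication and since \<open>J\<close> is two-sided. It remains to treat a generator
  \<open>x - e x\<close>, where \<open>c(x \<otimes> y)\<close> already lies in
  \<open>B \<otimes> P(B)\<close>.\<close>

lemma braiding_J:
  assumes "x \<in> J" "y \<in> carrier B"
  shows "braiding B (tens B [x, y]) \<in> tspan B (carrier B) J" "braiding B (tens B [y, x]) \<in> tspan B J (carrier B)"
proof -
  note CB = subset_refl[of "carrier B"]
  have Jc: "x \<in> carrier B" if "x \<in> J" for x using that J_carrier by blast
  note tl = tspan_tens[OF V J_carrier CB] and tr = tspan_tens[OF V CB J_carrier]
  have mr: "m23 (t \<cdot> tens B [j]) \<in> tspan B (carrier B) J" if "t \<in> carrier (tens_power B 2)" "j \<in> J" for t j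
    by (rule tspan_map[OF CB CB CB J_carrier linear_map_comp[OF mult_positions(2) linear_map_to_tensor_alg[OF lin(4)]]
          tens_power_2_tspan[OF V that(1)]])
      (use that J_closed(3,4) D(2) in \<open>simp_all add: positions Jc tr\<close>)
  have ml: "m12 (tens B [j] \<cdot> t) \<in> tspan B J (carrier B)" if "t \<in> carrier (tens_power B 2)" "j \<in> J" for t j
    by (rule tspan_map[OF CB CB J_carrier CB linear_map_comp[OF mult_positions(1) linear_map_to_tensor_alg[OF lin(3)]]
          tens_power_2_tspan[OF V that(1)]])
      (use that J_closed(3,4) D(2) in \<open>simp_all add: positions Jc tl\<close>)
  have mr': "m23 (t \<cdot> tens B [d]) \<in> tspan B (carrier B) J" if "t \<in> tspan B (carrier B) J" "d \<in> carrier B" for t d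
    by (rule tspan_map[OF CB J_carrier CB J_carrier linear_map_comp[OF mult_positions(2) linear_map_to_tensor_alg[OF lin(4)]] that(1)])
      (use that J_closed(3,4) D(2) in \<open>simp_all add: positions Jc tr\<close>)
  have ml': "m12 (tens B [d] \<cdot> t) \<in> tspan B J (carrier B)" if "t \<in> tspan B J (carrier B)" "d \<in> carrier B" for t d
    by (rule tspan_map[OF J_carrier CB J_carrier CB linear_map_comp[OF mult_positions(1) linear_map_to_tensor_alg[OF lin(3)]] that(1)])
      (use that J_closed(3,4) D(2) in \<open>simp_all add: positions Jc tl\<close>)
  \<comment> \<open>\<open>K1\<close> and \<open>K2\<close> quantify over all \<open>y\<close>,
    because in the braiding of a product the second argument has already been changed by the first
    crossing.\<close>
  define K1 where "K1 = {x \<in> carrier B. \<forall>y\<in>carrier B. braiding B (tens B [x, y]) \<in> tspan B (carrier B) J}"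
  define K2 where "K2 = {x \<in> carrier B. \<forall>y\<in>carrier B. braiding B (tens B [y, x]) \<in> tspan B J (carrier B)}"
  have hex1: "braiding B (tens B [x \<otimes>\<^bsub>B\<^esub> y, z]) = m23 (c12 (tens B [x] \<cdot> braiding B (tens B [y, z])))"
    and hex2: "braiding B (tens B [x, y \<otimes>\<^bsub>B\<^esub> z]) = m12 (c23 (braiding B (tens B [x, y]) \<cdot> tens B [z]))"
    if "x \<in> carrier B" "y \<in> carrier B" "z \<in> carrier B" for x y z
  proof -
    have e: "tens B [x, y, z] = tens B [x, y] \<cdot> tens B [z]" "tens B [x, y, z] = tens B [x] \<cdot> tens B [y, z]"
      using that by (simp_all add: tens_split(2,3))
    have t: "tens B [x, y, z] \<in> carrier (tens_power B 3)" using that by simp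
    show "braiding B (tens B [x \<otimes>\<^bsub>B\<^esub> y, z]) = m23 (c12 (tens B [x] \<cdot> braiding B (tens B [y, z])))"
      using axioms_c(1)[OF t] that unfolding e(2) by (simp add: positions)
    show "braiding B (tens B [x, y \<otimes>\<^bsub>B\<^esub> z]) = m12 (c23 (braiding B (tens B [x, y]) \<cdot> tens B [z]))"
      using axioms_c(2)[OF t] that unfolding e(1) by (simp add: positions)
  qed
  have zero: "braiding B (tens B [\<zero>\<^bsub>B\<^esub>, y]) = \<zero>\<^bsub>tensor_alg B\<^esub>" "braiding B (tens B [y, \<zero>\<^bsub>B\<^esub>]) = \<zero>\<^bsub>tensor_alg B\<^esub>"
    if "y \<in> carrier B" for y
    using that linear_map_zero[OF l1 V] linear_map_zero[OF l2 V] linear_map_zero[OF D(5)] V T by simp_all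
  have "ideal K1 B"
  proof (rule ideal_subspaceI[OF D(2)])
    fix x y assume x: "x \<in> K1" and y: "y \<in> carrier B"
    then have xc: "x \<in> carrier B" by (simp add: K1_def)
    have "m23 (c12 (tens B [x] \<cdot> t)) \<in> tspan B (carrier B) J" if "t \<in> carrier (tens_power B 2)" for t
      by (rule tspan_map[OF CB CB CB J_carrier linear_map_comp[OF linear_map_comp[OF mult_positions(1)[OF xc] lin(1)]
              linear_map_to_tensor_alg[OF lin(4)]] tens_power_2_tspan[OF V that]])
        (use x xc mr' in \<open>simp add: positions K1_def\<close>)
    then show "x \<otimes>\<^bsub>B\<^esub> y \<in> K1" using xc y D(2) by (auto simp: K1_def hex1)
    have "m23 (c12 (tens B [y] \<cdot> t)) \<in> tspan B (carrier B) J" if "t \<in> tspan B (carrier B) J" for t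
      by (rule tspan_map[OF CB J_carrier CB J_carrier linear_map_comp[OF linear_map_comp[OF mult_positions(1)[OF y] lin(1)]
              linear_map_to_tensor_alg[OF lin(4)]] that])
        (use y mr in \<open>simp add: positions Jc\<close>)
    then show "y \<otimes>\<^bsub>B\<^esub> x \<in> K1" using x xc y D(2) by (auto simp: K1_def hex1)
  qed (use V D(2) zero tspan_add[OF V CB J_carrier] tspan_smult[OF V CB J_carrier]
      in \<open>auto simp: K1_def braiding_bilinear intro: tspan.zero\<close>)
  moreover have "ideal K2 B"
  proof (rule ideal_subspaceI[OF D(2)])
    fix x y assume x: "x \<in> K2" and y: "y \<in> carrier B"
    then have xc: "x \<in> carrier B" by (simp add: K2_def)
    have "m12 (c23 (t \<cdot> tens B [x])) \<in> tspan B J (carrier B)" if "t \<in> carrier (tens_power B 2)" for t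
      by (rule tspan_map[OF CB CB J_carrier CB linear_map_comp[OF linear_map_comp[OF mult_positions(2)[OF xc] lin(2)]
              linear_map_to_tensor_alg[OF lin(3)]] tens_power_2_tspan[OF V that]])
        (use x xc ml' in \<open>simp add: positions K2_def\<close>)
    then show "y \<otimes>\<^bsub>B\<^esub> x \<in> K2" using xc y D(2) by (auto simp: K2_def hex2)
    have "m12 (c23 (t \<cdot> tens B [y])) \<in> tspan B J (carrier B)" if "t \<in> tspan B J (carrier B)" for t
      by (rule tspan_map[OF J_carrier CB J_carrier CB linear_map_comp[OF linear_map_comp[OF mult_positions(2)[OF y] lin(2)]
              linear_map_to_tensor_alg[OF lin(3)]] that])
        (use y ml in \<open>simp add: positions Jc\<close>)
    then show "x \<otimes>\<^bsub>B\<^esub> y \<in> K2" using x xc y D(2) by (auto simp: K2_def hex2)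
  qed (use V D(2) zero tspan_add[OF V J_carrier CB] tspan_smult[OF V J_carrier CB] J_closed
      in \<open>auto simp: K2_def braiding_bilinear intro: tspan.zero\<close>)
  moreover have "x \<ominus>\<^bsub>B\<^esub> e x \<in> K1 \<and> x \<ominus>\<^bsub>B\<^esub> e x \<in> K2" if x: "x \<in> primitives B" for x
  proof -
    have xc: "x \<in> carrier B" using x primitives_carrier by auto
    have lm: "linear_map (tens_power B 2) (tensor_alg B) (\<lambda>t. t \<ominus>\<^bsub>tensor_alg B\<^esub> act2 B e t)"
      "linear_map (tens_power B 2) (tensor_alg B) (\<lambda>t. t \<ominus>\<^bsub>tensor_alg B\<^esub> act1 B e t)"
      using T by (intro linear_map_add linear_map_incl linear_map_to_tensor_alg[OF ac(2)] linear_map_to_tensor_alg[OF ac(1)]; simp)+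
    have w: "tens B [u, z] \<ominus>\<^bsub>tensor_alg B\<^esub> tens B [u, e z] = tens B [u, z \<ominus>\<^bsub>B\<^esub> e z]"
      "tens B [z, u] \<ominus>\<^bsub>tensor_alg B\<^esub> tens B [e z, u] = tens B [z \<ominus>\<^bsub>B\<^esub> e z, u]"
      if "u \<in> carrier B" "z \<in> carrier B" for u z
      using that linear_map_minus[OF l1 V] linear_map_minus[OF l2 V] T by simp_all
    have "t \<ominus>\<^bsub>tensor_alg B\<^esub> act2 B e t \<in> tspan B (carrier B) J" if "t \<in> tspan B (carrier B) (primitives B)" for t
      by (rule tspan_map[OF CB primitives_carrier CB J_carrier lm(1) that])
        (use generator_in_J in \<open>simp add: ac w tr primitives_subset\<close>)
    moreover have "t \<ominus>\<^bsub>tensor_alg B\<^esub> act1 B e t \<in> tspan B J (carrier B)" if "t \<in> tspan B (primitives B) (carrier B)" for t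
      by (rule tspan_map[OF primitives_carrier CB J_carrier CB lm(2) that])
        (use generator_in_J in \<open>simp add: ac w tl primitives_subset\<close>)
    \<comment> \<open>The invariant enters here: \<open>c((x - e x) \<otimes> y)\<close> is
      \<open>id - id \<otimes> e\<close> applied to \<open>c(x \<otimes> y)\<close>. On
      \<open>B \<otimes> P(B)\<close> this operator takes values in
      \<open>B \<otimes> J\<close>.\<close>
    moreover have "braiding B (tens B [x \<ominus>\<^bsub>B\<^esub> e x, y]) = braiding B (tens B [x, y]) \<ominus>\<^bsub>tensor_alg B\<^esub> act2 B e (braiding B (tens B [x, y]))"
      "braiding B (tens B [y, x \<ominus>\<^bsub>B\<^esub> e x]) = braiding B (tens B [y, x]) \<ominus>\<^bsub>tensor_alg B\<^esub> act1 B e (braiding B (tens B [y, x]))"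
      if y: "y \<in> carrier B" for y
      using xc y braiding_act(1)[of "tens B [x, y]"] braiding_act(2)[of "tens B [y, x]"]
      by (simp_all add: w(1,2)[symmetric] braiding_minus ac)
    ultimately show ?thesis using xc V braiding_primitives[OF x] by (auto simp: K1_def K2_def)
  qed
  ultimately have "J \<subseteq> K1" "J \<subseteq> K2" using J_minimal[of K1] J_minimal[of K2] by blast+
  then show "braiding B (tens B [x, y]) \<in> tspan B (carrier B) J" "braiding B (tens B [y, x]) \<in> tspan B J (carrier B)"
    using assms by (auto simp: K1_def K2_def)
qed

lemma q_id: "x \<in> carrier B \<Longrightarrow> q (id (q x)) = q x" "x \<in> carrier B \<Longrightarrow> id (q x) \<in> carrier B"
  using quot_proj_idem[OF _ J_ideal] quot_proj_mem(1)[OF _ J_ideal] D(2) by auto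

lemma truncate_quotient: "module.truncate Q = quot_alg B J"
  by (simp add: image_bialg_simps image_alg_def quot_alg_def)

sublocale quotient_alg: alg_image B q id J
proof (intro alg_image.intro bialg_axioms alg_image_axioms.intro J_ideal)
  show "q x = q y \<longleftrightarrow> x \<ominus>\<^bsub>B\<^esub> y \<in> J" if "x \<in> carrier B" "y \<in> carrier B" for x y
    using quot_proj_eq_iff[OF _ J_ideal that] D(2) by simp
  show "id (q x) \<in> carrier B" "q (id (q x)) = q x" if "x \<in> carrier B" for x
    using q_id[OF that] by blast+
qed

lemmas quotient_algebra = quotient_alg.image_algebra

sublocale quotient: bialg_image B q id J
proof (intro bialg_image.intro quotient_alg.alg_image_axioms bialg_image_axioms.intro)
  note VQ = assoc_algebraD(1)[OF quotient_algebra(1)] and ql = algebra_mapD(1)[OF quotient_algebra(2)]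
  note CB = subset_refl[of "carrier B"]
  note z = quotient_alg.p_zero
  have tz: "tens Q [\<zero>\<^bsub>Q\<^esub>, y] = \<zero>\<^bsub>tensor_alg Q\<^esub>" "tens Q [y, \<zero>\<^bsub>Q\<^esub>] = \<zero>\<^bsub>tensor_alg Q\<^esub>" if "y \<in> carrier Q" for y
    using linear_map_zero[OF tens2_linear(1)[OF VQ that] VQ] linear_map_zero[OF tens2_linear(2)[OF VQ that] VQ] VQ by simp_all
  note pw = power_map_tens[OF V VQ ql, of "[_, _]" 2] and plin = linear_map_to_tensor_alg[OF power_map_linear[OF V VQ ql]]
  have Jc: "x \<in> carrier B" if "x \<in> J" for x using that J_carrier by blast
  have TQ: "vec_space (tensor_alg Q)" using VQ by simp
  show "power_map Q 2 q (braiding B (tens B [x, y])) = \<zero>\<^bsub>tensor_alg Q\<^esub>" if "x \<in> J" "y \<in> carrier B" for x y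
    using tspan_image[OF V TQ CB J_carrier plin braiding_J(1)[OF that], of "{\<zero>\<^bsub>tensor_alg Q\<^esub>}"] linear_mapD(1)[OF ql] TQ
    by (simp add: pw z tz Jc)
  show "power_map Q 2 q (braiding B (tens B [y, x])) = \<zero>\<^bsub>tensor_alg Q\<^esub>" if "x \<in> J" "y \<in> carrier B" for x y
    using tspan_image[OF V TQ J_carrier CB plin braiding_J(2)[OF that], of "{\<zero>\<^bsub>tensor_alg Q\<^esub>}"] linear_mapD(1)[OF ql] TQ
    by (simp add: pw z tz Jc)
qed

lemma quotient_bialgebra: "braided_bialgebra Q" "braided_bialgebra_map B Q q"
proof -
  note ql = algebra_mapD(1)[OF quotient_algebra(2)] and VQ = quotient_alg.W
  note tz = linear_map_zero[OF tens2_linear(1)[OF VQ] VQ] linear_map_zero[OF tens2_linear(2)[OF VQ] VQ]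
  have TQ: "vec_space (tensor_alg Q)" using VQ by simp
  have "J \<subseteq> {x \<in> carrier B. power_map Q 2 q (comult B x) = \<zero>\<^bsub>tensor_alg Q\<^esub>}"
  proof (rule J_minimal[OF quotient.comult_kernel])
    fix x assume x: "x \<in> primitives B"
    define z where "z = x \<ominus>\<^bsub>B\<^esub> e x"
    have z: "z \<in> primitives B" "z \<in> carrier B" "z \<in> J" "comult B z = tens B [z, \<one>\<^bsub>B\<^esub>] \<boxplus> tens B [\<one>\<^bsub>B\<^esub>, z]"
      using generators generator_in_J[OF x] x primitives_carrier by (auto simp: z_def primitives_def)
    have "power_map Q 2 q (comult B z) = tens Q [\<zero>\<^bsub>Q\<^esub>, q \<one>\<^bsub>B\<^esub>] \<oplus>\<^bsub>tensor_alg Q\<^esub> tens Q [q \<one>\<^bsub>B\<^esub>, \<zero>\<^bsub>Q\<^esub>]"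
      using z linear_mapD(2)[OF quotient_alg.pp[of 2], of "tens B [z, \<one>\<^bsub>B\<^esub>]" "tens B [\<one>\<^bsub>B\<^esub>, z]"]
      by (simp add: power_map_tens[OF V VQ ql] quotient_alg.p_zero)
    also have "\<dots> = \<zero>\<^bsub>tensor_alg Q\<^esub>" using tz TQ linear_mapD(1)[OF ql] by simp
    finally show "x \<ominus>\<^bsub>B\<^esub> e x \<in> {x \<in> carrier B. power_map Q 2 q (comult B x) = \<zero>\<^bsub>tensor_alg Q\<^esub>}"
      using z(2) by (simp add: z_def)
  qed
  moreover have "J \<subseteq> {x \<in> carrier B. counit B x = 0}"
  proof (rule J_minimal)
    show "ideal {x \<in> carrier B. counit B x = 0} B"
    proof (rule ideal_subspaceI[OF D(2)])
      have "counit B (0 \<odot>\<^bsub>B\<^esub> \<zero>\<^bsub>B\<^esub>) = 0" using D(7) V by (simp add: counit_linear_def del: vec_space_smult_zero vec_space_smult)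
      then show "\<zero>\<^bsub>B\<^esub> \<in> {x \<in> carrier B. counit B x = 0}" using V by simp
    qed (use D(2,10) V in \<open>auto simp: counit_algebra_map_def counit_linear_def\<close>)
    fix x assume x: "x \<in> primitives B"
    \<comment> \<open>Applying \<open>\<epsilon> \<otimes> id\<close> to
      \<open>z \<otimes> 1 + 1 \<otimes> z\<close> gives \<open>\<epsilon>(z) 1 + z = z\<close>, so
      \<open>\<epsilon>(z) 1\<close> is zero; applying the counit once more gives
      \<open>\<epsilon>(z) = 0\<close>.\<close>
    have c: "counit B z = 0" if "z \<in> primitives B" for z
    proof -
      have z: "z \<in> carrier B" "comult B z = tens B [z, \<one>\<^bsub>B\<^esub>] \<boxplus> tens B [\<one>\<^bsub>B\<^esub>, z]" using that by (auto simp: primitives_def)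
      have one: "counit B \<one>\<^bsub>B\<^esub> = 1" using D(10) by (simp add: counit_algebra_map_def)
      note cm = counit_map[OF V D(7)]
      have l: "linear_map (tens_power B 2) (tens_power B 1) (tens_map B 1 (counit_map B) 1 id)"
        by (rule tens_map_linear[OF V cm(1) linear_map_id_power[OF V]]) simp_all
      have w: "tens_map B 1 (counit_map B) 1 id (tens B [a, b]) = counit B a \<odot>\<^bsub>tensor_alg B\<^esub> tens B [b]"
        if "a \<in> carrier B" "b \<in> carrier B" for a b
        using tens_map_tens[OF V cm(1) linear_map_id_power[OF V], of "[a]" "[b]" 1] that T by (simp add: cm)
      have "tens_map B 1 (counit_map B) 1 id (comult B z) = tens B [z]"
        using D(8) z(1) by (simp add: braided_coalgebra_def)
      then have *: "counit B z \<odot>\<^bsub>tensor_alg B\<^esub> tens B [\<one>\<^bsub>B\<^esub>] \<boxplus> tens B [z] = tens B [z]"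
        using linear_mapD(2)[OF l, of "tens B [z, \<one>\<^bsub>B\<^esub>]" "tens B [\<one>\<^bsub>B\<^esub>, z]"] z T by (simp add: w one)
      interpret TT: abelian_group "tensor_alg B" by (rule vec_space_abelian_group) (use T in simp)
      have "counit B z \<odot>\<^bsub>tensor_alg B\<^esub> tens B [\<one>\<^bsub>B\<^esub>] = \<zero>\<^bsub>tensor_alg B\<^esub>"
        using z(1) T * TT.add.r_cancel_one[of "tens B [z]" "counit B z \<odot>\<^bsub>tensor_alg B\<^esub> tens B [\<one>\<^bsub>B\<^esub>]"] by simp
      then have 0: "counit_map B (counit B z \<odot>\<^bsub>tensor_alg B\<^esub> tens B [\<one>\<^bsub>B\<^esub>]) = \<zero>\<^bsub>tensor_alg B\<^esub>"
        using linear_map_zero[OF cm(1)] V by simp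
      have "counit B z \<odot>\<^bsub>tensor_alg B\<^esub> \<one>\<^bsub>tensor_alg B\<^esub> = \<zero>\<^bsub>tensor_alg B\<^esub>"
        using 0 linear_mapD(3)[OF cm(1), of "tens B [\<one>\<^bsub>B\<^esub>]" "counit B z"] T by (simp add: cm one)
      then show ?thesis using tensor_alg_one_free[OF V] by blast
    qed
    show "x \<ominus>\<^bsub>B\<^esub> e x \<in> {x \<in> carrier B. counit B x = 0}"
      using c[OF subsetD[OF generators]] x V primitives_subset[OF x] by auto
  qed
  ultimately show "braided_bialgebra Q" "braided_bialgebra_map B Q q"
    by (intro quotient.image_bialgebra; blast)+
qed

text \<open>Elements of the quotient are representatives taken from \<open>B\<close>, so the map
  induced by \<open>\<phi>\<close> is \<open>\<phi>\<close> itself, restricted to the chosen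
  representatives.\<close>

lemma \<phi>_q: "x \<in> carrier B \<Longrightarrow> \<phi> (q x) = \<phi> x"
proof -
  assume x: "x \<in> carrier B"
  have "q x \<ominus>\<^bsub>B\<^esub> x \<in> J" "q x \<in> carrier B" using quot_proj_mem[OF _ J_ideal x] D(2) by auto
  then have "\<phi> (q x) \<ominus>\<^bsub>A\<^esub> \<phi> x = \<zero>\<^bsub>A\<^esub>"
    using \<phi>_J linear_map_minus[OF \<phi>_linear V _ _ x, of "q x"] A by simp
  then show ?thesis using vec_space_minus_eq_zero[of A "\<phi> (q x)" "\<phi> x"] A x \<open>q x \<in> carrier B\<close> by simp
qed

text \<open>Every clause of the invariant is an equation that can be checked on images under the
  surjection \<open>q\<close>. For \<open>braiding_act\<close>, both the braiding and the two
  operators built from \<open>e\<close> are natural with respect to \<open>q\<close>.\<close>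

lemma next_stage: "lie_stage Q A (\<lambda>a. q (i a)) \<phi>"
proof (intro lie_stage.intro bialg.intro lie_stage_axioms.intro)
  note qm = quotient_bialgebra(2)[unfolded braided_bialgebra_map_def]
  note ql = algebra_mapD(1)[OF quotient_algebra(2)] and VQ = quotient_alg.W
  have VA: "vec_space A" using A by simp
  note D' = braided_bialgebraD[OF quotient_bialgebra(1)]
  show "braided_bialgebra Q" by (rule quotient_bialgebra)
  show "assoc_algebra A" by (rule A)
  show "braiding A t \<in> carrier (tens_power A 2)" if "t \<in> carrier (tens_power A 2)" for t
    using that by (rule braiding_A)
  show iq: "braided_map A Q (\<lambda>a. q (i a))"
    unfolding braided_map_def
  proof (intro conjI ballI linear_map_comp[OF i_linear ql])
    fix t assume t: "t \<in> carrier (tens_power A 2)"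
    then have it: "power_map B 2 i t \<in> carrier (tens_power B 2)"
      by (rule linear_mapD(1)[OF power_map_linear[OF VA V i_linear]])
    have bA: "braiding B (power_map B 2 i t) = power_map B 2 i (braiding A t)" using i t by (simp add: braided_map_def)
    show "braiding Q (power_map Q 2 (\<lambda>a. q (i a)) t) = power_map Q 2 (\<lambda>a. q (i a)) (braiding A t)"
      using t it bA qm braiding_A[OF t]
      by (simp add: power_map_comp[OF VA V VQ i_linear ql, symmetric] quotient.image_braiding)
  qed
  show "q (i a) \<in> primitives Q" if "a \<in> carrier A" for a
  proof -
    have z: "i a \<in> carrier B" "comult B (i a) = tens B [i a, \<one>\<^bsub>B\<^esub>] \<boxplus> tens B [\<one>\<^bsub>B\<^esub>, i a]"
      using i_primitive[OF that] by (auto simp: primitives_def)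
    have "comult Q (q (i a)) = power_map Q 2 q (comult B (i a))" using qm z(1) by blast
    also have "\<dots> = tens Q [q (i a), \<one>\<^bsub>Q\<^esub>] \<oplus>\<^bsub>tensor_alg Q\<^esub> tens Q [\<one>\<^bsub>Q\<^esub>, q (i a)]"
      unfolding z(2) using z(1) linear_mapD(2)[OF quotient_alg.pp[of 2], of "tens B [i a, \<one>\<^bsub>B\<^esub>]" "tens B [\<one>\<^bsub>B\<^esub>, i a]"]
        algebra_mapD(3)[OF quotient_algebra(2)]
      by (simp add: power_map_tens[OF V VQ ql])
    finally show ?thesis using linear_mapD(1)[OF ql z(1)] by (simp add: primitives_def)
  qed
  show \<phi>': "algebra_map Q A \<phi>"
  proof (intro algebra_mapI linear_mapI)
    note h = quotient_algebra(2) and l = linear_mapD[OF \<phi>_linear]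
    show "\<phi> \<one>\<^bsub>Q\<^esub> = \<one>\<^bsub>A\<^esub>"
      using algebra_mapD(3)[OF h] algebra_mapD(3)[OF \<phi>] \<phi>_q[of "\<one>\<^bsub>B\<^esub>"] by simp
    fix x assume "x \<in> carrier Q"
    then obtain u where u: "u \<in> carrier B" "x = q u" by (auto simp: image_bialg_simps)
    show "\<phi> x \<in> carrier A" using u by (simp add: \<phi>_q)
    show "\<phi> (a \<odot>\<^bsub>Q\<^esub> x) = a \<odot>\<^bsub>A\<^esub> \<phi> x" for a
      using u l V linear_mapD(3)[OF ql u(1), of a, symmetric] by (simp add: \<phi>_q)
    fix y assume "y \<in> carrier Q"
    then obtain v where v: "v \<in> carrier B" "y = q v" by (auto simp: image_bialg_simps)
    show "\<phi> (x \<oplus>\<^bsub>Q\<^esub> y) = \<phi> x \<oplus>\<^bsub>A\<^esub> \<phi> y"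
      using u v l V linear_mapD(2)[OF ql u(1) v(1), symmetric] by (simp add: \<phi>_q)
    show "\<phi> (x \<otimes>\<^bsub>Q\<^esub> y) = \<phi> x \<otimes>\<^bsub>A\<^esub> \<phi> y"
      using u v D(2) algebra_mapD(2)[OF h u(1) v(1), symmetric] algebra_mapD(2)[OF \<phi> u(1) v(1)] by (simp add: \<phi>_q)
  qed
  show "\<phi> (q (i a)) = a" if "a \<in> carrier A" for a
    using that linear_mapD(1)[OF i_linear that] by (simp add: \<phi>_q \<phi>_i)
  have e': "linear_map Q Q (\<lambda>x. q (i (\<phi> x)))"
    by (rule linear_map_comp[OF algebra_mapD(1)[OF \<phi>'] linear_map_comp[OF i_linear ql]])
  have nbr: "natural B Q q 2 2 (braiding B) (braiding Q)"
    by (rule naturalI_surj[OF V VQ ql quotient_alg.image_surj D(5)]) (rule quotient.image_braiding)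
  have "q (i (\<phi> (q x))) = q (e x)" if "x \<in> carrier B" for x using that by (simp add: \<phi>_q)
  note nact = natural_act[OF V VQ ql e_linear e' this]
  note eqI = natural_eq[OF V VQ ql quotient_alg.image_surj]
  show "braiding Q (act1 Q (\<lambda>x. q (i (\<phi> x))) t) = act2 Q (\<lambda>x. q (i (\<phi> x))) (braiding Q t)"
    "braiding Q (act2 Q (\<lambda>x. q (i (\<phi> x))) t) = act1 Q (\<lambda>x. q (i (\<phi> x))) (braiding Q t)"
    if "t \<in> carrier (tens_power Q 2)" for t
    using eqI[OF natural_comp[OF nact(1) nbr] natural_comp[OF nbr nact(2)] _ that]
      eqI[OF natural_comp[OF nact(2) nbr] natural_comp[OF nbr nact(1)] _ that] braiding_act
    by simp_all
qed

text \<open>For \<open>y\<close> in the image of \<open>i\<close> one has \<open>e y = y\<close>,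
  hence \<open>c(x \<otimes> y)\<close> equals \<open>(e \<otimes> id)c(x \<otimes> y)\<close>. With
  \<open>braiding_primitives\<close> this places it in \<open>i(A) \<otimes> P(B)\<close> and not
  merely in \<open>B \<otimes> P(B)\<close>. The commutation conditions are then the invariant
  restricted to these subspaces.\<close>

lemma admissible: "admissible A B i \<phi>"
proof -
  let ?P = "primitives B" and ?V = "i ` carrier A"
  note P = primitives_carrier and I = i_carrier and CB = subset_refl[of "carrier B"]
  have lin: "linear_map (B\<lparr>carrier := ?P\<rparr>) A \<phi>"
    using linear_mapD[OF \<phi>_linear] by (intro linear_mapI) (simp_all add: primitives_subset)
  have eV: "e y = y" if "y \<in> ?V" for y using that by auto
  have g1: "(t, u) \<in> sub_tens_graph B ?P e ?V id \<longleftrightarrow> t \<in> tspan B ?P ?V \<and> u = act1 B e t" for t u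
    using P I by (intro sub_tens_graph_iff[OF V P I ac(1)]) (auto simp: ac(3) subset_iff)
  have g2: "(t, u) \<in> sub_tens_graph B ?V id ?P e \<longleftrightarrow> t \<in> tspan B ?V ?P \<and> u = act2 B e t" for t u
    using P I by (intro sub_tens_graph_iff[OF V I P ac(2)]) (auto simp: ac(4) subset_iff)
  note bl = linear_map_to_tensor_alg[OF D(5)]
  have s1: "act1 B e t \<in> tspan B ?V ?P" if "t \<in> tspan B (carrier B) ?P" for t
    by (rule tspan_map[OF CB P I P linear_map_to_tensor_alg[OF ac(1)] that])
      (use P in \<open>auto simp: ac(3) subset_iff intro!: tspan_tens[OF V I P]\<close>)
  have s2: "act2 B e t \<in> tspan B ?P ?V" if "t \<in> tspan B ?P (carrier B)" for t
    by (rule tspan_map[OF P CB P I linear_map_to_tensor_alg[OF ac(2)] that])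
      (use P in \<open>auto simp: ac(4) subset_iff intro!: tspan_tens[OF V P I]\<close>)
  have c1: "braiding B t \<in> tspan B ?V ?P" if "t \<in> tspan B ?P ?V" for t
  proof (rule tspan_map[OF P I I P bl that])
    fix x y assume x: "x \<in> ?P" and y: "y \<in> ?V"
    have xy: "x \<in> carrier B" "y \<in> carrier B" using x y P I by auto
    have "braiding B (tens B [x, y]) = act1 B e (braiding B (tens B [x, y]))"
      using braiding_act(2)[of "tens B [x, y]"] xy by (simp add: ac(4) eV[OF y])
    then show "braiding B (tens B [x, y]) \<in> tspan B ?V ?P"
      using s1[OF braiding_primitives(1)[OF x xy(2)]] by simp
  qed
  have c2: "braiding B t \<in> tspan B ?P ?V" if "t \<in> tspan B ?V ?P" for t
  proof (rule tspan_map[OF I P P I bl that])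
    fix y x assume x: "x \<in> ?P" and y: "y \<in> ?V"
    have xy: "x \<in> carrier B" "y \<in> carrier B" using x y P I by auto
    have "braiding B (tens B [y, x]) = act2 B e (braiding B (tens B [y, x]))"
      using braiding_act(1)[of "tens B [y, x]"] xy by (simp add: ac(3) eV[OF y])
    then show "braiding B (tens B [y, x]) \<in> tspan B ?P ?V"
      using s2[OF braiding_primitives(2)[OF x xy(2)]] by simp
  qed
  show ?thesis
    unfolding admissible_def
    using lin c1 c2 braiding_act tspan_closed[OF V P I] tspan_closed[OF V I P]
    by (auto simp: g1 g2)
qed

end

section \<open>Direct limits\<close>

lemma braided_bialgebra_mapD:
  assumes "braided_bialgebra_map B B' f"
  shows "algebra_map B B' f" "linear_map B B' f" "braided_map B B' f"
    "t \<in> carrier (tens_power B 2) \<Longrightarrow> braiding B' (power_map B' 2 f t) = power_map B' 2 f (braiding B t)"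
    "x \<in> carrier B \<Longrightarrow> comult B' (f x) = power_map B' 2 f (comult B x)" "x \<in> carrier B \<Longrightarrow> counit B' (f x) = counit B x"
  using assms by (auto simp: braided_bialgebra_map_def braided_map_def algebra_map_def)

lemma braided_bialgebra_map_id:
  assumes B: "braided_bialgebra B"
  shows "braided_bialgebra_map B B (\<lambda>x. x)"
proof -
  note D = braided_bialgebraD[OF B] and V = braided_bialgebraD(3)[OF B]
  have l: "linear_map B B (\<lambda>x. x)" by (intro linear_mapI) auto
  have p: "power_map B 2 (\<lambda>x. x) t = t" if "t \<in> carrier (tens_power B 2)" for t
    using linear_map_tens_eq[OF V _ power_map_linear[OF V V l, of 2] linear_map_id_power[OF V] _ that] V
    by (auto simp: power_map_tens[OF V V l])
  show ?thesis
    using l p linear_mapD(1)[OF D(5)] linear_mapD(1)[OF D(6)]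
    by (simp add: braided_bialgebra_map_def braided_map_def algebra_map_def ring_hom_def)
qed

lemma braided_bialgebra_map_comp:
  assumes B: "braided_bialgebra B" and C: "braided_bialgebra C" and Z: "braided_bialgebra Z"
    and f: "braided_bialgebra_map B C f" and g: "braided_bialgebra_map C Z g"
  shows "braided_bialgebra_map B Z (\<lambda>x. g (f x))"
proof -
  note V = braided_bialgebraD(3)[OF B] braided_bialgebraD(3)[OF C] braided_bialgebraD(3)[OF Z]
  note F = braided_bialgebra_mapD[OF f] and G = braided_bialgebra_mapD[OF g]
  note pc = power_map_comp[OF V F(2) G(2), symmetric]
  note c = linear_mapD(1)[OF F(2)] linear_mapD(1)[OF power_map_linear[OF V(1,2) F(2)]]
    linear_mapD(1)[OF braided_bialgebraD(5)[OF B]] linear_mapD(1)[OF braided_bialgebraD(6)[OF B]]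
  show ?thesis
    using algebra_map_comp[OF F(1) G(1)] linear_map_comp[OF F(2) G(2)] c
    by (simp add: braided_bialgebra_map_def braided_map_def pc F(4-6) G(4-6))
qed

lemma linear_map_factor:
  assumes f: "linear_map B C f" and h: "linear_map B Z (\<lambda>x. g (f x))" and surj: "carrier C = f ` carrier B" and B: "vec_space B"
  shows "linear_map C Z g"
proof (rule linear_mapI)
  fix x assume "x \<in> carrier C"
  then obtain u where u: "u \<in> carrier B" "x = f u" using surj by auto
  show "g x \<in> carrier Z" using u linear_mapD(1)[OF h] by simp
  show "g (a \<odot>\<^bsub>C\<^esub> x) = a \<odot>\<^bsub>Z\<^esub> g x" for a
    using u linear_mapD(3)[OF h u(1), of a] linear_mapD(3)[OF f u(1), of a] by simp
  fix y assume "y \<in> carrier C"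
  then obtain v where v: "v \<in> carrier B" "y = f v" using surj by auto
  show "g (x \<oplus>\<^bsub>C\<^esub> y) = g x \<oplus>\<^bsub>Z\<^esub> g y"
    using u v linear_mapD(2)[OF h u(1) v(1)] linear_mapD(2)[OF f u(1) v(1)] by simp
qed

text \<open>Since \<open>f\<close> is surjective, each compatibility of \<open>g\<close> may be
  checked on values of \<open>f\<close>, where it is that of the composite. This yields the
  canonical maps of later stages into the limit from the one at stage 0.\<close>

lemma braided_bialgebra_map_factor:
  assumes B: "braided_bialgebra B" and C: "braided_bialgebra C" and Z: "braided_bialgebra Z"
    and f: "braided_bialgebra_map B C f" and h: "braided_bialgebra_map B Z (\<lambda>x. g (f x))" and surj: "carrier C = f ` carrier B"
  shows "braided_bialgebra_map C Z g"
proof -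
  note V = braided_bialgebraD(3)[OF B] braided_bialgebraD(3)[OF C] braided_bialgebraD(3)[OF Z]
  note F = braided_bialgebra_mapD[OF f] and H = braided_bialgebra_mapD[OF h]
  have g: "linear_map C Z g" by (rule linear_map_factor[OF F(2) H(2) surj V(1)])
  note pc = power_map_comp[OF V F(2) g]
  have "algebra_map C Z g"
  proof (rule algebra_mapI[OF g])
    fix x y assume "x \<in> carrier C" "y \<in> carrier C"
    then obtain u v where u: "u \<in> carrier B" "x = f u" and v: "v \<in> carrier B" "y = f v" using surj by auto
    show "g (x \<otimes>\<^bsub>C\<^esub> y) = g x \<otimes>\<^bsub>Z\<^esub> g y"
      using u v algebra_mapD(2)[OF H(1) u(1) v(1)] algebra_mapD(2)[OF F(1) u(1) v(1)] by simp
  qed (use algebra_mapD(3)[OF F(1)] algebra_mapD(3)[OF H(1)] in simp)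
  moreover have "braiding Z (power_map Z 2 g t) = power_map Z 2 g (braiding C t)" if t: "t \<in> carrier (tens_power C 2)" for t
  proof -
    obtain r where r: "r \<in> carrier (tens_power B 2)" "t = power_map C 2 f r"
      using power_map_surj[OF V(1,2) F(2) surj t] by blast
    then show ?thesis
      using linear_mapD(1)[OF braided_bialgebraD(5)[OF B] r(1)] by (simp add: pc H(4) F(4))
  qed
  moreover have "comult Z (g x) = power_map Z 2 g (comult C x) \<and> counit Z (g x) = counit C x" if "x \<in> carrier C" for x
  proof -
    obtain u where u: "u \<in> carrier B" "x = f u" using surj \<open>x \<in> carrier C\<close> by auto
    then show ?thesis
      using linear_mapD(1)[OF braided_bialgebraD(6)[OF B] u(1)] H(5,6)[OF u(1)] F(5,6)[OF u(1)] by (simp add: pc)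
  qed
  ultimately show ?thesis using g by (simp add: braided_bialgebra_map_def braided_map_def)
qed

text \<open>With surjective transition maps every element of the limit comes from stage 0. The limit
  is therefore the image of \<open>U 0\<close> with kernel \<open>lim_ideal\<close>, the elements
  that vanish at some stage, and \<open>bialg_image\<close> applies.\<close>

locale bialg_sequence =
  fixes U :: "nat \<Rightarrow> ('k::field, 'u) braided_bialg" and p :: "nat \<Rightarrow> 'u \<Rightarrow> 'u"
  assumes U: "\<And>n. braided_bialgebra (U n)"
    and p: "\<And>n. braided_bialgebra_map (U n) (U (Suc n)) (p n)"
    and p_surj: "\<And>n. carrier (U (Suc n)) = p n ` carrier (U n)"
begin

abbreviation "tr \<equiv> transition p"
abbreviation "lm \<equiv> limit_map U p"

lemma tr_map: "braided_bialgebra_map (U m) (U (m + d)) (tr m d)" "carrier (U (m + d)) = tr m d ` carrier (U m)"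
proof (induction d)
  case 0
  { case 1 show ?case using braided_bialgebra_map_id[OF U] by simp
  next case 2 show ?case by simp }
next
  case (Suc d)
  { case 1 show ?case using braided_bialgebra_map_comp[OF U U U Suc(1) p] by simp
  next case 2 show ?case using Suc(2) p_surj by (auto simp: image_image) }
qed

lemma tr_closed: "x \<in> carrier (U m) \<Longrightarrow> tr m d x \<in> carrier (U (m + d))"
  using tr_map(2) by auto

lemma tr_add: "tr m (d + d') x = tr (m + d) d' (tr m d x)"
  by (induction d') (simp_all add: add.assoc)

text \<open>The two shifts \<open>d\<close> and \<open>e\<close> are replaced by one common stage
  \<open>N\<close>, which can be raised by \<open>tr_mono\<close>; transitivity of the relation is
  proved by raising two such stages to their maximum.\<close>

lemma limit_rel_iff:
  "((m, x), (n, y)) \<in> limit_rel U p \<longleftrightarrow> x \<in> carrier (U m) \<and> y \<in> carrier (U n) \<and>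
     (\<exists>N\<ge>max m n. tr m (N - m) x = tr n (N - n) y)"
proof
  assume "((m, x), (n, y)) \<in> limit_rel U p"
  then obtain d e where "x \<in> carrier (U m)" "y \<in> carrier (U n)" "m + d = n + e" "tr m d x = tr n e y"
    by (auto simp: limit_rel_def)
  then show "x \<in> carrier (U m) \<and> y \<in> carrier (U n) \<and> (\<exists>N\<ge>max m n. tr m (N - m) x = tr n (N - n) y)"
    by (metis add_diff_cancel_left' le_add1 max.bounded_iff)
next
  assume "x \<in> carrier (U m) \<and> y \<in> carrier (U n) \<and> (\<exists>N\<ge>max m n. tr m (N - m) x = tr n (N - n) y)"
  then obtain N where N: "x \<in> carrier (U m)" "y \<in> carrier (U n)" "N \<ge> m" "N \<ge> n" "tr m (N - m) x = tr n (N - n) y"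
    by auto
  then have "m + (N - m) = n + (N - n)" by simp
  then show "((m, x), (n, y)) \<in> limit_rel U p" using N unfolding limit_rel_def by blast
qed

lemma tr_mono:
  assumes "m \<le> N" "n \<le> N" "N \<le> N'" "tr m (N - m) x = tr n (N - n) y"
  shows "tr m (N' - m) x = tr n (N' - n) y"
proof -
  have eqs: "N' - m = (N - m) + (N' - N)" "N' - n = (N - n) + (N' - N)" "m + (N - m) = N" "n + (N - n) = N"
    using assms by auto
  show ?thesis unfolding eqs(1,2) tr_add eqs(3,4) assms(4) by (rule refl)
qed

lemma equiv_limit_rel: "equiv (SIGMA n:UNIV. carrier (U n)) (limit_rel U p)"
proof (rule equivI)
  show "limit_rel U p \<subseteq> (SIGMA n:UNIV. carrier (U n)) \<times> (SIGMA n:UNIV. carrier (U n))"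
    by (auto simp: limit_rel_def)
  show "refl_on (SIGMA n:UNIV. carrier (U n)) (limit_rel U p)"
    by (rule refl_onI) (auto simp: limit_rel_iff)
  show "sym (limit_rel U p)"
    by (rule symI) (auto simp: limit_rel_iff, metis)
  show "trans (limit_rel U p)"
  proof (rule transI)
    fix a b c assume ab: "(a, b) \<in> limit_rel U p" and bc: "(b, c) \<in> limit_rel U p"
    obtain m x n y k z where e: "a = (m, x)" "b = (n, y)" "c = (k, z)" by (metis surj_pair)
    obtain N where N: "m \<le> N" "n \<le> N" "tr m (N - m) x = tr n (N - n) y" "x \<in> carrier (U m)"
      using ab unfolding e limit_rel_iff by auto
    obtain N' where N': "n \<le> N'" "k \<le> N'" "tr n (N' - n) y = tr k (N' - k) z" "z \<in> carrier (U k)"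
      using bc unfolding e limit_rel_iff by auto
    have "tr m (max N N' - m) x = tr k (max N N' - k) z"
      using tr_mono[OF N(1,2) _ N(3), of "max N N'"] tr_mono[OF N'(1,2) _ N'(3), of "max N N'"] by simp
    then show "(a, c) \<in> limit_rel U p" unfolding e limit_rel_iff using N N' by (auto intro!: exI[of _ "max N N'"])
  qed
qed

lemma lm_eq_iff:
  assumes "x \<in> carrier (U m)" "y \<in> carrier (U n)"
  shows "lm m x = lm n y \<longleftrightarrow> (\<exists>N\<ge>max m n. tr m (N - m) x = tr n (N - n) y)"
proof -
  have "lm m x = lm n y \<longleftrightarrow> ((m, x), (n, y)) \<in> limit_rel U p"
    unfolding limit_map_def using assms by (intro eq_equiv_class_iff[OF equiv_limit_rel]) auto
  then show ?thesis using assms by (simp add: limit_rel_iff)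
qed

lemma lm_tr: "x \<in> carrier (U 0) \<Longrightarrow> lm d (tr 0 d x) = lm 0 x"
  using tr_closed[of x 0 d] by (subst lm_eq_iff) (auto intro!: exI[of _ d])

lemma tr0_map: "braided_bialgebra_map (U 0) (U d) (tr 0 d)" "carrier (U d) = tr 0 d ` carrier (U 0)"
  using tr_map[of 0 d] by simp_all

lemma lm0_eq_iff:
  assumes "x \<in> carrier (U 0)" "y \<in> carrier (U 0)"
  shows "lm 0 x = lm 0 y \<longleftrightarrow> (\<exists>d. tr 0 d x = tr 0 d y)"
  using assms by (simp add: lm_eq_iff)

lemma lm0_surj: "lm 0 ` carrier (U 0) = (SIGMA n:UNIV. carrier (U n)) // limit_rel U p"
proof (intro equalityI subsetI)
  fix z assume "z \<in> lm 0 ` carrier (U 0)"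
  then show "z \<in> (SIGMA n:UNIV. carrier (U n)) // limit_rel U p"
    by (auto simp: limit_map_def intro!: quotientI)
next
  fix z assume "z \<in> (SIGMA n:UNIV. carrier (U n)) // limit_rel U p"
  then obtain n y where "y \<in> carrier (U n)" "z = lm n y" by (auto simp: quotient_def limit_map_def)
  moreover then obtain x where "x \<in> carrier (U 0)" "y = tr 0 n x" using tr0_map(2) by blast
  ultimately show "z \<in> lm 0 ` carrier (U 0)" using lm_tr by auto
qed

definition "rep z = (SOME x. x \<in> carrier (U 0) \<and> lm 0 x = z)"
definition "lim_ideal = {x \<in> carrier (U 0). \<exists>d. tr 0 d x = \<zero>\<^bsub>U d\<^esub>}"

sublocale U0: bialg "U 0" by (rule bialg.intro[OF U])

lemma rep: "x \<in> carrier (U 0) \<Longrightarrow> rep (lm 0 x) \<in> carrier (U 0) \<and> lm 0 (rep (lm 0 x)) = lm 0 x"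
  unfolding rep_def by (rule someI[of _ x]) simp

lemma VU: "vec_space (U n)" by (rule braided_bialgebraD(3)[OF U])

lemmas tr0_linear = braided_bialgebra_mapD(2)[OF tr0_map(1)]

lemma tr0_zero: "tr 0 d \<zero>\<^bsub>U 0\<^esub> = \<zero>\<^bsub>U d\<^esub>"
  by (rule linear_map_zero[OF tr0_linear VU VU])

sublocale limit: alg_image "U 0" "lm 0" rep lim_ideal
proof (intro alg_image.intro U0.bialg_axioms alg_image_axioms.intro)
  show "rep (lm 0 x) \<in> carrier (U 0)" "lm 0 (rep (lm 0 x)) = lm 0 x" if "x \<in> carrier (U 0)" for x
    using rep[OF that] by auto
  show "lm 0 x = lm 0 y \<longleftrightarrow> x \<ominus>\<^bsub>U 0\<^esub> y \<in> lim_ideal" if "x \<in> carrier (U 0)" "y \<in> carrier (U 0)" for x y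
    using that linear_map_minus[OF tr0_linear VU VU that] VU linear_mapD(1)[OF tr0_linear]
    by (simp add: lm0_eq_iff lim_ideal_def vec_space_minus_eq_zero)
  show "ideal lim_ideal (U 0)"
  proof (rule ideal_subspaceI[OF U0.D(2)])
    note l = linear_mapD[OF tr0_linear]
    have z: "tr 0 d' x = \<zero>\<^bsub>U d'\<^esub>" if "tr 0 d x = \<zero>\<^bsub>U d\<^esub>" "d \<le> d'" for d d' x
      using tr_mono[of 0 d 0 d' x "\<zero>\<^bsub>U 0\<^esub>"] that tr0_zero by simp
    show "x \<oplus>\<^bsub>U 0\<^esub> y \<in> lim_ideal" if xy: "x \<in> lim_ideal" "y \<in> lim_ideal" for x y
    proof -
      obtain d d' where d: "tr 0 d x = \<zero>\<^bsub>U d\<^esub>" "tr 0 d' y = \<zero>\<^bsub>U d'\<^esub>" "x \<in> carrier (U 0)" "y \<in> carrier (U 0)"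
        using xy by (auto simp: lim_ideal_def)
      then have "tr 0 (max d d') (x \<oplus>\<^bsub>U 0\<^esub> y) = \<zero>\<^bsub>U (max d d')\<^esub>"
        using l(2)[OF d(3,4)] z[OF d(1), of "max d d'"] z[OF d(2), of "max d d'"] VU by simp
      then show ?thesis using d VU unfolding lim_ideal_def by auto
    qed
    show "a \<odot>\<^bsub>U 0\<^esub> x \<in> lim_ideal" if x: "x \<in> lim_ideal" for a x
    proof -
      obtain d where d: "tr 0 d x = \<zero>\<^bsub>U d\<^esub>" "x \<in> carrier (U 0)" using x unfolding lim_ideal_def by blast
      then have "tr 0 d (a \<odot>\<^bsub>U 0\<^esub> x) = \<zero>\<^bsub>U d\<^esub>" using l(3)[OF d(2), of d a] VU by simp
      then show ?thesis using d VU unfolding lim_ideal_def by auto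
    qed
    show "x \<otimes>\<^bsub>U 0\<^esub> y \<in> lim_ideal" "y \<otimes>\<^bsub>U 0\<^esub> x \<in> lim_ideal" if x: "x \<in> lim_ideal" and y: "y \<in> carrier (U 0)" for x y
    proof -
      obtain d where d: "tr 0 d x = \<zero>\<^bsub>U d\<^esub>" "x \<in> carrier (U 0)" using x unfolding lim_ideal_def by blast
      note a = algebra_mapD(2)[OF braided_bialgebra_mapD(1)[OF tr0_map(1)]]
      note Ad = braided_bialgebraD(2)[OF U]
      have "tr 0 d (x \<otimes>\<^bsub>U 0\<^esub> y) = \<zero>\<^bsub>U d\<^esub>" "tr 0 d (y \<otimes>\<^bsub>U 0\<^esub> x) = \<zero>\<^bsub>U d\<^esub>"
        using a[OF d(2) y, of d] a[OF y d(2), of d] d l(1)[OF y, of d] Ad[of d] by simp_all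
      then show "x \<otimes>\<^bsub>U 0\<^esub> y \<in> lim_ideal" "y \<otimes>\<^bsub>U 0\<^esub> x \<in> lim_ideal"
        using d y Ad[of 0] unfolding lim_ideal_def by auto
    qed
    show "\<zero>\<^bsub>U 0\<^esub> \<in> lim_ideal" using tr0_zero VU unfolding lim_ideal_def by auto
  qed (auto simp: lim_ideal_def)
qed

abbreviation "L \<equiv> image_bialg (U 0) (lm 0) rep"

lemma lm_linear: "linear_map (U d) L (lm d)"
proof (rule linear_map_factor[OF tr0_linear[of d] _ tr0_map(2) VU])
  show "linear_map (U 0) L (\<lambda>x. lm d (tr 0 d x))"
    using limit.pl VU by (simp add: linear_map_def lm_tr Pi_iff)
qed

text \<open>The canonical map from \<open>U 0\<close> factors through every stage \<open>d\<close>.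
  An element of \<open>lim_ideal\<close> is already zero at some stage, so anything computed from it
  by the structure maps vanishes there and hence in the limit.\<close>

lemma lm_power:
  assumes "t \<in> carrier (tens_power (U 0) 2)"
  shows "power_map L 2 (lm 0) t = power_map L 2 (lm d) (power_map (U d) 2 (tr 0 d) t)"
proof -
  have "power_map L 2 (lm d) (power_map (U d) 2 (tr 0 d) t) = power_map L 2 (\<lambda>x. lm d (tr 0 d x)) t"
    by (rule power_map_comp[OF VU VU limit.W tr0_linear lm_linear assms])
  also have "\<dots> = power_map L 2 (lm 0) t"
    by (rule power_map_cong[OF VU limit.W linear_map_comp[OF tr0_linear lm_linear] limit.pl lm_tr assms])
  finally show ?thesis by simp
qed

sublocale limit_bialg: bialg_image "U 0" "lm 0" rep lim_ideal
proof (intro bialg_image.intro limit.alg_image_axioms bialg_image_axioms.intro)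
  fix x y assume x: "x \<in> lim_ideal" and y: "y \<in> carrier (U 0)"
  obtain d where d: "tr 0 d x = \<zero>\<^bsub>U d\<^esub>" "x \<in> carrier (U 0)" using x unfolding lim_ideal_def by blast
  note Dd = braided_bialgebraD[OF U, of d]
  have ty: "tr 0 d y \<in> carrier (U d)" using linear_mapD(1)[OF tr0_linear y] .
  have t: "tens (U 0) [x, y] \<in> carrier (tens_power (U 0) 2)" "tens (U 0) [y, x] \<in> carrier (tens_power (U 0) 2)"
    using d y by simp_all
  have z: "tens (U d) [\<zero>\<^bsub>U d\<^esub>, tr 0 d y] = \<zero>\<^bsub>tensor_alg (U d)\<^esub>" "tens (U d) [tr 0 d y, \<zero>\<^bsub>U d\<^esub>] = \<zero>\<^bsub>tensor_alg (U d)\<^esub>"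
    using linear_map_zero[OF tens2_linear(1)[OF VU ty] VU] linear_map_zero[OF tens2_linear(2)[OF VU ty] VU] tensor_alg[OF VU[of d]] by simp_all
  have pz: "power_map L 2 (lm d) (braiding (U d) \<zero>\<^bsub>tensor_alg (U d)\<^esub>) = \<zero>\<^bsub>tensor_alg L\<^esub>"
    using linear_map_zero[OF linear_map_comp[OF Dd(5) power_map_linear[OF VU limit.W lm_linear]]] VU limit.W by simp
  show "power_map L 2 (lm 0) (braiding (U 0) (tens (U 0) [x, y])) = \<zero>\<^bsub>tensor_alg L\<^esub>"
    "power_map L 2 (lm 0) (braiding (U 0) (tens (U 0) [y, x])) = \<zero>\<^bsub>tensor_alg L\<^esub>"
    using linear_mapD(1)[OF U0.D(5) t(1)] linear_mapD(1)[OF U0.D(5) t(2)]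
      braided_bialgebra_mapD(4)[OF tr0_map(1)[of d] t(1)] braided_bialgebra_mapD(4)[OF tr0_map(1)[of d] t(2)] d y
    by (simp_all add: lm_power[of _ d] power_map_tens[OF VU VU tr0_linear] z pz flip: braided_bialgebra_mapD(4)[OF tr0_map(1)[of d] t(1)] braided_bialgebra_mapD(4)[OF tr0_map(1)[of d] t(2)])
qed

lemma limit_bialgebra: "braided_bialgebra L" "braided_bialgebra_map (U 0) L (lm 0)"
proof -
  have "power_map L 2 (lm 0) (comult (U 0) x) = \<zero>\<^bsub>tensor_alg L\<^esub> \<and> counit (U 0) x = 0" if x: "x \<in> lim_ideal" for x
  proof -
    obtain d where d: "tr 0 d x = \<zero>\<^bsub>U d\<^esub>" "x \<in> carrier (U 0)" using x unfolding lim_ideal_def by blast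
    note Dd = braided_bialgebraD[OF U, of d] and m = braided_bialgebra_mapD[OF tr0_map(1)[of d]]
    have "power_map L 2 (lm 0) (comult (U 0) x) = power_map L 2 (lm d) (comult (U d) (tr 0 d x))"
      using linear_mapD(1)[OF U0.D(6) d(2)] m(5)[OF d(2)] by (simp add: lm_power[of _ d])
    also have "\<dots> = \<zero>\<^bsub>tensor_alg L\<^esub>"
      using linear_map_zero[OF linear_map_comp[OF Dd(6) power_map_linear[OF VU limit.W lm_linear]]] VU limit.W d by simp
    finally have 1: "power_map L 2 (lm 0) (comult (U 0) x) = \<zero>\<^bsub>tensor_alg L\<^esub>" .
    have "counit (U d) (0 \<odot>\<^bsub>U d\<^esub> \<zero>\<^bsub>U d\<^esub>) = 0 * counit (U d) \<zero>\<^bsub>U d\<^esub>"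
      using Dd(7) VU unfolding counit_linear_def by (metis vec_space_closed(1))
    then have "counit (U 0) x = 0" using m(6)[OF d(2)] d VU[of d] by simp
    then show ?thesis using 1 by simp
  qed
  then show "braided_bialgebra L" "braided_bialgebra_map (U 0) L (lm 0)"
    by (intro limit_bialg.image_bialgebra; simp)+
qed

lemma direct_limit: "is_direct_limit U p L"
  unfolding is_direct_limit_def
proof (intro conjI allI)
  show "carrier L = (SIGMA n:UNIV. carrier (U n)) // limit_rel U p"
    using lm0_surj by (simp add: image_bialg_simps)
  show "braided_bialgebra L" by (rule limit_bialgebra)
  fix n
  have "braided_bialgebra_map (U 0) L (\<lambda>x. lm n (tr 0 n x))"
  proof -
    note m = braided_bialgebra_mapD[OF limit_bialgebra(2)]
    have l: "linear_map (U 0) L (\<lambda>x. lm n (tr 0 n x))" by (rule linear_map_comp[OF tr0_linear lm_linear])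
    have pw: "power_map L 2 (\<lambda>x. lm n (tr 0 n x)) t = power_map L 2 (lm 0) t" if "t \<in> carrier (tens_power (U 0) 2)" for t
      by (rule power_map_cong[OF VU limit.W l limit.pl lm_tr that])
    have "algebra_map (U 0) L (\<lambda>x. lm n (tr 0 n x))"
      using algebra_mapD(2,3)[OF m(1)] U0.D(2) by (intro algebra_mapI l) (simp_all add: lm_tr)
    then show ?thesis
      using l m linear_mapD(1)[OF U0.D(5)] linear_mapD(1)[OF U0.D(6)]
      by (simp add: braided_bialgebra_map_def braided_map_def pw lm_tr)
  qed
  then show "braided_bialgebra_map (U n) L (lm n)"
    by (rule braided_bialgebra_map_factor[OF U U limit_bialgebra(1) tr0_map(1) _ tr0_map(2)])
qed

end


section \<open>The canonical bracket\<close>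

text \<open>Only the bialgebra and the map from \<open>A\<close> change from stage to stage;
  \<open>\<phi>\<close> is a fixed parameter by \<open>\<phi>_q\<close>.\<close>

primrec lie_seq :: "('k::field, 'u) braided_bialg \<Rightarrow> ('a \<Rightarrow> 'u) \<Rightarrow> ('u \<Rightarrow> 'a) \<Rightarrow> nat \<Rightarrow> ('k, 'u) braided_bialg \<times> ('a \<Rightarrow> 'u)" where
  "lie_seq B i \<phi> 0 = (B, i)"
| "lie_seq B i \<phi> (Suc n) =
    (let C = fst (lie_seq B i \<phi> n); j = snd (lie_seq B i \<phi> n); q = quot_proj C (bracket_ideal C j \<phi>)
     in (image_bialg C q id, \<lambda>a. q (j a)))"

lemma canonical_bracket:
  fixes A :: "('k::field, 'a) braided_space" and T :: "('k, 'a list \<Rightarrow>\<^sub>0 'k) braided_bialg"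
  assumes stage: "lie_stage T A (\<lambda>a. tens A [a]) \<phi>" and T: "is_braided_tensor_algebra A T" and A: "braided_algebra A"
  shows "\<exists>U i b. is_canonical_bracket A U i b \<and> is_braided_Lie_algebra A U i b"
proof -
  define U where "U n = fst (lie_seq T (\<lambda>a. tens A [a]) \<phi> n)" for n
  define i where "i n = snd (lie_seq T (\<lambda>a. tens A [a]) \<phi> n)" for n
  have 0: "U 0 = T" "i 0 = (\<lambda>a. tens A [a])" by (simp_all add: U_def i_def)
  define b where "b = (\<lambda>n::nat. \<phi>)"
  define p where "p = bracket_proj U i b"
  have pn: "p n = quot_proj (U n) (bracket_ideal (U n) (i n) \<phi>)" for n by (simp add: p_def bracket_proj_def b_def)
  have step: "U (Suc n) = image_bialg (U n) (p n) id" "i (Suc n) = (\<lambda>a. p n (i n a))" for n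
    by (simp_all add: U_def i_def pn Let_def)
  have st: "lie_stage (U n) A (i n) \<phi>" for n
  proof (induction n)
    case (Suc n)
    then show ?case using lie_stage.next_stage[OF Suc] by (simp add: step pn lie_stage.J_def[OF Suc])
  qed (simp add: stage 0)
  note pj = pn[folded lie_stage.J_def[OF st]]
  have map: "braided_bialgebra_map (U n) (U (Suc n)) (p n)" for n
    using lie_stage.quotient_bialgebra(2)[OF st[of n]] by (simp add: step(1) pj)
  have bi: "braided_bialgebra (U n)" for n
    using st[of n] by (simp add: lie_stage_def bialg_def)
  interpret bialg_sequence U p
  proof
    show "carrier (U (Suc n)) = p n ` carrier (U n)" for n by (simp add: step(1) image_bialg_simps)
  qed (rule bi map)+
  have \<phi>p: "\<phi> (p n x) = \<phi> x" if "x \<in> carrier (U n)" for n x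
    using lie_stage.\<phi>_q[OF st[of n] that] by (simp add: pj)
  have br: "is_bracket A U i b"
    unfolding is_bracket_def
  proof (intro conjI allI ballI)
    show "braided_vec_space A" using A by (simp add: braided_algebra_def)
    show "is_braided_tensor_algebra A (U 0)" using T by (simp add: 0)
    show "i 0 v = tens A [v]" for v by (simp add: 0)
    fix n
    show "braided_bialgebra (U n)" by (rule bi)
    show "braided_map A (U n) (i n)" by (rule lie_stage.i[OF st])
    show "i n ` carrier A \<subseteq> primitives (U n)" using lie_stage.i_primitive[OF st] by auto
    show "admissible A (U n) (i n) (b n)" unfolding b_def by (rule lie_stage.admissible[OF st])
    show "module.truncate (U (Suc n)) = quot_alg (U n) (bracket_ideal (U n) (i n) (b n))"
      using lie_stage.truncate_quotient[OF st[of n]] by (simp add: step(1) pj b_def lie_stage.J_def[OF st])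
    show "braided_bialgebra_map (U n) (U (Suc n)) (bracket_proj U i b n)" using map by (simp add: p_def)
    show "i (Suc n) v = bracket_proj U i b n (i n v)" for v by (simp add: step(2) flip: p_def)
  qed
  have "is_canonical_bracket A U i b"
    unfolding is_canonical_bracket_def
    using br lie_stage.\<phi>[OF st[of 0]] lie_stage.\<phi>_i[OF st[of 0]] \<phi>p
    by (auto intro!: exI[of _ "\<lambda>_. \<phi>"] simp: 0 b_def p_def)
  moreover have "inj_on (\<lambda>v. limit_map U p 0 (i 0 v)) (carrier A)"
  proof (rule inj_onI)
    fix v w assume v: "v \<in> carrier A" and w: "w \<in> carrier A" and eq: "lm 0 (i 0 v) = lm 0 (i 0 w)"
    note ic = linear_mapD(1)[OF lie_stage.i_linear[OF st[of 0]]]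
    obtain d where d: "tr 0 d (i 0 v) = tr 0 d (i 0 w)" using eq ic v w by (auto simp: lm0_eq_iff)
    \<comment> \<open>\<open>\<phi>\<close> is invariant under the transition maps, so two elements
      identified at stage \<open>d\<close> have equal values already at stage 0, where
      \<open>\<phi>\<close> inverts the inclusion.\<close>
    have "\<phi> (tr 0 d x) = \<phi> x" if "x \<in> carrier (U 0)" for x d
      using that tr_closed[of x 0] by (induction d) (simp_all add: \<phi>p)
    then show "v = w" using d lie_stage.\<phi>_i[OF st[of 0]] ic v w by metis
  qed
  ultimately show ?thesis
    using br direct_limit unfolding is_braided_Lie_algebra_def p_def by blast
qed

section \<open>Braidings on words\<close>

lemma fbind_case [simp]: "case_prod F x \<bind> g = case_prod (\<lambda>a b. F a b \<bind> g) x"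
  by (cases x) simp

lemma fbind_ext2: "(\<And>a b. f a b = g a b) \<Longrightarrow> t \<bind> (\<lambda>(a, b). f a b) = t \<bind> (\<lambda>(a, b). g a b)"
  by simp

lemma fbind_commute2:
  "t \<bind> (\<lambda>(a, b). s \<bind> (\<lambda>(c, d). f a b c d)) = s \<bind> (\<lambda>(c, d). t \<bind> (\<lambda>(a, b). f a b c d))"
  by (simp add: split_def fbind_commute[of t])

lemma fbind_commute1: "t \<bind> (\<lambda>x. s \<bind> (\<lambda>(c, d). g x c d)) = s \<bind> (\<lambda>(c, d). t \<bind> (\<lambda>x. g x c d))"
  by (simp add: split_def fbind_commute[of t])

lemma fbind_add_right2:
  "t \<bind> (\<lambda>(a, b). f a b + g a b) = (t \<bind> (\<lambda>(a, b). f a b)) + (t \<bind> (\<lambda>(a, b). g a b))"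
  by (simp add: split_def fbind_add_right)

lemma fbind_zero_right2 [simp]: "t \<bind> (\<lambda>(a, b). 0) = 0"
  by (simp add: split_def)

text \<open>Letters are elements of a basis. A formal combination \<open>c v w\<close> of pairs is the value of a braiding at
  \<open>v \<otimes> w\<close>, and \<open>cl l v\<close>, \<open>cc x y\<close> are the values of the induced braidings at \<open>v \<otimes> l\<close> and \<open>x \<otimes> y\<close>, for a letter \<open>v\<close>
  and words \<open>l\<close>, \<open>x\<close>, \<open>y\<close>. Identities are stated with a continuation \<open>k\<close>, so that they apply inside nested \<open>\<bind>\<close>.\<close>

locale braided_letters =
  fixes c :: "'a \<Rightarrow> 'a \<Rightarrow> ('a \<times> 'a \<Rightarrow>\<^sub>0 'k::field)"
  assumes yang_baxter:
    "c x y \<bind> (\<lambda>(y1, x1). c x1 z \<bind> (\<lambda>(z1, x2). c y1 z1 \<bind> (\<lambda>(z2, y2). fret (z2, y2, x2)))) =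
     c y z \<bind> (\<lambda>(z1, y1). c x z1 \<bind> (\<lambda>(z2, x1). c x1 y1 \<bind> (\<lambda>(y2, x2). fret (z2, y2, x2))))"
begin

lemma yb:
  "c x y \<bind> (\<lambda>(y1, x1). c x1 z \<bind> (\<lambda>(z1, x2). c y1 z1 \<bind> (\<lambda>(z2, y2). k z2 y2 x2))) =
   c y z \<bind> (\<lambda>(z1, y1). c x z1 \<bind> (\<lambda>(z2, x1). c x1 y1 \<bind> (\<lambda>(y2, x2). k z2 y2 x2)))"
  using arg_cong[OF yang_baxter[of x y z], of "\<lambda>t. t \<bind> (\<lambda>(z2, y2, x2). k z2 y2 x2)"] by simp

primrec cl :: "'a list \<Rightarrow> 'a \<Rightarrow> ('a list \<times> 'a \<Rightarrow>\<^sub>0 'k)" where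
  "cl [] v = fret ([], v)"
| "cl (w # l) v = c v w \<bind> (\<lambda>(w1, v1). cl l v1 \<bind> (\<lambda>(l1, v2). fret (w1 # l1, v2)))"

primrec cc :: "'a list \<Rightarrow> 'a list \<Rightarrow> ('a list \<times> 'a list \<Rightarrow>\<^sub>0 'k)" where
  "cc [] y = fret (y, [])"
| "cc (v # x) y = cc x y \<bind> (\<lambda>(y1, x1). cl y1 v \<bind> (\<lambda>(y2, v1). fret (y2, v1 # x1)))"

text \<open>The first summand puts the new letter into the left factor, the second moves it, by the braiding,
  past the left factor into the right one.\<close>

primrec dl :: "'a list \<Rightarrow> ('a list \<times> 'a list \<Rightarrow>\<^sub>0 'k)" where
  "dl [] = fret ([], [])"
| "dl (v # x) = (dl x \<bind> (\<lambda>(a, b). fret (v # a, b))) + (dl x \<bind> (\<lambda>(a, b). cl a v \<bind> (\<lambda>(a1, v1). fret (a1, v1 # b))))"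

lemma cl_append: "cl (y @ z) v = cl y v \<bind> (\<lambda>(y1, v1). cl z v1 \<bind> (\<lambda>(z1, v2). fret (y1 @ z1, v2)))"
  by (induction y arbitrary: v) (simp_all add: split_def fbind_ret[simplified])

lemma cc_Nil [simp]: "cc x [] = fret ([], x)"
  by (induction x) auto

lemma cc_append_left: "cc (x @ x') y = cc x' y \<bind> (\<lambda>(y1, b1). cc x y1 \<bind> (\<lambda>(y2, b). fret (y2, b @ b1)))"
  by (induction x) (simp_all add: split_def)

text \<open>Together with \<open>cc_append_left\<close> this is the compatibility of the braiding
  with concatenation, the multiplication of the tensor algebra. The left version follows the
  recursion on the first word; here the crossing of a single letter has to be moved past a crossing
  of disjoint factors.\<close>

lemma cc_append_right: "cc x (y @ z) = cc x y \<bind> (\<lambda>(y1, x1). cc x1 z \<bind> (\<lambda>(z1, x2). fret (y1 @ z1, x2)))"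
proof (induction x)
  case (Cons v x)
  have "cc (v # x) (y @ z) = cc x y \<bind> (\<lambda>(y1, x1). cc x1 z \<bind> (\<lambda>(z1, x2).
      cl y1 v \<bind> (\<lambda>(y2, v1). cl z1 v1 \<bind> (\<lambda>(z2, v2). fret (y2 @ z2, v2 # x2)))))"
    by (simp add: Cons.IH cl_append)
  also have "\<dots> = cc x y \<bind> (\<lambda>(y1, x1). cl y1 v \<bind> (\<lambda>(y2, v1). cc x1 z \<bind> (\<lambda>(z1, x2).
      cl z1 v1 \<bind> (\<lambda>(z2, v2). fret (y2 @ z2, v2 # x2)))))"
    by (intro fbind_ext2 fbind_commute2)
  finally show ?case by simp
qed simp

text \<open>The Yang-Baxter equation for two letters and a word; each letter of \<open>z\<close>
  costs one use of \<open>yb\<close>. The next two lemmas replace the remaining letters by words,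
  the middle one first.\<close>

lemma yb_letters:
  "c v w \<bind> (\<lambda>(w1, v1). cl z v1 \<bind> (\<lambda>(z1, v2). cl z1 w1 \<bind> (\<lambda>(z2, w2). k z2 w2 v2))) =
   cl z w \<bind> (\<lambda>(z1, w1). cl z1 v \<bind> (\<lambda>(z2, v1). c v1 w1 \<bind> (\<lambda>(w2, v2). k z2 w2 v2)))"
proof (induction z arbitrary: v w k)
  case (Cons u z)
  have "c v w \<bind> (\<lambda>(w1, v1). cl (u # z) v1 \<bind> (\<lambda>(z1, v2). cl z1 w1 \<bind> (\<lambda>(z2, w2). k z2 w2 v2))) =
      c v w \<bind> (\<lambda>(w1, v1). c v1 u \<bind> (\<lambda>(u1, v2). cl z v2 \<bind> (\<lambda>(z1, v3).
        c w1 u1 \<bind> (\<lambda>(u2, w2). cl z1 w2 \<bind> (\<lambda>(z2, w3). k (u2 # z2) w3 v3)))))"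
    by simp
  also have "\<dots> = c v w \<bind> (\<lambda>(w1, v1). c v1 u \<bind> (\<lambda>(u1, v2). c w1 u1 \<bind> (\<lambda>(u2, w2).
      cl z v2 \<bind> (\<lambda>(z1, v3). cl z1 w2 \<bind> (\<lambda>(z2, w3). k (u2 # z2) w3 v3)))))"
    by (intro fbind_ext2 fbind_commute2)
  also have "\<dots> = c w u \<bind> (\<lambda>(u1, w1). c v u1 \<bind> (\<lambda>(u2, v1). c v1 w1 \<bind> (\<lambda>(w2, v2).
      cl z v2 \<bind> (\<lambda>(z1, v3). cl z1 w2 \<bind> (\<lambda>(z2, w3). k (u2 # z2) w3 v3)))))"
    by (rule yb)
  also have "\<dots> = c w u \<bind> (\<lambda>(u1, w1). c v u1 \<bind> (\<lambda>(u2, v1).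
      cl z w1 \<bind> (\<lambda>(z1, w2). cl z1 v1 \<bind> (\<lambda>(z2, v2). c v2 w2 \<bind> (\<lambda>(w3, v3). k (u2 # z2) w3 v3)))))"
    by (intro fbind_ext2 Cons.IH)
  also have "\<dots> = c w u \<bind> (\<lambda>(u1, w1). cl z w1 \<bind> (\<lambda>(z1, w2). c v u1 \<bind> (\<lambda>(u2, v1).
      cl z1 v1 \<bind> (\<lambda>(z2, v2). c v2 w2 \<bind> (\<lambda>(w3, v3). k (u2 # z2) w3 v3)))))"
    by (intro fbind_ext2 fbind_commute2)
  finally show ?case by simp
qed simp

text \<open>The induction peels letters off the middle word \<open>y\<close>: the rest of
  \<open>y\<close> is handled by the hypothesis, and the peeled letter meets \<open>v\<close> and
  the word \<open>z1\<close>, the case of \<open>yb_letters\<close>.\<close>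

lemma yb_letter:
  "cl y v \<bind> (\<lambda>(y1, v1). cl z v1 \<bind> (\<lambda>(z1, v2). cc y1 z1 \<bind> (\<lambda>(z2, y2). k z2 y2 v2))) =
   cc y z \<bind> (\<lambda>(z1, y1). cl z1 v \<bind> (\<lambda>(z2, v1). cl y1 v1 \<bind> (\<lambda>(y2, v2). k z2 y2 v2)))"
proof (induction y arbitrary: v z k)
  case (Cons w y)
  have "cl (w # y) v \<bind> (\<lambda>(y1, v1). cl z v1 \<bind> (\<lambda>(z1, v2). cc y1 z1 \<bind> (\<lambda>(z2, y2). k z2 y2 v2))) =
      c v w \<bind> (\<lambda>(w1, v1). cl y v1 \<bind> (\<lambda>(y1, v2). cl z v2 \<bind> (\<lambda>(z1, v3). cc y1 z1 \<bind> (\<lambda>(z2, y2).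
        cl z2 w1 \<bind> (\<lambda>(z3, w2). k z3 (w2 # y2) v3)))))"
    by simp
  also have "\<dots> = c v w \<bind> (\<lambda>(w1, v1). cc y z \<bind> (\<lambda>(z1, y1). cl z1 v1 \<bind> (\<lambda>(z2, v2). cl y1 v2 \<bind> (\<lambda>(y2, v3).
        cl z2 w1 \<bind> (\<lambda>(z3, w2). k z3 (w2 # y2) v3)))))"
    by (intro fbind_ext2 Cons.IH)
  also have "\<dots> = c v w \<bind> (\<lambda>(w1, v1). cc y z \<bind> (\<lambda>(z1, y1). cl z1 v1 \<bind> (\<lambda>(z2, v2).
        cl z2 w1 \<bind> (\<lambda>(z3, w2). cl y1 v2 \<bind> (\<lambda>(y2, v3). k z3 (w2 # y2) v3)))))"
    by (intro fbind_ext2 fbind_commute2)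
  also have "\<dots> = cc y z \<bind> (\<lambda>(z1, y1). c v w \<bind> (\<lambda>(w1, v1). cl z1 v1 \<bind> (\<lambda>(z2, v2).
        cl z2 w1 \<bind> (\<lambda>(z3, w2). cl y1 v2 \<bind> (\<lambda>(y2, v3). k z3 (w2 # y2) v3)))))"
    by (rule fbind_commute2)
  also have "\<dots> = cc y z \<bind> (\<lambda>(z1, y1). cl z1 w \<bind> (\<lambda>(z2, w1). cl z2 v \<bind> (\<lambda>(z3, v1). c v1 w1 \<bind> (\<lambda>(w2, v2).
        cl y1 v2 \<bind> (\<lambda>(y2, v3). k z3 (w2 # y2) v3)))))"
    by (intro fbind_ext2 yb_letters)
  finally show ?case by simp
qed simp

text \<open>The Yang-Baxter equation of the tensor algebra on spanning words, by peeling letters off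
  \<open>x\<close>, each of which is an instance of \<open>yb_letter\<close>.\<close>

lemma yb_words:
  "cc x y \<bind> (\<lambda>(y1, x1). cc x1 z \<bind> (\<lambda>(z1, x2). cc y1 z1 \<bind> (\<lambda>(z2, y2). k z2 y2 x2))) =
   cc y z \<bind> (\<lambda>(z1, y1). cc x z1 \<bind> (\<lambda>(z2, x1). cc x1 y1 \<bind> (\<lambda>(y2, x2). k z2 y2 x2)))"
proof (induction x arbitrary: k)
  case (Cons v x)
  have "cc (v # x) y \<bind> (\<lambda>(y1, x1). cc x1 z \<bind> (\<lambda>(z1, x2). cc y1 z1 \<bind> (\<lambda>(z2, y2). k z2 y2 x2))) =
      cc x y \<bind> (\<lambda>(y1, x1). cl y1 v \<bind> (\<lambda>(y2, v1). cc x1 z \<bind> (\<lambda>(z1, x2). cl z1 v1 \<bind> (\<lambda>(z2, v2).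
        cc y2 z2 \<bind> (\<lambda>(z3, y3). k z3 y3 (v2 # x2))))))"
    by simp
  also have "\<dots> = cc x y \<bind> (\<lambda>(y1, x1). cc x1 z \<bind> (\<lambda>(z1, x2). cl y1 v \<bind> (\<lambda>(y2, v1). cl z1 v1 \<bind> (\<lambda>(z2, v2).
        cc y2 z2 \<bind> (\<lambda>(z3, y3). k z3 y3 (v2 # x2))))))"
    by (intro fbind_ext2 fbind_commute2)
  also have "\<dots> = cc x y \<bind> (\<lambda>(y1, x1). cc x1 z \<bind> (\<lambda>(z1, x2). cc y1 z1 \<bind> (\<lambda>(z2, y2). cl z2 v \<bind> (\<lambda>(z3, v1).
        cl y2 v1 \<bind> (\<lambda>(y3, v2). k z3 y3 (v2 # x2))))))"
    by (intro fbind_ext2 yb_letter)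
  also have "\<dots> = cc y z \<bind> (\<lambda>(z1, y1). cc x z1 \<bind> (\<lambda>(z2, x1). cc x1 y1 \<bind> (\<lambda>(y2, x2). cl z2 v \<bind> (\<lambda>(z3, v1).
        cl y2 v1 \<bind> (\<lambda>(y3, v2). k z3 y3 (v2 # x2))))))"
    by (rule Cons.IH)
  also have "\<dots> = cc y z \<bind> (\<lambda>(z1, y1). cc x z1 \<bind> (\<lambda>(z2, x1). cl z2 v \<bind> (\<lambda>(z3, v1). cc x1 y1 \<bind> (\<lambda>(y2, x2).
        cl y2 v1 \<bind> (\<lambda>(y3, v2). k z3 y3 (v2 # x2))))))"
    by (intro fbind_ext2 fbind_commute2)
  finally show ?case by simp
qed simp

text \<open>Multiplicativity of the coproduct for the multiplication twisted by the braiding,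
  \<open>cc b a1\<close> being the crossing of the inner factors. In the summand where
  \<open>v\<close> moves to the right factor it crosses \<open>a\<close> and then \<open>a2\<close>,
  as \<open>cl_append\<close> prescribes for their concatenation.\<close>

lemma dl_append:
  "dl (x @ y) = dl x \<bind> (\<lambda>(a, b). dl y \<bind> (\<lambda>(a1, b1). cc b a1 \<bind> (\<lambda>(a2, b2). fret (a @ a2, b2 @ b1))))"
proof (induction x)
  case Nil
  show ?case by (simp add: split_def)
next
  case (Cons v x)
  have "dl x \<bind> (\<lambda>(a, b). dl y \<bind> (\<lambda>(a1, b1). cc b a1 \<bind> (\<lambda>(a2, b2). cl a v \<bind> (\<lambda>(a3, v1). cl a2 v1 \<bind> (\<lambda>(a4, v2).
        fret (a3 @ a4, v2 # b2 @ b1)))))) =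
      dl x \<bind> (\<lambda>(a, b). cl a v \<bind> (\<lambda>(a3, v1). dl y \<bind> (\<lambda>(a1, b1). cc b a1 \<bind> (\<lambda>(a2, b2). cl a2 v1 \<bind> (\<lambda>(a4, v2).
        fret (a3 @ a4, v2 # b2 @ b1))))))" (is "?l = ?r")
  proof -
    have "?l = dl x \<bind> (\<lambda>(a, b). dl y \<bind> (\<lambda>(a1, b1). cl a v \<bind> (\<lambda>(a3, v1). cc b a1 \<bind> (\<lambda>(a2, b2). cl a2 v1 \<bind> (\<lambda>(a4, v2).
        fret (a3 @ a4, v2 # b2 @ b1))))))"
      by (intro fbind_ext2 fbind_commute2)
    also have "\<dots> = ?r" by (intro fbind_ext2 fbind_commute2)
    finally show ?thesis .
  qed
  then show ?case by (simp add: Cons.IH cl_append)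
qed

text \<open>Splitting a word is compatible with a letter crossing it. In the summand of
  \<open>dl\<close> that moves \<open>w\<close>, the letters \<open>v\<close> and \<open>w\<close>
  cross each other and then the same word, whence \<open>yb_letters\<close>.\<close>

lemma dl_cl:
  "cl y v \<bind> (\<lambda>(y1, v1). dl y1 \<bind> (\<lambda>(a, b). k a b v1)) =
   dl y \<bind> (\<lambda>(a, b). cl a v \<bind> (\<lambda>(a1, v1). cl b v1 \<bind> (\<lambda>(b1, v2). k a1 b1 v2)))"
proof (induction y arbitrary: v k)
  case (Cons w y)
  have "cl (w # y) v \<bind> (\<lambda>(y1, v1). dl y1 \<bind> (\<lambda>(a, b). k a b v1)) =
      (c v w \<bind> (\<lambda>(w1, v1). cl y v1 \<bind> (\<lambda>(y1, v2). dl y1 \<bind> (\<lambda>(a, b). k (w1 # a) b v2)))) +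
      (c v w \<bind> (\<lambda>(w1, v1). cl y v1 \<bind> (\<lambda>(y1, v2). dl y1 \<bind> (\<lambda>(a, b). cl a w1 \<bind> (\<lambda>(a1, w2). k a1 (w2 # b) v2)))))"
    by (simp add: fbind_add_right2)
  also have "c v w \<bind> (\<lambda>(w1, v1). cl y v1 \<bind> (\<lambda>(y1, v2). dl y1 \<bind> (\<lambda>(a, b). k (w1 # a) b v2))) =
      c v w \<bind> (\<lambda>(w1, v1). dl y \<bind> (\<lambda>(a, b). cl a v1 \<bind> (\<lambda>(a1, v2). cl b v2 \<bind> (\<lambda>(b1, v3). k (w1 # a1) b1 v3))))"
    by (intro fbind_ext2 Cons.IH)
  also have "\<dots> = dl y \<bind> (\<lambda>(a, b). c v w \<bind> (\<lambda>(w1, v1). cl a v1 \<bind> (\<lambda>(a1, v2). cl b v2 \<bind> (\<lambda>(b1, v3). k (w1 # a1) b1 v3))))"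
    by (rule fbind_commute2)
  also have "c v w \<bind> (\<lambda>(w1, v1). cl y v1 \<bind> (\<lambda>(y1, v2). dl y1 \<bind> (\<lambda>(a, b). cl a w1 \<bind> (\<lambda>(a1, w2). k a1 (w2 # b) v2)))) =
      c v w \<bind> (\<lambda>(w1, v1). dl y \<bind> (\<lambda>(a, b). cl a v1 \<bind> (\<lambda>(a1, v2). cl b v2 \<bind> (\<lambda>(b1, v3). cl a1 w1 \<bind> (\<lambda>(a2, w2). k a2 (w2 # b1) v3)))))"
    by (intro fbind_ext2 Cons.IH)
  also have "\<dots> = dl y \<bind> (\<lambda>(a, b). c v w \<bind> (\<lambda>(w1, v1). cl a v1 \<bind> (\<lambda>(a1, v2). cl b v2 \<bind> (\<lambda>(b1, v3). cl a1 w1 \<bind> (\<lambda>(a2, w2). k a2 (w2 # b1) v3)))))"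
    by (rule fbind_commute2)
  also have "\<dots> = dl y \<bind> (\<lambda>(a, b). c v w \<bind> (\<lambda>(w1, v1). cl a v1 \<bind> (\<lambda>(a1, v2). cl a1 w1 \<bind> (\<lambda>(a2, w2). cl b v2 \<bind> (\<lambda>(b1, v3). k a2 (w2 # b1) v3)))))"
    by (intro fbind_ext2 fbind_commute2)
  also have "\<dots> = dl y \<bind> (\<lambda>(a, b). cl a w \<bind> (\<lambda>(a1, w1). cl a1 v \<bind> (\<lambda>(a2, v1). c v1 w1 \<bind> (\<lambda>(w2, v2). cl b v2 \<bind> (\<lambda>(b1, v3). k a2 (w2 # b1) v3)))))"
    by (intro fbind_ext2 yb_letters)
  finally show ?case by simp
qed simp

text \<open>On words this is the axiom \<open>(\<Delta> \<otimes> C)c = (C \<otimes> c)(c \<otimes>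
  C)(C \<otimes> \<Delta>)\<close>; the letters of \<open>x\<close> cross the two parts of
  \<open>y\<close> one at a time by \<open>dl_cl\<close>.\<close>

lemma dl_cc_left:
  "cc x y \<bind> (\<lambda>(y1, x1). dl y1 \<bind> (\<lambda>(a, b). k a b x1)) =
   dl y \<bind> (\<lambda>(a, b). cc x a \<bind> (\<lambda>(a1, x1). cc x1 b \<bind> (\<lambda>(b1, x2). k a1 b1 x2)))"
proof (induction x arbitrary: k)
  case (Cons v x)
  have "cc (v # x) y \<bind> (\<lambda>(y1, x1). dl y1 \<bind> (\<lambda>(a, b). k a b x1)) =
      cc x y \<bind> (\<lambda>(y1, x1). cl y1 v \<bind> (\<lambda>(y2, v1). dl y2 \<bind> (\<lambda>(a, b). k a b (v1 # x1))))"
    by simp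
  also have "\<dots> = cc x y \<bind> (\<lambda>(y1, x1). dl y1 \<bind> (\<lambda>(a, b). cl a v \<bind> (\<lambda>(a1, v1). cl b v1 \<bind> (\<lambda>(b1, v2). k a1 b1 (v2 # x1)))))"
    by (intro fbind_ext2 dl_cl)
  also have "\<dots> = dl y \<bind> (\<lambda>(a, b). cc x a \<bind> (\<lambda>(a1, x1). cc x1 b \<bind> (\<lambda>(b1, x2). cl a1 v \<bind> (\<lambda>(a2, v1). cl b1 v1 \<bind> (\<lambda>(b2, v2). k a2 b2 (v2 # x2))))))"
    by (rule Cons.IH)
  also have "\<dots> = dl y \<bind> (\<lambda>(a, b). cc x a \<bind> (\<lambda>(a1, x1). cl a1 v \<bind> (\<lambda>(a2, v1). cc x1 b \<bind> (\<lambda>(b1, x2). cl b1 v1 \<bind> (\<lambda>(b2, v2). k a2 b2 (v2 # x2))))))"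
    by (intro fbind_ext2 fbind_commute2)
  finally show ?case by simp
qed simp

text \<open>On words this is the axiom \<open>(C \<otimes> \<Delta>)c = (c \<otimes> C)(C \<otimes>
  c)(\<Delta> \<otimes> C)\<close>. Here the word being split is the one on which the induction
  runs, so both summands of \<open>dl\<close> have to be followed.\<close>

lemma dl_cc_right:
  "cc x y \<bind> (\<lambda>(y1, x1). dl x1 \<bind> (\<lambda>(a, b). k y1 a b)) =
   dl x \<bind> (\<lambda>(a, b). cc b y \<bind> (\<lambda>(y1, b1). cc a y1 \<bind> (\<lambda>(y2, a1). k y2 a1 b1)))"
proof (induction x arbitrary: k)
  case (Cons v x)
  have "cc (v # x) y \<bind> (\<lambda>(y1, x1). dl x1 \<bind> (\<lambda>(a, b). k y1 a b)) =
      (cc x y \<bind> (\<lambda>(y1, x1). cl y1 v \<bind> (\<lambda>(y2, v1). dl x1 \<bind> (\<lambda>(a, b). k y2 (v1 # a) b)))) +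
      (cc x y \<bind> (\<lambda>(y1, x1). cl y1 v \<bind> (\<lambda>(y2, v1). dl x1 \<bind> (\<lambda>(a, b). cl a v1 \<bind> (\<lambda>(a1, v2). k y2 a1 (v2 # b))))))"
    by (simp add: fbind_add_right2)
  also have "cc x y \<bind> (\<lambda>(y1, x1). cl y1 v \<bind> (\<lambda>(y2, v1). dl x1 \<bind> (\<lambda>(a, b). k y2 (v1 # a) b))) =
      cc x y \<bind> (\<lambda>(y1, x1). dl x1 \<bind> (\<lambda>(a, b). cl y1 v \<bind> (\<lambda>(y2, v1). k y2 (v1 # a) b)))"
    by (intro fbind_ext2 fbind_commute2)
  also have "\<dots> = dl x \<bind> (\<lambda>(a, b). cc b y \<bind> (\<lambda>(y1, b1). cc a y1 \<bind> (\<lambda>(y2, a1). cl y2 v \<bind> (\<lambda>(y3, v1). k y3 (v1 # a1) b1))))"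
    by (rule Cons.IH)
  also have "cc x y \<bind> (\<lambda>(y1, x1). cl y1 v \<bind> (\<lambda>(y2, v1). dl x1 \<bind> (\<lambda>(a, b). cl a v1 \<bind> (\<lambda>(a1, v2). k y2 a1 (v2 # b))))) =
      cc x y \<bind> (\<lambda>(y1, x1). dl x1 \<bind> (\<lambda>(a, b). cl y1 v \<bind> (\<lambda>(y2, v1). cl a v1 \<bind> (\<lambda>(a1, v2). k y2 a1 (v2 # b)))))"
    by (intro fbind_ext2 fbind_commute2)
  also have "\<dots> = dl x \<bind> (\<lambda>(a, b). cc b y \<bind> (\<lambda>(y1, b1). cc a y1 \<bind> (\<lambda>(y2, a1). cl y2 v \<bind> (\<lambda>(y3, v1). cl a1 v1 \<bind> (\<lambda>(a2, v2). k y3 a2 (v2 # b1))))))"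
    by (rule Cons.IH)
  \<comment> \<open>After the induction hypothesis \<open>v\<close> crosses two words that have
    already crossed each other; by \<open>yb_letter\<close> it may instead cross \<open>a\<close>
    and \<open>y1\<close> before they do.\<close>
  also have "\<dots> = dl x \<bind> (\<lambda>(a, b). cc b y \<bind> (\<lambda>(y1, b1). cl a v \<bind> (\<lambda>(a1, v1). cl y1 v1 \<bind> (\<lambda>(y2, v2). cc a1 y2 \<bind> (\<lambda>(y3, a2). k y3 a2 (v2 # b1))))))"
    by (intro fbind_ext2 yb_letter[symmetric])
  also have "\<dots> = dl x \<bind> (\<lambda>(a, b). cl a v \<bind> (\<lambda>(a1, v1). cc b y \<bind> (\<lambda>(y1, b1). cl y1 v1 \<bind> (\<lambda>(y2, v2). cc a1 y2 \<bind> (\<lambda>(y3, a2). k y3 a2 (v2 # b1))))))"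
    by (intro fbind_ext2 fbind_commute2)
  finally show ?case by simp
qed simp

text \<open>The first letter ends in the first, second or third factor, and the three contributions
  match separately: the first by the induction hypothesis alone, the second by (2), the third by
  (1), which uses \<open>dl_cl\<close>.\<close>

lemma dl_coassoc:
  "dl x \<bind> (\<lambda>(a, b). dl a \<bind> (\<lambda>(a1, a2). k a1 a2 b)) = dl x \<bind> (\<lambda>(a, b). dl b \<bind> (\<lambda>(b1, b2). k a b1 b2))"
proof (induction x arbitrary: k)
  case (Cons v x)
  have 1: "dl x \<bind> (\<lambda>(a, b). cl a v \<bind> (\<lambda>(a1, v1). dl a1 \<bind> (\<lambda>(a2, a3). k a2 a3 (v1 # b)))) =
      dl x \<bind> (\<lambda>(a, b). cl a v \<bind> (\<lambda>(a1, v1). dl b \<bind> (\<lambda>(b1, b2). cl b1 v1 \<bind> (\<lambda>(b3, v2). k a1 b3 (v2 # b2)))))"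
  proof -
    have "dl x \<bind> (\<lambda>(a, b). cl a v \<bind> (\<lambda>(a1, v1). dl a1 \<bind> (\<lambda>(a2, a3). k a2 a3 (v1 # b)))) =
        dl x \<bind> (\<lambda>(a, b). dl a \<bind> (\<lambda>(a1, a2). cl a1 v \<bind> (\<lambda>(a3, v1). cl a2 v1 \<bind> (\<lambda>(a4, v2). k a3 a4 (v2 # b)))))"
      by (intro fbind_ext2 dl_cl)
    also have "\<dots> = dl x \<bind> (\<lambda>(a, b). dl b \<bind> (\<lambda>(b1, b2). cl a v \<bind> (\<lambda>(a3, v1). cl b1 v1 \<bind> (\<lambda>(b3, v2). k a3 b3 (v2 # b2)))))"
      by (rule Cons.IH)
    also have "\<dots> = dl x \<bind> (\<lambda>(a, b). cl a v \<bind> (\<lambda>(a1, v1). dl b \<bind> (\<lambda>(b1, b2). cl b1 v1 \<bind> (\<lambda>(b3, v2). k a1 b3 (v2 # b2)))))"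
      by (intro fbind_ext2 fbind_commute2)
    finally show ?thesis .
  qed
  have 2: "dl x \<bind> (\<lambda>(a, b). dl a \<bind> (\<lambda>(a1, a2). cl a1 v \<bind> (\<lambda>(a3, v1). k a3 (v1 # a2) b))) =
      dl x \<bind> (\<lambda>(a, b). cl a v \<bind> (\<lambda>(a1, v1). dl b \<bind> (\<lambda>(b1, b2). k a1 (v1 # b1) b2)))"
  proof -
    have "dl x \<bind> (\<lambda>(a, b). dl a \<bind> (\<lambda>(a1, a2). cl a1 v \<bind> (\<lambda>(a3, v1). k a3 (v1 # a2) b))) =
        dl x \<bind> (\<lambda>(a, b). dl b \<bind> (\<lambda>(b1, b2). cl a v \<bind> (\<lambda>(a3, v1). k a3 (v1 # b1) b2)))"
      by (rule Cons.IH)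
    also have "\<dots> = dl x \<bind> (\<lambda>(a, b). cl a v \<bind> (\<lambda>(a1, v1). dl b \<bind> (\<lambda>(b1, b2). k a1 (v1 # b1) b2)))"
      by (intro fbind_ext2 fbind_commute2)
    finally show ?thesis .
  qed
  show ?case
    by (simp add: fbind_add_right2 1 2 Cons.IH[of "\<lambda>a1 a2 b. k (v # a1) a2 b"] add.assoc)
qed simp

lemma cl_if_Nil: "cl a v \<bind> (\<lambda>(a1, v1). if a1 = [] then k v1 else 0) = (if a = [] then k v else 0)"
  by (cases a) simp_all

text \<open>Testing a factor for the empty word is the counit on words. At each step only the
  summand that puts the first letter into the other factor survives.\<close>

lemma dl_counit:
  "dl x \<bind> (\<lambda>(a, b). if a = [] then k b else 0) = k x" "dl x \<bind> (\<lambda>(a, b). if b = [] then k a else 0) = k x"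
proof (induction x arbitrary: k)
  case (Cons v x)
  { case 1 then show ?case using Cons.IH(1)[of "\<lambda>b. k (v # b)"] by (simp add: cl_if_Nil)
  next case 2 then show ?case using Cons.IH(2)[of "\<lambda>a. k (v # a)"] by simp }
qed simp_all

lemma cc_counit:
  "cc x y \<bind> (\<lambda>(y1, x1). if y1 = [] then k x1 else 0) = (if y = [] then k x else 0)"
  "cc x y \<bind> (\<lambda>(y1, x1). if x1 = [] then k y1 else 0) = (if x = [] then k y else 0)"
proof (induction x arbitrary: k)
  case (Cons v x)
  { case 1 then show ?case using Cons.IH(1)[of "\<lambda>b. k (v # b)"] by (simp add: cl_if_Nil)
  next case 2 then show ?case by simp }
qed simp_all

end

text \<open>\<open>m v w\<close> and \<open>u\<close> stand for the coordinates of a product and of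
  the unit. The unit laws are restricted to \<open>E\<close> because in the intended instance
  \<open>c\<close> vanishes off \<open>E\<close>; there both sides of the other laws are
  zero.\<close>

locale braided_letter_algebra = braided_letters c for c :: "'a \<Rightarrow> 'a \<Rightarrow> ('a \<times> 'a \<Rightarrow>\<^sub>0 'k::field)" +
  fixes m :: "'a \<Rightarrow> 'a \<Rightarrow> ('a \<Rightarrow>\<^sub>0 'k)" and u :: "'a \<Rightarrow>\<^sub>0 'k" and E :: "'a set"
  assumes support: "Poly_Mapping.keys (c v w) \<subseteq> E \<times> E"
    and mult_left: "m v w \<bind> (\<lambda>b. c b y) = c w y \<bind> (\<lambda>(y1, w1). c v y1 \<bind> (\<lambda>(y2, v1). m v1 w1 \<bind> (\<lambda>b. fret (y2, b))))"
    and mult_right: "m w y \<bind> (\<lambda>d. c v d) = c v w \<bind> (\<lambda>(w1, v1). c v1 y \<bind> (\<lambda>(y1, v2). m w1 y1 \<bind> (\<lambda>d. fret (d, v2))))"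
    and unit_left: "y \<in> E \<Longrightarrow> u \<bind> (\<lambda>a. c a y) = u \<bind> (\<lambda>a. fret (y, a))"
    and unit_right: "y \<in> E \<Longrightarrow> u \<bind> (\<lambda>a. c y a) = u \<bind> (\<lambda>a. fret (a, y))"
begin

text \<open>The product in the algebra of the letters of a word, in coordinates; later identified
  with \<open>\<phi>\<close> on words.\<close>

primrec mm :: "'a list \<Rightarrow> ('a \<Rightarrow>\<^sub>0 'k)" where
  "mm [] = u"
| "mm (v # l) = mm l \<bind> m v"

lemma mult_left':
  "m v w \<bind> (\<lambda>b. c b y \<bind> (\<lambda>(y1, b1). k y1 b1)) =
   c w y \<bind> (\<lambda>(y1, w1). c v y1 \<bind> (\<lambda>(y2, v1). m v1 w1 \<bind> (\<lambda>b. k y2 b)))"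
  using arg_cong[OF mult_left[of v w y], of "\<lambda>t. t \<bind> (\<lambda>(y1, b1). k y1 b1)"] by simp

lemma mult_right':
  "m w y \<bind> (\<lambda>d. c v d \<bind> (\<lambda>(d1, v1). k d1 v1)) =
   c v w \<bind> (\<lambda>(w1, v1). c v1 y \<bind> (\<lambda>(y1, v2). m w1 y1 \<bind> (\<lambda>d. k d v2)))"
  using arg_cong[OF mult_right[of w y v], of "\<lambda>t. t \<bind> (\<lambda>(y1, b1). k y1 b1)"] by simp

lemma unit_left': "y \<in> E \<Longrightarrow> u \<bind> (\<lambda>a. c a y \<bind> (\<lambda>(y1, a1). k y1 a1)) = u \<bind> (\<lambda>a. k y a)"
  using arg_cong[OF unit_left[of y], of "\<lambda>t. t \<bind> (\<lambda>(y1, b1). k y1 b1)"] by simp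

lemma unit_right': "y \<in> E \<Longrightarrow> u \<bind> (\<lambda>a. c y a \<bind> (\<lambda>(a1, y1). k a1 y1)) = u \<bind> (\<lambda>a. k a y)"
  using arg_cong[OF unit_right[of y], of "\<lambda>t. t \<bind> (\<lambda>(y1, b1). k y1 b1)"] by simp

lemma cl_mult:
  "m v a \<bind> (\<lambda>b. cl y b \<bind> (\<lambda>(y1, b1). k y1 b1)) =
   cl y a \<bind> (\<lambda>(y1, a1). cl y1 v \<bind> (\<lambda>(y2, v1). m v1 a1 \<bind> (\<lambda>b. k y2 b)))"
proof (induction y arbitrary: v a k)
  case (Cons w y)
  have "m v a \<bind> (\<lambda>b. cl (w # y) b \<bind> (\<lambda>(y1, b1). k y1 b1)) =
      m v a \<bind> (\<lambda>b. c b w \<bind> (\<lambda>(w1, b1). cl y b1 \<bind> (\<lambda>(y1, b2). k (w1 # y1) b2)))"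
    by simp
  also have "\<dots> = c a w \<bind> (\<lambda>(w1, a1). c v w1 \<bind> (\<lambda>(w2, v1). m v1 a1 \<bind> (\<lambda>b. cl y b \<bind> (\<lambda>(y1, b2). k (w2 # y1) b2))))"
    by (rule mult_left')
  also have "\<dots> = c a w \<bind> (\<lambda>(w1, a1). c v w1 \<bind> (\<lambda>(w2, v1). cl y a1 \<bind> (\<lambda>(y1, a2). cl y1 v1 \<bind> (\<lambda>(y2, v2). m v2 a2 \<bind> (\<lambda>b. k (w2 # y2) b)))))"
    by (intro fbind_ext2 Cons.IH)
  also have "\<dots> = c a w \<bind> (\<lambda>(w1, a1). cl y a1 \<bind> (\<lambda>(y1, a2). c v w1 \<bind> (\<lambda>(w2, v1). cl y1 v1 \<bind> (\<lambda>(y2, v2). m v2 a2 \<bind> (\<lambda>b. k (w2 # y2) b)))))"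
    by (intro fbind_ext2 fbind_commute2)
  finally show ?case by simp
qed simp

lemma cl_unit: "set y \<subseteq> E \<Longrightarrow> u \<bind> (\<lambda>a. cl y a \<bind> (\<lambda>(y1, a1). k y1 a1)) = u \<bind> (\<lambda>a. k y a)"
  by (induction y arbitrary: k) (simp_all add: unit_left')

text \<open>This is \<open>c(e \<otimes> id) = (id \<otimes> e)c\<close> on words: multiplying
  \<open>x\<close> out and letting the result cross \<open>y\<close> agrees with letting each letter
  of \<open>x\<close> cross \<open>y\<close> first. Induction reduces it to a product of two
  letters, \<open>cl_mult\<close>, and to the unit, \<open>cl_unit\<close>.\<close>

lemma mm_cc_left:
  assumes "set y \<subseteq> E"
  shows "mm x \<bind> (\<lambda>a. cl y a \<bind> (\<lambda>(y1, a1). k y1 a1)) = cc x y \<bind> (\<lambda>(y1, x1). mm x1 \<bind> (\<lambda>a. k y1 a))"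
proof (induction x arbitrary: k)
  case Nil
  then show ?case by (simp add: cl_unit[OF assms])
next
  case (Cons v x)
  have "mm (v # x) \<bind> (\<lambda>a. cl y a \<bind> (\<lambda>(y1, a1). k y1 a1)) =
      mm x \<bind> (\<lambda>a. cl y a \<bind> (\<lambda>(y1, a1). cl y1 v \<bind> (\<lambda>(y2, v1). m v1 a1 \<bind> (\<lambda>b. k y2 b))))"
    by (simp add: cl_mult)
  also have "\<dots> = cc x y \<bind> (\<lambda>(y1, x1). mm x1 \<bind> (\<lambda>a. cl y1 v \<bind> (\<lambda>(y2, v1). m v1 a \<bind> (\<lambda>b. k y2 b))))"
    by (rule Cons.IH)
  also have "\<dots> = cc x y \<bind> (\<lambda>(y1, x1). cl y1 v \<bind> (\<lambda>(y2, v1). mm x1 \<bind> (\<lambda>a. m v1 a \<bind> (\<lambda>b. k y2 b))))"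
    by (intro fbind_ext2 fbind_commute1)
  finally show ?case by simp
qed

text \<open>A variant of \<open>cc x [a]\<close> that returns a letter instead of a one-letter word,
  so that the result can be fed into \<open>c\<close> and \<open>m\<close> again.\<close>

primrec cr :: "'a list \<Rightarrow> 'a \<Rightarrow> ('a \<times> 'a list \<Rightarrow>\<^sub>0 'k)" where
  "cr [] a = fret (a, [])"
| "cr (v # x) a = cr x a \<bind> (\<lambda>(a1, x1). c v a1 \<bind> (\<lambda>(a2, v1). fret (a2, v1 # x1)))"

lemma cc_single_right: "cc x [a] = cr x a \<bind> (\<lambda>(a1, x1). fret ([a1], x1))"
  by (induction x) (simp_all add: split_def)

lemma mm_letter:
  "v \<in> E \<Longrightarrow> mm y \<bind> (\<lambda>a. c v a \<bind> (\<lambda>(a1, v1). k a1 v1)) = cl y v \<bind> (\<lambda>(y1, v1). mm y1 \<bind> (\<lambda>a. k a v1))"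
proof (induction y arbitrary: v k)
  case Nil
  then show ?case by (simp add: unit_right')
next
  case (Cons w y)
  have "mm (w # y) \<bind> (\<lambda>a. c v a \<bind> (\<lambda>(a1, v1). k a1 v1)) =
      mm y \<bind> (\<lambda>a. c v w \<bind> (\<lambda>(w1, v1). c v1 a \<bind> (\<lambda>(a1, v2). m w1 a1 \<bind> (\<lambda>b. k b v2))))"
    by (simp add: mult_right')
  also have "\<dots> = c v w \<bind> (\<lambda>(w1, v1). mm y \<bind> (\<lambda>a. c v1 a \<bind> (\<lambda>(a1, v2). m w1 a1 \<bind> (\<lambda>b. k b v2))))"
    by (rule fbind_commute1)
  \<comment> \<open>The hypothesis of the induction asks for a letter in \<open>E\<close>;
    \<open>fbind_cong\<close> restricts attention to the support of \<open>c v w\<close>, where this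
    holds for \<open>v1\<close>.\<close>
  also have "\<dots> = c v w \<bind> (\<lambda>(w1, v1). cl y v1 \<bind> (\<lambda>(y1, v2). mm y1 \<bind> (\<lambda>a. m w1 a \<bind> (\<lambda>b. k b v2))))"
    using support[of v w] Cons.IH by (intro fbind_cong) auto
  finally show ?case by simp
qed

text \<open>The mirror image \<open>c(id \<otimes> e) = (e \<otimes> id)c\<close> of
  \<open>mm_cc_left\<close>. Here the product of \<open>y\<close> is crossed by the letters of
  \<open>x\<close> one at a time, each by \<open>mm_letter\<close>.\<close>

lemma mm_cc_right:
  assumes "set x \<subseteq> E"
  shows "mm y \<bind> (\<lambda>a. cr x a \<bind> (\<lambda>(a1, x1). k a1 x1)) = cc x y \<bind> (\<lambda>(y1, x1). mm y1 \<bind> (\<lambda>a. k a x1))"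
  using assms
proof (induction x arbitrary: k)
  case (Cons v x)
  have "mm y \<bind> (\<lambda>a. cr (v # x) a \<bind> (\<lambda>(a1, x1). k a1 x1)) =
      mm y \<bind> (\<lambda>a. cr x a \<bind> (\<lambda>(a1, x1). c v a1 \<bind> (\<lambda>(a2, v1). k a2 (v1 # x1))))"
    by simp
  also have "\<dots> = cc x y \<bind> (\<lambda>(y1, x1). mm y1 \<bind> (\<lambda>a. c v a \<bind> (\<lambda>(a2, v1). k a2 (v1 # x1))))"
    using Cons.prems by (intro Cons.IH) simp
  also have "\<dots> = cc x y \<bind> (\<lambda>(y1, x1). cl y1 v \<bind> (\<lambda>(y2, v1). mm y2 \<bind> (\<lambda>a. k a (v1 # x1))))"
    using Cons.prems by (intro fbind_ext2 mm_letter) simp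
  finally show ?case by simp
qed simp

end

section \<open>Linear maps on tensor powers in terms of spanning words\<close>

text \<open>A space with a spanning family. Independence is not assumed, so identities between
  combinations of index words imply identities between maps; the converse is obtained for
  \<open>A\<close> in \<open>A_eq\<close>. The instances are \<open>A\<close> with a basis and
  \<open>T\<close> with the words over that basis.\<close>

locale model =
  fixes V :: "('k::field, 'v, 'm) module_scheme" and \<beta> :: "'i \<Rightarrow> 'v" and I :: "'i set"
  assumes V: "vec_space V" and \<beta>: "\<And>i. i \<in> I \<Longrightarrow> \<beta> i \<in> carrier V"
    and span: "\<And>v. v \<in> carrier V \<Longrightarrow> \<exists>p. Poly_Mapping.keys p \<subseteq> I \<and> v = lin_ext V p \<beta>"
begin

definition "words n = {l. set l \<subseteq> I \<and> length l = n}"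
definition "evl p = lin_ext (tensor_alg V) p (\<lambda>l. tens V (map \<beta> l))"
text \<open>\<open>F\<close> plays the role of a matrix of \<open>f\<close>: it expresses the value
  on each spanning word as a combination of index words. Since these need not be independent,
  \<open>F\<close> is not determined by \<open>f\<close>.\<close>

definition "represents p q f F \<longleftrightarrow> linear_map (tens_power V p) (tens_power V q) f \<and>
  (\<forall>l\<in>words p. Poly_Mapping.keys (F l) \<subseteq> words q \<and> f (tens V (map \<beta> l)) = evl (F l))"

lemma T: "assoc_algebra (tensor_alg V)" and TV: "vec_space (tensor_alg V)"
  using V by simp_all

lemma map_\<beta>: "set l \<subseteq> I \<Longrightarrow> set (map \<beta> l) \<subseteq> carrier V"
  using \<beta> by auto

lemma word_closed:
  "l \<in> words n \<Longrightarrow> tens V (map \<beta> l) \<in> carrier (tens_power V n)" "l \<in> words n \<Longrightarrow> tens V (map \<beta> l) \<in> carrier (tensor_alg V)"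
  using map_\<beta> V by (auto simp: words_def intro!: tens_in_power tens_closed simp del: set_map)

lemma evl_single: "l \<in> words n \<Longrightarrow> evl (Poly_Mapping.single l a) = a \<odot>\<^bsub>tensor_alg V\<^esub> tens V (map \<beta> l)"
  unfolding evl_def by (rule lin_ext_single[OF TV]) (rule word_closed)

lemma evl_fret: "l \<in> words n \<Longrightarrow> evl (fret l) = tens V (map \<beta> l)"
  using evl_single[of l n 1] word_closed(2)[of l n] TV by simp

lemma evl_power:
  assumes "Poly_Mapping.keys p \<subseteq> words n"
  shows "evl p \<in> carrier (tens_power V n)"
proof -
  have VP: "vec_space (tens_power V n)" using V by simp
  have "evl p = lin_ext (tens_power V n) p (\<lambda>l. tens V (map \<beta> l))"
    unfolding evl_def using assms word_closed
    by (intro lin_ext_linear[OF linear_map_incl VP TV, symmetric]) blast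
  then show ?thesis using assms word_closed(1) by (auto intro!: lin_ext_closed[OF VP])
qed

lemma evl_closed: "Poly_Mapping.keys p \<subseteq> words n \<Longrightarrow> evl p \<in> carrier (tensor_alg V)"
  by (rule tens_power_subset[OF evl_power])

lemma evl_bind:
  assumes "Poly_Mapping.keys t \<subseteq> S" "\<And>x. x \<in> S \<Longrightarrow> Poly_Mapping.keys (f x) \<subseteq> words n"
  shows "evl (t \<bind> f) = lin_ext (tensor_alg V) t (\<lambda>x. evl (f x))"
  unfolding evl_def using assms word_closed(2) by (intro lin_ext_bind[OF TV]) blast

lemma linear_evl:
  assumes "linear_map (tens_power V n) W f" "vec_space W" "Poly_Mapping.keys p \<subseteq> words n"
  shows "f (evl p) = lin_ext W p (\<lambda>l. f (tens V (map \<beta> l)))"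
proof -
  have VP: "vec_space (tens_power V n)" using V by simp
  have "evl p = lin_ext (tens_power V n) p (\<lambda>l. tens V (map \<beta> l))"
    unfolding evl_def using assms word_closed
    by (intro lin_ext_linear[OF linear_map_incl VP TV, symmetric]) blast
  also have "f \<dots> = lin_ext W p (\<lambda>l. f (tens V (map \<beta> l)))"
    using assms(3) word_closed(1) by (intro lin_ext_linear[OF assms(1) VP assms(2)]) blast
  finally show ?thesis .
qed

lemma represents_eval:
  assumes f: "represents p q f F" and t: "Poly_Mapping.keys t \<subseteq> words p"
  shows "f (evl t) = evl (t \<bind> F)"
proof -
  have l: "linear_map (tens_power V p) (tensor_alg V) f"
    using f linear_map_to_tensor_alg by (auto simp: represents_def)
  have "f (evl t) = lin_ext (tensor_alg V) t (\<lambda>l. f (tens V (map \<beta> l)))" by (rule linear_evl[OF l TV t])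
  also have "\<dots> = lin_ext (tensor_alg V) t (\<lambda>l. evl (F l))"
  proof (rule lin_ext_cong[OF TV])
    fix x assume "x \<in> Poly_Mapping.keys t"
    then have x: "x \<in> words p" using t by blast
    then show "f (tens V (map \<beta> x)) = evl (F x)" "evl (F x) \<in> carrier (tensor_alg V)"
      using f evl_closed[of "F x" q] by (auto simp: represents_def)
  qed
  also have "\<dots> = evl (t \<bind> F)"
    using f by (intro evl_bind[OF t, symmetric]) (auto simp: represents_def)
  finally show ?thesis .
qed

lemma evl_mult:
  assumes p: "Poly_Mapping.keys p \<subseteq> words n" and q: "Poly_Mapping.keys q \<subseteq> words n'"
  shows "evl p \<otimes>\<^bsub>tensor_alg V\<^esub> evl q = evl (p \<bind> (\<lambda>a. q \<bind> (\<lambda>b. fret (a @ b))))"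
proof -
  have w: "a @ b \<in> words (n + n')" if "a \<in> words n" "b \<in> words n'" for a b using that by (auto simp: words_def)
  have ab: "tens V (map \<beta> a) \<otimes>\<^bsub>tensor_alg V\<^esub> tens V (map \<beta> b) = evl (fret (a @ b))" if "a \<in> words n" "b \<in> words n'" for a b
    using evl_fret[OF w[OF that]] that map_\<beta> V by (auto simp: words_def tens_append simp del: set_map)
  have eq: "evl q \<in> carrier (tensor_alg V)" by (rule evl_closed[OF q])
  have kq: "Poly_Mapping.keys (q \<bind> (\<lambda>b. fret (a @ b))) \<subseteq> words (n + n')" if "a \<in> words n" for a
    by (rule keys_fbind[OF q]) (use w that in auto)
  have "evl p \<otimes>\<^bsub>tensor_alg V\<^esub> evl q = lin_ext (tensor_alg V) p (\<lambda>a. tens V (map \<beta> a) \<otimes>\<^bsub>tensor_alg V\<^esub> evl q)"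
    by (rule linear_evl[OF linear_map_mult_right[OF T linear_map_incl eq] TV p])
  also have "\<dots> = lin_ext (tensor_alg V) p (\<lambda>a. evl (q \<bind> (\<lambda>b. fret (a @ b))))"
  proof (rule lin_ext_cong[OF TV])
    fix a assume "a \<in> Poly_Mapping.keys p"
    then have a: "a \<in> words n" using p by auto
    have "tens V (map \<beta> a) \<otimes>\<^bsub>tensor_alg V\<^esub> evl q = lin_ext (tensor_alg V) q (\<lambda>b. tens V (map \<beta> a) \<otimes>\<^bsub>tensor_alg V\<^esub> tens V (map \<beta> b))"
      by (rule linear_evl[OF linear_map_mult_left[OF T linear_map_incl word_closed(2)[OF a]] TV q])
    also have "\<dots> = lin_ext (tensor_alg V) q (\<lambda>b. evl (fret (a @ b)))"
      using q ab[OF a] w[OF a] evl_closed[of "fret (a @ _)" "n + n'"] by (intro lin_ext_cong[OF TV]) auto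
    also have "\<dots> = evl (q \<bind> (\<lambda>b. fret (a @ b)))"
      by (rule evl_bind[OF q, symmetric]) (use w[OF a] in auto)
    finally show "tens V (map \<beta> a) \<otimes>\<^bsub>tensor_alg V\<^esub> evl q = evl (q \<bind> (\<lambda>b. fret (a @ b)))" .
    show "evl (q \<bind> (\<lambda>b. fret (a @ b))) \<in> carrier (tensor_alg V)" by (rule evl_closed[OF kq[OF a]])
  qed
  also have "\<dots> = evl (p \<bind> (\<lambda>a. q \<bind> (\<lambda>b. fret (a @ b))))"
    by (rule evl_bind[OF p kq, symmetric])
  finally show ?thesis .
qed

lemma evl_add: "Poly_Mapping.keys p \<subseteq> words n \<Longrightarrow> Poly_Mapping.keys q \<subseteq> words n \<Longrightarrow> evl (p + q) = evl p \<oplus>\<^bsub>tensor_alg V\<^esub> evl q"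
  unfolding evl_def using word_closed(2) by (intro lin_ext_add[OF TV]) blast+

lemma evl_scale: "Poly_Mapping.keys p \<subseteq> words n \<Longrightarrow> evl (fscale a p) = a \<odot>\<^bsub>tensor_alg V\<^esub> evl p"
  unfolding evl_def using word_closed(2) by (intro lin_ext_scale[OF TV]) blast+

lemma evl_zero [simp]: "evl 0 = \<zero>\<^bsub>tensor_alg V\<^esub>"
  using TV by (simp add: evl_def)

lemma tens_evl:
  assumes "set l \<subseteq> carrier V"
  shows "\<exists>p. Poly_Mapping.keys p \<subseteq> words (length l) \<and> tens V l = evl p"
  using assms
proof (induction l)
  case Nil
  have "[] \<in> words 0" by (simp add: words_def)
  then show ?case using evl_fret[of "[]" 0] by (intro exI[of _ "fret []"]) simp
next
  case (Cons v l)
  then obtain q where q: "Poly_Mapping.keys q \<subseteq> words (length l)" "tens V l = evl q" by auto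
  obtain p where p: "Poly_Mapping.keys p \<subseteq> I" "v = lin_ext V p \<beta>" using span Cons.prems by auto
  have w1: "i \<in> I \<Longrightarrow> [i] \<in> words 1" for i by (simp add: words_def)
  define p' where "p' = p \<bind> (\<lambda>i. fret [i])"
  have kp: "Poly_Mapping.keys p' \<subseteq> words 1" unfolding p'_def by (rule keys_fbind[OF p(1)]) (use w1 in auto)
  have "tens V [v] = lin_ext (tensor_alg V) p (\<lambda>i. tens V [\<beta> i])"
    unfolding p(2) using p(1) \<beta> by (intro lin_ext_linear[OF linear_map_tens_singleton[OF V] V TV]) auto
  also have "\<dots> = lin_ext (tensor_alg V) p (\<lambda>i. evl (fret [i]))"
    using p(1) w1 \<beta> V by (intro lin_ext_cong[OF TV]) (auto simp: evl_fret[OF w1] subset_iff intro!: tens_closed)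
  also have "\<dots> = evl p'" unfolding p'_def by (rule evl_bind[OF p(1), symmetric, of _ 1]) (use w1 in auto)
  finally have v: "tens V [v] = evl p'" .
  have "tens V (v # l) = evl p' \<otimes>\<^bsub>tensor_alg V\<^esub> evl q"
    using Cons.prems V tens_append[OF V, of "[v]" l] by (simp add: v[symmetric] q(2)[symmetric])
  also have "\<dots> = evl (p' \<bind> (\<lambda>a. q \<bind> (\<lambda>b. fret (a @ b))))" by (rule evl_mult[OF kp q(1)])
  finally have "tens V (v # l) = evl (p' \<bind> (\<lambda>a. q \<bind> (\<lambda>b. fret (a @ b))))" .
  moreover have "Poly_Mapping.keys (p' \<bind> (\<lambda>a. q \<bind> (\<lambda>b. fret (a @ b)))) \<subseteq> words (length (v # l))"
    by (rule keys_fbind[OF kp], rule keys_fbind[OF q(1)]) (auto simp: words_def)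
  ultimately show ?case by blast
qed

lemma power_evl:
  assumes "t \<in> carrier (tens_power V n)"
  shows "\<exists>p. Poly_Mapping.keys p \<subseteq> words n \<and> t = evl p"
  using V assms
proof (induction t rule: tens_power_induct)
  case (tens l)
  then show ?case using tens_evl by auto
next
  case (add s t)
  then show ?case by (metis evl_add keys_subsetI(1))
next
  case (smult a t)
  then show ?case by (metis evl_scale keys_subsetI(3))
next
  case zero
  then show ?case by (intro exI[of _ 0]) simp
qed

lemma linear_words_eq:
  assumes W: "vec_space W" and f: "linear_map (tens_power V n) W f" and g: "linear_map (tens_power V n) W g"
    and eq: "\<And>l. l \<in> words n \<Longrightarrow> f (tens V (map \<beta> l)) = g (tens V (map \<beta> l))" and t: "t \<in> carrier (tens_power V n)"
  shows "f t = g t"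
proof -
  obtain p where p: "Poly_Mapping.keys p \<subseteq> words n" "t = evl p" using power_evl[OF t] by blast
  show ?thesis unfolding p(2) linear_evl[OF f W p(1)] linear_evl[OF g W p(1)]
    using p(1) eq linear_mapD(1)[OF g] word_closed(1) by (intro lin_ext_cong[OF W]) blast+
qed

text \<open>The bridge from the word calculus to the axioms: each axiom is an equation between
  represented maps and reduces to an identity between the representing functions.\<close>

lemma represents_eq:
  assumes f: "represents p q f F" and g: "represents p q g G" and eq: "\<And>l. l \<in> words p \<Longrightarrow> F l = G l"
    and t: "t \<in> carrier (tens_power V p)"
  shows "f t = g t"
  using assms by (intro linear_words_eq[of "tens_power V q" p f g t]) (auto simp: represents_def V)

lemma represents_id: "represents n n id fret"
  using linear_map_id_power[OF V] evl_fret by (auto simp: represents_def)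

lemma represents_comp:
  assumes f: "represents p q f F" and g: "represents q r g G"
  shows "represents p r (\<lambda>t. g (f t)) (\<lambda>l. F l \<bind> G)"
  unfolding represents_def
proof (intro conjI ballI)
  show "linear_map (tens_power V p) (tens_power V r) (\<lambda>t. g (f t))"
    using f g by (auto simp: represents_def intro: linear_map_comp)
  fix l assume l: "l \<in> words p"
  then have k: "Poly_Mapping.keys (F l) \<subseteq> words q" using f by (auto simp: represents_def)
  show "Poly_Mapping.keys (F l \<bind> G) \<subseteq> words r"
    by (rule keys_fbind[OF k]) (use g in \<open>auto simp: represents_def\<close>)
  show "g (f (tens V (map \<beta> l))) = evl (F l \<bind> G)"
    using f l represents_eval[OF g k] by (auto simp: represents_def)
qed

lemma represents_tens_map:
  assumes f: "represents p p' f F" and g: "represents q q' g G" and nm: "n = p + q" "m = p' + q'"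
  shows "represents n m (tens_map V p f q g) (\<lambda>l. F (take p l) \<bind> (\<lambda>a. G (drop p l) \<bind> (\<lambda>b. fret (a @ b))))"
  unfolding represents_def
proof (intro conjI ballI)
  have lf: "linear_map (tens_power V p) (tens_power V p') f" and lg: "linear_map (tens_power V q) (tens_power V q') g"
    using f g by (auto simp: represents_def)
  show "linear_map (tens_power V n) (tens_power V m) (tens_map V p f q g)" by (rule tens_map_linear[OF V lf lg nm])
  fix l assume l: "l \<in> words n"
  then have td: "take p l \<in> words p" "drop p l \<in> words q"
    using nm by (auto simp: words_def dest: in_set_takeD in_set_dropD)
  then have k: "Poly_Mapping.keys (F (take p l)) \<subseteq> words p'" "Poly_Mapping.keys (G (drop p l)) \<subseteq> words q'"
    and e: "f (tens V (map \<beta> (take p l))) = evl (F (take p l))" "g (tens V (map \<beta> (drop p l))) = evl (G (drop p l))"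
    using f g by (auto simp: represents_def)
  show "Poly_Mapping.keys (F (take p l) \<bind> (\<lambda>a. G (drop p l) \<bind> (\<lambda>b. fret (a @ b)))) \<subseteq> words m"
    by (rule keys_fbind[OF k(1)], rule keys_fbind[OF k(2)]) (auto simp: words_def nm)
  have s: "set (map \<beta> (take p l)) \<subseteq> carrier V" "set (map \<beta> (drop p l)) \<subseteq> carrier V" "length (take p l) = p" "length (drop p l) = q"
    using td map_\<beta> by (auto simp: words_def simp del: set_map)
  have "tens_map V p f q g (tens V (map \<beta> (take p l) @ map \<beta> (drop p l))) = f (tens V (map \<beta> (take p l))) \<otimes>\<^bsub>tensor_alg V\<^esub> g (tens V (map \<beta> (drop p l)))"
    using s by (intro tens_map_tens[OF V lf lg]) simp_all
  then show "tens_map V p f q g (tens V (map \<beta> l)) = evl (F (take p l) \<bind> (\<lambda>a. G (drop p l) \<bind> (\<lambda>b. fret (a @ b))))"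
    using evl_mult[OF k] e by (simp flip: map_append)
qed

lemma represents_id_right:
  assumes f: "represents p p' f F" and nm: "n = p + q" "m = p' + q"
  shows "represents n m (tens_map V p f q id) (\<lambda>l. F (take p l) \<bind> (\<lambda>a. fret (a @ drop p l)))"
  using represents_tens_map[OF f represents_id nm] by simp

lemma represents_id_left:
  assumes f: "represents p p' f F" and nm: "n = q + p" "m = q + p'"
  shows "represents n m (tens_map V q id p f) (\<lambda>l. F (drop q l) \<bind> (\<lambda>b. fret (take q l @ b)))"
  using represents_tens_map[OF represents_id f nm] by simp

lemma words_1E: "l \<in> words 1 \<Longrightarrow> \<exists>x\<in>I. l = [x]" and words_2E: "l \<in> words 2 \<Longrightarrow> \<exists>x\<in>I. \<exists>y\<in>I. l = [x, y]"
  and words_3E: "l \<in> words 3 \<Longrightarrow> \<exists>x\<in>I. \<exists>y\<in>I. \<exists>z\<in>I. l = [x, y, z]"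
  by (auto simp: words_def numeral_2_eq_2 numeral_3_eq_3 One_nat_def length_Suc_conv)

lemma words_iff: "[] \<in> words 0" "[x] \<in> words 1 \<longleftrightarrow> x \<in> I" "[x, y] \<in> words 2 \<longleftrightarrow> x \<in> I \<and> y \<in> I"
  by (auto simp: words_def)

lemma represents_mult:
  assumes A: "assoc_algebra V" and m: "\<And>x y. x \<in> I \<Longrightarrow> y \<in> I \<Longrightarrow> Poly_Mapping.keys (m x y) \<subseteq> I \<and> \<beta> x \<otimes>\<^bsub>V\<^esub> \<beta> y = lin_ext V (m x y) \<beta>"
  shows "represents 2 1 (mult_map V) (\<lambda>l. m (l ! 0) (l ! 1) \<bind> (\<lambda>a. fret [a]))"
  unfolding represents_def
proof (intro conjI ballI mult_map(1)[OF A])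
  fix l assume "l \<in> words 2"
  then obtain x y where xy: "x \<in> I" "y \<in> I" "l = [x, y]" using words_2E by blast
  note k = m[OF xy(1,2), THEN conjunct1]
  show "Poly_Mapping.keys (m (l ! 0) (l ! 1) \<bind> (\<lambda>a. fret [a])) \<subseteq> words 1"
    unfolding xy by (rule keys_fbind[of _ I]) (use k in \<open>auto simp: words_iff\<close>)
  have "mult_map V (tens V (map \<beta> l)) = tens V [lin_ext V (m x y) \<beta>]"
    using xy m \<beta> by (simp add: mult_map(2)[OF A])
  also have "\<dots> = lin_ext (tensor_alg V) (m x y) (\<lambda>a. tens V [\<beta> a])"
    using k \<beta> by (intro lin_ext_linear[OF linear_map_tens_singleton[OF V] V TV]) auto
  also have "\<dots> = lin_ext (tensor_alg V) (m x y) (\<lambda>a. evl (fret [a]))"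
    using k \<beta> V by (intro lin_ext_cong[OF TV]) (auto simp: evl_fret[of _ 1] words_iff subset_iff intro!: tens_closed)
  also have "\<dots> = evl (m x y \<bind> (\<lambda>a. fret [a]))" by (rule evl_bind[OF k, symmetric, of _ 1]) (auto simp: words_iff)
  finally show "mult_map V (tens V (map \<beta> l)) = evl (m (l ! 0) (l ! 1) \<bind> (\<lambda>a. fret [a]))" by (simp add: xy)
qed

lemma represents_unit:
  assumes A: "assoc_algebra V" and k: "Poly_Mapping.keys u \<subseteq> I" "\<one>\<^bsub>V\<^esub> = lin_ext V u \<beta>"
  shows "represents 0 1 (unit_map V) (\<lambda>l. u \<bind> (\<lambda>a. fret [a]))"
  unfolding represents_def
proof (intro conjI ballI unit_map(1)[OF A])
  fix l assume "l \<in> words 0"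
  then have l: "l = []" by (simp add: words_def)
  show "Poly_Mapping.keys (u \<bind> (\<lambda>a. fret [a])) \<subseteq> words 1"
    by (rule keys_fbind[of _ I]) (use k in \<open>auto simp: words_iff\<close>)
  have "unit_map V (tens V (map \<beta> l)) = tens V [lin_ext V u \<beta>]"
    using unit_map(2)[OF A] by (simp add: l k(2) del: tens_Nil)
  also have "\<dots> = lin_ext (tensor_alg V) u (\<lambda>a. tens V [\<beta> a])"
    using k \<beta> by (intro lin_ext_linear[OF linear_map_tens_singleton[OF V] V TV]) auto
  also have "\<dots> = lin_ext (tensor_alg V) u (\<lambda>a. evl (fret [a]))"
    using k \<beta> V by (intro lin_ext_cong[OF TV]) (auto simp: evl_fret[of _ 1] words_iff subset_iff intro!: tens_closed)
  also have "\<dots> = evl (u \<bind> (\<lambda>a. fret [a]))" by (rule evl_bind[OF k(1), symmetric, of _ 1]) (auto simp: words_iff)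
  finally show "unit_map V (tens V (map \<beta> l)) = evl (u \<bind> (\<lambda>a. fret [a]))" .
qed

lemma linear_span_eq:
  assumes W: "vec_space W" and f: "linear_map V W f" and g: "linear_map V W g" and eq: "\<And>i. i \<in> I \<Longrightarrow> f (\<beta> i) = g (\<beta> i)"
    and v: "v \<in> carrier V"
  shows "f v = g v"
proof -
  obtain p where p: "Poly_Mapping.keys p \<subseteq> I" "v = lin_ext V p \<beta>" using span[OF v] by blast
  have "f v = lin_ext W p (\<lambda>i. f (\<beta> i))" "g v = lin_ext W p (\<lambda>i. g (\<beta> i))"
    unfolding p(2) using p(1) \<beta> by (intro lin_ext_linear[OF f V W] lin_ext_linear[OF g V W]; blast)+
  moreover have "lin_ext W p (\<lambda>i. f (\<beta> i)) = lin_ext W p (\<lambda>i. g (\<beta> i))"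
    using p(1) eq \<beta> linear_mapD(1)[OF g] by (intro lin_ext_cong[OF W]) blast+
  ultimately show ?thesis by simp
qed

end

section \<open>The braided tensor algebra of a braided algebra\<close>

lemma list_1 [simp]: "take 1 (x # xs) = [x]" "drop 1 (x # xs) = xs" "(x # xs) ! 1 = xs ! 0"
  by (simp_all add: One_nat_def)

lemma lin_ext_free_fret:
  fixes V :: "('k::field, 'v, 'm) module_scheme"
  assumes "Poly_Mapping.keys p \<subseteq> lists (carrier V)"
  shows "lin_ext (free_alg V) p fret = p"
  using assms
proof (induction p rule: free_module_induct)
  case (add x a t)
  then have k: "x \<in> lists (carrier V)" "Poly_Mapping.keys t \<subseteq> lists (carrier V)" by (simp_all add: keys_single_add)
  have f: "fret y \<in> carrier (free_alg V)" if "y \<in> lists (carrier V)" for y :: "'v list"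
    using that by simp
  have "lin_ext (free_alg V) (Poly_Mapping.single x a + t) fret = a \<odot>\<^bsub>free_alg V\<^esub> fret x \<oplus>\<^bsub>free_alg V\<^esub> lin_ext (free_alg V) t fret"
    using add(1,2) k f by (intro lin_ext_single_add assoc_algebraD(1)[OF free_alg]) blast+
  then show ?case using add.IH[OF k(2)] by simp
qed (simp add: assoc_algebraD(1)[OF free_alg])

locale based_braided_algebra =
  fixes A :: "('k::field, 'a) braided_space" and E :: "'a set" and g :: "'a \<Rightarrow> ('a \<Rightarrow>\<^sub>0 'k)"
  assumes A: "braided_algebra A" and E: "coordinates A E g"
begin

lemma AA: "assoc_algebra A" and VA: "vec_space A" and cA: "linear_map (tens_power A 2) (tens_power A 2) (braiding A)"
  using A by (auto simp: braided_algebra_def braided_vec_space_def)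

lemma E_carrier: "x \<in> E \<Longrightarrow> x \<in> carrier A" and g_E: "x \<in> E \<Longrightarrow> g x = fret x"
  and g_keys: "a \<in> carrier A \<Longrightarrow> Poly_Mapping.keys (g a) \<subseteq> E" and g_sum: "a \<in> carrier A \<Longrightarrow> lin_ext A (g a) (\<lambda>x. x) = a"
  and g_add: "a \<in> carrier A \<Longrightarrow> b \<in> carrier A \<Longrightarrow> g (a \<oplus>\<^bsub>A\<^esub> b) = g a + g b"
  and g_smult: "a \<in> carrier A \<Longrightarrow> g (k \<odot>\<^bsub>A\<^esub> a) = fscale k (g a)"
  using E by (auto simp: coordinates_def)

sublocale A: model A "\<lambda>x. x" E
proof
  show "\<exists>p. Poly_Mapping.keys p \<subseteq> E \<and> v = lin_ext A p (\<lambda>x. x)" if "v \<in> carrier A" for v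
    using g_keys[OF that] g_sum[OF that] by metis
qed (auto simp: VA E_carrier)

section \<open>Coordinates on the tensor algebra in terms of basis words\<close>

primrec gw :: "'a list \<Rightarrow> ('a list \<Rightarrow>\<^sub>0 'k)" where
  "gw [] = fret []"
| "gw (a # l) = g a \<bind> (\<lambda>x. gw l \<bind> (\<lambda>r. fret (x # r)))"

lemma gw_keys: "set l \<subseteq> carrier A \<Longrightarrow> Poly_Mapping.keys (gw l) \<subseteq> A.words (length l)"
proof (induction l)
  case (Cons a l)
  then have k: "Poly_Mapping.keys (g a) \<subseteq> E" "Poly_Mapping.keys (gw l) \<subseteq> A.words (length l)" using g_keys by auto
  show ?case unfolding gw.simps by (rule keys_fbind[OF k(1)], rule keys_fbind[OF k(2)]) (auto simp: A.words_def)
qed (simp add: A.words_def)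

lemma gw_word: "set l \<subseteq> E \<Longrightarrow> gw l = fret l"
  by (induction l) (simp_all add: g_E)

lemma free_vec_space: "vec_space (free_alg A)"
  by (rule assoc_algebraD(1)[OF free_alg])

lemma gw_multilinear: "multilinear A (free_alg A) gw"
  unfolding multilinear_def
proof (intro conjI allI impI ballI)
  show "gw l \<in> carrier (free_alg A)" if "set l \<subseteq> carrier A" for l
    using gw_keys[OF that] E_carrier by (force simp: A.words_def)
  fix u w assume "set u \<subseteq> carrier A"
  show "gw (u @ (a \<oplus>\<^bsub>A\<^esub> b) # w) = gw (u @ a # w) \<oplus>\<^bsub>free_alg A\<^esub> gw (u @ b # w)" if "a \<in> carrier A" "b \<in> carrier A" for a b
    using that by (induction u) (simp_all add: g_add fbind_add_right)
  show "gw (u @ (k \<odot>\<^bsub>A\<^esub> a) # w) = k \<odot>\<^bsub>free_alg A\<^esub> gw (u @ a # w)" if "a \<in> carrier A" for k a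
    using that by (induction u) (simp_all add: g_smult fbind_scale_right)
qed

text \<open>The coordinates on \<open>T(A)\<close> with respect to the words over \<open>E\<close>:
  by \<open>reconstruct\<close> and \<open>co_evl\<close> it inverts evaluation. Thus these words
  are linearly independent, and identities of maps on \<open>A\<close> can be read back as
  identities of structure constants.\<close>

definition "co t = lin_ext (free_alg A) t gw"

lemma co_linear: "linear_map (tensor_alg A) (free_alg A) co"
  unfolding co_def by (rule linear_map_lin_ext[OF VA free_vec_space gw_multilinear])

lemma co_add: "s \<in> carrier (tensor_alg A) \<Longrightarrow> t \<in> carrier (tensor_alg A) \<Longrightarrow> co (s \<oplus>\<^bsub>tensor_alg A\<^esub> t) = co s + co t"
  and co_smult: "t \<in> carrier (tensor_alg A) \<Longrightarrow> co (k \<odot>\<^bsub>tensor_alg A\<^esub> t) = fscale k (co t)"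
  using linear_mapD[OF co_linear] by auto

lemma co_tens: "set l \<subseteq> carrier A \<Longrightarrow> co (tens A l) = gw l"
  unfolding co_def by (rule lin_ext_tens[OF VA free_vec_space gw_multilinear])

lemma co_word: "set l \<subseteq> E \<Longrightarrow> co (tens A l) = fret l"
  using E_carrier by (simp add: co_tens gw_word subset_iff)

lemma co_keys: "t \<in> carrier (tensor_alg A) \<Longrightarrow> Poly_Mapping.keys (co t) \<subseteq> lists E"
proof -
  assume t: "t \<in> carrier (tensor_alg A)"
  show ?thesis using VA t
  proof (induction t rule: tensor_alg_induct)
    case (tens l)
    then show ?case using gw_keys[of l] by (auto simp: co_tens A.words_def subset_iff)
  qed (simp_all only: co_add co_smult keys_subsetI)
qed

lemma co_power_keys: "t \<in> carrier (tens_power A n) \<Longrightarrow> Poly_Mapping.keys (co t) \<subseteq> A.words n"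
proof -
  assume t: "t \<in> carrier (tens_power A n)"
  show ?thesis using VA t
  proof (induction t rule: tens_power_induct)
    case (tens l)
    then show ?case using gw_keys[of l] by (auto simp: co_tens)
  next
    case zero
    then show ?case using linear_map_zero[OF co_linear] VA free_vec_space by simp
  qed (simp_all only: co_add co_smult keys_subsetI tens_power_subset)
qed

lemma tens_words: "l \<in> lists E \<Longrightarrow> tens A l \<in> carrier (tensor_alg A)"
  using VA E_carrier by (auto intro!: tens_closed)

lemma words_lists: "S \<subseteq> A.words n \<Longrightarrow> S \<subseteq> lists (carrier A)"
proof
  fix x assume "S \<subseteq> A.words n" "x \<in> S"
  then have "set x \<subseteq> E" by (auto simp: A.words_def)
  then show "x \<in> lists (carrier A)" using E_carrier by (auto simp: in_lists_conv_set)
qed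

lemma reconstruct: "t \<in> carrier (tensor_alg A) \<Longrightarrow> lin_ext (tensor_alg A) (co t) (tens A) = t"
proof -
  assume t: "t \<in> carrier (tensor_alg A)"
  have TV: "vec_space (tensor_alg A)" using VA by simp
  show ?thesis using VA t
  proof (induction t rule: tensor_alg_induct)
    case (tens l)
    obtain p where p: "Poly_Mapping.keys p \<subseteq> A.words (length l)" "tens A l = A.evl p" using A.tens_evl[OF tens] by blast
    have "co (tens A l) = lin_ext (free_alg A) p (\<lambda>l. co (tens A l))"
      using A.linear_evl[OF linear_map_from_power[OF co_linear] free_vec_space p(1)] unfolding p(2) by simp
    also have "\<dots> = lin_ext (free_alg A) p fret"
      using p(1) E_carrier by (intro lin_ext_cong free_vec_space) (auto simp: A.words_def co_word subset_iff lists_eq_set)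
    also have "\<dots> = p" by (rule lin_ext_free_fret[OF words_lists[OF p(1)]])
    finally show ?case using p(2) by (simp add: A.evl_def)
  next
    case (add s t)
    then show ?case using co_keys tens_words by (simp add: co_add lin_ext_add[OF TV] subset_iff)
  next
    case (smult a t)
    then show ?case using co_keys tens_words by (simp add: co_smult lin_ext_scale[OF TV] subset_iff)
  qed
qed

lemma co_evl: "Poly_Mapping.keys p \<subseteq> A.words n \<Longrightarrow> co (A.evl p) = p"
proof -
  assume p: "Poly_Mapping.keys p \<subseteq> A.words n"
  have "co (A.evl p) = lin_ext (free_alg A) p (\<lambda>l. co (tens A l))"
    using A.linear_evl[OF linear_map_from_power[OF co_linear] free_vec_space p] by simp
  also have "\<dots> = lin_ext (free_alg A) p fret"
    using p E_carrier by (intro lin_ext_cong free_vec_space) (auto simp: A.words_def co_word subset_iff lists_eq_set)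
  also have "\<dots> = p" by (rule lin_ext_free_fret[OF words_lists[OF p]])
  finally show ?thesis .
qed

text \<open>Structure constants of the braiding in the basis. The default 0 off \<open>E\<close>
  makes the Yang-Baxter and product laws, which range over all letters of the type, hold there with
  both sides zero.\<close>

definition c :: "'a \<Rightarrow> 'a \<Rightarrow> ('a \<times> 'a \<Rightarrow>\<^sub>0 'k)" where
  "c v w = (if v \<in> E \<and> w \<in> E then co (braiding A (tens A [v, w])) \<bind> (\<lambda>l. fret (l ! 0, l ! 1)) else 0)"
definition m :: "'a \<Rightarrow> 'a \<Rightarrow> ('a \<Rightarrow>\<^sub>0 'k)" where
  "m v w = (if v \<in> E \<and> w \<in> E then g (v \<otimes>\<^bsub>A\<^esub> w) else 0)"
definition u :: "'a \<Rightarrow>\<^sub>0 'k" where "u = g \<one>\<^bsub>A\<^esub>"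

lemma c_zero: "v \<notin> E \<or> w \<notin> E \<Longrightarrow> c v w = 0" "v \<notin> E \<or> w \<notin> E \<Longrightarrow> m v w = 0"
  by (auto simp: c_def m_def)

lemma braiding_word:
  assumes "v \<in> E" "w \<in> E"
  shows "Poly_Mapping.keys (co (braiding A (tens A [v, w]))) \<subseteq> A.words 2"
    "braiding A (tens A [v, w]) = A.evl (co (braiding A (tens A [v, w])))"
proof -
  have t: "braiding A (tens A [v, w]) \<in> carrier (tens_power A 2)"
    using assms E_carrier VA by (intro linear_mapD(1)[OF cA] tens_in_power) auto
  show "Poly_Mapping.keys (co (braiding A (tens A [v, w]))) \<subseteq> A.words 2" by (rule co_power_keys[OF t])
  show "braiding A (tens A [v, w]) = A.evl (co (braiding A (tens A [v, w])))"
    using reconstruct[OF tens_power_subset[OF t]] by (simp add: A.evl_def)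
qed

lemma c_keys: "Poly_Mapping.keys (c v w) \<subseteq> E \<times> E"
proof (cases "v \<in> E \<and> w \<in> E")
  case True
  then have k: "Poly_Mapping.keys (co (braiding A (tens A [v, w]))) \<subseteq> A.words 2" using braiding_word by blast
  have "Poly_Mapping.keys (co (braiding A (tens A [v, w])) \<bind> (\<lambda>l. fret (l ! 0, l ! 1))) \<subseteq> E \<times> E"
  proof (rule keys_fbind[OF k])
    fix l assume "l \<in> A.words 2"
    then obtain a b where "a \<in> E" "b \<in> E" "l = [a, b]" using A.words_2E by blast
    then show "Poly_Mapping.keys (fret (l ! 0, l ! 1) :: _ \<Rightarrow>\<^sub>0 'k) \<subseteq> E \<times> E" by simp
  qed
  then show ?thesis using True by (simp add: c_def)
qed (auto simp: c_def)

lemma c_list: "v \<in> E \<Longrightarrow> w \<in> E \<Longrightarrow> c v w \<bind> (\<lambda>(a, b). fret [a, b]) = co (braiding A (tens A [v, w]))"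
proof -
  assume vw: "v \<in> E" "w \<in> E"
  have "c v w \<bind> (\<lambda>(a, b). fret [a, b]) = co (braiding A (tens A [v, w])) \<bind> (\<lambda>l. fret [l ! 0, l ! 1])"
    using vw by (simp add: c_def)
  also have "\<dots> = co (braiding A (tens A [v, w])) \<bind> fret"
  proof (rule fbind_cong)
    fix l assume "l \<in> Poly_Mapping.keys (co (braiding A (tens A [v, w])))"
    then have "l \<in> A.words 2" using braiding_word(1)[OF vw] by blast
    then obtain a b where "l = [a, b]" using A.words_2E by blast
    then show "fret [l ! 0, l ! 1] = (fret l :: _ \<Rightarrow>\<^sub>0 'k)" by simp
  qed
  finally show ?thesis by simp
qed

abbreviation "clist l \<equiv> c (l ! 0) (l ! 1) \<bind> (\<lambda>(a, b). fret [a, b])"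

lemma A_braiding: "A.represents 2 2 (braiding A) clist"
  unfolding A.represents_def
proof (intro conjI ballI cA)
  fix l assume "l \<in> A.words 2"
  then obtain a b where l: "a \<in> E" "b \<in> E" "l = [a, b]" using A.words_2E by blast
  show "Poly_Mapping.keys (clist l) \<subseteq> A.words 2" "braiding A (tens A (map (\<lambda>x. x) l)) = A.evl (clist l)"
    using braiding_word[OF l(1,2)] c_list[OF l(1,2)] by (simp_all add: l(3))
qed

lemma m_keys: "Poly_Mapping.keys (m v w) \<subseteq> E" and m_sum: "v \<in> E \<Longrightarrow> w \<in> E \<Longrightarrow> lin_ext A (m v w) (\<lambda>x. x) = v \<otimes>\<^bsub>A\<^esub> w"
  using E_carrier g_keys[of "v \<otimes>\<^bsub>A\<^esub> w"] g_sum[of "v \<otimes>\<^bsub>A\<^esub> w"] AA by (auto simp: m_def)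

lemma u_keys: "Poly_Mapping.keys u \<subseteq> E" and u_sum: "lin_ext A u (\<lambda>x. x) = \<one>\<^bsub>A\<^esub>"
  using g_keys[of "\<one>\<^bsub>A\<^esub>"] g_sum[of "\<one>\<^bsub>A\<^esub>"] AA by (auto simp: u_def)

lemma A_mult: "A.represents 2 1 (mult_map A) (\<lambda>l. m (l ! 0) (l ! 1) \<bind> (\<lambda>a. fret [a]))"
  using m_keys m_sum by (intro A.represents_mult AA) auto

lemma A_unit: "A.represents 0 1 (unit_map A) (\<lambda>l. u \<bind> (\<lambda>a. fret [a]))"
  using u_keys u_sum by (intro A.represents_unit AA) auto

text \<open>The converse of \<open>represents_eq\<close>, valid because \<open>co_evl\<close>
  recovers a combination of basis words from its value. It extracts the laws of the structure
  constants from the axioms of \<open>A\<close>.\<close>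

lemma A_eq:
  assumes "A.represents p q f F" "A.represents p q f' F'" "\<And>t. t \<in> carrier (tens_power A p) \<Longrightarrow> f t = f' t" "l \<in> A.words p"
  shows "F l = F' l"
proof -
  have "A.evl (F l) = A.evl (F' l)" "Poly_Mapping.keys (F l) \<subseteq> A.words q" "Poly_Mapping.keys (F' l) \<subseteq> A.words q"
    using assms A.word_closed(1)[OF assms(4)] by (auto simp: A.represents_def)
  then show ?thesis using co_evl by metis
qed

lemmas A_comp = A.represents_comp

lemma A_c12: "A.represents 3 3 (tens_map A 2 (braiding A) 1 id) (\<lambda>l. clist (take 2 l) \<bind> (\<lambda>a. fret (a @ drop 2 l)))"
  by (rule A.represents_id_right[OF A_braiding]) simp_all

lemma A_c23: "A.represents 3 3 (tens_map A 1 id 2 (braiding A)) (\<lambda>l. clist (drop 1 l) \<bind> (\<lambda>b. fret (take 1 l @ b)))"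
  by (rule A.represents_id_left[OF A_braiding]) simp_all

lemma A_m12: "A.represents 3 2 (tens_map A 2 (mult_map A) 1 id) (\<lambda>l. (m (take 2 l ! 0) (take 2 l ! 1) \<bind> (\<lambda>a. fret [a])) \<bind> (\<lambda>a. fret (a @ drop 2 l)))"
  by (rule A.represents_id_right[OF A_mult]) simp_all

lemma A_m23: "A.represents 3 2 (tens_map A 1 id 2 (mult_map A)) (\<lambda>l. (m (drop 1 l ! 0) (drop 1 l ! 1) \<bind> (\<lambda>a. fret [a])) \<bind> (\<lambda>b. fret (take 1 l @ b)))"
  by (rule A.represents_id_left[OF A_mult]) simp_all

lemma A_u1: "A.represents 1 2 (tens_map A 0 (unit_map A) 1 id) (\<lambda>l. (u \<bind> (\<lambda>a. fret [a])) \<bind> (\<lambda>a. fret (a @ drop 0 l)))"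
  by (rule A.represents_id_right[OF A_unit]) simp_all

lemma A_u2: "A.represents 1 2 (tens_map A 1 id 0 (unit_map A)) (\<lambda>l. (u \<bind> (\<lambda>a. fret [a])) \<bind> (\<lambda>b. fret (take 1 l @ b)))"
  by (rule A.represents_id_left[OF A_unit]) simp_all

lemma words3: "x \<in> E \<Longrightarrow> y \<in> E \<Longrightarrow> z \<in> E \<Longrightarrow> [x, y, z] \<in> A.words 3"
  by (simp add: A.words_def)

lemma yang_baxter_letters:
  "c x y \<bind> (\<lambda>(y1, x1). c x1 z \<bind> (\<lambda>(z1, x2). c y1 z1 \<bind> (\<lambda>(z2, y2). fret (z2, y2, x2)))) =
   c y z \<bind> (\<lambda>(z1, y1). c x z1 \<bind> (\<lambda>(z2, x1). c x1 y1 \<bind> (\<lambda>(y2, x2). fret (z2, y2, x2))))"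
proof (cases "x \<in> E \<and> y \<in> E \<and> z \<in> E")
  case True
  have "c x y \<bind> (\<lambda>(y1, x1). c x1 z \<bind> (\<lambda>(z1, x2). c y1 z1 \<bind> (\<lambda>(z2, y2). fret [z2, y2, x2]))) =
   c y z \<bind> (\<lambda>(z1, y1). c x z1 \<bind> (\<lambda>(z2, x1). c x1 y1 \<bind> (\<lambda>(y2, x2). fret [z2, y2, x2])))"
    using A_eq[OF A_comp[OF A_comp[OF A_c12 A_c23] A_c12] A_comp[OF A_comp[OF A_c23 A_c12] A_c23] _ words3[of x y z]] True A
    by (simp add: braided_algebra_def braided_vec_space_def)
  \<comment> \<open>The identity is obtained for lists, the index words of the tensor cube, and
    decoded into triples by reading off the entries.\<close>
  from arg_cong[OF this, of "\<lambda>t. t \<bind> (\<lambda>l. fret (l ! 0, l ! 1, l ! 2))"] show ?thesis by (simp add: split_def)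
next
  case False
  then show ?thesis by (auto simp: c_zero)
qed

sublocale braided_letter_algebra c m u E
proof
  show "Poly_Mapping.keys (c v w) \<subseteq> E \<times> E" for v w by (rule c_keys)
  show "c x y \<bind> (\<lambda>(y1, x1). c x1 z \<bind> (\<lambda>(z1, x2). c y1 z1 \<bind> (\<lambda>(z2, y2). fret (z2, y2, x2)))) =
   c y z \<bind> (\<lambda>(z1, y1). c x z1 \<bind> (\<lambda>(z2, x1). c x1 y1 \<bind> (\<lambda>(y2, x2). fret (z2, y2, x2))))" for x y z
    by (rule yang_baxter_letters)
  show "m x y \<bind> (\<lambda>b. c b z) = c y z \<bind> (\<lambda>(z1, y1). c x z1 \<bind> (\<lambda>(z2, x1). m x1 y1 \<bind> (\<lambda>b. fret (z2, b))))" for x y z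
  proof (cases "x \<in> E \<and> y \<in> E \<and> z \<in> E")
    case True
    have "m x y \<bind> (\<lambda>b. c b z \<bind> (\<lambda>(z1, b1). fret [z1, b1])) =
        c y z \<bind> (\<lambda>(z1, y1). c x z1 \<bind> (\<lambda>(z2, x1). m x1 y1 \<bind> (\<lambda>b. fret [z2, b])))"
      using A_eq[OF A_comp[OF A_m12 A_braiding] A_comp[OF A_comp[OF A_c23 A_c12] A_m23] _ words3[of x y z]] True A
      by (simp add: braided_algebra_def)
    from arg_cong[OF this, of "\<lambda>t. t \<bind> (\<lambda>l. fret (l ! 0, l ! 1))"] show ?thesis by (simp add: split_def)
  next
    case False
    then show ?thesis by (auto simp: c_zero)
  qed
  show "m y z \<bind> (\<lambda>d. c x d) = c x y \<bind> (\<lambda>(y1, x1). c x1 z \<bind> (\<lambda>(z1, x2). m y1 z1 \<bind> (\<lambda>d. fret (d, x2))))" for x y z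
  proof (cases "x \<in> E \<and> y \<in> E \<and> z \<in> E")
    case True
    have "m y z \<bind> (\<lambda>d. c x d \<bind> (\<lambda>(d1, x1). fret [d1, x1])) =
        c x y \<bind> (\<lambda>(y1, x1). c x1 z \<bind> (\<lambda>(z1, x2). m y1 z1 \<bind> (\<lambda>d. fret [d, x2])))"
      using A_eq[OF A_comp[OF A_m23 A_braiding] A_comp[OF A_comp[OF A_c12 A_c23] A_m12] _ words3[of x y z]] True A
      by (simp add: braided_algebra_def)
    from arg_cong[OF this, of "\<lambda>t. t \<bind> (\<lambda>l. fret (l ! 0, l ! 1))"] show ?thesis by (simp add: split_def)
  next
    case False
    then show ?thesis by (auto simp: c_zero)
  qed
  fix y assume y: "y \<in> E"
  have w: "[y] \<in> A.words 1" using y by (simp add: A.words_iff)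
  have "u \<bind> (\<lambda>a. c a y \<bind> (\<lambda>(y1, a1). fret [y1, a1])) = u \<bind> (\<lambda>a. fret [y, a])"
    using A_eq[OF A_comp[OF A_u1 A_braiding] A_u2 _ w] A by (simp add: braided_algebra_def)
  from arg_cong[OF this, of "\<lambda>t. t \<bind> (\<lambda>l. fret (l ! 0, l ! 1))"]
  show "u \<bind> (\<lambda>a. c a y) = u \<bind> (\<lambda>a. fret (y, a))" by (simp add: split_def)
  have "u \<bind> (\<lambda>a. c y a \<bind> (\<lambda>(y1, a1). fret [y1, a1])) = u \<bind> (\<lambda>a. fret [a, y])"
    using A_eq[OF A_comp[OF A_u2 A_braiding] A_u1 _ w] A by (simp add: braided_algebra_def)
  from arg_cong[OF this, of "\<lambda>t. t \<bind> (\<lambda>l. fret (l ! 0, l ! 1))"]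
  show "u \<bind> (\<lambda>a. c y a) = u \<bind> (\<lambda>a. fret (a, y))" by (simp add: split_def)
qed

end

section \<open>Supports of the operations on words\<close>

context braided_letter_algebra
begin

lemma cl_keys: "set l \<subseteq> E \<Longrightarrow> v \<in> E \<Longrightarrow> Poly_Mapping.keys (cl l v) \<subseteq> lists E \<times> E"
proof (induction l arbitrary: v)
  case (Cons w l)
  have "Poly_Mapping.keys (cl l v1 \<bind> (\<lambda>(l1, v2). fret (w1 # l1, v2))) \<subseteq> lists E \<times> E" if "w1 \<in> E" "v1 \<in> E" for w1 v1
    by (rule keys_fbind[of _ "lists E \<times> E"]) (use Cons that in \<open>simp_all add: split_def mem_Times_iff\<close>)
  then show ?case unfolding cl.simps by (intro keys_fbind[OF support[of v w]]) (simp add: split_def mem_Times_iff)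
qed simp

lemma cc_keys: "set x \<subseteq> E \<Longrightarrow> set y \<subseteq> E \<Longrightarrow> Poly_Mapping.keys (cc x y) \<subseteq> lists E \<times> lists E"
proof (induction x)
  case (Cons v x)
  then have k: "Poly_Mapping.keys (cc x y) \<subseteq> lists E \<times> lists E" and v: "v \<in> E" by simp_all
  have "Poly_Mapping.keys (cl y1 v \<bind> (\<lambda>(y2, v1). fret (y2, v1 # x1))) \<subseteq> lists E \<times> lists E" if "y1 \<in> lists E" "x1 \<in> lists E" for x1 y1
    by (rule keys_fbind[OF cl_keys[OF _ v]]) (use that in \<open>simp_all add: split_def mem_Times_iff lists_eq_set\<close>)
  then show ?case unfolding cc.simps by (intro keys_fbind[OF k]) (simp add: split_def mem_Times_iff)
qed (simp add: lists_eq_set)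

lemma dl_keys: "set x \<subseteq> E \<Longrightarrow> Poly_Mapping.keys (dl x) \<subseteq> lists E \<times> lists E"
proof (induction x)
  case (Cons v x)
  then have k: "Poly_Mapping.keys (dl x) \<subseteq> lists E \<times> lists E" and v: "v \<in> E" by simp_all
  have "Poly_Mapping.keys (cl a v \<bind> (\<lambda>(a1, v1). fret (a1, v1 # b))) \<subseteq> lists E \<times> lists E" if "a \<in> lists E" "b \<in> lists E" for a b
    by (rule keys_fbind[OF cl_keys[OF _ v]]) (use that in \<open>simp_all add: split_def mem_Times_iff lists_eq_set\<close>)
  then show ?case unfolding dl.simps using v
    by (intro keys_subsetI(1) keys_fbind[OF k]) (simp_all add: split_def mem_Times_iff)
qed simp

lemma mm_keys:
  assumes "\<And>x y. Poly_Mapping.keys (m x y) \<subseteq> E" "Poly_Mapping.keys u \<subseteq> E"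
  shows "Poly_Mapping.keys (mm x) \<subseteq> E"
  by (induction x) (auto simp: assms(2) intro!: keys_fbind[OF _ assms(1), THEN subsetD])

end

section \<open>The structure maps of the tensor algebra, defined on words\<close>

context based_braided_algebra
begin

text \<open>\<open>cc\<close>, and in the next line \<open>dl\<close>, with the resulting pair of
  words encoded as a list of length two, an index word of \<open>T \<otimes> T\<close>.\<close>

definition bw :: "'a list \<Rightarrow> 'a list \<Rightarrow> ('a list list \<Rightarrow>\<^sub>0 'k)" where "bw x y = cc x y \<bind> (\<lambda>(a, b). fret [a, b])"
definition dw :: "'a list \<Rightarrow> ('a list list \<Rightarrow>\<^sub>0 'k)" where "dw x = dl x \<bind> (\<lambda>(a, b). fret [a, b])"

text \<open>The operations are extended linearly from basis words by means of \<open>co\<close>. The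
  local \<open>ev\<close> is \<open>T.evl\<close> written out over
  \<open>tensor_alg (tensor_alg A)\<close>, since the record cannot refer to its own tensor algebra;
  \<open>T_tensor\<close> identifies the two. The counit is the coefficient of the empty
  word.\<close>

definition T :: "('k, 'a list \<Rightarrow>\<^sub>0 'k) braided_bialg" where
  "T = (let ev = (\<lambda>p. lin_ext (tensor_alg (tensor_alg A)) p (\<lambda>l. tens (tensor_alg A) (map (tens A) l))) in
     \<lparr>carrier = carrier (tensor_alg A), monoid.mult = monoid.mult (tensor_alg A), monoid.one = \<one>\<^bsub>tensor_alg A\<^esub>,
      ring.zero = \<zero>\<^bsub>tensor_alg A\<^esub>, ring.add = ring.add (tensor_alg A), module.smult = module.smult (tensor_alg A),
      braiding = multilin (tensor_alg (tensor_alg A)) 2 (\<lambda>l. ev (co (l ! 0) \<bind> (\<lambda>x. co (l ! 1) \<bind> bw x))),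
      comult = (\<lambda>t. ev (co t \<bind> dw)), counit = (\<lambda>t. Poly_Mapping.lookup (co t) [])\<rparr>)"

lemma T_simps [simp]:
  "carrier T = carrier (tensor_alg A)" "monoid.mult T = monoid.mult (tensor_alg A)" "\<one>\<^bsub>T\<^esub> = \<one>\<^bsub>tensor_alg A\<^esub>"
  "\<zero>\<^bsub>T\<^esub> = \<zero>\<^bsub>tensor_alg A\<^esub>" "ring.add T = ring.add (tensor_alg A)" "module.smult T = module.smult (tensor_alg A)"
  by (simp_all add: T_def Let_def)

lemma T_truncate: "module.truncate T = tensor_alg A"
  by (simp add: module.truncate_def)

lemmas T_tensor = tensor_alg_truncate[of T, unfolded T_truncate]

lemma T_algebra: "assoc_algebra T"
  by (rule assoc_algebra_surj_image[of "tensor_alg A" T "\<lambda>x. x"]) (simp_all add: VA)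

lemma VT: "vec_space T" by (rule assoc_algebraD(1)[OF T_algebra])

lemma lin_ext_T: "lin_ext T p h = lin_ext (tensor_alg A) p h"
  by (simp add: lin_ext_def finsum_def finprod_def)

lemma listsD: "x \<in> lists E \<Longrightarrow> set x \<subseteq> E"
  by (auto simp: in_lists_conv_set)

text \<open>Tensors over \<open>T\<close> are thus spanned by words whose letters are themselves
  words over \<open>E\<close>, which accounts for the lists of lists below.\<close>

lemma T_model: "model T (tens A) (lists E)"
proof (unfold model_def, intro conjI allI impI)
  show "vec_space T" by (rule VT)
  show "tens A l \<in> carrier T" if "l \<in> lists E" for l
    using tens_words[OF that] by simp
  fix t assume "t \<in> carrier T"
  then have "t \<in> carrier (tensor_alg A)" by simp
  then show "\<exists>p. Poly_Mapping.keys p \<subseteq> lists E \<and> t = lin_ext T p (tens A)"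
    unfolding lin_ext_T by (intro exI[of _ "co t"] conjI co_keys reconstruct[symmetric])
qed

sublocale T: model T "tens A" "lists E"
  by (rule T_model)

lemma T_ops:
  "braiding T = multilin (tensor_alg T) 2 (\<lambda>l. T.evl (co (l ! 0) \<bind> (\<lambda>x. co (l ! 1) \<bind> bw x)))"
  "comult T t = T.evl (co t \<bind> dw)" "counit T t = Poly_Mapping.lookup (co t) []"
proof -
  let ?ev = "\<lambda>p. lin_ext (tensor_alg (tensor_alg A)) p (\<lambda>l. tens (tensor_alg A) (map (tens A) l))"
  have "braiding T = multilin (tensor_alg (tensor_alg A)) 2 (\<lambda>l. ?ev (co (l ! 0) \<bind> (\<lambda>x. co (l ! 1) \<bind> bw x)))"
    "comult T t = ?ev (co t \<bind> dw)"
    by (simp_all add: T_def Let_def)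
  then show "braiding T = multilin (tensor_alg T) 2 (\<lambda>l. T.evl (co (l ! 0) \<bind> (\<lambda>x. co (l ! 1) \<bind> bw x)))"
    "comult T t = T.evl (co t \<bind> dw)"
    by (simp_all only: T.evl_def T_tensor)
  show "counit T t = Poly_Mapping.lookup (co t) []" by (simp add: T_def Let_def)
qed

lemma bw_keys: "x \<in> lists E \<Longrightarrow> y \<in> lists E \<Longrightarrow> Poly_Mapping.keys (bw x y) \<subseteq> T.words 2"
  unfolding bw_def by (rule keys_fbind[OF cc_keys]) (simp_all add: listsD split_def mem_Times_iff T.words_iff)

lemma dw_keys: "x \<in> lists E \<Longrightarrow> Poly_Mapping.keys (dw x) \<subseteq> T.words 2"
  unfolding dw_def by (rule keys_fbind[OF dl_keys]) (simp_all add: listsD split_def mem_Times_iff T.words_iff)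

lemma co_bw_keys:
  "s \<in> carrier (tensor_alg A) \<Longrightarrow> t \<in> carrier (tensor_alg A) \<Longrightarrow> Poly_Mapping.keys (co s \<bind> (\<lambda>x. co t \<bind> bw x)) \<subseteq> T.words 2"
  by (rule keys_fbind[OF co_keys], assumption, rule keys_fbind[OF co_keys], assumption, rule bw_keys)

lemma co_dw_keys: "t \<in> carrier (tensor_alg A) \<Longrightarrow> Poly_Mapping.keys (co t \<bind> dw) \<subseteq> T.words 2"
  by (rule keys_fbind[OF co_keys], assumption, rule dw_keys)

lemma co_list: "l \<in> lists E \<Longrightarrow> co (tens A l) = fret l"
  by (simp add: co_word lists_eq_set)

lemma T_braiding: "T.represents 2 2 (braiding T) (\<lambda>l. bw (l ! 0) (l ! 1))"
proof -
  have m: "multilinear_on 2 T (tensor_alg T) (\<lambda>l. T.evl (co (l ! 0) \<bind> (\<lambda>x. co (l ! 1) \<bind> bw x)))"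
  proof (rule multilinear_on_2I)
    show "linear_map T (tensor_alg T) (\<lambda>s. T.evl (co s \<bind> (\<lambda>x. co t \<bind> bw x)))" if "t \<in> carrier T" for t
      using that by (intro linear_mapI)
        (simp_all add: co_add co_smult T.evl_add[OF co_bw_keys co_bw_keys] T.evl_scale[OF co_bw_keys] T.evl_closed[OF co_bw_keys])
    show "linear_map T (tensor_alg T) (\<lambda>t. T.evl (co s \<bind> (\<lambda>x. co t \<bind> bw x)))" if "s \<in> carrier T" for s
      using that by (intro linear_mapI)
        (simp_all add: co_add co_smult T.evl_add[OF co_bw_keys co_bw_keys] T.evl_scale[OF co_bw_keys] T.evl_closed[OF co_bw_keys] fbind_add_right fbind_scale_right)
  qed
  show ?thesis unfolding T.represents_def
  proof (intro conjI ballI)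
    show "linear_map (tens_power T 2) (tens_power T 2) (braiding T)"
      unfolding T_ops
    proof (rule multilin_linear_power[OF VT VT m])
      fix l assume "set l \<subseteq> carrier T" "length l = 2"
      then obtain s t where "s \<in> carrier T" "t \<in> carrier T" "l = [s, t]" by (auto simp: numeral_2_eq_2 length_Suc_conv)
      then show "T.evl (co (l ! 0) \<bind> (\<lambda>x. co (l ! 1) \<bind> bw x)) \<in> carrier (tens_power T 2)"
        by (simp add: T.evl_power[OF co_bw_keys])
    qed
    fix l assume "l \<in> T.words 2"
    then obtain x y where l: "x \<in> lists E" "y \<in> lists E" "l = [x, y]" using T.words_2E by blast
    show "Poly_Mapping.keys (bw (l ! 0) (l ! 1)) \<subseteq> T.words 2" using bw_keys l by simp
    show "braiding T (tens T (map (tens A) l)) = T.evl (bw (l ! 0) (l ! 1))"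
      unfolding T_ops using l tens_words by (subst multilin_tens[OF VT T.TV m]) (simp_all add: co_list)
  qed
qed

lemma T_mult: "T.represents 2 1 (mult_map T) (\<lambda>l. fret (l ! 0 @ l ! 1) \<bind> (\<lambda>a. fret [a]))"
proof (rule T.represents_mult[OF T_algebra])
  fix x y assume xy: "x \<in> lists E" "y \<in> lists E"
  then have "tens A x \<otimes>\<^bsub>T\<^esub> tens A y = tens A (x @ y)"
    using tens_append[OF VA, of x y] E_carrier by (simp add: lists_eq_set subset_iff)
  then show "Poly_Mapping.keys (fret (x @ y) :: _ \<Rightarrow>\<^sub>0 'k) \<subseteq> lists E \<and> tens A x \<otimes>\<^bsub>T\<^esub> tens A y = lin_ext T (fret (x @ y)) (tens A)"
    using xy tens_words VT VA by (simp add: lin_ext_single)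
qed

lemma T_unit: "T.represents 0 1 (unit_map T) (\<lambda>l. fret [] \<bind> (\<lambda>a. fret [a]))"
  by (rule T.represents_unit[OF T_algebra]) (use tens_words VT VA in \<open>simp_all add: lin_ext_single\<close>)

lemma T_counit_linear: "counit_linear T"
  unfolding counit_linear_def by (simp add: T_ops co_add co_smult lookup_add)

lemma T_comult_linear: "linear_map T (tens_power T 2) (comult T)"
  by (rule linear_mapI) (simp_all add: T_ops co_add co_smult T.evl_add[OF co_dw_keys co_dw_keys] T.evl_scale[OF co_dw_keys] T.evl_power[OF co_dw_keys])

lemma T_comult: "T.represents 1 2 (comult_map T) (\<lambda>l. dw (l ! 0))"
  unfolding T.represents_def
proof (intro conjI ballI comult_map[OF VT T_comult_linear])
  fix l assume "l \<in> T.words 1"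
  then obtain x where l: "x \<in> lists E" "l = [x]" using T.words_1E by blast
  then show "Poly_Mapping.keys (dw (l ! 0)) \<subseteq> T.words 2" "comult_map T (tens T (map (tens A) l)) = T.evl (dw (l ! 0))"
    using tens_words dw_keys by (simp_all add: comult_map(2)[OF VT T_comult_linear] T_ops co_list)
qed

lemma T_counit: "T.represents 1 0 (counit_map T) (\<lambda>l. if l ! 0 = [] then fret [] else 0)"
  unfolding T.represents_def
proof (intro conjI ballI counit_map[OF VT T_counit_linear])
  fix l assume "l \<in> T.words 1"
  then obtain x where l: "x \<in> lists E" "l = [x]" using T.words_1E by blast
  then show "Poly_Mapping.keys (if l ! 0 = [] then fret [] else 0 :: _ \<Rightarrow>\<^sub>0 'k) \<subseteq> T.words 0"
    by (simp add: T.words_iff)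
  show "counit_map T (tens T (map (tens A) l)) = T.evl (if l ! 0 = [] then fret [] else 0)"
    using l tens_words VT by (simp add: counit_map(2)[OF VT T_counit_linear] T_ops co_list T.evl_fret[OF T.words_iff(1)] lookup_single)
qed

lemma T_c12: "T.represents 3 3 (tens_map T 2 (braiding T) 1 id) (\<lambda>l. bw (take 2 l ! 0) (take 2 l ! 1) \<bind> (\<lambda>a. fret (a @ drop 2 l)))"
  by (rule T.represents_id_right[OF T_braiding]) simp_all

lemma T_c23: "T.represents 3 3 (tens_map T 1 id 2 (braiding T)) (\<lambda>l. bw (drop 1 l ! 0) (drop 1 l ! 1) \<bind> (\<lambda>b. fret (take 1 l @ b)))"
  by (rule T.represents_id_left[OF T_braiding]) simp_all

lemma T_m12: "T.represents 3 2 (tens_map T 2 (mult_map T) 1 id) (\<lambda>l. (fret (take 2 l ! 0 @ take 2 l ! 1) \<bind> (\<lambda>a. fret [a])) \<bind> (\<lambda>a. fret (a @ drop 2 l)))"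
  by (rule T.represents_id_right[OF T_mult]) simp_all

lemma T_m23: "T.represents 3 2 (tens_map T 1 id 2 (mult_map T)) (\<lambda>l. (fret (drop 1 l ! 0 @ drop 1 l ! 1) \<bind> (\<lambda>a. fret [a])) \<bind> (\<lambda>b. fret (take 1 l @ b)))"
  by (rule T.represents_id_left[OF T_mult]) simp_all

lemma T_u1: "T.represents 1 2 (tens_map T 0 (unit_map T) 1 id) (\<lambda>l. (fret [] \<bind> (\<lambda>a. fret [a])) \<bind> (\<lambda>a. fret (a @ drop 0 l)))"
  by (rule T.represents_id_right[OF T_unit]) simp_all

lemma T_u2: "T.represents 1 2 (tens_map T 1 id 0 (unit_map T)) (\<lambda>l. (fret [] \<bind> (\<lambda>a. fret [a])) \<bind> (\<lambda>b. fret (take 1 l @ b)))"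
  by (rule T.represents_id_left[OF T_unit]) simp_all

lemma T_d1: "q = p + 1 \<Longrightarrow> r = p + 2 \<Longrightarrow> T.represents q r (tens_map T 1 (comult_map T) p id) (\<lambda>l. dw (take 1 l ! 0) \<bind> (\<lambda>a. fret (a @ drop 1 l)))"
  by (rule T.represents_id_right[OF T_comult]) simp_all

lemma T_d2: "q = p + 1 \<Longrightarrow> r = p + 2 \<Longrightarrow> T.represents q r (tens_map T p id 1 (comult_map T)) (\<lambda>l. dw (drop p l ! 0) \<bind> (\<lambda>b. fret (take p l @ b)))"
  by (rule T.represents_id_left[OF T_comult]) simp_all

lemma T_e1: "T.represents 2 1 (tens_map T 1 (counit_map T) 1 id) (\<lambda>l. (if take 1 l ! 0 = [] then fret [] else 0) \<bind> (\<lambda>a. fret (a @ drop 1 l)))"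
  by (rule T.represents_id_right[OF T_counit]) simp_all

lemma T_e2: "T.represents 2 1 (tens_map T 1 id 1 (counit_map T)) (\<lambda>l. (if drop 1 l ! 0 = [] then fret [] else 0) \<bind> (\<lambda>b. fret (take 1 l @ b)))"
  by (rule T.represents_id_left[OF T_counit]) simp_all

lemmas T_comp = T.represents_comp

lemma if_bind: "(if P then t else 0) \<bind> f = (if P then t \<bind> f else 0)"
  by simp

section \<open>The axioms of a braided bialgebra, reduced to identities between words\<close>

lemma T_braided_vec_space: "braided_vec_space T"
  unfolding braided_vec_space_def
proof (intro conjI ballI VT)
  show "linear_map (tens_power T 2) (tens_power T 2) (braiding T)" using T_braiding by (simp add: T.represents_def)
  fix t assume t: "t \<in> carrier (tens_power T 3)"
  show "tens_map T 2 (braiding T) 1 id (tens_map T 1 id 2 (braiding T) (tens_map T 2 (braiding T) 1 id t)) =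
      tens_map T 1 id 2 (braiding T) (tens_map T 2 (braiding T) 1 id (tens_map T 1 id 2 (braiding T) t))"
  proof (rule T.represents_eq[OF T_comp[OF T_comp[OF T_c12 T_c23] T_c12] T_comp[OF T_comp[OF T_c23 T_c12] T_c23] _ t])
    fix l assume "l \<in> T.words 3"
    then obtain x y z where l: "l = [x, y, z]" using T.words_3E by blast
    show "((bw (take 2 l ! 0) (take 2 l ! 1) \<bind> (\<lambda>a. fret (a @ drop 2 l))) \<bind> (\<lambda>l. bw (drop 1 l ! 0) (drop 1 l ! 1) \<bind> (\<lambda>b. fret (take 1 l @ b)))) \<bind>
        (\<lambda>l. bw (take 2 l ! 0) (take 2 l ! 1) \<bind> (\<lambda>a. fret (a @ drop 2 l))) =
      ((bw (drop 1 l ! 0) (drop 1 l ! 1) \<bind> (\<lambda>b. fret (take 1 l @ b))) \<bind> (\<lambda>l. bw (take 2 l ! 0) (take 2 l ! 1) \<bind> (\<lambda>a. fret (a @ drop 2 l)))) \<bind>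
        (\<lambda>l. bw (drop 1 l ! 0) (drop 1 l ! 1) \<bind> (\<lambda>b. fret (take 1 l @ b)))"
      using yb_words[of x y z "\<lambda>a b c. fret [a, b, c]"] by (simp add: l bw_def)
  qed
qed

lemma T_braided_algebra: "braided_algebra T"
  unfolding braided_algebra_def
proof (intro conjI ballI T_algebra T_braided_vec_space)
  fix t assume t: "t \<in> carrier (tens_power T 3)"
  show "braiding T (tens_map T 2 (mult_map T) 1 id t) =
      tens_map T 1 id 2 (mult_map T) (tens_map T 2 (braiding T) 1 id (tens_map T 1 id 2 (braiding T) t))"
  proof (rule T.represents_eq[OF T_comp[OF T_m12 T_braiding] T_comp[OF T_comp[OF T_c23 T_c12] T_m23] _ t], goal_cases)
    case (1 l)
    then obtain x y z where l: "l = [x, y, z]" using T.words_3E by blast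
    show ?case by (simp add: l bw_def cc_append_left split_def)
  qed
  show "braiding T (tens_map T 1 id 2 (mult_map T) t) =
      tens_map T 2 (mult_map T) 1 id (tens_map T 1 id 2 (braiding T) (tens_map T 2 (braiding T) 1 id t))"
  proof (rule T.represents_eq[OF T_comp[OF T_m23 T_braiding] T_comp[OF T_comp[OF T_c12 T_c23] T_m12] _ t], goal_cases)
    case (1 l)
    then obtain x y z where l: "l = [x, y, z]" using T.words_3E by blast
    show ?case by (simp add: l bw_def cc_append_right split_def)
  qed
next
  fix t assume t: "t \<in> carrier (tens_power T 1)"
  show "braiding T (tens_map T 0 (unit_map T) 1 id t) = tens_map T 1 id 0 (unit_map T) t"
  proof (rule T.represents_eq[OF T_comp[OF T_u1 T_braiding] T_u2 _ t], goal_cases)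
    case (1 l)
    then obtain x where l: "l = [x]" using T.words_1E by blast
    show ?case by (simp add: l bw_def)
  qed
  show "braiding T (tens_map T 1 id 0 (unit_map T) t) = tens_map T 0 (unit_map T) 1 id t"
  proof (rule T.represents_eq[OF T_comp[OF T_u2 T_braiding] T_u1 _ t], goal_cases)
    case (1 l)
    then obtain x where l: "l = [x]" using T.words_1E by blast
    show ?case by (simp add: l bw_def)
  qed
qed

lemma tens_1: "x \<in> carrier T \<Longrightarrow> tens T [x] \<in> carrier (tens_power T 1)" "x \<in> carrier T \<Longrightarrow> comult T x = comult_map T (tens T [x])"
  using VT comult_map(2)[OF VT T_comult_linear] by (auto intro!: tens_in_power)

lemma T_braided_coalgebra: "braided_coalgebra T"
  unfolding braided_coalgebra_def
proof (intro conjI ballI T_braided_vec_space T_counit_linear T_comult_linear)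
  fix x assume x: "x \<in> carrier T"
  show "tens_map T 1 (comult_map T) 1 id (comult T x) = tens_map T 1 id 1 (comult_map T) (comult T x)"
    unfolding tens_1(2)[OF x]
  proof (rule T.represents_eq[OF T_comp[OF T_comult T_d1] T_comp[OF T_comult T_d2] _ tens_1(1)[OF x]], goal_cases)
    \<comment> \<open>The first four goals are the degree equations of \<open>T_d1\<close> and
      \<open>T_d2\<close>; the fifth is coassociativity on words.\<close>
    case (5 l)
    then obtain x where l: "l = [x]" using T.words_1E by blast
    show ?case using dl_coassoc[of x "\<lambda>a b c. fret [a, b, c]"] by (simp add: l dw_def)
  qed simp_all
  have "tens_map T 1 (counit_map T) 1 id (comult_map T (tens T [x])) = id (tens T [x])"
  proof (rule T.represents_eq[OF T_comp[OF T_comult T_e1] T.represents_id _ tens_1(1)[OF x]], goal_cases)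
    case (1 l)
    then obtain x where l: "l = [x]" using T.words_1E by blast
    show ?case using dl_counit(1)[of x "\<lambda>a. fret [a]"] by (simp add: l dw_def if_bind cong: if_cong)
  qed
  then show "tens_map T 1 (counit_map T) 1 id (comult T x) = tens T [x]" by (simp add: tens_1(2)[OF x])
  have "tens_map T 1 id 1 (counit_map T) (comult_map T (tens T [x])) = id (tens T [x])"
  proof (rule T.represents_eq[OF T_comp[OF T_comult T_e2] T.represents_id _ tens_1(1)[OF x]], goal_cases)
    case (1 l)
    then obtain x where l: "l = [x]" using T.words_1E by blast
    show ?case using dl_counit(2)[of x "\<lambda>a. fret [a]"] by (simp add: l dw_def if_bind cong: if_cong)
  qed
  then show "tens_map T 1 id 1 (counit_map T) (comult T x) = tens T [x]" by (simp add: tens_1(2)[OF x])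
next
  fix t assume t: "t \<in> carrier (tens_power T 2)"
  show "tens_map T 1 (comult_map T) 1 id (braiding T t) =
      tens_map T 1 id 2 (braiding T) (tens_map T 2 (braiding T) 1 id (tens_map T 1 id 1 (comult_map T) t))"
  proof (rule T.represents_eq[OF T_comp[OF T_braiding T_d1] T_comp[OF T_comp[OF T_d2 T_c12] T_c23] _ t], goal_cases)
    case (5 l)
    then obtain x y where l: "l = [x, y]" using T.words_2E by blast
    show ?case using dl_cc_left[of x y "\<lambda>a b c. fret [a, b, c]"] by (simp add: l dw_def bw_def)
  qed simp_all
  show "tens_map T 1 id 1 (comult_map T) (braiding T t) =
      tens_map T 2 (braiding T) 1 id (tens_map T 1 id 2 (braiding T) (tens_map T 1 (comult_map T) 1 id t))"
  proof (rule T.represents_eq[OF T_comp[OF T_braiding T_d2] T_comp[OF T_comp[OF T_d1 T_c23] T_c12] _ t], goal_cases)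
    case (5 l)
    then obtain x y where l: "l = [x, y]" using T.words_2E by blast
    show ?case using dl_cc_right[of x y "\<lambda>a b c. fret [a, b, c]"] by (simp add: l dw_def bw_def)
  qed simp_all
  show "tens_map T 1 (counit_map T) 1 id (braiding T t) = tens_map T 1 id 1 (counit_map T) t"
  proof (rule T.represents_eq[OF T_comp[OF T_braiding T_e1] T_e2 _ t], goal_cases)
    case (1 l)
    then obtain x y where l: "l = [x, y]" using T.words_2E by blast
    show ?case using cc_counit(1)[of x y "\<lambda>a. fret [a]"] by (simp add: l bw_def if_bind cong: if_cong)
  qed
  show "tens_map T 1 id 1 (counit_map T) (braiding T t) = tens_map T 1 (counit_map T) 1 id t"
  proof (rule T.represents_eq[OF T_comp[OF T_braiding T_e2] T_e1 _ t], goal_cases)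
    case (1 l)
    then obtain x y where l: "l = [x, y]" using T.words_2E by blast
    show ?case using cc_counit(2)[of x y "\<lambda>a. fret [a]"] by (simp add: l bw_def if_bind cong: if_cong)
  qed
qed

lemma T_comult_algebra_map: "comult_algebra_map T"
  unfolding comult_algebra_map_def
proof (intro conjI ballI T_comult_linear)
  have "co (tens A []) = fret []" by (rule co_word) simp
  then show "comult T \<one>\<^bsub>T\<^esub> = tens T [\<one>\<^bsub>T\<^esub>, \<one>\<^bsub>T\<^esub>]"
    using VA T.evl_fret[of "[[], []]" 2] by (simp add: T_ops dw_def T.words_iff)
  fix x y assume xy: "x \<in> carrier T" "y \<in> carrier T"
  have t: "tens T [x, y] \<in> carrier (tens_power T 2)" using xy by (intro tens_in_power[OF VT]) auto
  have d: "linear_map (tens_power T 1) (tens_power T 2) (comult_map T)" by (rule comult_map[OF VT T_comult_linear])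
  have c: "T.represents 4 4 (tens_map T 3 (tens_map T 1 id 2 (braiding T)) 1 id)
      (\<lambda>l. (bw (drop 1 (take 3 l) ! 0) (drop 1 (take 3 l) ! 1) \<bind> (\<lambda>b. fret (take 1 (take 3 l) @ b))) \<bind> (\<lambda>a. fret (a @ drop 3 l)))"
    by (rule T.represents_id_right[OF T_c23]) simp_all
  have m: "T.represents 4 2 (tens_map T 2 (mult_map T) 2 (mult_map T))
      (\<lambda>l. (fret (take 2 l ! 0 @ take 2 l ! 1) \<bind> (\<lambda>a. fret [a])) \<bind> (\<lambda>a. (fret (drop 2 l ! 0 @ drop 2 l ! 1) \<bind> (\<lambda>a. fret [a])) \<bind> (\<lambda>b. fret (a @ b))))"
    by (rule T.represents_tens_map[OF T_mult T_mult]) simp_all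
  \<comment> \<open>The product of two coproducts is written as
    \<open>\<Delta> \<otimes> \<Delta>\<close> applied to \<open>x \<otimes> y\<close>, so that both
    sides of the axiom become maps on the tensor square and \<open>represents_eq\<close>
    applies.\<close>
  have dd: "T.represents 2 4 (tens_map T 1 (comult_map T) 1 (comult_map T))
      (\<lambda>l. dw (take 1 l ! 0) \<bind> (\<lambda>a. dw (drop 1 l ! 0) \<bind> (\<lambda>b. fret (a @ b))))"
    by (rule T.represents_tens_map[OF T_comult T_comult]) simp_all
  have "comult_map T (mult_map T (tens T [x, y])) = tens_map T 2 (mult_map T) 2 (mult_map T)
      (tens_map T 3 (tens_map T 1 id 2 (braiding T)) 1 id (tens_map T 1 (comult_map T) 1 (comult_map T) (tens T [x, y])))"
  proof (rule T.represents_eq[OF T_comp[OF T_mult T_comult] T_comp[OF T_comp[OF dd c] m] _ t], goal_cases)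
    case (1 l)
    then obtain x y where l: "l = [x, y]" using T.words_2E by blast
    show ?case by (simp add: l dw_def bw_def dl_append split_def)
  qed
  moreover have "tens_map T 1 (comult_map T) 1 (comult_map T) (tens T [x, y]) = comult T x \<otimes>\<^bsub>tensor_alg T\<^esub> comult T y"
    using tens_map_tens[OF VT d d, of "[x]" "[y]"] xy by (simp add: tens_1(2)[symmetric])
  moreover have "comult_map T (mult_map T (tens T [x, y])) = comult T (x \<otimes>\<^bsub>T\<^esub> y)"
    using xy T_algebra VA by (simp add: mult_map(2)[OF T_algebra] comult_map(2)[OF VT T_comult_linear])
  ultimately show "comult T (x \<otimes>\<^bsub>T\<^esub> y) = tens_map T 2 (mult_map T) 2 (mult_map T)
      (tens_map T 3 (tens_map T 1 id 2 (braiding T)) 1 id (comult T x \<otimes>\<^bsub>tensor_alg T\<^esub> comult T y))"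
    by simp
qed

lemma T_counit_algebra_map: "counit_algebra_map T"
  unfolding counit_algebra_map_def
proof (intro conjI ballI T_counit_linear)
  have "co (tens A []) = fret []" by (rule co_word) simp
  then show "counit T \<one>\<^bsub>T\<^esub> = 1" using VA by (simp add: T_ops lookup_single)
  fix x y assume xy: "x \<in> carrier T" "y \<in> carrier T"
  have t: "tens T [x, y] \<in> carrier (tens_power T 2)" using xy by (intro tens_in_power[OF VT]) auto
  note e = counit_map[OF VT T_counit_linear]
  have ee: "T.represents 2 0 (tens_map T 1 (counit_map T) 1 (counit_map T))
      (\<lambda>l. (if take 1 l ! 0 = [] then fret [] else 0) \<bind> (\<lambda>a. (if drop 1 l ! 0 = [] then fret [] else 0) \<bind> (\<lambda>b. fret (a @ b))))"
    by (rule T.represents_tens_map[OF T_counit T_counit]) simp_all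
  have "counit_map T (mult_map T (tens T [x, y])) = tens_map T 1 (counit_map T) 1 (counit_map T) (tens T [x, y])"
  proof (rule T.represents_eq[OF T_comp[OF T_mult T_counit] ee _ t], goal_cases)
    case (1 l)
    then obtain x y where l: "l = [x, y]" using T.words_2E by blast
    show ?case by (simp add: l)
  qed
  moreover have "tens_map T 1 (counit_map T) 1 (counit_map T) (tens T [x, y]) =
      (counit T x \<odot>\<^bsub>tensor_alg T\<^esub> \<one>\<^bsub>tensor_alg T\<^esub>) \<otimes>\<^bsub>tensor_alg T\<^esub> (counit T y \<odot>\<^bsub>tensor_alg T\<^esub> \<one>\<^bsub>tensor_alg T\<^esub>)"
    using tens_map_tens[OF VT e(1) e(1), of "[x]" "[y]"] xy by (simp add: e(2))
  moreover have "counit_map T (mult_map T (tens T [x, y])) = counit T (x \<otimes>\<^bsub>T\<^esub> y) \<odot>\<^bsub>tensor_alg T\<^esub> \<one>\<^bsub>tensor_alg T\<^esub>"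
    using xy T_algebra VA by (simp add: mult_map(2)[OF T_algebra] e(2))
  ultimately have "counit T (x \<otimes>\<^bsub>T\<^esub> y) \<odot>\<^bsub>tensor_alg T\<^esub> \<one>\<^bsub>tensor_alg T\<^esub> = (counit T x * counit T y) \<odot>\<^bsub>tensor_alg T\<^esub> \<one>\<^bsub>tensor_alg T\<^esub>"
    using T.T by (simp add: assoc_algebra_distr mult.commute)
  \<comment> \<open>The word calculus compares multiples of the unit in degree 0; the scalars
    themselves are recovered here.\<close>
  from tensor_alg_one_inject[OF VT this] show "counit T (x \<otimes>\<^bsub>T\<^esub> y) = counit T x * counit T y" .
qed

lemma T_incl_linear: "linear_map A T (\<lambda>v. tens A [v])"
  using linear_mapD[OF linear_map_tens_singleton[OF VA]] by (intro linear_mapI) simp_all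

lemma T_incl_braided: "braided_map A T (\<lambda>v. tens A [v])"
  unfolding braided_map_def
proof (intro conjI ballI T_incl_linear)
  fix t assume t: "t \<in> carrier (tens_power A 2)"
  let ?h = "power_map T 2 (\<lambda>v. tens A [v])"
  have h: "linear_map (tens_power A 2) (tens_power T 2) ?h" by (rule power_map_linear[OF VA VT T_incl_linear])
  have b: "linear_map (tens_power T 2) (tens_power T 2) (braiding T)" using T_braiding by (simp add: T.represents_def)
  have W: "vec_space (tens_power T 2)" using VT by simp
  show "braiding T (?h t) = ?h (braiding A t)"
  proof (rule A.linear_words_eq[OF W linear_map_comp[OF h b] linear_map_comp[OF cA h] _ t])
    fix l assume "l \<in> A.words 2"
    then obtain v w where l: "v \<in> E" "w \<in> E" "l = [v, w]" using A.words_2E by blast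
    have k: "Poly_Mapping.keys (clist l) \<subseteq> A.words 2" and e: "braiding A (tens A (map (\<lambda>x. x) l)) = A.evl (clist l)"
      using A_braiding \<open>l \<in> A.words 2\<close> by (auto simp: A.represents_def)
    have hw: "?h (tens A (map (\<lambda>x. x) r)) = T.evl (fret (map (\<lambda>x. [x]) r))" "map (\<lambda>x. [x]) r \<in> T.words 2" if r: "r \<in> A.words 2" for r
    proof -
      obtain a b where ab: "a \<in> E" "b \<in> E" "r = [a, b]" using A.words_2E[OF r] by blast
      show w: "map (\<lambda>x. [x]) r \<in> T.words 2" using ab by (simp add: T.words_iff)
      show "?h (tens A (map (\<lambda>x. x) r)) = T.evl (fret (map (\<lambda>x. [x]) r))"
        using ab E_carrier T.evl_fret[OF w] by (simp add: power_map_tens[OF VA VT T_incl_linear])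
    qed
    have "?h (A.evl (clist l)) = lin_ext (tensor_alg T) (clist l) (\<lambda>r. ?h (tens A (map (\<lambda>x. x) r)))"
      by (rule A.linear_evl[OF linear_map_to_tensor_alg[OF h] T.TV k])
    also have "\<dots> = lin_ext (tensor_alg T) (clist l) (\<lambda>r. T.evl (fret (map (\<lambda>x. [x]) r)))"
    proof (rule lin_ext_cong[OF T.TV])
      fix r assume "r \<in> Poly_Mapping.keys (clist l)"
      then have r: "r \<in> A.words 2" using k by auto
      show "?h (tens A (map (\<lambda>x. x) r)) = T.evl (fret (map (\<lambda>x. [x]) r))" by (rule hw(1)[OF r])
      show "T.evl (fret (map (\<lambda>x. [x]) r)) \<in> carrier (tensor_alg T)" by (rule T.evl_closed) (use hw(2)[OF r] in simp)
    qed
    also have "\<dots> = T.evl (clist l \<bind> (\<lambda>r. fret (map (\<lambda>x. [x]) r)))"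
      by (rule T.evl_bind[OF k, symmetric]) (use hw(2) in simp)
    \<comment> \<open>Two one-letter words cross each other by \<open>c\<close> itself.\<close>
    also have "clist l \<bind> (\<lambda>r. fret (map (\<lambda>x. [x]) r)) = bw [v] [w]"
      by (simp add: l bw_def split_def)
    also have "T.evl (bw [v] [w]) = braiding T (T.evl (fret [[v], [w]]))"
      using l T.represents_eval[OF T_braiding, of "fret [[v], [w]]"] by (simp add: T.words_iff)
    also have "T.evl (fret [[v], [w]]) = ?h (tens A (map (\<lambda>x. x) l))"
      using hw(1)[OF \<open>l \<in> A.words 2\<close>] by (simp add: l)
    finally show "braiding T (?h (tens A (map (\<lambda>x. x) l))) = ?h (braiding A (tens A (map (\<lambda>x. x) l)))" unfolding e by simp
  qed
qed

lemma T_primitive: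
  assumes v: "v \<in> carrier A"
  shows "comult T (tens A [v]) = tens T [tens A [v], \<one>\<^bsub>T\<^esub>] \<oplus>\<^bsub>tensor_alg T\<^esub> tens T [\<one>\<^bsub>T\<^esub>, tens A [v]]"
    and "counit T (tens A [v]) = 0"
proof -
  note mt = multilinearD[OF multilinear_tens[OF VT]]
  have one: "\<one>\<^bsub>tensor_alg A\<^esub> = tens A []" using VA by simp
  have "linear_map T (tensor_alg T) (\<lambda>x. tens T [x, \<one>\<^bsub>T\<^esub>])" "linear_map T (tensor_alg T) (\<lambda>x. tens T [\<one>\<^bsub>T\<^esub>, x])"
    using mt(1) mt(2,3)[of "[]" "[\<one>\<^bsub>T\<^esub>]"] mt(2,3)[of "[\<one>\<^bsub>T\<^esub>]" "[]"] VA by (auto intro!: linear_mapI)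
  from linear_map_comp[OF T_incl_linear linear_map_add(1)[OF T.TV this]]
  have r: "linear_map A (tensor_alg T) (\<lambda>v. tens T [tens A [v], \<one>\<^bsub>T\<^esub>] \<oplus>\<^bsub>tensor_alg T\<^esub> tens T [\<one>\<^bsub>T\<^esub>, tens A [v]])" .
  have l: "linear_map A (tensor_alg T) (\<lambda>v. comult T (tens A [v]))"
    by (rule linear_map_to_tensor_alg[OF linear_map_comp[OF T_incl_linear T_comult_linear]])
  show "comult T (tens A [v]) = tens T [tens A [v], \<one>\<^bsub>T\<^esub>] \<oplus>\<^bsub>tensor_alg T\<^esub> tens T [\<one>\<^bsub>T\<^esub>, tens A [v]]"
  proof (rule A.linear_span_eq[OF T.TV l r _ v])
    fix v assume v: "v \<in> E"
    then have w: "[[v], []] \<in> T.words 2" "[[], [v]] \<in> T.words 2" by (simp_all add: T.words_iff)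
    have "comult T (tens A [v]) = T.evl (fret [[v], []] + fret [[], [v]])"
      using v by (simp add: T_ops co_word dw_def fbind_add)
    also have "\<dots> = T.evl (fret [[v], []]) \<oplus>\<^bsub>tensor_alg T\<^esub> T.evl (fret [[], [v]])"
      by (rule T.evl_add[where n = 2]) (use w in simp_all)
    finally show "comult T (tens A [v]) = tens T [tens A [v], \<one>\<^bsub>T\<^esub>] \<oplus>\<^bsub>tensor_alg T\<^esub> tens T [\<one>\<^bsub>T\<^esub>, tens A [v]]"
      by (simp add: T.evl_fret[OF w(1)] T.evl_fret[OF w(2)] one del: tens_Nil)
  qed
  \<comment> \<open>A single vector expands into words of length one, so its coefficient at the
    empty word, the counit, is zero.\<close>
  have "Poly_Mapping.keys (gw [v]) \<subseteq> A.words 1" using gw_keys[of "[v]"] v by (simp add: One_nat_def)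
  then have "[] \<notin> Poly_Mapping.keys (gw [v])" by (auto simp: A.words_def)
  then show "counit T (tens A [v]) = 0" using v by (simp add: T_ops co_tens in_keys_iff)
qed

lemma T_braided_tensor_algebra: "is_braided_tensor_algebra A T"
  unfolding is_braided_tensor_algebra_def
  using T_truncate T_braided_algebra T_incl_braided T_comult_algebra_map T_counit_algebra_map T_primitive by blast

lemma T_bialgebra: "braided_bialgebra T"
  by (simp add: braided_bialgebra_def T_braided_algebra T_braided_coalgebra T_comult_algebra_map T_counit_algebra_map)

section \<open>The multiplication map from the tensor algebra to \<open>A\<close>\<close>

definition "prodl l = foldr (\<lambda>x y. x \<otimes>\<^bsub>A\<^esub> y) l \<one>\<^bsub>A\<^esub>"
text \<open>Defined on all words over the carrier and not through the basis, so that it is the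
  identity on every one-letter word; \<open>\<phi>_word\<close> supplies its coordinates on basis
  words.\<close>

definition "\<phi> t = lin_ext A t prodl"

lemma prodl_closed: "set l \<subseteq> carrier A \<Longrightarrow> prodl l \<in> carrier A"
  by (induction l) (simp_all add: prodl_def AA)

lemma prodl_Cons: "prodl (x # l) = x \<otimes>\<^bsub>A\<^esub> prodl l" and prodl_Nil: "prodl [] = \<one>\<^bsub>A\<^esub>"
  by (simp_all add: prodl_def)

lemma prodl_append: "set l \<subseteq> carrier A \<Longrightarrow> set r \<subseteq> carrier A \<Longrightarrow> prodl (l @ r) = prodl l \<otimes>\<^bsub>A\<^esub> prodl r"
  using AA by (induction l) (simp_all add: prodl_Cons prodl_Nil prodl_closed assoc_algebra_distr)

lemma prodl_multilinear: "multilinear A A prodl"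
  unfolding multilinear_def
proof (intro conjI allI impI ballI prodl_closed)
  fix u w assume u: "set u \<subseteq> carrier A" and w: "set w \<subseteq> carrier A"
  show "prodl (u @ (a \<oplus>\<^bsub>A\<^esub> b) # w) = prodl (u @ a # w) \<oplus>\<^bsub>A\<^esub> prodl (u @ b # w)" if "a \<in> carrier A" "b \<in> carrier A" for a b
    using AA VA u w that by (induction u) (simp_all add: prodl_Cons prodl_closed assoc_algebra_distr)
  show "prodl (u @ (k \<odot>\<^bsub>A\<^esub> a) # w) = k \<odot>\<^bsub>A\<^esub> prodl (u @ a # w)" if "a \<in> carrier A" for k a
    using AA VA u w that by (induction u) (simp_all add: prodl_Cons prodl_closed assoc_algebra_distr)
qed

lemma \<phi>_tens: "set l \<subseteq> carrier A \<Longrightarrow> \<phi> (tens A l) = prodl l"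
  unfolding \<phi>_def by (rule lin_ext_tens[OF VA VA prodl_multilinear])

lemma \<phi>_linear: "linear_map T A \<phi>"
  using linear_mapD[OF linear_map_lin_ext[OF VA VA prodl_multilinear]]
  by (intro linear_mapI) (simp_all add: \<phi>_def)

lemma \<phi>_incl: "a \<in> carrier A \<Longrightarrow> \<phi> (tens A [a]) = a"
  using AA by (simp add: \<phi>_tens prodl_Cons prodl_Nil)

lemma words_carrier: "x \<in> lists E \<Longrightarrow> set x \<subseteq> carrier A"
  using listsD[of x] E_carrier by auto

lemma \<phi>_algebra: "algebra_map T A \<phi>"
proof (rule algebra_mapI[OF \<phi>_linear])
  show "\<phi> \<one>\<^bsub>T\<^esub> = \<one>\<^bsub>A\<^esub>" using \<phi>_tens[of "[]"] VA by (simp add: prodl_Nil)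
  have idT: "linear_map T T (\<lambda>x. x)" by (rule linear_mapI) simp_all
  have 1: "\<phi> (s \<otimes>\<^bsub>T\<^esub> t) = \<phi> s \<otimes>\<^bsub>A\<^esub> \<phi> t" if s: "s \<in> carrier T" and t: "t = tens A x" "x \<in> lists E" for s t x
  proof (rule T.linear_span_eq[OF VA _ _ _ s])
    have tc: "t \<in> carrier T" "\<phi> t \<in> carrier A" using t tens_words linear_mapD(1)[OF \<phi>_linear] by auto
    show "linear_map T A (\<lambda>s. \<phi> (s \<otimes>\<^bsub>T\<^esub> t))" "linear_map T A (\<lambda>s. \<phi> s \<otimes>\<^bsub>A\<^esub> \<phi> t)"
      by (rule linear_map_comp[OF linear_map_mult_right[OF T_algebra idT tc(1)] \<phi>_linear], rule linear_map_mult_right[OF AA \<phi>_linear tc(2)])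
    show "\<phi> (tens A y \<otimes>\<^bsub>T\<^esub> t) = \<phi> (tens A y) \<otimes>\<^bsub>A\<^esub> \<phi> t" if "y \<in> lists E" for y
      using words_carrier[OF that] words_carrier[OF t(2)] by (simp add: t(1) tens_append[OF VA] \<phi>_tens prodl_append)
  qed
  fix s t assume s: "s \<in> carrier T" and t: "t \<in> carrier T"
  have sc: "\<phi> s \<in> carrier A" using s linear_mapD(1)[OF \<phi>_linear] by auto
  show "\<phi> (s \<otimes>\<^bsub>T\<^esub> t) = \<phi> s \<otimes>\<^bsub>A\<^esub> \<phi> t"
  proof (rule T.linear_span_eq[OF VA _ _ _ t])
    show "linear_map T A (\<lambda>t. \<phi> (s \<otimes>\<^bsub>T\<^esub> t))" "linear_map T A (\<lambda>t. \<phi> s \<otimes>\<^bsub>A\<^esub> \<phi> t)"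
      by (rule linear_map_comp[OF linear_map_mult_left[OF T_algebra idT s] \<phi>_linear], rule linear_map_mult_left[OF AA \<phi>_linear sc])
    show "\<phi> (s \<otimes>\<^bsub>T\<^esub> tens A x) = \<phi> s \<otimes>\<^bsub>A\<^esub> \<phi> (tens A x)" if "x \<in> lists E" for x by (rule 1[OF s refl that])
  qed
qed

lemma mm_support: "Poly_Mapping.keys (mm x) \<subseteq> E"
  by (rule mm_keys[OF m_keys u_keys])

text \<open>The recursions of \<open>prodl\<close> and \<open>mm\<close> agree step by step, as
  \<open>m v a\<close> lists the coordinates of the product of two basis vectors and
  \<open>u\<close> those of the unit.\<close>

lemma \<phi>_word: "x \<in> lists E \<Longrightarrow> \<phi> (tens A x) = lin_ext A (mm x) (\<lambda>a. a)"
proof -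
  assume "x \<in> lists E"
  then have "prodl x = lin_ext A (mm x) (\<lambda>a. a)"
  proof (induction x)
    case (Cons v x)
    have v: "v \<in> E" and vc: "v \<in> carrier A" using Cons E_carrier by auto
    have idA: "linear_map A A (\<lambda>x. x)" by (rule linear_mapI) simp_all
    have "prodl (v # x) = v \<otimes>\<^bsub>A\<^esub> lin_ext A (mm x) (\<lambda>a. a)" using Cons by (simp add: prodl_Cons)
    also have "\<dots> = lin_ext A (mm x) (\<lambda>a. v \<otimes>\<^bsub>A\<^esub> a)"
      using mm_support[of x] E_carrier by (intro lin_ext_linear[OF linear_map_mult_left[OF AA idA vc] VA VA]) auto
    also have "\<dots> = lin_ext A (mm x) (\<lambda>a. lin_ext A (m v a) (\<lambda>a. a))"
    proof (rule lin_ext_cong[OF VA])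
      fix a assume "a \<in> Poly_Mapping.keys (mm x)"
      then have a: "a \<in> E" using mm_support by auto
      show "v \<otimes>\<^bsub>A\<^esub> a = lin_ext A (m v a) (\<lambda>a. a)" by (rule m_sum[OF v a, symmetric])
      show "lin_ext A (m v a) (\<lambda>a. a) \<in> carrier A" unfolding m_sum[OF v a] using AA vc E_carrier[OF a] by simp
    qed
    also have "\<dots> = lin_ext A (mm x \<bind> m v) (\<lambda>a. a)"
      using m_keys E_carrier by (intro lin_ext_bind[OF VA, symmetric]) auto
    finally show ?case by simp
  qed (simp add: prodl_Nil u_sum)
  then show ?thesis using \<phi>_tens words_carrier \<open>x \<in> lists E\<close> by simp
qed

abbreviation "e x \<equiv> tens A [\<phi> x]"

lemma e_linear: "linear_map T T (\<lambda>x. e x)"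
  by (rule linear_map_comp[OF \<phi>_linear T_incl_linear])

text \<open>In \<open>[[a]]\<close> the inner list is a one-letter word, that is an element of
  \<open>T\<close> in the image of \<open>A\<close>, and the outer list marks a tensor of degree one
  over \<open>T\<close>.\<close>

lemma T_power_e: "T.represents 1 1 (power_map T 1 (\<lambda>x. e x)) (\<lambda>l. mm (l ! 0) \<bind> (\<lambda>a. fret [[a]]))"
  unfolding T.represents_def
proof (intro conjI ballI power_map_linear[OF VT VT e_linear])
  fix l assume "l \<in> T.words 1"
  then obtain x where l: "x \<in> lists E" "l = [x]" using T.words_1E by blast
  have w: "[[a]] \<in> T.words 1" if "a \<in> E" for a using that by (simp add: T.words_iff)
  show "Poly_Mapping.keys (mm (l ! 0) \<bind> (\<lambda>a. fret [[a]])) \<subseteq> T.words 1"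
    by (rule keys_fbind[OF mm_support]) (use w in simp)
  have "power_map T 1 (\<lambda>x. e x) (tens T [tens A x]) = tens T [tens A [lin_ext A (mm x) (\<lambda>a. a)]]"
    using tens_words[OF l(1)] \<phi>_word[OF l(1)] by (simp add: power_map_tens[OF VT VT e_linear])
  also have "\<dots> = lin_ext (tensor_alg T) (mm x) (\<lambda>a. tens T [tens A [a]])"
    by (rule lin_ext_linear[OF linear_map_comp[OF T_incl_linear linear_map_tens_singleton[OF VT]] VA T.TV]) (use mm_support E_carrier in auto)
  also have "\<dots> = lin_ext (tensor_alg T) (mm x) (\<lambda>a. T.evl (fret [[a]]))"
  proof (rule lin_ext_cong[OF T.TV])
    fix a assume "a \<in> Poly_Mapping.keys (mm x)"
    then have a: "a \<in> E" using mm_support by auto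
    show "tens T [tens A [a]] = T.evl (fret [[a]])" using T.evl_fret[OF w[OF a]] by simp
    show "T.evl (fret [[a]]) \<in> carrier (tensor_alg T)" by (rule T.evl_closed) (use w[OF a] in simp)
  qed
  also have "\<dots> = T.evl (mm x \<bind> (\<lambda>a. fret [[a]]))"
    by (rule T.evl_bind[OF mm_support, symmetric]) (use w in simp)
  finally show "power_map T 1 (\<lambda>x. e x) (tens T (map (tens A) l)) = T.evl (mm (l ! 0) \<bind> (\<lambda>a. fret [[a]]))"
    by (simp add: l)
qed

lemma T_act1: "T.represents 2 2 (act1 T (\<lambda>x. e x)) (\<lambda>l. (mm (take 1 l ! 0) \<bind> (\<lambda>a. fret [[a]])) \<bind> (\<lambda>a. fret (a @ drop 1 l)))"
  unfolding act1_def by (rule T.represents_id_right[OF T_power_e]) simp_all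

lemma T_act2: "T.represents 2 2 (act2 T (\<lambda>x. e x)) (\<lambda>l. (mm (drop 1 l ! 0) \<bind> (\<lambda>a. fret [[a]])) \<bind> (\<lambda>b. fret (take 1 l @ b)))"
  unfolding act2_def by (rule T.represents_id_left[OF T_power_e]) simp_all

lemma T_braiding_act:
  assumes t: "t \<in> carrier (tens_power T 2)"
  shows "braiding T (act1 T (\<lambda>x. e x) t) = act2 T (\<lambda>x. e x) (braiding T t)"
    and "braiding T (act2 T (\<lambda>x. e x) t) = act1 T (\<lambda>x. e x) (braiding T t)"
proof -
  show "braiding T (act1 T (\<lambda>x. e x) t) = act2 T (\<lambda>x. e x) (braiding T t)"
  proof (rule T.represents_eq[OF T_comp[OF T_act1 T_braiding] T_comp[OF T_braiding T_act2] _ t], goal_cases)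
    case (1 l)
    then obtain x y where l: "l = [x, y]" "y \<in> lists E" using T.words_2E by blast
    show ?case using mm_cc_left[OF listsD[OF l(2)], of x "\<lambda>y a. fret [y, [a]]"] by (simp add: l(1) bw_def split_def)
  qed
  show "braiding T (act2 T (\<lambda>x. e x) t) = act1 T (\<lambda>x. e x) (braiding T t)"
  proof (rule T.represents_eq[OF T_comp[OF T_act2 T_braiding] T_comp[OF T_braiding T_act1] _ t], goal_cases)
    case (1 l)
    then obtain x y where l: "l = [x, y]" "x \<in> lists E" using T.words_2E by blast
    show ?case using mm_cc_right[OF listsD[OF l(2)], of y "\<lambda>a x. fret [[a], x]"]
      by (simp add: l(1) bw_def split_def cc_single_right)
  qed
qed

lemma lie_stage_T: "lie_stage T A (\<lambda>a. tens A [a]) \<phi>"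
proof (unfold lie_stage_def lie_stage_axioms_def bialg_def, intro conjI allI impI)
  show "tens A [a] \<in> primitives T" if "a \<in> carrier A" for a
    using T_primitive(1)[OF that] that VA by (simp add: primitives_def tens_closed)
qed (use T_bialgebra AA linear_mapD(1)[OF cA] T_incl_braided \<phi>_algebra \<phi>_incl T_braiding_act in blast)+

end

theorem proposition6p1:
  fixes A :: "('k::field, 'a) braided_space"
  assumes "braided_algebra A"
  shows "\<exists>U i b. is_canonical_bracket A U i b \<and> is_braided_Lie_algebra A U i b"
proof -
  have "vec_space A" using assms by (simp add: braided_algebra_def braided_vec_space_def)
  from coordinates_exist[OF this] obtain E and g :: "'a \<Rightarrow> ('a \<Rightarrow>\<^sub>0 'k)" where "coordinates A E g" by blast
  then interpret based_braided_algebra A E g by (unfold_locales) (use assms in auto)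
  show ?thesis by (rule canonical_bracket[OF lie_stage_T T_braided_tensor_algebra assms])
qed

end
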